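(* Let $n\ge 1$ be an integer and let $k$ be a field with $\operatorname{char}(k)\nmid n!$. Let $D=D_n$ or $D=\mathrm{UD}(n)$. Let $m\ge 1$ and let $i,j$ be integers between $1$ and $n$. Suppose that $i$ and $m$ are divisible by $\operatorname{sqf}(n)$. Then the system $$\left\{\begin{array}{l}\sigma^{(i)}(x_1)=\dots=\sigma^{(i)}(x_m)\\ \sigma^{(j)}(x_1\cdots x_m)=0\end{array}\right.$$ has no nontrivial solutions $(x_1,\dots,x_m)$ in $D$, i.e., the only solution with all $x_r\in D$ is $x_1=\dots=x_m=0$.
   Context: Characteristic $0$ is regarded as dividing no positive integer. $\operatorname{sqf}(n)$ denotes the product of the distinct primes dividing $n$. For a central simple algebra $A$ of degree $n$ with center $F$ and $x\in A$, the elements $\sigma^{(i)}(x)=\sigma^{(i)}_{A/F}(x)\in F$ ($1\le i\le n$) are defined by $\det(\lambda 1-x)=\lambda^n+\sigma^{(1)}(x)\lambda^{n-1}+\dots+\sigma^{(n)}(x)$, where $\det$ is the reduced norm of $A\otimes_F F(\lambda)$. The algebra $D_n$: write $n=p_1\cdots p_s$ as a product of (not necessarily distinct) primes, and let $K=k(z_1,w_1,\dots,z_s,w_s)$ with $z_1,w_1,\dots,z_s,w_s$ independent variables over $k$. Then $D_n=(z_1,w_1)_{p_1}\otimes_K\dots\otimes_K(z_s,w_s)_{p_s}$, where the symbol algebra is $(z,w)_r=K\{x,y\}/(x^r=z,\ y^r=w,\ yx=\zeta_r xy)$ and $\zeta_r$ is a primitive $r$th root of unity in $K$ (so when $D=D_n$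 it is assumed that $k$ contains primitive $p_i$th roots of unity for each $i$). $D_n$ is a division algebra of degree $n$ with center $K$. The universal division algebra $\mathrm{UD}(n)$ is the subalgebra of $\mathrm{M}_n(k(s_{ij},t_{ij}))$ generated, as a division algebra, by the two generic $n\times n$ matrices $(s_{ij})$ and $(t_{ij})$, where $s_{ij},t_{ij}$ are $2n^2$ independent variables over $k$. *)

theory Defs
  imports
    "HOL-Algebra.Algebraic_Closure_Type"
    "HOL-Algebra.Product_Groups"
    "HOL-Algebra.QuotRing"
    "HOL-Algebra.Generated_Fields"
    "Jordan_Normal_Form.Char_Poly"
begin

definition sqf :: "nat \<Rightarrow> nat" where
  "sqf n = \<Prod>(prime_factors n)"

definition primitive_root_of_unity :: "nat \<Rightarrow> 'k::field \<Rightarrow> bool" where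
  "primitive_root_of_unity r \<zeta> \<longleftrightarrow> \<zeta> ^ r = 1 \<and> (\<forall>d. 0 < d \<and> d < r \<longrightarrow> \<zeta> ^ d \<noteq> 1)"


subsection \<open>Rational function fields\<close>

definition algebraically_independent ::
    "('k::field \<Rightarrow> 'K::field) \<Rightarrow> 'v set \<Rightarrow> ('v \<Rightarrow> 'K) \<Rightarrow> bool" where
  "algebraically_independent \<iota> V xs \<longleftrightarrow>
     (\<forall>(E :: ('v \<Rightarrow> nat) set) c. finite E \<and> E \<subseteq> (V \<rightarrow>\<^sub>E UNIV) \<and>
        (\<Sum>e\<in>E. \<iota> (c e) * (\<Prod>v\<in>V. xs v ^ e v)) = 0 \<longrightarrow> (\<forall>e\<in>E. c e = 0))"

text \<open>The type \<open>'K\<close>, with the embedding \<open>\<iota>\<close>, is the field of rational functions over \<open>'k\<close> in the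
  independent variables \<open>xs v\<close>, \<open>v \<in> V\<close> (\<open>V\<close> finite). As the number of variables depends on \<open>n\<close>,
  the field is described by this property rather than by a type constructor.\<close>

definition rational_function_field ::
    "('k::field \<Rightarrow> 'K::field) \<Rightarrow> 'v set \<Rightarrow> ('v \<Rightarrow> 'K) \<Rightarrow> bool" where
  "rational_function_field \<iota> V xs \<longleftrightarrow>
     field_hom \<iota> \<and> finite V \<and> algebraically_independent \<iota> V xs \<and>
     generate_field (ring_of_type_algebra :: 'K ring) (range \<iota> \<union> xs ` V) = UNIV"


subsection \<open>Monoid algebras, symbol algebras and tensor products\<close>

text \<open>Finitely supported functions on the monoid \<open>M\<close> with the convolution product. For \<open>M\<close> the
  monoid of words over an alphabet this is the free associative algebra on that alphabet.\<close>

definition monoid_algebra :: "('m, 'x) monoid_scheme \<Rightarrow> ('m \<Rightarrow> 'c::field) ring" where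
  "monoid_algebra M =
     \<lparr>carrier = {f. finite {u. f u \<noteq> 0} \<and> {u. f u \<noteq> 0} \<subseteq> carrier M},
      monoid.mult = (\<lambda>f g u. \<Sum>(v, w) \<in> {(v, w). f v \<noteq> 0 \<and> g w \<noteq> 0 \<and> v \<otimes>\<^bsub>M\<^esub> w = u}. f v * g w),
      monoid.one = (\<lambda>u. if u = \<one>\<^bsub>M\<^esub> then 1 else 0),
      ring.zero = (\<lambda>u. 0),
      ring.add = (\<lambda>f g u. f u + g u)\<rparr>"

definition single :: "'m \<Rightarrow> 'c::zero \<Rightarrow> 'm \<Rightarrow> 'c" where
  "single v c = (\<lambda>u. if u = v then c else 0)"

datatype symbol_gen = GenX | GenY

definition word_monoid :: "symbol_gen list monoid" where
  "word_monoid = \<lparr>carrier = UNIV, monoid.mult = (@), monoid.one = []\<rparr>"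

abbreviation free_xy :: "(symbol_gen list \<Rightarrow> 'c::field) ring" where
  "free_xy \<equiv> monoid_algebra word_monoid"

text \<open>The two-sided ideal of \<open>K{x,y}\<close> generated by \<open>x\<^sup>r - z\<close>, \<open>y\<^sup>r - w\<close> and \<open>y x - \<zeta> x y\<close>.\<close>

definition symbol_ideal :: "nat \<Rightarrow> 'c::field \<Rightarrow> 'c \<Rightarrow> 'c \<Rightarrow> (symbol_gen list \<Rightarrow> 'c) set" where
  "symbol_ideal r \<zeta> z w = Idl\<^bsub>free_xy\<^esub>
     {single (replicate r GenX) 1 \<ominus>\<^bsub>free_xy\<^esub> single [] z,
      single (replicate r GenY) 1 \<ominus>\<^bsub>free_xy\<^esub> single [] w,
      single [GenY, GenX] 1 \<ominus>\<^bsub>free_xy\<^esub> single [GenX, GenY] \<zeta>}"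

definition symbol_algebra ::
    "nat \<Rightarrow> 'c::field \<Rightarrow> 'c \<Rightarrow> 'c \<Rightarrow> (symbol_gen list \<Rightarrow> 'c) set ring" where
  "symbol_algebra r \<zeta> z w = free_xy Quot symbol_ideal r \<zeta> z w"

definition symbol_scalar ::
    "nat \<Rightarrow> 'c::field \<Rightarrow> 'c \<Rightarrow> 'c \<Rightarrow> 'c \<Rightarrow> (symbol_gen list \<Rightarrow> 'c) set" where
  "symbol_scalar r \<zeta> z w c = symbol_ideal r \<zeta> z w +>\<^bsub>free_xy\<^esub> single [] c"

text \<open>The tensor product over the field \<open>'c\<close> of the algebras \<open>A i\<close>, \<open>i \<in> I\<close>, with structure maps
  \<open>\<eta> i\<close> from \<open>'c\<close> to \<open>A i\<close>: the vector space with basis \<open>\<Prod>i\<in>I. A i\<close>, multiplied by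
  the componentwise product of families, modulo the relations of multilinearity. (These span an
  ideal, so it does not matter that the ideal rather than the subspace is formed.)
  The family \<open>(a\<^sub>i)\<close> represents the pure tensor of the \<open>a\<^sub>i\<close>; for empty \<open>I\<close> the result is \<open>'c\<close>.\<close>

definition tensor_relations ::
    "'i set \<Rightarrow> ('i \<Rightarrow> 'a ring) \<Rightarrow> ('i \<Rightarrow> 'c \<Rightarrow> 'a) \<Rightarrow> (('i \<Rightarrow> 'a) \<Rightarrow> 'c::field) set" where
  "tensor_relations I A \<eta> =
     (let R = monoid_algebra (product_group I A) :: (('i \<Rightarrow> 'a) \<Rightarrow> 'c) ring in
      {single (t(i := a \<oplus>\<^bsub>A i\<^esub> b)) 1 \<ominus>\<^bsub>R\<^esub> single (t(i := a)) 1 \<ominus>\<^bsub>R\<^esub> single (t(i := b)) 1 | t i a b.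
         t \<in> (\<Pi>\<^sub>E i\<in>I. carrier (A i)) \<and> i \<in> I \<and> a \<in> carrier (A i) \<and> b \<in> carrier (A i)} \<union>
      {single (t(i := \<eta> i c \<otimes>\<^bsub>A i\<^esub> a)) 1 \<ominus>\<^bsub>R\<^esub> single (t(i := a)) c | t i a c.
         t \<in> (\<Pi>\<^sub>E i\<in>I. carrier (A i)) \<and> i \<in> I \<and> a \<in> carrier (A i)})"

definition tensor_algebra ::
    "'i set \<Rightarrow> ('i \<Rightarrow> 'a ring) \<Rightarrow> ('i \<Rightarrow> 'c::field \<Rightarrow> 'a) \<Rightarrow> (('i \<Rightarrow> 'a) \<Rightarrow> 'c) set ring" where
  "tensor_algebra I A \<eta> =
     (let R = monoid_algebra (product_group I A) in R Quot (Idl\<^bsub>R\<^esub> (tensor_relations I A \<eta>)))"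

text \<open>\<open>D_n\<close> for the factorization \<open>n = prod_list ps\<close>; \<open>\<zeta> r\<close> is the chosen primitive \<open>r\<close>-th root of
  unity. The variables are numbered from \<open>0\<close>.\<close>

definition D_algebra ::
    "nat list \<Rightarrow> (nat \<Rightarrow> 'K::field) \<Rightarrow> (nat \<Rightarrow> 'K) \<Rightarrow> (nat \<Rightarrow> 'K) \<Rightarrow>
       ((nat \<Rightarrow> (symbol_gen list \<Rightarrow> 'K) set) \<Rightarrow> 'K) set ring" where
  "D_algebra ps \<zeta> z w = tensor_algebra {..<length ps}
     (\<lambda>l. symbol_algebra (ps ! l) (\<zeta> (ps ! l)) (z l) (w l))
     (\<lambda>l. symbol_scalar (ps ! l) (\<zeta> (ps ! l)) (z l) (w l))"


subsection \<open>The universal division algebra\<close>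

definition division_subalgebra :: "('k::field \<Rightarrow> 'L::field) \<Rightarrow> nat \<Rightarrow> 'L mat set \<Rightarrow> bool" where
  "division_subalgebra \<iota> n S \<longleftrightarrow>
     S \<subseteq> carrier_mat n n \<and>
     (\<forall>c. \<iota> c \<cdot>\<^sub>m 1\<^sub>m n \<in> S) \<and>
     (\<forall>A\<in>S. \<forall>B\<in>S. A + B \<in> S \<and> A * B \<in> S) \<and>
     (\<forall>A\<in>S. A \<noteq> 0\<^sub>m n n \<longrightarrow> (\<exists>B\<in>S. A * B = 1\<^sub>m n \<and> B * A = 1\<^sub>m n))"

text \<open>The smallest division subalgebra of the matrix algebra that contains the two generic matrices.
  (That there is one at all is Amitsur's theorem; inverses being unique, an intersection
  of division subalgebras is again one.)\<close>

definition UD_carrier ::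
    "('k::field \<Rightarrow> 'L::field) \<Rightarrow> nat \<Rightarrow> (nat \<Rightarrow> nat \<Rightarrow> 'L) \<Rightarrow> (nat \<Rightarrow> nat \<Rightarrow> 'L) \<Rightarrow> 'L mat set" where
  "UD_carrier \<iota> n s t =
     \<Inter>{S. division_subalgebra \<iota> n S \<and> mat n n (\<lambda>(a, b). s a b) \<in> S \<and> mat n n (\<lambda>(a, b). t a b) \<in> S}"

definition UD ::
    "('k::field \<Rightarrow> 'L::field) \<Rightarrow> nat \<Rightarrow> (nat \<Rightarrow> nat \<Rightarrow> 'L) \<Rightarrow> (nat \<Rightarrow> nat \<Rightarrow> 'L) \<Rightarrow> 'L mat ring" where
  "UD \<iota> n s t = (ring_mat TYPE('L) n ())\<lparr>carrier := UD_carrier \<iota> n s t\<rparr>"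


subsection \<open>The reduced characteristic polynomial\<close>

definition ring_center :: "('a, 'x) ring_scheme \<Rightarrow> 'a set" where
  "ring_center A = {c \<in> carrier A. \<forall>a\<in>carrier A. c \<otimes>\<^bsub>A\<^esub> a = a \<otimes>\<^bsub>A\<^esub> c}"

text \<open>\<open>\<phi>\<close> embeds \<open>A\<close> in the \<open>n \<times> n\<close> matrices over \<open>L = 'l\<close>, mapping the center \<open>F\<close> of \<open>A\<close> to scalar
  matrices, so that \<open>L\<close> becomes an extension of \<open>F\<close>, and maps some \<open>F\<close>-basis \<open>B\<close> of \<open>A\<close> injectively
  to an \<open>L\<close>-basis of the matrix algebra; this says that the induced homomorphism from
  \<open>A \<otimes>\<^sub>F L\<close> to the matrix algebra is an isomorphism.\<close>

definition splitting :: "('a, 'x) ring_scheme \<Rightarrow> nat \<Rightarrow> ('a \<Rightarrow> 'l::field mat) \<Rightarrow> bool" where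
  "splitting A n \<phi> \<longleftrightarrow>
     \<phi> \<in> Ring.ring_hom A (ring_mat TYPE('l) n ()) \<and>
     (\<forall>c\<in>ring_center A. \<exists>e. \<phi> c = e \<cdot>\<^sub>m 1\<^sub>m n) \<and>
     (\<exists>B. finite B \<and> B \<subseteq> carrier A \<and>
        (\<forall>a\<in>carrier A. \<exists>!f. f \<in> B \<rightarrow>\<^sub>E ring_center A \<and> a = (\<Oplus>\<^bsub>A\<^esub>b\<in>B. f b \<otimes>\<^bsub>A\<^esub> b)) \<and>
        (\<forall>M\<in>carrier_mat n n. \<exists>!g. g \<in> B \<rightarrow>\<^sub>E (UNIV :: 'l set) \<and>
            M = (\<Oplus>\<^bsub>ring_mat TYPE('l) n ()\<^esub>b\<in>B. g b \<cdot>\<^sub>m \<phi> b)))"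

text \<open>\<open>\<sigma>\<^sup>(\<^sup>i\<^sup>)(x)\<close> for \<open>x\<close> in a central simple algebra \<open>A\<close> of degree \<open>n\<close>, as an element of its center.
  Over \<open>L(\<lambda>)\<close> the algebra \<open>A \<otimes>\<^sub>F F(\<lambda>)\<close> becomes a matrix algebra, with \<open>\<lambda>1 - x\<close> becoming the matrix
  \<open>\<lambda>1 - \<phi> x\<close>, so that the reduced norm of \<open>\<lambda>1 - x\<close> is \<^term>\<open>char_poly (\<phi> x)\<close>; its coefficients lie
  in the image of \<open>F\<close> in \<open>L\<close>. By the Skolem--Noether theorem the result does not depend on the
  splitting \<open>\<phi>\<close>, nor on the splitting field \<open>'l\<close> (which is named by the first argument).\<close>

definition reduced_splitting :: "'l::field itself \<Rightarrow> ('a, 'x) ring_scheme \<Rightarrow> nat \<Rightarrow> 'a \<Rightarrow> 'l mat" where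
  "reduced_splitting ty A n = (SOME \<phi>. splitting A n \<phi>)"

definition reduced_sigma ::
    "'l::field itself \<Rightarrow> ('a, 'x) ring_scheme \<Rightarrow> nat \<Rightarrow> nat \<Rightarrow> 'a \<Rightarrow> 'a" where
  "reduced_sigma ty A n i x =
     (let \<phi> = reduced_splitting ty A n in
      THE c. c \<in> ring_center A \<and> \<phi> c = Polynomial.coeff (char_poly (\<phi> x)) (n - i) \<cdot>\<^sub>m 1\<^sub>m n)"

definition solves_system ::
    "'l::field itself \<Rightarrow> ('a, 'x) ring_scheme \<Rightarrow> nat \<Rightarrow> nat \<Rightarrow> nat \<Rightarrow> 'a list \<Rightarrow> bool" where
  "solves_system ty A n i j xs \<longleftrightarrow>
     (\<forall>x\<in>set xs. \<forall>y\<in>set xs. reduced_sigma ty A n i x = reduced_sigma ty A n i y) \<and>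
     reduced_sigma ty A n j (foldr (\<otimes>\<^bsub>A\<^esub>) xs \<one>\<^bsub>A\<^esub>) = \<zero>\<^bsub>A\<^esub>"

end

theory Submission
  imports Defs "HOL-Library.Poly_Mapping" "HOL-Number_Theory.Cong"
begin

text \<open>Over an extension of the center, the elements of the algebras in question become matrices
  \<open>\<Sum>\<alpha>. c\<^sub>\<alpha> T\<^sup>\<alpha> N\<^sub>\<alpha>\<close> with polynomial entries, where the \<open>N\<^sub>\<alpha>\<close> are invertible monomial matrices that
  represent a finite abelian group projectively, and where \<open>N\<^sub>\<alpha>\<close> depends on \<open>\<alpha>\<close> modulo the \<open>p\<^sub>l\<close> only.
  For \<open>D\<^sub>n\<close> the \<open>T\<^sub>v\<close> are the \<open>p\<^sub>l\<close>-th roots of the parameters \<open>z\<^sub>l\<close>, \<open>w\<^sub>l\<close>. If \<open>e\<close> is the order of \<open>N\<^sub>\<alpha>\<close> modulo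
  scalars, its characteristic polynomial is \<open>(\<lambda>\<^sup>e - \<mu>)\<^sup>n\<^sup>/\<^sup>e\<close> with \<open>\<mu> \<noteq> 0\<close>, and \<open>e\<close> divides \<open>sqf n\<close>; as no prime
  up to \<open>n\<close> vanishes in \<open>k\<close>, \<open>\<sigma>\<^sup>(\<^sup>i\<^sup>)(N\<^sub>\<alpha>) \<noteq> 0\<close> whenever \<open>sqf n\<close> divides \<open>i\<close>. Order the monomials linearly.
  If \<open>\<alpha>\<close> is the leading exponent of \<open>x\<close>, that of \<open>\<sigma>\<^sup>(\<^sup>i\<^sup>)(x)\<close> is therefore \<open>i \<alpha>\<close>, so that in a nontrivial
  solution all of \<open>x\<^sub>1, \<dots>, x\<^sub>m\<close> are nonzero, with the same leading exponent \<open>\<alpha>\<close>. The leading matrix of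
  the product is a multiple of \<open>N\<^sub>\<alpha>\<^sup>m\<close>, which is scalar because \<open>sqf n\<close> divides \<open>m\<close>; but a nonzero scalar
  matrix \<open>c\<close> has \<open>\<sigma>\<^sup>(\<^sup>j\<^sup>) = \<plusminus> (n choose j) c\<^sup>j \<noteq> 0\<close>.

  For \<open>UD(n)\<close>, a nonzero solution would survive under some specialization of the generic matrices to
  matrices of this kind, since every pair of \<open>n \<times> n\<close> matrices is a specialization of such a pair.\<close>

section \<open>Determinants and characteristic polynomials\<close>

text \<open>Two obstacles shape what follows. The elements \<open>reduced_sigma\<close> come from an
  arbitrarily chosen splitting. They are tied to a concrete one by the regular representation: left
  multiplication has its matrix over the center, its characteristic polynomial is the n-th power of
  the reduced one, and since n is invertible, a monic n-th root is unique and keeps its coefficients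
  in the center. This takes the place of Skolem-Noether. For UD(n), the defining intersection is a
  division algebra only if some division subalgebra contains the generic matrices, and a splitting
  requires a basis over the center. The former consists of fractions of polynomial matrices all of
  whose specializations are equivariant; the leading monomials show that their determinants do not
  vanish. The basis consists of words in the generic matrices, tested at one explicit
  specialization. Polynomials are used throughout instead of a valuation: the system is homogeneous,
  so one denominator can be cleared from all unknowns, and algebraic independence turns equations
  between values back into equations between polynomials.\<close>

locale graded_map =
  fixes p :: "nat \<Rightarrow> 'a::comm_ring_1 \<Rightarrow> bool" and \<gamma> :: "nat \<Rightarrow> 'a \<Rightarrow> 'b::comm_ring_1"
  assumes p_one: "p 0 1" and g_one: "\<gamma> 0 1 = 1"
    and p_zero: "p e 0" and g_zero: "\<gamma> e 0 = 0"
    and p_add: "p e x \<Longrightarrow> p e y \<Longrightarrow> p e (x + y)"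
    and g_add: "p e x \<Longrightarrow> p e y \<Longrightarrow> \<gamma> e (x + y) = \<gamma> e x + \<gamma> e y"
    and p_minus: "p e x \<Longrightarrow> p e (- x)"
    and g_minus: "p e x \<Longrightarrow> \<gamma> e (- x) = - \<gamma> e x"
    and p_mult: "p d x \<Longrightarrow> p e y \<Longrightarrow> p (d + e) (x * y)"
    and g_mult: "p d x \<Longrightarrow> p e y \<Longrightarrow> \<gamma> (d + e) (x * y) = \<gamma> d x * \<gamma> e y"
begin

lemma sum_graded:
  assumes "\<And>i. i \<in> I \<Longrightarrow> p e (f i)"
  shows "p e (sum f I) \<and> \<gamma> e (sum f I) = (\<Sum>i\<in>I. \<gamma> e (f i))"
  using assms by (induction I rule: infinite_finite_induct) (auto simp: p_zero g_zero p_add g_add)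

lemma prod_graded:
  assumes "finite I" "\<And>i. i \<in> I \<Longrightarrow> p 1 (f i)"
  shows "p (card I) (prod f I) \<and> \<gamma> (card I) (prod f I) = (\<Prod>i\<in>I. \<gamma> 1 (f i))"
  using assms
proof (induction I rule: finite_induct)
  case empty
  then show ?case by (simp add: p_one g_one)
next
  case (insert x F)
  then show ?case using p_mult[of 1 "f x" "card F"] g_mult[of 1 "f x" "card F"] by simp
qed

text \<open>Each term of the Leibniz formula is a product of \<open>n\<close> factors of degree
  1.\<close>

lemma det_graded:
  assumes A: "A \<in> carrier_mat n n" and e: "\<And>i j. i < n \<Longrightarrow> j < n \<Longrightarrow> p 1 (A $$ (i, j))"
  shows "p n (det A) \<and> \<gamma> n (det A) = det (map_mat (\<gamma> 1) A)"
proof -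
  let ?S = "{\<pi>. \<pi> permutes {0..<n}}"
  have pr: "p n (\<Prod>i = 0..<n. A $$ (i, \<pi> i)) \<and>
      \<gamma> n (\<Prod>i = 0..<n. A $$ (i, \<pi> i)) = (\<Prod>i = 0..<n. \<gamma> 1 (A $$ (i, \<pi> i)))"
    if "\<pi> \<in> ?S" for \<pi>
    using prod_graded[of "{0..<n}" "\<lambda>i. A $$ (i, \<pi> i)"] e that
    by (auto simp: permutes_in_image)
  have sg: "p n (signof \<pi> * (\<Prod>i = 0..<n. A $$ (i, \<pi> i))) \<and>
      \<gamma> n (signof \<pi> * (\<Prod>i = 0..<n. A $$ (i, \<pi> i))) = signof \<pi> * (\<Prod>i = 0..<n. \<gamma> 1 (A $$ (i, \<pi> i)))"
    if "\<pi> \<in> ?S" for \<pi>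
    using pr[OF that] by (auto simp: sign_def p_minus g_minus)
  have "(\<Sum>\<pi>\<in>?S. signof \<pi> * (\<Prod>i = 0..<n. \<gamma> 1 (A $$ (i, \<pi> i)))) = det (map_mat (\<gamma> 1) A)"
    using A by (auto simp: det_def permutes_in_image intro!: sum.cong prod.cong)
  then show ?thesis
    using sum_graded[of ?S n "\<lambda>\<pi>. signof \<pi> * (\<Prod>i = 0..<n. A $$ (i, \<pi> i))"] sg A
    by (simp add: det_def)
qed

text \<open>The variable gets degree 1, so in filtration step \<open>e\<close> the coefficient of
  index \<open>d\<close> has degree \<open>e - d\<close>. With this convention the entries of the
  characteristic matrix have degree 1 whenever those of the matrix do.\<close>

definition pP :: "nat \<Rightarrow> 'a poly \<Rightarrow> bool" where
  "pP e q \<longleftrightarrow> (\<forall>d. if d \<le> e then p (e - d) (poly.coeff q d) else poly.coeff q d = 0)"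

definition gP :: "nat \<Rightarrow> 'a poly \<Rightarrow> 'b poly" where
  "gP e q = (\<Sum>d\<le>e. Polynomial.monom (\<gamma> (e - d) (poly.coeff q d)) d)"

lemma coeff_gP: "poly.coeff (gP e q) d = (if d \<le> e then \<gamma> (e - d) (poly.coeff q d) else 0)"
  unfolding gP_def by (auto simp: coeff_sum if_distrib sum.delta cong: if_cong)

lemma poly_graded_map: "graded_map pP gP"
proof
  fix d e x y assume x: "pP d x" and y: "pP e y"
  have t: "p (d + e - k) (poly.coeff x i * poly.coeff y (k - i)) \<and>
      \<gamma> (d + e - k) (poly.coeff x i * poly.coeff y (k - i)) =
      poly.coeff (gP d x) i * poly.coeff (gP e y) (k - i)" if "k \<le> d + e" "i \<le> k" for k i
  proof (cases "i \<le> d \<and> k - i \<le> e")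
    case True
    then have "d + e - k = (d - i) + (e - (k - i))" using that by auto
    moreover have "p (d - i) (poly.coeff x i)" "p (e - (k - i)) (poly.coeff y (k - i))"
      using x y True unfolding pP_def by metis+
    ultimately show ?thesis
      using True p_mult[of "d - i" "poly.coeff x i" "e - (k - i)"]
        g_mult[of "d - i" "poly.coeff x i" "e - (k - i)"] by (simp add: coeff_gP)
  next
    case False
    then have "poly.coeff x i = 0 \<or> poly.coeff y (k - i) = 0" using x y unfolding pP_def by metis
    then show ?thesis using False by (auto simp: p_zero g_zero coeff_gP)
  qed
  have z: "poly.coeff (x * y) k = 0" if "k > d + e" for k
    unfolding coeff_mult
  proof (rule sum.neutral, rule ballI)
    fix i assume "i \<in> {..k}"
    then have "i > d \<or> k - i > e" using that by auto
    then have "poly.coeff x i = 0 \<or> poly.coeff y (k - i) = 0"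
      using x y unfolding pP_def by (metis not_le)
    then show "poly.coeff x i * poly.coeff y (k - i) = 0" by auto
  qed
  have z2: "poly.coeff (gP d x * gP e y) k = 0" if "k > d + e" for k
    unfolding coeff_mult coeff_gP using that by (intro sum.neutral) auto
  show "pP (d + e) (x * y)"
    unfolding pP_def using z sum_graded[of "{.._}" _ "\<lambda>i. poly.coeff x i * poly.coeff y (_ - i)"] t
    by (auto simp: coeff_mult)
  show "gP (d + e) (x * y) = gP d x * gP e y"
  proof (rule poly_eqI)
    fix k show "poly.coeff (gP (d + e) (x * y)) k = poly.coeff (gP d x * gP e y) k"
    proof (cases "k \<le> d + e")
      case True
      have "\<gamma> (d + e - k) (\<Sum>i\<le>k. poly.coeff x i * poly.coeff y (k - i)) =
        (\<Sum>i\<le>k. poly.coeff (gP d x) i * poly.coeff (gP e y) (k - i))"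
        using sum_graded[of "{..k}" "d + e - k" "\<lambda>i. poly.coeff x i * poly.coeff y (k - i)"] t[OF True]
        by simp
      then show ?thesis using True by (simp add: coeff_gP) (simp add: coeff_mult coeff_gP)
    next
      case False
      then show ?thesis using z2 by (simp add: coeff_gP)
    qed
  qed
next
  fix e x y assume "pP e x" "pP e y"
  then show "pP e (x + y)" "gP e (x + y) = gP e x + gP e y"
    by (auto simp: pP_def p_add split: if_splits) 
      (auto simp: pP_def poly_eq_iff coeff_gP g_add)
next
  fix e x assume "pP e x"
  then show "pP e (- x)" "gP e (- x) = - gP e x"
    by (auto simp: pP_def p_minus poly_eq_iff coeff_gP g_minus)
qed (auto simp: pP_def poly_eq_iff coeff_gP p_zero g_zero p_one g_one)

text \<open>The determinant rule is applied over polynomials, where the characteristic matrix has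
  degree 1. There are three uses: multiplication by \<open>c ^ e\<close>, a homomorphism defined
  only on a subring, and the coefficient at \<open>mscale e \<alpha>\<close> of polynomials bounded
  by that exponent.\<close>

theorem char_poly_graded:
  assumes A: "A \<in> carrier_mat n n" and e: "\<And>i j. i < n \<Longrightarrow> j < n \<Longrightarrow> p 1 (A $$ (i, j))" and d: "d \<le> n"
  shows "p (n - d) (poly.coeff (char_poly A) d)"
    and "\<gamma> (n - d) (poly.coeff (char_poly A) d) = poly.coeff (char_poly (map_mat (\<gamma> 1) A)) d"
proof -
  interpret P: graded_map pP gP by (rule poly_graded_map)
  have c: "poly.coeff (char_poly_matrix A $$ (i, j)) k =
      (if k = 0 then - A $$ (i, j) else if k = 1 \<and> i = j then 1 else 0)" if "i < n" "j < n" for i j k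
    using A that by (auto simp: char_poly_matrix_def coeff_pCons split: nat.splits)
  have c2: "poly.coeff (char_poly_matrix (map_mat (\<gamma> 1) A) $$ (i, j)) k =
      (if k = 0 then - \<gamma> 1 (A $$ (i, j)) else if k = 1 \<and> i = j then 1 else 0)" if "i < n" "j < n" for i j k
    using A that by (auto simp: char_poly_matrix_def coeff_pCons split: nat.splits)
  have cm: "char_poly_matrix A \<in> carrier_mat n n" using A by simp
  have ent: "pP 1 (char_poly_matrix A $$ (i, j))" if "i < n" "j < n" for i j
    unfolding pP_def using e[OF that] by (auto simp: c[OF that] p_minus p_one p_zero)
  have "map_mat (gP 1) (char_poly_matrix A) = char_poly_matrix (map_mat (\<gamma> 1) A)"
  proof (rule eq_matI)
    fix i j assume "i < dim_row (char_poly_matrix (map_mat (\<gamma> 1) A))"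
      "j < dim_col (char_poly_matrix (map_mat (\<gamma> 1) A))"
    then have ij: "i < n" "j < n" using A by (auto simp: char_poly_matrix_def)
    have "gP 1 (char_poly_matrix A $$ (i, j)) = char_poly_matrix (map_mat (\<gamma> 1) A) $$ (i, j)"
      using e[OF ij]
      by (cases "i = j") (auto simp: poly_eq_iff coeff_gP c c2 ij g_minus g_one g_zero not_le
          simp del: One_nat_def)
    then show "map_mat (gP 1) (char_poly_matrix A) $$ (i, j) = char_poly_matrix (map_mat (\<gamma> 1) A) $$ (i, j)"
      using ij cm by simp
  qed (use A in \<open>auto simp: char_poly_matrix_def\<close>)
  then have "pP n (char_poly A) \<and> gP n (char_poly A) = char_poly (map_mat (\<gamma> 1) A)"
    using P.det_graded[OF cm ent] by (simp add: char_poly_def)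
  then show "p (n - d) (poly.coeff (char_poly A) d)"
    "\<gamma> (n - d) (poly.coeff (char_poly A) d) = poly.coeff (char_poly (map_mat (\<gamma> 1) A)) d"
    using d unfolding pP_def by (metis, metis coeff_gP)
qed

end

lemma coeff_char_poly_smult:
  fixes A :: "'a::comm_ring_1 mat"
  assumes "A \<in> carrier_mat n n" "d \<le> n"
  shows "poly.coeff (char_poly (c \<cdot>\<^sub>m A)) d = c ^ (n - d) * poly.coeff (char_poly A) d"
proof -
  \<comment> \<open>Every element counts as having every degree; scaling by \<open>c ^ e\<close> in
    degree \<open>e\<close> is then compatible with products.\<close>
  interpret graded_map "\<lambda>_ _. True" "\<lambda>e x. c ^ e * x"
    by standard (auto simp: algebra_simps power_add)
  have "map_mat (\<lambda>x. c ^ 1 * x) A = c \<cdot>\<^sub>m A" by (rule eq_matI) auto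
  then show ?thesis using char_poly_graded(2)[OF assms(1) _ assms(2)] by simp
qed

section \<open>Roots of monic polynomials\<close>

lemma coeff_mult_bounds:
  fixes a b :: "'a::comm_ring_1 poly"
  assumes "degree a \<le> x" "degree b \<le> y"
  shows "poly.coeff (a * b) (x + y) = poly.coeff a x * poly.coeff b y"
proof -
  have "poly.coeff (a * b) (x + y) = (\<Sum>i\<le>x + y. if i = x then poly.coeff a x * poly.coeff b y else 0)"
    unfolding coeff_mult
  proof (rule sum.cong)
    fix i assume "i \<in> {..x + y}"
    show "poly.coeff a i * poly.coeff b (x + y - i) = (if i = x then poly.coeff a x * poly.coeff b y else 0)"
    proof (cases i x rule: linorder_cases)
      case less
      then have "poly.coeff b (x + y - i) = 0" using assms by (intro coeff_eq_0) auto
      then show ?thesis using less by simp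
    next
      case greater
      then have "poly.coeff a i = 0" using assms by (intro coeff_eq_0) auto
      then show ?thesis using greater by simp
    qed simp
  qed simp
  then show ?thesis by simp
qed

text \<open>Perturbing a monic \<open>H\<close> of degree \<open>n\<close> in degrees \<open>\<le> n - j\<close> changes the coefficient of
  \<open>H ^ r\<close> in degree \<open>r * n - j\<close> linearly. Hence a monic \<open>r\<close>-th root is determined from the top
  coefficient downwards, each step requiring a division by \<open>r\<close> only.\<close>

lemma monic_power_perturb:
  fixes H E :: "'a::comm_ring_1 poly"
  assumes H: "degree H \<le> n" "poly.coeff H n = 1" and E: "degree E \<le> n - j" and j: "1 \<le> j" "j \<le> n"
  shows "\<exists>D. (H + E) ^ r = H ^ r + D \<and> degree D \<le> r * n - j \<and>
    poly.coeff D (r * n - j) = of_nat r * poly.coeff E (n - j)"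
proof (induction r)
  case 0
  show ?case by (intro exI[of _ 0]) auto
next
  case (Suc r)
  then obtain D where D: "(H + E) ^ r = H ^ r + D" "degree D \<le> r * n - j"
    "poly.coeff D (r * n - j) = of_nat r * poly.coeff E (n - j)" by auto
  have HE: "degree (H + E) \<le> n" using H(1) E by (intro degree_add_le) auto
  have HEn: "poly.coeff (H + E) n = 1" using H(2) E j by (simp add: coeff_eq_0)
  have Hr: "degree (H ^ r) \<le> r * n \<and> poly.coeff (H ^ r) (r * n) = 1"
  proof (induction r)
    case (Suc r)
    then show ?case using H coeff_mult_bounds[of H n "H ^ r" "r * n"]
      by (auto intro: order_trans[OF degree_mult_le])
  qed simp
  let ?D = "D * (H + E) + H ^ r * E"
  have eq: "(H + E) ^ Suc r = H ^ Suc r + ?D" using D(1) by (simp add: algebra_simps)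
  have i2: "Suc r * n - j = r * n + (n - j)" using j by simp
  have d2: "degree (H ^ r * E) \<le> Suc r * n - j"
    unfolding i2 using Hr E by (intro order_trans[OF degree_mult_le]) auto
  have c2: "poly.coeff (H ^ r * E) (Suc r * n - j) = poly.coeff E (n - j)"
    unfolding i2 using coeff_mult_bounds[of "H ^ r" "r * n" E "n - j"] Hr E by simp
  show ?case
  proof (cases "r = 0")
    case True
    then show ?thesis using E by (intro exI[of _ E]) auto
  next
    case False
    then have "j \<le> r * n" using j by (cases r) auto
    then have i1: "Suc r * n - j = (r * n - j) + n" by simp
    have d1: "degree (D * (H + E)) \<le> Suc r * n - j"
      unfolding i1 using D HE by (intro order_trans[OF degree_mult_le]) auto
    have c1: "poly.coeff (D * (H + E)) (Suc r * n - j) = of_nat r * poly.coeff E (n - j)"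
      unfolding i1 using coeff_mult_bounds[of D "r * n - j" "H + E" n] D HE HEn by simp
    have "degree ?D \<le> Suc r * n - j" by (rule degree_add_le[OF d1 d2])
    moreover have "poly.coeff ?D (Suc r * n - j) = of_nat (Suc r) * poly.coeff E (n - j)"
      by (simp only: coeff_add c1 c2) (simp add: algebra_simps)
    ultimately show ?thesis using eq by blast
  qed
qed

text \<open>If the roots differed, the leading coefficient of their difference, multiplied by
  \<open>r\<close>, would survive in the difference of the \<open>r\<close>-th powers.\<close>

lemma monic_root_unique:
  fixes P Q :: "'a::idom poly"
  assumes "degree P = n" "degree Q = n" "poly.coeff P n = 1" "poly.coeff Q n = 1"
    and "P ^ r = Q ^ r" and r: "(of_nat r :: 'a) \<noteq> 0"
  shows "P = Q"
proof (rule ccontr)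
  assume ne: "P \<noteq> Q"
  let ?E = "Q - P"
  have dE: "degree ?E \<le> n" using assms(1,2) by (intro degree_diff_le) auto
  have "degree ?E \<noteq> n"
  proof
    assume "degree ?E = n"
    then have "lead_coeff ?E = 0" using assms by simp
    then have "?E = 0" by (simp only: leading_coeff_0_iff)
    then show False using ne by simp
  qed
  then have dn: "degree ?E < n" using dE by simp
  \<comment> \<open>Chosen so that the difference has degree exactly \<open>n - j\<close>; its
    leading coefficient is then the one that the perturbation lemma multiplies by
    \<open>r\<close>.\<close>
  define j where "j = n - degree ?E"
  have j: "1 \<le> j" "j \<le> n" "n - j = degree ?E" using dn by (auto simp: j_def)
  obtain D where D: "(P + ?E) ^ r = P ^ r + D" "poly.coeff D (r * n - j) = of_nat r * poly.coeff ?E (n - j)"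
    using monic_power_perturb[of P n ?E j r] assms j by auto
  have "D = 0" using D(1) assms(5) by simp
  then have "lead_coeff ?E = 0" using D(2) r j(3) by simp
  then have "?E = 0" by (simp only: leading_coeff_0_iff)
  then show False using ne by simp
qed

text \<open>\<open>F\<close> plays the role of a subring containing \<open>1/r\<close>. Descending
  from the top, the contribution of the known coefficients to the \<open>r\<close>-th power can be
  subtracted, and \<open>r\<close> times the next coefficient is left.\<close>

lemma monic_root_coeffs:
  fixes Q :: "'a::field poly" and F :: "'a set"
  assumes F: "0 \<in> F" "1 \<in> F" "\<And>x y. x \<in> F \<Longrightarrow> y \<in> F \<Longrightarrow> x + y \<in> F"
      "\<And>x y. x \<in> F \<Longrightarrow> y \<in> F \<Longrightarrow> x * y \<in> F" "\<And>x. x \<in> F \<Longrightarrow> - x \<in> F"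
    and r: "inverse (of_nat r) \<in> F" "(of_nat r :: 'a) \<noteq> 0"
    and Q: "degree Q = n" "poly.coeff Q n = 1" and Qr: "\<And>d. poly.coeff (Q ^ r) d \<in> F"
  shows "poly.coeff Q d \<in> F"
proof -
  have sm: "sum f I \<in> F" if "\<And>i. i \<in> I \<Longrightarrow> f i \<in> F" for I :: "nat set" and f
    using that by (induction I rule: infinite_finite_induct) (auto simp: F)
  have *: "poly.coeff Q (n - j) \<in> F" if "j \<le> n" for j
    using that
  proof (induction j rule: less_induct)
    case (less j)
    show ?case
    proof (cases "j = 0")
      case True
      then show ?thesis using Q F by simp
    next
      case False
      \<comment> \<open>The part of \<open>Q\<close> above degree \<open>n - j\<close>, whose
        coefficients lie in \<open>F\<close> by induction; the rest \<open>E\<close> has degree at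
        most \<open>n - j\<close>.\<close>
      define H where "H = (\<Sum>d\<in>{n - j<..n}. Polynomial.monom (poly.coeff Q d) d)"
      define E where "E = Q - H"
      have cH: "poly.coeff H d = (if n - j < d \<and> d \<le> n then poly.coeff Q d else 0)" for d
        unfolding H_def by (auto simp: coeff_sum if_distrib sum.delta cong: if_cong)
      have cHF: "poly.coeff H d \<in> F" for d
      proof (cases "n - j < d \<and> d \<le> n")
        case True
        then have "n - (n - d) = d" "n - d < j" by auto
        then show ?thesis using less.IH[of "n - d"] True by (simp add: cH)
      qed (auto simp: cH F)
      have cHr: "poly.coeff (H ^ k) d \<in> F" for k d
      proof (induction k arbitrary: d)
        case 0
        then show ?case by (auto simp: F)
      next
        case (Suc k)
        then show ?case unfolding power_Suc coeff_mult by (intro sm F(4) cHF) auto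
      qed
      have dH: "degree H \<le> n" by (rule degree_le) (auto simp: cH)
      have H1: "poly.coeff H n = 1" using Q False less.prems by (simp add: cH)
      have dE: "degree E \<le> n - j"
        by (rule degree_le) (auto simp: E_def cH Q(1) intro: coeff_eq_0)
      obtain D where D: "(H + E) ^ r = H ^ r + D" "poly.coeff D (r * n - j) = of_nat r * poly.coeff E (n - j)"
        using monic_power_perturb[OF dH H1 dE, of r] False less.prems by auto
      have "of_nat r * poly.coeff Q (n - j) = poly.coeff (Q ^ r) (r * n - j) + - poly.coeff (H ^ r) (r * n - j)"
        using D by (simp add: E_def cH algebra_simps)
      also have "\<dots> \<in> F" by (intro F Qr cHr)
      finally have "of_nat r * poly.coeff Q (n - j) \<in> F" .
      then have "inverse (of_nat r) * (of_nat r * poly.coeff Q (n - j)) \<in> F" by (rule F(4)[OF r(1)])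
      then show ?thesis using r(2) by (simp add: mult.assoc[symmetric])
    qed
  qed
  show ?thesis
  proof (cases "d \<le> n")
    case True
    then show ?thesis using *[of "n - d"] by simp
  next
    case False
    then show ?thesis using Q(1) F(1) by (simp add: coeff_eq_0)
  qed
qed

section \<open>Block matrices\<close>

text \<open>The block diagonal matrix with \<open>k\<close> copies of \<open>M\<close>. For
  \<open>k = n\<close> it describes left multiplication by \<open>M\<close> on the \<open>n\<close>
  by \<open>n\<close> matrices when their columns are stacked.\<close>

definition rep_block :: "nat \<Rightarrow> nat \<Rightarrow> 'a::zero mat \<Rightarrow> 'a mat" where
  "rep_block k n M = mat (k * n) (k * n) (\<lambda>(i, j). if i div n = j div n then M $$ (i mod n, j mod n) else 0)"

lemma det_rep_block:
  fixes M :: "'a::idom mat"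
  assumes M: "M \<in> carrier_mat n n" and n: "0 < n"
  shows "det (rep_block k n M) = det M ^ k"
proof (induction k)
  case 0
  have "rep_block 0 n M \<in> carrier_mat 0 0" by (simp add: rep_block_def)
  then show ?case by simp
next
  case (Suc k)
  have e: "rep_block (Suc k) n M = four_block_mat (rep_block k n M) (0\<^sub>m (k * n) n) (0\<^sub>m n (k * n)) M"
    (is "_ = ?R")
  proof (rule eq_matI)
    fix i j assume "i < dim_row ?R" "j < dim_col ?R"
    then have ij: "i < k * n + n" "j < k * n + n" using M by (auto simp: rep_block_def)
    have dv: "x div n = k \<and> x mod n = x - k * n" if "x < k * n + n" "k * n \<le> x" for x
    proof -
      have "k \<le> x div n" using that n by (simp add: less_eq_div_iff_mult_less_eq)
      moreover have "x div n < Suc k" using that n by (simp add: div_less_iff_less_mult)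
      ultimately have "x div n = k" by simp
      then show ?thesis using minus_div_mult_eq_mod[of x n] by simp
    qed
    have lt: "(x div n < k) = (x < k * n)" for x using n by (simp add: div_less_iff_less_mult)
    show "rep_block (Suc k) n M $$ (i, j) = ?R $$ (i, j)"
      using ij M lt[of i] lt[of j] dv[of i] dv[of j]
      by (cases "i < k * n"; cases "j < k * n") (auto simp: rep_block_def not_less)
  qed (use M in \<open>auto simp: rep_block_def\<close>)
  have "det (rep_block (Suc k) n M) = det (rep_block k n M) * det M"
    unfolding e by (rule det_four_block_mat_lower_left_zero[OF _ _ _ M]) (auto simp: rep_block_def)
  then show ?case using Suc by simp
qed

lemma char_poly_rep_block:
  fixes M :: "'a::field mat"
  assumes M: "M \<in> carrier_mat n n" and n: "0 < n"
  shows "char_poly (rep_block k n M) = char_poly M ^ k"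
proof -
  have "char_poly_matrix (rep_block k n M) = rep_block k n (char_poly_matrix M)"
  proof (rule eq_matI)
    fix i j assume "i < dim_row (rep_block k n (char_poly_matrix M))" "j < dim_col (rep_block k n (char_poly_matrix M))"
    then have ij: "i < k * n" "j < k * n" by (auto simp: rep_block_def)
    have "i = j \<longleftrightarrow> i div n = j div n \<and> i mod n = j mod n" by (metis div_mult_mod_eq)
    then show "char_poly_matrix (rep_block k n M) $$ (i, j) = rep_block k n (char_poly_matrix M) $$ (i, j)"
      using ij M n by (auto simp: rep_block_def char_poly_matrix_def)
  qed (auto simp: rep_block_def char_poly_matrix_def)
  then show ?thesis using det_rep_block[OF char_poly_matrix_closed[OF M] n]
    by (simp add: char_poly_def)
qed

section \<open>The reduced characteristic polynomial from an explicit splitting\<close>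

lemma index_mult_sum:
  assumes "A \<in> carrier_mat n k" "B \<in> carrier_mat k m" "i < n" "j < m"
  shows "(A * B) $$ (i, j) = (\<Sum>l<k. A $$ (i, l) * B $$ (l, j))"
  using assms by (auto simp: scalar_prod_def atLeast0LessThan intro!: sum.cong)

lemma smult_one_mult_index:
  assumes "(B :: 'a::comm_ring_1 mat) \<in> carrier_mat n n" "i < n" "j < n"
  shows "((c \<cdot>\<^sub>m 1\<^sub>m n) * B) $$ (i, j) = c * B $$ (i, j)"
proof -
  have "(c \<cdot>\<^sub>m 1\<^sub>m n) * B = c \<cdot>\<^sub>m (1\<^sub>m n * B)" using assms(1) by (intro mult_smult_assoc_mat) auto
  then show ?thesis using assms by simp
qed

lemma smult_one_eqD: "0 < n \<Longrightarrow> (c :: 'a::comm_ring_1) \<cdot>\<^sub>m 1\<^sub>m n = d \<cdot>\<^sub>m 1\<^sub>m n \<Longrightarrow> c = d"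
proof -
  assume n: "0 < n" and eq: "c \<cdot>\<^sub>m 1\<^sub>m n = d \<cdot>\<^sub>m 1\<^sub>m n"
  have "(c \<cdot>\<^sub>m 1\<^sub>m n) $$ (0, 0) = (d \<cdot>\<^sub>m 1\<^sub>m n) $$ (0, 0)" by (simp only: eq)
  then show "c = d" using n by simp
qed

text \<open>Matrix units suffice as test matrices: commuting with them kills the entries off the
  diagonal and equates those on it.\<close>

lemma commuting_imp_scalar:
  fixes M :: "'a::comm_ring_1 mat"
  assumes M: "M \<in> carrier_mat n n" and n: "0 < n"
    and c: "\<And>Z. Z \<in> carrier_mat n n \<Longrightarrow> M * Z = Z * M"
  shows "\<exists>e. M = e \<cdot>\<^sub>m 1\<^sub>m n"
proof -
  have e: "(\<Sum>l<n. M $$ (i, l) * (if l = i \<and> j = j' then 1 else 0)) =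
      (\<Sum>l<n. (if i = i \<and> l = j then 1 else 0) * M $$ (l, j'))" if "i < n" "j < n" "j' < n" for i j j'
  proof -
    let ?Z = "mat n n (\<lambda>(a, b). if a = i \<and> b = j then 1 else 0 :: 'a)"
    have Z: "?Z \<in> carrier_mat n n" by simp
    have "(M * ?Z) $$ (i, j') = (?Z * M) $$ (i, j')" using c[OF Z] by simp
    moreover have "(M * ?Z) $$ (i, j') = (\<Sum>l<n. M $$ (i, l) * (if l = i \<and> j = j' then 1 else 0))"
      unfolding index_mult_sum[OF M Z that(1,3)] using that by (intro sum.cong) auto
    moreover have "(?Z * M) $$ (i, j') = (\<Sum>l<n. (if i = i \<and> l = j then 1 else 0) * M $$ (l, j'))"
      unfolding index_mult_sum[OF Z M that(1,3)] using that by (intro sum.cong) auto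
    ultimately show ?thesis by simp
  qed
  define e0 where "e0 = M $$ (0, 0)"
  have "M $$ (i, j) = (if i = j then e0 else 0)" if ij: "i < n" "j < n" for i j
  proof -
    have s: "(\<Sum>l<n. M $$ (i, l) * (if l = i \<and> P then 1 else 0)) = (if P then M $$ (i, i) else 0)"
      if "i < n" for i P using that by (auto simp: if_distrib cong: if_cong)
    have s': "(\<Sum>l<n. (if i = i \<and> l = j then 1 else 0) * M $$ (l, j')) = M $$ (j, j')"
      if "j < n" for i j' j :: nat using that by (auto simp: if_distrib if_distribR cong: if_cong)
    have d: "M $$ (0, 0) = M $$ (i, i)" if "i < n" for i
      using e[OF n that that] unfolding s[OF n] s'[OF that] by simp
    show ?thesis using e[OF n ij] d[OF ij(1)] unfolding s[OF n] s'[OF ij(1)] e0_def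
      by (cases "i = j") auto
  qed
  then have "M = e0 \<cdot>\<^sub>m 1\<^sub>m n" using M by (intro eq_matI) auto
  then show ?thesis by blast
qed

lemma hom_finsum_index:
  fixes \<psi> :: "'a \<Rightarrow> 'l::field mat"
  assumes A: "ring A" and hom: "\<psi> \<in> Ring.ring_hom A (ring_mat TYPE('l) n ())"
    and f: "\<And>x. x \<in> B \<Longrightarrow> f x \<in> carrier A" and ij: "i < n" "j < n" and B: "finite B"
  shows "\<psi> (finsum A f B) $$ (i, j) = (\<Sum>x\<in>B. \<psi> (f x) $$ (i, j))"
proof -
  interpret ring A by fact
  have cl: "\<psi> x \<in> carrier_mat n n" if "x \<in> carrier A" for x
    using ring_hom_closed[OF hom that] by (simp add: ring_mat_simps)
  have ad: "\<psi> (x \<oplus>\<^bsub>A\<^esub> y) = \<psi> x + \<psi> y" if "x \<in> carrier A" "y \<in> carrier A" for x y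
    using ring_hom_add[OF hom that] by (simp add: ring_mat_simps)
  have z: "\<psi> \<zero>\<^bsub>A\<^esub> $$ (i, j) = 0"
  proof -
    have "\<psi> \<zero>\<^bsub>A\<^esub> $$ (i, j) = (\<psi> \<zero>\<^bsub>A\<^esub> + \<psi> \<zero>\<^bsub>A\<^esub>) $$ (i, j)" using ad[of "\<zero>\<^bsub>A\<^esub>" "\<zero>\<^bsub>A\<^esub>"] by simp
    also have "\<dots> = \<psi> \<zero>\<^bsub>A\<^esub> $$ (i, j) + \<psi> \<zero>\<^bsub>A\<^esub> $$ (i, j)" using cl[of "\<zero>\<^bsub>A\<^esub>"] ij by simp
    finally have "\<psi> \<zero>\<^bsub>A\<^esub> $$ (i, j) + 0 = \<psi> \<zero>\<^bsub>A\<^esub> $$ (i, j) + \<psi> \<zero>\<^bsub>A\<^esub> $$ (i, j)"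
      by (simp only: add_0_right)
    then show ?thesis by (simp only: add_left_cancel)
  qed
  show ?thesis using B f
  proof (induction B rule: finite_induct)
    case empty
    then show ?case using z by simp
  next
    case (insert x F)
    have "finsum A f F \<in> carrier A" using insert by (intro finsum_closed) auto
    moreover have "f \<in> F \<rightarrow> carrier A" using insert by auto
    ultimately show ?case using insert ij ad[of "f x" "finsum A f F"] cl[of "f x"] cl[of "finsum A f F"]
      by (simp add: finsum_insert)
  qed
qed

lemma ring_mat_finsum_index:
  fixes f :: "'b \<Rightarrow> 'l::field mat"
  assumes f: "\<And>x. x \<in> B \<Longrightarrow> f x \<in> carrier_mat n n" and ij: "i < n" "j < n" and B: "finite B"
  shows "finsum (ring_mat TYPE('l) n ()) f B $$ (i, j) = (\<Sum>x\<in>B. f x $$ (i, j))"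
proof (rule hom_finsum_index[where \<psi> = "\<lambda>x. x" and A = "ring_mat TYPE('l) n ()"])
  show "ring (ring_mat TYPE('l) n ())" by (rule ring_mat)
  show "(\<lambda>x. x) \<in> Ring.ring_hom (ring_mat TYPE('l) n ()) (ring_mat TYPE('l) n ())"
    by (simp add: Ring.ring_hom_def)
qed (use assms in \<open>simp_all add: ring_mat_simps\<close>)

text \<open>A splitting given by an indexed family and conditions on matrix entries. The center is
  not mentioned: coordinates only have to be scalars that come from the algebra, and
  \<open>center_iff\<close> recovers the center as the preimage of the scalar matrices. By
  \<open>center_inverse\<close> it is closed under inverses.\<close>

locale explicit_splitting =
  fixes A :: "('a, 'x) ring_scheme" and n :: nat and \<phi> :: "'a \<Rightarrow> 'l::field mat" and b :: "nat \<Rightarrow> 'a"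
  assumes ringA: "ring A" and n: "0 < n"
    and hom: "\<phi> \<in> Ring.ring_hom A (ring_mat TYPE('l) n ())"
    and inj: "inj_on \<phi> (carrier A)"
    and b: "\<And>r. r < n * n \<Longrightarrow> b r \<in> carrier A"
    and span: "\<And>M. M \<in> carrier_mat n n \<Longrightarrow>
      \<exists>g. \<forall>i<n. \<forall>j<n. M $$ (i, j) = (\<Sum>r<n * n. g r * \<phi> (b r) $$ (i, j))"
    and coord: "\<And>a. a \<in> carrier A \<Longrightarrow>
      \<exists>f. (\<forall>r<n * n. \<exists>c\<in>carrier A. \<phi> c = f r \<cdot>\<^sub>m 1\<^sub>m n) \<and>
        (\<forall>i<n. \<forall>j<n. \<phi> a $$ (i, j) = (\<Sum>r<n * n. f r * \<phi> (b r) $$ (i, j)))"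
    and center_inverse: "\<And>c f. c \<in> carrier A \<Longrightarrow> \<phi> c = f \<cdot>\<^sub>m 1\<^sub>m n \<Longrightarrow> f \<noteq> 0 \<Longrightarrow>
      \<exists>d\<in>carrier A. \<phi> d = inverse f \<cdot>\<^sub>m 1\<^sub>m n"
begin

sublocale ring A by (rule ringA)

abbreviation "RM \<equiv> ring_mat TYPE('l) n ()"

text \<open>Column \<open>r\<close> is the matrix of \<open>b r\<close> with its columns written
  below one another: position \<open>y\<close> stands for row \<open>y mod n\<close> and column
  \<open>y div n\<close>.\<close>

definition stack :: "('a \<Rightarrow> 'l mat) \<Rightarrow> 'l mat" where
  "stack \<psi> = mat (n * n) (n * n) (\<lambda>(y, r). \<psi> (b r) $$ (y mod n, y div n))"

lemma nn: "x < n * n \<longleftrightarrow> x div n < n" for x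
  using n by (simp add: div_less_iff_less_mult)

lemma pair_index: "i < n \<Longrightarrow> j < n \<Longrightarrow> j * n + i < n * n \<and> (j * n + i) mod n = i \<and> (j * n + i) div n = j"
  using n by (auto simp: nn)

text \<open>Writing each matrix unit as a combination gives a right inverse. Because there are
  \<open>n * n\<close> generators, \<open>stack\<close> is square and the inverse is two-sided,
  which is where independence comes from.\<close>

lemma stack_right_inverse:
  assumes sp: "\<And>M. M \<in> carrier_mat n n \<Longrightarrow>
    \<exists>g. \<forall>i<n. \<forall>j<n. M $$ (i, j) = (\<Sum>r<n * n. g r * \<psi> (b r) $$ (i, j))"
  shows "\<exists>Y\<in>carrier_mat (n * n) (n * n). stack \<psi> * Y = 1\<^sub>m (n * n) \<and> Y * stack \<psi> = 1\<^sub>m (n * n)"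
proof -
  define E where "E x = (mat n n (\<lambda>(a, c). if a = x mod n \<and> c = x div n then 1 else 0 :: 'l))" for x
  have "\<forall>x. \<exists>g. \<forall>i<n. \<forall>j<n. E x $$ (i, j) = (\<Sum>r<n * n. g r * \<psi> (b r) $$ (i, j))"
  proof
    fix x
    have "E x \<in> carrier_mat n n" by (simp add: E_def)
    then show "\<exists>g. \<forall>i<n. \<forall>j<n. E x $$ (i, j) = (\<Sum>r<n * n. g r * \<psi> (b r) $$ (i, j))" by (rule sp)
  qed
  from choice[OF this] obtain g where
    g': "\<forall>x. \<forall>i<n. \<forall>j<n. E x $$ (i, j) = (\<Sum>r<n * n. g x r * \<psi> (b r) $$ (i, j))" ..
  then have g: "E x $$ (i, j) = (\<Sum>r<n * n. g x r * \<psi> (b r) $$ (i, j))" if "i < n" "j < n" for x i j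
    using that by simp
  define Y where "Y = mat (n * n) (n * n) (\<lambda>(r, x). g x r)"
  have Y: "Y \<in> carrier_mat (n * n) (n * n)" and P: "stack \<psi> \<in> carrier_mat (n * n) (n * n)"
    by (auto simp: Y_def stack_def)
  have "stack \<psi> * Y = 1\<^sub>m (n * n)"
  proof (rule eq_matI)
    fix y x assume "y < dim_row (1\<^sub>m (n * n))" "x < dim_col (1\<^sub>m (n * n))"
    then have yx: "y < n * n" "x < n * n" by auto
    then have yn: "y mod n < n" "y div n < n" using n by (auto simp: nn)
    have "(stack \<psi> * Y) $$ (y, x) = (\<Sum>r<n * n. g x r * \<psi> (b r) $$ (y mod n, y div n))"
      unfolding index_mult_sum[OF P Y yx] using yx by (auto simp: stack_def Y_def intro!: sum.cong)
    also have "\<dots> = (if y mod n = x mod n \<and> y div n = x div n then 1 else 0)"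
      unfolding g[OF yn, symmetric] using yn by (simp add: E_def)
    also have "\<dots> = 1\<^sub>m (n * n) $$ (y, x)" using yx by (auto, metis div_mult_mod_eq)
    finally show "(stack \<psi> * Y) $$ (y, x) = 1\<^sub>m (n * n) $$ (y, x)" .
  qed (auto simp: Y_def stack_def)
  then show ?thesis using mat_mult_left_right_inverse[OF P Y] Y by blast
qed

lemma independent:
  assumes g: "\<And>i j. i < n \<Longrightarrow> j < n \<Longrightarrow> (\<Sum>r<n * n. g r * \<phi> (b r) $$ (i, j)) = 0" and r: "r < n * n"
  shows "g r = 0"
proof -
  obtain Y where Y: "Y \<in> carrier_mat (n * n) (n * n)" "Y * stack \<phi> = 1\<^sub>m (n * n)"
    using stack_right_inverse[of \<phi>, OF span] by blast
  define v where "v = mat (n * n) 1 (\<lambda>(r, _). g r)"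
  have v: "v \<in> carrier_mat (n * n) 1" and P: "stack \<phi> \<in> carrier_mat (n * n) (n * n)"
    by (auto simp: v_def stack_def)
  have "stack \<phi> * v = 0\<^sub>m (n * n) 1"
  proof (rule eq_matI)
    fix y x assume "y < dim_row (0\<^sub>m (n * n) 1 :: 'l mat)" "x < dim_col (0\<^sub>m (n * n) 1 :: 'l mat)"
    then have yx: "y < n * n" "x < 1" by auto
    then have yn: "y mod n < n" "y div n < n" using n by (auto simp: nn)
    have "(stack \<phi> * v) $$ (y, x) = (\<Sum>r<n * n. g r * \<phi> (b r) $$ (y mod n, y div n))"
      unfolding index_mult_sum[OF P v yx] using yx by (auto simp: stack_def v_def intro!: sum.cong)
    then show "(stack \<phi> * v) $$ (y, x) = 0\<^sub>m (n * n) 1 $$ (y, x)" using g[OF yn] yx by simp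
  qed (auto simp: v_def stack_def)
  then have "Y * (stack \<phi> * v) = 0\<^sub>m (n * n) 1" using Y(1) by simp
  then have "v = 0\<^sub>m (n * n) 1" using Y v P by (simp add: assoc_mult_mat[symmetric])
  then have "v $$ (r, 0) = 0" using r by simp
  then show ?thesis using r by (simp add: v_def)
qed

lemma \<phi>_closed: "x \<in> carrier A \<Longrightarrow> \<phi> x \<in> carrier_mat n n"
  using ring_hom_closed[OF hom] by (simp add: ring_mat_simps)

lemma \<phi>_mult: "x \<in> carrier A \<Longrightarrow> y \<in> carrier A \<Longrightarrow> \<phi> (x \<otimes>\<^bsub>A\<^esub> y) = \<phi> x * \<phi> y"
  using ring_hom_mult[OF hom] by (simp add: ring_mat_simps)

lemma \<phi>_one: "\<phi> \<one>\<^bsub>A\<^esub> = 1\<^sub>m n"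
  using ring_hom_one[OF hom] by (simp add: ring_mat_simps)

text \<open>Spanning forces the image of a central element to commute with all matrices; conversely,
  injectivity pulls commutation with a scalar matrix back to the algebra.\<close>

lemma center_iff: "c \<in> ring_center A \<longleftrightarrow> c \<in> carrier A \<and> (\<exists>e. \<phi> c = e \<cdot>\<^sub>m 1\<^sub>m n)"
proof safe
  assume c: "c \<in> ring_center A"
  then show cA: "c \<in> carrier A" by (simp add: ring_center_def)
  show "\<exists>e. \<phi> c = e \<cdot>\<^sub>m 1\<^sub>m n"
  proof (rule commuting_imp_scalar[OF \<phi>_closed[OF cA] n])
    fix Z :: "'l mat" assume Z: "Z \<in> carrier_mat n n"
    obtain g where g: "\<And>i j. i < n \<Longrightarrow> j < n \<Longrightarrow> Z $$ (i, j) = (\<Sum>r<n * n. g r * \<phi> (b r) $$ (i, j))"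
      using span[OF Z] by metis
    have cb: "\<phi> c * \<phi> (b r) = \<phi> (b r) * \<phi> c" if "r < n * n" for r
      using c b[OF that] by (metis (mono_tags, lifting) \<phi>_mult mem_Collect_eq ring_center_def)
    have C: "\<phi> c \<in> carrier_mat n n" by (rule \<phi>_closed[OF cA])
    show "\<phi> c * Z = Z * \<phi> c"
    proof (rule eq_matI)
      fix i j assume "i < dim_row (Z * \<phi> c)" "j < dim_col (Z * \<phi> c)"
      then have ij: "i < n" "j < n" using Z C by auto
      have "(\<phi> c * Z) $$ (i, j) = (\<Sum>l<n. \<Sum>r<n * n. g r * (\<phi> c $$ (i, l) * \<phi> (b r) $$ (l, j)))"
        unfolding index_mult_sum[OF C Z ij] using ij
        by (auto simp: g sum_distrib_left intro!: sum.cong)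
      also have "\<dots> = (\<Sum>r<n * n. g r * (\<phi> c * \<phi> (b r)) $$ (i, j))"
        by (subst sum.swap) (auto simp: index_mult_sum[OF C \<phi>_closed[OF b] ij] sum_distrib_left intro!: sum.cong)
      also have "\<dots> = (\<Sum>r<n * n. g r * (\<phi> (b r) * \<phi> c) $$ (i, j))"
        by (auto simp: cb intro!: sum.cong)
      also have "\<dots> = (\<Sum>l<n. \<Sum>r<n * n. g r * (\<phi> (b r) $$ (i, l) * \<phi> c $$ (l, j)))"
        by (subst sum.swap) (auto simp: index_mult_sum[OF \<phi>_closed[OF b] C ij] sum_distrib_left intro!: sum.cong)
      also have "\<dots> = (Z * \<phi> c) $$ (i, j)"
        unfolding index_mult_sum[OF Z C ij] using ij
        by (auto simp: g sum_distrib_right mult.assoc intro!: sum.cong)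
      finally show "(\<phi> c * Z) $$ (i, j) = (Z * \<phi> c) $$ (i, j)" .
    qed (use Z C in auto)
  qed
next
  fix e assume c: "c \<in> carrier A" and e: "\<phi> c = e \<cdot>\<^sub>m 1\<^sub>m n"
  have "c \<otimes>\<^bsub>A\<^esub> a = a \<otimes>\<^bsub>A\<^esub> c" if a: "a \<in> carrier A" for a
  proof (rule inj_onD[OF inj])
    have "\<phi> c * \<phi> a = \<phi> a * \<phi> c"
      using \<phi>_closed[OF a] unfolding e
      by (simp add: mult_smult_assoc_mat[of _ n n _ n] mult_smult_distrib[of _ n n _ n])
    then show "\<phi> (c \<otimes>\<^bsub>A\<^esub> a) = \<phi> (a \<otimes>\<^bsub>A\<^esub> c)" using c a by (simp add: \<phi>_mult)
  qed (use c a in auto)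
  then show "c \<in> ring_center A" using c by (simp add: ring_center_def)
qed

lemma center_closed: "c \<in> ring_center A \<Longrightarrow> c \<in> carrier A"
  by (simp add: ring_center_def)

lemma \<phi>_comb:
  assumes "\<And>r. r < n * n \<Longrightarrow> c r \<in> ring_center A" "i < n" "j < n"
    and hom': "\<psi> \<in> Ring.ring_hom A RM" and sc: "\<And>c. c \<in> ring_center A \<Longrightarrow> \<psi> c = \<tau> c \<cdot>\<^sub>m 1\<^sub>m n"
  shows "\<psi> (finsum A (\<lambda>r. c r \<otimes>\<^bsub>A\<^esub> b r) {..<n * n}) $$ (i, j) = (\<Sum>r<n * n. \<tau> (c r) * \<psi> (b r) $$ (i, j))"
proof -
  have "\<psi> (c r \<otimes>\<^bsub>A\<^esub> b r) $$ (i, j) = \<tau> (c r) * \<psi> (b r) $$ (i, j)" if "r < n * n" for r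
  proof -
    have "\<psi> (b r) \<in> carrier_mat n n"
      using ring_hom_closed[OF hom' b[OF that]] by (simp add: ring_mat_simps)
    moreover have "\<psi> (c r \<otimes>\<^bsub>A\<^esub> b r) = \<psi> (c r) * \<psi> (b r)"
      using ring_hom_mult[OF hom' center_closed[OF assms(1)[OF that]] b[OF that]]
      by (simp add: ring_mat_simps)
    ultimately show ?thesis using smult_one_mult_index assms that by metis
  qed
  then show ?thesis
    using assms b center_closed by (subst hom_finsum_index[OF ringA hom']) auto
qed

definition sc :: "'a \<Rightarrow> 'l" where "sc c = \<phi> c $$ (0, 0)"

lemma \<phi>_center: "c \<in> ring_center A \<Longrightarrow> \<phi> c = sc c \<cdot>\<^sub>m 1\<^sub>m n"
  using n by (auto simp: center_iff sc_def)

lemma sc_inj: "inj_on sc (ring_center A)"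
proof (rule inj_onI)
  fix c d assume c: "c \<in> ring_center A" "d \<in> ring_center A" "sc c = sc d"
  then have "\<phi> c = \<phi> d" using \<phi>_center by simp
  then show "c = d" using inj c center_closed by (auto dest: inj_onD)
qed

lemma coords:
  assumes a: "a \<in> carrier A"
  shows "\<exists>c. (\<forall>r<n * n. c r \<in> ring_center A) \<and> a = finsum A (\<lambda>r. c r \<otimes>\<^bsub>A\<^esub> b r) {..<n * n}"
proof -
  obtain f where f: "\<And>r. r < n * n \<Longrightarrow> \<exists>c\<in>carrier A. \<phi> c = f r \<cdot>\<^sub>m 1\<^sub>m n"
    "\<And>i j. i < n \<Longrightarrow> j < n \<Longrightarrow> \<phi> a $$ (i, j) = (\<Sum>r<n * n. f r * \<phi> (b r) $$ (i, j))"
    using coord[OF a] by blast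
  obtain c where c: "\<And>r. r < n * n \<Longrightarrow> c r \<in> carrier A \<and> \<phi> (c r) = f r \<cdot>\<^sub>m 1\<^sub>m n" using f(1) by metis
  have cc: "c r \<in> ring_center A" if "r < n * n" for r using c[OF that] center_iff by blast
  have cl: "finsum A (\<lambda>r. c r \<otimes>\<^bsub>A\<^esub> b r) {..<n * n} \<in> carrier A"
    using c b by (intro finsum_closed) auto
  have "\<phi> a = \<phi> (finsum A (\<lambda>r. c r \<otimes>\<^bsub>A\<^esub> b r) {..<n * n})"
  proof (rule eq_matI)
    have d: "\<phi> a \<in> carrier_mat n n" "\<phi> (finsum A (\<lambda>r. c r \<otimes>\<^bsub>A\<^esub> b r) {..<n * n}) \<in> carrier_mat n n"
      using a cl \<phi>_closed by auto
    then show "dim_row (\<phi> a) = dim_row (\<phi> (finsum A (\<lambda>r. c r \<otimes>\<^bsub>A\<^esub> b r) {..<n * n}))"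
      "dim_col (\<phi> a) = dim_col (\<phi> (finsum A (\<lambda>r. c r \<otimes>\<^bsub>A\<^esub> b r) {..<n * n}))" by auto
    fix i j assume "i < dim_row (\<phi> (finsum A (\<lambda>r. c r \<otimes>\<^bsub>A\<^esub> b r) {..<n * n}))"
      "j < dim_col (\<phi> (finsum A (\<lambda>r. c r \<otimes>\<^bsub>A\<^esub> b r) {..<n * n}))"
    then have ij: "i < n" "j < n" using d by auto
    have "sc (c r) = f r" if "r < n * n" for r using c[OF that] n by (simp add: sc_def)
    then show "\<phi> a $$ (i, j) = \<phi> (finsum A (\<lambda>r. c r \<otimes>\<^bsub>A\<^esub> b r) {..<n * n}) $$ (i, j)"
      using f(2)[OF ij] \<phi>_comb[OF cc ij hom \<phi>_center] by simp
  qed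
  then have "a = finsum A (\<lambda>r. c r \<otimes>\<^bsub>A\<^esub> b r) {..<n * n}" by (rule inj_onD[OF inj _ a cl])
  then show ?thesis using cc by blast
qed

lemma b_inj: "inj_on b {..<n * n}"
proof (rule inj_onI)
  fix r r' assume r: "r \<in> {..<n * n}" "r' \<in> {..<n * n}" and eq: "b r = b r'"
  show "r = r'"
  proof (rule ccontr)
    assume ne: "r \<noteq> r'"
    let ?g = "\<lambda>x. (if x = r then 1 else 0) - (if x = r' then 1 else 0) :: 'l"
    have "?g r = 0"
    proof (rule independent[of ?g r])
      show "r < n * n" using r by simp
      fix i j assume "i < n" "j < n"
      show "(\<Sum>x<n * n. ?g x * \<phi> (b x) $$ (i, j)) = 0"
      proof -
        have *: "?g x * \<phi> (b x) $$ (i, j) =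
            (if x = r then \<phi> (b x) $$ (i, j) else 0) - (if x = r' then \<phi> (b x) $$ (i, j) else 0)" for x
          by simp
        show ?thesis unfolding * sum_subtractf using r eq by simp
      qed
    qed
    then show False using ne by simp
  qed
qed

end

section \<open>Comparison of an arbitrary splitting with the explicit one\<close>

context explicit_splitting
begin

lemma splitting: "splitting A n \<phi>"
proof -
  let ?B = "b ` {..<n * n}" and ?C = "ring_center A"
  have reA: "finsum A (\<lambda>x. f x \<otimes>\<^bsub>A\<^esub> x) ?B = finsum A (\<lambda>r. f (b r) \<otimes>\<^bsub>A\<^esub> b r) {..<n * n}"
    if f: "f \<in> ?B \<rightarrow>\<^sub>E ?C" for f
  proof (rule finsum_reindex[where f = "\<lambda>x. f x \<otimes>\<^bsub>A\<^esub> x" and h = b, OF _ b_inj], rule funcsetI)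
    fix x assume x: "x \<in> ?B"
    then have "f x \<in> carrier A" using f center_closed by (auto simp: PiE_def Pi_def)
    then show "f x \<otimes>\<^bsub>A\<^esub> x \<in> carrier A" using x b by auto
  qed
  have 1: "\<exists>!f. f \<in> ?B \<rightarrow>\<^sub>E ?C \<and> a = finsum A (\<lambda>x. f x \<otimes>\<^bsub>A\<^esub> x) ?B" if a: "a \<in> carrier A" for a
  proof -
    obtain c where c: "\<And>r. r < n * n \<Longrightarrow> c r \<in> ?C" "a = finsum A (\<lambda>r. c r \<otimes>\<^bsub>A\<^esub> b r) {..<n * n}"
      using coords[OF a] by blast
    let ?f = "restrict (\<lambda>x. c (inv_into {..<n * n} b x)) ?B"
    have fb: "?f (b r) = c r" if "r < n * n" for r using that b_inj by simp
    have f: "?f \<in> ?B \<rightarrow>\<^sub>E ?C" using c fb by auto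
    have fe: "a = finsum A (\<lambda>x. ?f x \<otimes>\<^bsub>A\<^esub> x) ?B"
      unfolding reA[OF f] c(2) by (rule finsum_cong') (use fb c b center_closed in auto)
    show ?thesis
    proof (rule ex1I[of _ ?f])
      fix g assume g: "g \<in> ?B \<rightarrow>\<^sub>E ?C \<and> a = finsum A (\<lambda>x. g x \<otimes>\<^bsub>A\<^esub> x) ?B"
      have gc: "g (b r) \<in> ?C" if "r < n * n" for r using g that by auto
      have "sc (g (b r)) - sc (c r) = 0" if r: "r < n * n" for r
      proof (rule independent[of "\<lambda>r. sc (g (b r)) - sc (c r)", OF _ r])
        fix i j assume ij: "i < n" "j < n"
        have "(\<Sum>r<n * n. sc (g (b r)) * \<phi> (b r) $$ (i, j)) = \<phi> a $$ (i, j)"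
          using \<phi>_comb[of "\<lambda>r. g (b r)", OF gc ij hom \<phi>_center] g reA by auto
        moreover have "(\<Sum>r<n * n. sc (c r) * \<phi> (b r) $$ (i, j)) = \<phi> a $$ (i, j)"
          using \<phi>_comb[of c, OF c(1) ij hom \<phi>_center] c(2) by auto
        ultimately show "(\<Sum>r<n * n. (sc (g (b r)) - sc (c r)) * \<phi> (b r) $$ (i, j)) = 0"
          by (simp add: left_diff_distrib sum_subtractf)
      qed
      then have "g (b r) = c r" if "r < n * n" for r
        using inj_onD[OF sc_inj _ gc[OF that] c(1)[OF that]] that by auto
      then show "g = ?f" using g f fb by (intro extensionalityI[of g ?B]) (auto simp: PiE_def)
    qed (use f fe in blast)
  qed
  have reM: "finsum RM (\<lambda>x. g x \<cdot>\<^sub>m \<phi> x) ?B $$ (i, j) = (\<Sum>r<n * n. g (b r) * \<phi> (b r) $$ (i, j))"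
    if "i < n" "j < n" for g i j
  proof -
    have "(g (b r) \<cdot>\<^sub>m \<phi> (b r)) $$ (i, j) = g (b r) * \<phi> (b r) $$ (i, j)" if "r < n * n" for r
      using \<phi>_closed[OF b[OF that]] \<open>i < n\<close> \<open>j < n\<close> by simp
    then show ?thesis
      using that b \<phi>_closed by (subst ring_mat_finsum_index) (auto simp: sum.reindex[OF b_inj] intro!: sum.cong)
  qed
  have clM: "finsum RM (\<lambda>x. g x \<cdot>\<^sub>m \<phi> x) ?B \<in> carrier_mat n n" for g
  proof -
    interpret M: ring RM by (rule ring_mat)
    have "finsum RM (\<lambda>x. g x \<cdot>\<^sub>m \<phi> x) ?B \<in> carrier RM"
      by (rule M.finsum_closed) (use b \<phi>_closed in \<open>auto simp: ring_mat_simps\<close>)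
    then show ?thesis by (simp add: ring_mat_simps)
  qed
  have 2: "\<exists>!g. g \<in> ?B \<rightarrow>\<^sub>E (UNIV :: 'l set) \<and> M = finsum RM (\<lambda>x. g x \<cdot>\<^sub>m \<phi> x) ?B"
    if M: "M \<in> carrier_mat n n" for M
  proof -
    obtain c where c: "\<And>i j. i < n \<Longrightarrow> j < n \<Longrightarrow> M $$ (i, j) = (\<Sum>r<n * n. c r * \<phi> (b r) $$ (i, j))"
      using span[OF M] by blast
    let ?f = "restrict (\<lambda>x. c (inv_into {..<n * n} b x)) ?B"
    have fb: "?f (b r) = c r" if "r < n * n" for r using that b_inj by simp
    show ?thesis
    proof (rule ex1I[of _ ?f])
      have "M = finsum RM (\<lambda>x. ?f x \<cdot>\<^sub>m \<phi> x) ?B"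
      proof (rule eq_matI)
        fix i j assume "i < dim_row (finsum RM (\<lambda>x. ?f x \<cdot>\<^sub>m \<phi> x) ?B)"
          "j < dim_col (finsum RM (\<lambda>x. ?f x \<cdot>\<^sub>m \<phi> x) ?B)"
        then have ij: "i < n" "j < n" using clM[of ?f] by auto
        show "M $$ (i, j) = finsum RM (\<lambda>x. ?f x \<cdot>\<^sub>m \<phi> x) ?B $$ (i, j)"
          unfolding reM[OF ij] c[OF ij] by (intro sum.cong) (use fb in auto)
      qed (use M clM[of ?f] in auto)
      then show "?f \<in> ?B \<rightarrow>\<^sub>E (UNIV :: 'l set) \<and> M = finsum RM (\<lambda>x. ?f x \<cdot>\<^sub>m \<phi> x) ?B" by auto
      fix g assume g: "g \<in> ?B \<rightarrow>\<^sub>E (UNIV :: 'l set) \<and> M = finsum RM (\<lambda>x. g x \<cdot>\<^sub>m \<phi> x) ?B"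
      have "g (b r) - c r = 0" if r: "r < n * n" for r
      proof (rule independent[of "\<lambda>r. g (b r) - c r", OF _ r])
        fix i j assume ij: "i < n" "j < n"
        show "(\<Sum>r<n * n. (g (b r) - c r) * \<phi> (b r) $$ (i, j)) = 0"
          using reM[OF ij, of g] g c[OF ij] by (simp add: left_diff_distrib sum_subtractf)
      qed
      then show "g = ?f" using g fb by (intro extensionalityI[of g ?B]) (auto simp: PiE_def)
    qed
  qed
  have "finite ?B \<and> ?B \<subseteq> carrier A" using b by auto
  moreover have "\<forall>c\<in>ring_center A. \<exists>e. \<phi> c = e \<cdot>\<^sub>m 1\<^sub>m n" using center_iff by simp
  ultimately show ?thesis
    unfolding splitting_def using hom 1 2
    apply (intro conjI)
    apply assumption
    apply assumption
    apply (rule exI[of _ ?B])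
    apply (simp only: simp_thms ball_simps)
    apply (intro conjI ballI; simp)
    done
qed

lemma center_subring:
  "\<zero>\<^bsub>A\<^esub> \<in> ring_center A" "\<one>\<^bsub>A\<^esub> \<in> ring_center A"
  "c \<in> ring_center A \<Longrightarrow> d \<in> ring_center A \<Longrightarrow> c \<oplus>\<^bsub>A\<^esub> d \<in> ring_center A"
  "c \<in> ring_center A \<Longrightarrow> d \<in> ring_center A \<Longrightarrow> c \<otimes>\<^bsub>A\<^esub> d \<in> ring_center A"
  "c \<in> ring_center A \<Longrightarrow> \<ominus>\<^bsub>A\<^esub> c \<in> ring_center A"
proof -
  assume "c \<in> ring_center A" "d \<in> ring_center A"
  then have cl: "c \<in> carrier A" "d \<in> carrier A"
    and cm: "\<And>a. a \<in> carrier A \<Longrightarrow> c \<otimes>\<^bsub>A\<^esub> a = a \<otimes>\<^bsub>A\<^esub> c" "\<And>a. a \<in> carrier A \<Longrightarrow> d \<otimes>\<^bsub>A\<^esub> a = a \<otimes>\<^bsub>A\<^esub> d"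
    by (simp_all add: ring_center_def)
  have "c \<otimes>\<^bsub>A\<^esub> d \<otimes>\<^bsub>A\<^esub> a = a \<otimes>\<^bsub>A\<^esub> (c \<otimes>\<^bsub>A\<^esub> d)" if a: "a \<in> carrier A" for a
  proof -
    have "c \<otimes>\<^bsub>A\<^esub> d \<otimes>\<^bsub>A\<^esub> a = c \<otimes>\<^bsub>A\<^esub> (a \<otimes>\<^bsub>A\<^esub> d)"
      unfolding m_assoc[OF cl a] cm(2)[OF a] ..
    also have "\<dots> = a \<otimes>\<^bsub>A\<^esub> c \<otimes>\<^bsub>A\<^esub> d"
      unfolding m_assoc[OF cl(1) a cl(2), symmetric] cm(1)[OF a] ..
    finally show ?thesis unfolding m_assoc[OF a cl] .
  qed
  then show "c \<otimes>\<^bsub>A\<^esub> d \<in> ring_center A" using cl by (simp add: ring_center_def)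
qed (simp_all add: ring_center_def l_distr r_distr l_minus r_minus)

lemma sc_hom:
  assumes "\<psi> \<in> Ring.ring_hom A RM" and sc': "\<forall>c\<in>ring_center A. \<psi> c = \<tau> c \<cdot>\<^sub>m 1\<^sub>m n"
    and c: "c \<in> ring_center A" "d \<in> ring_center A"
  shows "\<tau> (c \<oplus>\<^bsub>A\<^esub> d) = \<tau> c + \<tau> d" "\<tau> (c \<otimes>\<^bsub>A\<^esub> d) = \<tau> c * \<tau> d" "\<tau> \<one>\<^bsub>A\<^esub> = 1"
    "\<tau> (\<ominus>\<^bsub>A\<^esub> c) = - \<tau> c" "\<tau> \<zero>\<^bsub>A\<^esub> = 0"
proof -
  note sc = bspec[OF sc']
  have t: "\<tau> x = \<psi> x $$ (0, 0)" if "x \<in> ring_center A" for x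
    using sc[OF that] n by simp
  note cl = center_closed[OF c(1)] center_closed[OF c(2)]
  have ad: "\<tau> (x \<oplus>\<^bsub>A\<^esub> y) = \<tau> x + \<tau> y" if "x \<in> ring_center A" "y \<in> ring_center A" for x y
  proof -
    have "\<psi> (x \<oplus>\<^bsub>A\<^esub> y) = \<psi> x + \<psi> y"
      using ring_hom_add[OF assms(1) that[THEN center_closed]] by (simp add: ring_mat_simps)
    moreover have "x \<oplus>\<^bsub>A\<^esub> y \<in> ring_center A" using that by (auto simp: ring_center_def l_distr r_distr)
    ultimately have "\<tau> (x \<oplus>\<^bsub>A\<^esub> y) = (\<psi> x + \<psi> y) $$ (0, 0)" using t by simp
    also have "\<dots> = \<tau> x + \<tau> y" using n unfolding sc[OF that(1)] sc[OF that(2)] by simp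
    finally show ?thesis .
  qed
  show "\<tau> (c \<oplus>\<^bsub>A\<^esub> d) = \<tau> c + \<tau> d" by (rule ad[OF c])
  have "\<psi> (c \<otimes>\<^bsub>A\<^esub> d) = \<psi> c * \<psi> d"
    using ring_hom_mult[OF assms(1) cl] by (simp add: ring_mat_simps)
  moreover have "c \<otimes>\<^bsub>A\<^esub> d \<in> ring_center A" by (rule center_subring(4)[OF c])
  ultimately show "\<tau> (c \<otimes>\<^bsub>A\<^esub> d) = \<tau> c * \<tau> d"
    using t[of "c \<otimes>\<^bsub>A\<^esub> d"] sc[OF c(1)] sc[OF c(2)] n
      smult_one_mult_index[of "\<tau> d \<cdot>\<^sub>m 1\<^sub>m n" n 0 0 "\<tau> c"] by simp
  have "\<psi> \<one>\<^bsub>A\<^esub> = 1\<^sub>m n" using ring_hom_one[OF assms(1)] by (simp add: ring_mat_simps)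
  moreover have "\<one>\<^bsub>A\<^esub> \<in> ring_center A" by (simp add: ring_center_def)
  ultimately show "\<tau> \<one>\<^bsub>A\<^esub> = 1" using t[of "\<one>\<^bsub>A\<^esub>"] n by simp
  have z: "\<zero>\<^bsub>A\<^esub> \<in> ring_center A" by (simp add: ring_center_def)
  have "\<tau> \<zero>\<^bsub>A\<^esub> + 0 = \<tau> \<zero>\<^bsub>A\<^esub> + \<tau> \<zero>\<^bsub>A\<^esub>" using ad[OF z z] by simp
  then show z0: "\<tau> \<zero>\<^bsub>A\<^esub> = 0" by (simp only: add_left_cancel)
  have "\<ominus>\<^bsub>A\<^esub> c \<in> ring_center A" using c by (auto simp: ring_center_def l_minus r_minus)
  then have "\<tau> (c \<oplus>\<^bsub>A\<^esub> (\<ominus>\<^bsub>A\<^esub> c)) = \<tau> c + \<tau> (\<ominus>\<^bsub>A\<^esub> c)" by (rule ad[OF c(1)])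
  then have "\<tau> c + \<tau> (\<ominus>\<^bsub>A\<^esub> c) = 0" using z0 cl by (simp add: r_neg)
  then show "\<tau> (\<ominus>\<^bsub>A\<^esub> c) = - \<tau> c" by (simp add: eq_neg_iff_add_eq_0 add.commute)
qed

text \<open>After extension of scalars, left multiplication by \<open>x\<close> becomes left
  multiplication by its matrix on all matrices, and \<open>stack\<close> conjugates this into
  \<open>n\<close> diagonal blocks. So the splitting \<open>\<psi>\<close> enters the left-hand side
  only through the embedding \<open>\<tau>\<close> of the center.\<close>

lemma regular_char_poly:
  assumes hom': "\<psi> \<in> Ring.ring_hom A RM" and sc': "\<And>c. c \<in> ring_center A \<Longrightarrow> \<psi> c = \<tau> c \<cdot>\<^sub>m 1\<^sub>m n"
    and sp: "\<And>M. M \<in> carrier_mat n n \<Longrightarrow>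
      \<exists>g. \<forall>i<n. \<forall>j<n. M $$ (i, j) = (\<Sum>r<n * n. g r * \<psi> (b r) $$ (i, j))"
    and x: "x \<in> carrier A"
    and F: "\<And>r q. r < n * n \<Longrightarrow> q < n * n \<Longrightarrow> F q r \<in> ring_center A"
      "\<And>r. r < n * n \<Longrightarrow> x \<otimes>\<^bsub>A\<^esub> b r = finsum A (\<lambda>q. F q r \<otimes>\<^bsub>A\<^esub> b q) {..<n * n}"
  shows "char_poly (mat (n * n) (n * n) (\<lambda>(q, r). \<tau> (F q r))) = char_poly (\<psi> x) ^ n"
proof -
  let ?N = "n * n" and ?R = "rep_block n n (\<psi> x)" and ?P = "stack \<psi>"
  let ?A = "mat ?N ?N (\<lambda>(q, r). \<tau> (F q r))"
  obtain Y where Y: "Y \<in> carrier_mat ?N ?N" "?P * Y = 1\<^sub>m ?N" "Y * ?P = 1\<^sub>m ?N"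
    using stack_right_inverse[of \<psi>, OF sp] by blast
  have cl: "\<psi> a \<in> carrier_mat n n" if "a \<in> carrier A" for a
    using ring_hom_closed[OF hom' that] by (simp add: ring_mat_simps)
  have P: "?P \<in> carrier_mat ?N ?N" and R: "?R \<in> carrier_mat ?N ?N" and Ac: "?A \<in> carrier_mat ?N ?N"
    by (auto simp: stack_def rep_block_def)
  have "?R * ?P = ?P * ?A"
  proof (rule eq_matI)
    fix y r assume "y < dim_row (?P * ?A)" "r < dim_col (?P * ?A)"
    then have yr: "y < ?N" "r < ?N" by (auto simp: stack_def)
    define i j where "i = y mod n" and "j = y div n"
    have ij: "i < n" "j < n" "y = j * n + i" using yr n by (auto simp: i_def j_def nn)
    have "(?R * ?P) $$ (y, r) = (\<Sum>l<?N. if l div n = j then \<psi> x $$ (i, l mod n) * \<psi> (b r) $$ (l mod n, j) else 0)"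
      unfolding index_mult_sum[OF R P yr] using yr
      by (intro sum.cong) (auto simp: rep_block_def stack_def i_def j_def)
    also have "\<dots> = (\<Sum>l\<in>(\<lambda>k. j * n + k) ` {..<n}. \<psi> x $$ (i, l mod n) * \<psi> (b r) $$ (l mod n, j))"
    proof (rule sum.mono_neutral_cong_right)
      show "(\<lambda>k. j * n + k) ` {..<n} \<subseteq> {..<?N}" using ij pair_index by auto
      show "\<forall>l\<in>{..<?N} - (\<lambda>k. j * n + k) ` {..<n}.
          (if l div n = j then \<psi> x $$ (i, l mod n) * \<psi> (b r) $$ (l mod n, j) else 0) = 0"
      proof
        fix l assume l: "l \<in> {..<?N} - (\<lambda>k. j * n + k) ` {..<n}"
        have "l div n \<noteq> j"
        proof
          assume "l div n = j"
          then have "l = j * n + l mod n" by (metis div_mult_mod_eq)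
          moreover have "l mod n < n" using n by simp
          ultimately show False using l by blast
        qed
        then show "(if l div n = j then \<psi> x $$ (i, l mod n) * \<psi> (b r) $$ (l mod n, j) else 0) = 0" by simp
      qed
    qed (use n in auto)
    also have "\<dots> = (\<Sum>k<n. \<psi> x $$ (i, k) * \<psi> (b r) $$ (k, j))"
      by (subst sum.reindex) (auto simp: inj_on_def intro!: sum.cong)
    also have "\<dots> = (\<psi> x * \<psi> (b r)) $$ (i, j)"
      using index_mult_sum[OF cl[OF x] cl[OF b[OF yr(2)]] ij(1,2)] by simp
    also have "\<dots> = \<psi> (x \<otimes>\<^bsub>A\<^esub> b r) $$ (i, j)"
      using ring_hom_mult[OF hom' x b[OF yr(2)]] by (simp add: ring_mat_simps)
    also have "\<dots> = (\<Sum>q<?N. \<tau> (F q r) * \<psi> (b q) $$ (i, j))"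
      unfolding F(2)[OF yr(2)] by (rule \<phi>_comb[OF F(1)[OF yr(2)] ij(1,2) hom' sc'])
    also have "\<dots> = (?P * ?A) $$ (y, r)"
      unfolding index_mult_sum[OF P Ac yr] using yr
      by (intro sum.cong) (auto simp: stack_def i_def j_def)
    finally show "(?R * ?P) $$ (y, r) = (?P * ?A) $$ (y, r)" .
  qed (auto simp: stack_def rep_block_def)
  then have "Y * (?R * ?P) = Y * (?P * ?A)" by simp
  also have "\<dots> = ?A" using Y(3) Ac by (simp only: assoc_mult_mat[OF Y(1) P Ac, symmetric]) simp
  finally have "?A = Y * ?R * ?P" by (simp only: assoc_mult_mat[OF Y(1) R P])
  then have "similar_mat ?A ?R"
    unfolding similar_mat_def similar_mat_wit_def using Y P R Ac
    by (intro exI[of _ Y] exI[of _ ?P]) auto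
  then have "char_poly ?A = char_poly ?R" by (rule char_poly_similar)
  then show ?thesis using char_poly_rep_block[OF cl[OF x] n] by simp
qed

text \<open>The \<open>n\<close>-th powers of the two characteristic polynomials come from one
  matrix over the center. As \<open>n\<close> is invertible, the root on the side of
  \<open>\<phi>\<close> has coefficients in the image of the center, and transporting it to the side
  of \<open>\<psi>\<close> gives the monic root there.\<close>

lemma splitting_char_poly:
  fixes \<psi> :: "'a \<Rightarrow> 'l mat"
  assumes nz: "(of_nat n :: 'l) \<noteq> 0" and \<psi>: "splitting A n \<psi>" and x: "x \<in> carrier A" and d: "d \<le> n"
  shows "\<exists>!c. c \<in> ring_center A \<and> \<psi> c = poly.coeff (char_poly (\<psi> x)) d \<cdot>\<^sub>m 1\<^sub>m n"
    and "\<exists>c. c \<in> ring_center A \<and> \<psi> c = poly.coeff (char_poly (\<psi> x)) d \<cdot>\<^sub>m 1\<^sub>m n \<and>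
      \<phi> c = poly.coeff (char_poly (\<phi> x)) d \<cdot>\<^sub>m 1\<^sub>m n"
proof -
  let ?C = "ring_center A"
  have hom': "\<psi> \<in> Ring.ring_hom A RM" using \<psi> by (simp add: splitting_def)
  define \<tau> where "\<tau> c = \<psi> c $$ (0, 0)" for c
  have \<tau>: "\<psi> c = \<tau> c \<cdot>\<^sub>m 1\<^sub>m n" if "c \<in> ?C" for c
  proof -
    obtain e where "\<psi> c = e \<cdot>\<^sub>m 1\<^sub>m n" using \<psi> \<open>c \<in> ?C\<close> by (auto simp: splitting_def)
    then show ?thesis using n by (simp add: \<tau>_def)
  qed
  have \<tau>': "\<forall>c\<in>?C. \<psi> c = \<tau> c \<cdot>\<^sub>m 1\<^sub>m n" and \<phi>': "\<forall>c\<in>?C. \<phi> c = sc c \<cdot>\<^sub>m 1\<^sub>m n"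
    using \<tau> \<phi>_center by auto
  note h\<tau> = sc_hom[OF hom' \<tau>'] and h\<phi> = sc_hom[OF hom \<phi>']
  note cs = center_subring
  have cl: "\<psi> a \<in> carrier_mat n n" if "a \<in> carrier A" for a
    using ring_hom_closed[OF hom' that] by (simp add: ring_mat_simps)
  have inv: "\<exists>d\<in>?C. sc d = inverse (sc c)" if c: "c \<in> ?C" "sc c \<noteq> 0" for c
  proof -
    obtain d where "d \<in> carrier A" "\<phi> d = inverse (sc c) \<cdot>\<^sub>m 1\<^sub>m n"
      using center_inverse[OF center_closed[OF c(1)] \<phi>_center[OF c(1)] c(2)] by blast
    moreover from this have "d \<in> ?C" using center_iff by blast
    ultimately have "d \<in> ?C" "sc d = inverse (sc c)" using n by (auto simp: sc_def)
    then show ?thesis by blast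
  qed
  \<comment> \<open>The center is a field, so \<open>\<psi>\<close> embeds it; this will give
    uniqueness of the central element.\<close>
  have \<tau>_inj: "inj_on \<tau> ?C"
  proof (rule inj_onI, rule ccontr)
    fix c c' assume c: "c \<in> ?C" "c' \<in> ?C" and eq: "\<tau> c = \<tau> c'" and ne: "c \<noteq> c'"
    let ?d = "c \<oplus>\<^bsub>A\<^esub> (\<ominus>\<^bsub>A\<^esub> c')"
    have dC: "?d \<in> ?C" using c cs by blast
    have t0: "\<tau> ?d = 0" using h\<tau>(1)[OF c(1) cs(5)[OF c(2)]] h\<tau>(4)[OF c(2) c(2)] eq by simp
    have "sc c \<noteq> sc c'"
    proof
      assume "sc c = sc c'"
      then have "c = c'" by (rule inj_onD[OF sc_inj _ c])
      with ne show False ..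
    qed
    then have "sc ?d \<noteq> 0" using h\<phi>(1)[OF c(1) cs(5)[OF c(2)]] h\<phi>(4)[OF c(2) c(2)] by simp
    then obtain d' where d': "d' \<in> ?C" "sc d' = inverse (sc ?d)" using inv[OF dC] by blast
    have "sc (?d \<otimes>\<^bsub>A\<^esub> d') = sc \<one>\<^bsub>A\<^esub>"
      using h\<phi>(2)[OF dC d'(1)] h\<phi>(3)[OF dC dC] d'(2) \<open>sc ?d \<noteq> 0\<close> by simp
    then have "?d \<otimes>\<^bsub>A\<^esub> d' = \<one>\<^bsub>A\<^esub>" by (rule inj_onD[OF sc_inj _ cs(4)[OF dC d'(1)] cs(2)])
    then have "\<tau> ?d * \<tau> d' = 1" using h\<tau>(2)[OF dC d'(1)] h\<tau>(3)[OF dC dC] by simp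
    then show False using t0 by simp
  qed
  \<comment> \<open>The copy of the center seen through \<open>\<phi>\<close>. The map
    \<open>h\<close> carries it to the copy seen through \<open>\<psi>\<close>; only its values on
    \<open>F0\<close> matter.\<close>
  define F0 where "F0 = sc ` ?C"
  define h where "h y = \<tau> (inv_into ?C sc y)" for y
  have hs: "h (sc c) = \<tau> c" if "c \<in> ?C" for c using that sc_inj by (simp add: h_def)
  have F0: "0 \<in> F0" "1 \<in> F0" "\<And>x y. x \<in> F0 \<Longrightarrow> y \<in> F0 \<Longrightarrow> x + y \<in> F0"
      "\<And>x y. x \<in> F0 \<Longrightarrow> y \<in> F0 \<Longrightarrow> x * y \<in> F0" "\<And>x. x \<in> F0 \<Longrightarrow> - x \<in> F0"
  proof -
    show "0 \<in> F0" using imageI[OF cs(1), of sc] h\<phi>(5)[OF cs(1) cs(1)] by (simp add: F0_def)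
    show "1 \<in> F0" using imageI[OF cs(2), of sc] h\<phi>(3)[OF cs(1) cs(1)] by (simp add: F0_def)
    fix y assume "y \<in> F0"
    then obtain c where c: "c \<in> ?C" "y = sc c" by (auto simp: F0_def)
    show "- y \<in> F0" using imageI[OF cs(5)[OF c(1)], of sc] h\<phi>(4)[OF c(1) c(1)] c by (simp add: F0_def)
    fix z assume "z \<in> F0"
    then obtain c' where c': "c' \<in> ?C" "z = sc c'" by (auto simp: F0_def)
    show "y + z \<in> F0"
      using imageI[OF cs(3)[OF c(1) c'(1)], of sc] h\<phi>(1)[OF c(1) c'(1)] c c' by (simp add: F0_def)
    show "y * z \<in> F0"
      using imageI[OF cs(4)[OF c(1) c'(1)], of sc] h\<phi>(2)[OF c(1) c'(1)] c c' by (simp add: F0_def)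
  qed
  \<comment> \<open>A homomorphism on a subring is a grading map in which all degrees coincide. Thus
    characteristic polynomials can be transported along \<open>h\<close>, which need not be a
    homomorphism of the whole field.\<close>
  interpret G: graded_map "\<lambda>_ y. y \<in> F0" "\<lambda>_. h"
  proof
    show "h 1 = 1" using hs[OF cs(2)] h\<phi>(3)[OF cs(1) cs(1)] h\<tau>(3)[OF cs(1) cs(1)] by simp
    show "h 0 = 0" using hs[OF cs(1)] h\<phi>(5)[OF cs(1) cs(1)] h\<tau>(5)[OF cs(1) cs(1)] by simp
    fix y z assume "y \<in> F0"
    then obtain c where c: "c \<in> ?C" "y = sc c" by (auto simp: F0_def)
    show "h (- y) = - h y" using hs cs(5)[OF c(1)] h\<phi>(4)[OF c(1) c(1)] h\<tau>(4)[OF c(1) c(1)] c by metis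
    assume "z \<in> F0"
    then obtain c' where c': "c' \<in> ?C" "z = sc c'" by (auto simp: F0_def)
    show "h (y + z) = h y + h z"
      using hs cs(3)[OF c(1) c'(1)] h\<phi>(1)[OF c(1) c'(1)] h\<tau>(1)[OF c(1) c'(1)] c c' by metis
    show "h (y * z) = h y * h z"
      using hs cs(4)[OF c(1) c'(1)] h\<phi>(2)[OF c(1) c'(1)] h\<tau>(2)[OF c(1) c'(1)] c c' by metis
  qed (use F0 in auto)
  interpret P: graded_map G.pP G.gP by (rule G.poly_graded_map)
  have "\<forall>r. \<exists>c. r < n * n \<longrightarrow> (\<forall>q<n * n. c q \<in> ?C) \<and>
      x \<otimes>\<^bsub>A\<^esub> b r = finsum A (\<lambda>q. c q \<otimes>\<^bsub>A\<^esub> b q) {..<n * n}"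
    using coords[of "x \<otimes>\<^bsub>A\<^esub> b _"] x b by auto
  from choice[OF this] obtain F' where F'0: "\<forall>r. r < n * n \<longrightarrow> (\<forall>q<n * n. F' r q \<in> ?C) \<and>
      x \<otimes>\<^bsub>A\<^esub> b r = finsum A (\<lambda>q. F' r q \<otimes>\<^bsub>A\<^esub> b q) {..<n * n}" ..
  then have F': "F' r q \<in> ?C" "x \<otimes>\<^bsub>A\<^esub> b r = finsum A (\<lambda>q. F' r q \<otimes>\<^bsub>A\<^esub> b q) {..<n * n}"
    if "r < n * n" "q < n * n" for r q using that by auto
  have sp: "\<exists>g. \<forall>i<n. \<forall>j<n. M $$ (i, j) = (\<Sum>r<n * n. g r * \<psi> (b r) $$ (i, j))"
    if M: "M \<in> carrier_mat n n" for M
  proof -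
    obtain B where B: "finite B" "B \<subseteq> carrier A" "\<exists>g. M = finsum RM (\<lambda>b. g b \<cdot>\<^sub>m \<psi> b) B"
      using \<psi> M unfolding splitting_def by blast
    then obtain g where g: "M = finsum RM (\<lambda>b. g b \<cdot>\<^sub>m \<psi> b) B" by blast
    have "\<forall>a. \<exists>c. a \<in> B \<longrightarrow> (\<forall>q<n * n. c q \<in> ?C) \<and> a = finsum A (\<lambda>q. c q \<otimes>\<^bsub>A\<^esub> b q) {..<n * n}"
      using coords B by auto
    from choice[OF this] obtain c where c0: "\<forall>a. a \<in> B \<longrightarrow> (\<forall>q<n * n. c a q \<in> ?C) \<and>
        a = finsum A (\<lambda>q. c a q \<otimes>\<^bsub>A\<^esub> b q) {..<n * n}" ..
    then have c: "(\<forall>q<n * n. c a q \<in> ?C) \<and> a = finsum A (\<lambda>q. c a q \<otimes>\<^bsub>A\<^esub> b q) {..<n * n}"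
      if "a \<in> B" for a using that by blast
    have e: "\<psi> a $$ (i, j) = (\<Sum>r<n * n. \<tau> (c a r) * \<psi> (b r) $$ (i, j))" if "a \<in> B" "i < n" "j < n" for a i j
    proof -
      have "\<psi> (finsum A (\<lambda>r. c a r \<otimes>\<^bsub>A\<^esub> b r) {..<n * n}) $$ (i, j) = (\<Sum>r<n * n. \<tau> (c a r) * \<psi> (b r) $$ (i, j))"
        by (rule \<phi>_comb[OF _ that(2,3) hom' \<tau>]) (use c[OF that(1)] in auto)
      then show ?thesis using c[OF that(1)] by simp
    qed
    have "M $$ (i, j) = (\<Sum>r<n * n. (\<Sum>a\<in>B. g a * \<tau> (c a r)) * \<psi> (b r) $$ (i, j))" if ij: "i < n" "j < n" for i j
    proof -
      have "M $$ (i, j) = (\<Sum>a\<in>B. (g a \<cdot>\<^sub>m \<psi> a) $$ (i, j))"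
        unfolding g by (rule ring_mat_finsum_index) (use B cl ij in auto)
      also have "\<dots> = (\<Sum>a\<in>B. \<Sum>r<n * n. g a * \<tau> (c a r) * \<psi> (b r) $$ (i, j))"
      proof (rule sum.cong[OF refl])
        fix a assume a: "a \<in> B"
        then have "\<psi> a \<in> carrier_mat n n" using B cl by auto
        then show "(g a \<cdot>\<^sub>m \<psi> a) $$ (i, j) = (\<Sum>r<n * n. g a * \<tau> (c a r) * \<psi> (b r) $$ (i, j))"
          using e[OF a ij] ij by (simp add: sum_distrib_left mult.assoc)
      qed
      also have "\<dots> = (\<Sum>r<n * n. (\<Sum>a\<in>B. g a * \<tau> (c a r)) * \<psi> (b r) $$ (i, j))"
        by (subst sum.swap) (simp add: sum_distrib_right)
      finally show ?thesis .
    qed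
    then show ?thesis by (intro exI[of _ "\<lambda>r. \<Sum>a\<in>B. g a * \<tau> (c a r)"]) blast
  qed
  let ?N = "n * n"
  let ?A = "mat ?N ?N (\<lambda>(q, r). sc (F' r q))"
  have c1: "char_poly ?A = char_poly (\<phi> x) ^ n"
    by (rule regular_char_poly[OF hom \<phi>_center span x F'(1)]) (use F'0 in blast)+
  have c2: "char_poly (mat ?N ?N (\<lambda>(q, r). \<tau> (F' r q))) = char_poly (\<psi> x) ^ n"
    by (rule regular_char_poly[OF hom' \<tau> sp x F'(1)]) (use F'0 in blast)+
  have mA: "map_mat h ?A = mat ?N ?N (\<lambda>(q, r). \<tau> (F' r q))"
    by (rule eq_matI) (use F' hs in auto)
  have A: "?A \<in> carrier_mat ?N ?N" by simp
  have Ae: "?A $$ (q, r) \<in> F0" if "q < ?N" "r < ?N" for q r using F' that by (auto simp: F0_def)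
  have dA: "degree (char_poly ?A) = ?N" using degree_monic_char_poly[OF A] by simp
  have co: "poly.coeff (char_poly ?A) k \<in> F0" for k
  proof (cases "k \<le> ?N")
    case True
    then show ?thesis using G.char_poly_graded(1)[OF A Ae True] by simp
  next
    case False
    then show ?thesis using dA F0(1) by (simp add: coeff_eq_0)
  qed
  let ?Q = "char_poly (\<phi> x)"
  have Q: "degree ?Q = n" "poly.coeff ?Q n = 1" using degree_monic_char_poly[OF \<phi>_closed[OF x]] by auto
  have R: "degree (char_poly (\<psi> x)) = n" "poly.coeff (char_poly (\<psi> x)) n = 1"
    using degree_monic_char_poly[OF cl[OF x]] by auto
  have "of_nat k \<in> F0" for k by (induction k) (use F0 in auto)
  then obtain c where c: "c \<in> ?C" "sc c = of_nat n" unfolding F0_def by (metis imageE)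
  then have invn: "inverse (of_nat n) \<in> F0" using inv[of c] nz unfolding F0_def by force
  have Qc: "poly.coeff ?Q k \<in> F0" for k
    by (rule monic_root_coeffs[OF F0 invn nz Q]) (use co c1 in auto)
  have pQ: "G.pP n ?Q" unfolding G.pP_def using Qc Q by (auto intro: coeff_eq_0)
  have pw: "G.pP (k * n) (?Q ^ k) \<and> G.gP (k * n) (?Q ^ k) = G.gP n ?Q ^ k" for k
  proof (induction k)
    case 0
    then show ?case using P.p_one P.g_one by simp
  next
    case (Suc k)
    then show ?case using P.p_mult[OF pQ, of "k * n" "?Q ^ k"] P.g_mult[OF pQ, of "k * n" "?Q ^ k"] by simp
  qed
  have "G.gP ?N (char_poly ?A) = char_poly (map_mat h ?A)"
  proof (rule poly_eqI)
    fix k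
    have "degree (char_poly (map_mat h ?A)) = ?N" using degree_monic_char_poly[of "map_mat h ?A" ?N] by simp
    then show "poly.coeff (G.gP ?N (char_poly ?A)) k = poly.coeff (char_poly (map_mat h ?A)) k"
      using G.char_poly_graded(2)[OF A Ae, of k] by (auto simp: G.coeff_gP coeff_eq_0)
  qed
  then have gn: "G.gP n ?Q ^ n = char_poly (\<psi> x) ^ n" using pw[of n] c1 c2 mA by simp
  have g1: "poly.coeff (G.gP n ?Q) n = 1" using Q G.g_one by (simp add: G.coeff_gP)
  have gd: "degree (G.gP n ?Q) = n"
  proof (rule antisym)
    show "degree (G.gP n ?Q) \<le> n" by (rule degree_le) (simp add: G.coeff_gP)
    show "n \<le> degree (G.gP n ?Q)" using g1 by (intro le_degree) simp
  qed
  \<comment> \<open>Both sides are monic of degree \<open>n\<close> with the same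
    \<open>n\<close>-th power.\<close>
  have eq: "G.gP n ?Q = char_poly (\<psi> x)" by (rule monic_root_unique[OF gd R(1) g1 R(2) gn nz])
  obtain c where c: "c \<in> ?C" "sc c = poly.coeff ?Q d" using Qc[of d] by (auto simp: F0_def)
  have "poly.coeff (char_poly (\<psi> x)) d = \<tau> c"
    using d c hs[OF c(1)] unfolding eq[symmetric] by (simp add: G.coeff_gP)
  then have *: "c \<in> ?C \<and> \<psi> c = poly.coeff (char_poly (\<psi> x)) d \<cdot>\<^sub>m 1\<^sub>m n \<and>
      \<phi> c = poly.coeff ?Q d \<cdot>\<^sub>m 1\<^sub>m n"
    using c \<phi>_center \<tau> by simp
  then show "\<exists>c. c \<in> ?C \<and> \<psi> c = poly.coeff (char_poly (\<psi> x)) d \<cdot>\<^sub>m 1\<^sub>m n \<and>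
      \<phi> c = poly.coeff ?Q d \<cdot>\<^sub>m 1\<^sub>m n" by blast
  show "\<exists>!c. c \<in> ?C \<and> \<psi> c = poly.coeff (char_poly (\<psi> x)) d \<cdot>\<^sub>m 1\<^sub>m n"
  proof (rule ex1I[of _ c])
    fix c' assume c': "c' \<in> ?C \<and> \<psi> c' = poly.coeff (char_poly (\<psi> x)) d \<cdot>\<^sub>m 1\<^sub>m n"
    then have "\<tau> c' = \<tau> c" using * unfolding \<tau>_def by simp
    then show "c' = c" using \<tau>_inj c c' by (simp add: inj_on_eq_iff)
  qed (use * in blast)
qed

text \<open>The choice in \<open>reduced_splitting\<close> is meaningful because
  \<open>\<phi>\<close> is a splitting; whichever one is chosen, the central element it defines can
  be computed through \<open>\<phi>\<close>.\<close>

theorem reduced_sigma: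
  assumes nz: "(of_nat n :: 'l) \<noteq> 0" and x: "x \<in> carrier A"
  shows "reduced_sigma (ty :: 'l itself) A n i x \<in> carrier A"
    and "\<phi> (reduced_sigma ty A n i x) = poly.coeff (char_poly (\<phi> x)) (n - i) \<cdot>\<^sub>m 1\<^sub>m n"
proof -
  let ?\<psi> = "reduced_splitting ty A n"
  have \<psi>: "splitting A n ?\<psi>" unfolding reduced_splitting_def by (rule someI[where P = "splitting A n", OF splitting])
  have u: "\<exists>!c. c \<in> ring_center A \<and> ?\<psi> c = poly.coeff (char_poly (?\<psi> x)) (n - i) \<cdot>\<^sub>m 1\<^sub>m n"
    by (rule splitting_char_poly(1)[OF nz \<psi> x]) simp
  obtain c where c: "c \<in> ring_center A" "?\<psi> c = poly.coeff (char_poly (?\<psi> x)) (n - i) \<cdot>\<^sub>m 1\<^sub>m n"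
    "\<phi> c = poly.coeff (char_poly (\<phi> x)) (n - i) \<cdot>\<^sub>m 1\<^sub>m n"
    using splitting_char_poly(2)[OF nz \<psi> x, of "n - i"] by auto
  have "reduced_sigma ty A n i x = c"
    unfolding reduced_sigma_def Let_def by (rule the1_equality[OF u]) (use c in blast)
  then show "reduced_sigma ty A n i x \<in> carrier A"
    "\<phi> (reduced_sigma ty A n i x) = poly.coeff (char_poly (\<phi> x)) (n - i) \<cdot>\<^sub>m 1\<^sub>m n"
    using c center_closed by auto
qed

end

section \<open>Evaluating polynomials\<close>

abbreviation lookup :: "('a \<Rightarrow>\<^sub>0 'b::zero) \<Rightarrow> 'a \<Rightarrow> 'b" where
  "lookup \<equiv> Poly_Mapping.lookup"

abbreviation keys :: "('a \<Rightarrow>\<^sub>0 'b::zero) \<Rightarrow> 'a set" where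
  "keys \<equiv> Poly_Mapping.keys"

definition mval :: "('v \<Rightarrow> 'b::comm_ring_1) \<Rightarrow> ('v \<Rightarrow>\<^sub>0 nat) \<Rightarrow> 'b" where
  "mval u \<alpha> = (\<Prod>v\<in>keys \<alpha>. u v ^ lookup \<alpha> v)"

text \<open>Coefficients pass through \<open>h\<close>, so one polynomial can be read in several
  rings; the specialization arguments compare such readings.\<close>

definition ev :: "('a::comm_ring_1 \<Rightarrow> 'b::comm_ring_1) \<Rightarrow> ('v \<Rightarrow> 'b) \<Rightarrow> (('v \<Rightarrow>\<^sub>0 nat) \<Rightarrow>\<^sub>0 'a) \<Rightarrow> 'b" where
  "ev h u f = (\<Sum>\<alpha>\<in>keys f. h (lookup f \<alpha>) * mval u \<alpha>)"

abbreviation const :: "'a::comm_ring_1 \<Rightarrow> ('v \<Rightarrow>\<^sub>0 nat) \<Rightarrow>\<^sub>0 'a" where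
  "const \<equiv> Poly_Mapping.single 0"

abbreviation var :: "'v \<Rightarrow> ('v \<Rightarrow>\<^sub>0 nat) \<Rightarrow>\<^sub>0 'a::comm_ring_1" where
  "var v \<equiv> Poly_Mapping.single (Poly_Mapping.single v 1) 1"

lemma mval_superset: "finite S \<Longrightarrow> keys \<alpha> \<subseteq> S \<Longrightarrow> mval u \<alpha> = (\<Prod>v\<in>S. u v ^ lookup \<alpha> v)"
  unfolding mval_def by (rule prod.mono_neutral_left) (auto simp: in_keys_iff)

lemma mval_add: "mval u (\<alpha> + \<beta>) = mval u \<alpha> * mval u \<beta>"
proof -
  let ?S = "keys \<alpha> \<union> keys \<beta>"
  have "mval u (\<alpha> + \<beta>) = (\<Prod>v\<in>?S. u v ^ lookup (\<alpha> + \<beta>) v)"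
    by (rule mval_superset) (use Poly_Mapping.keys_add[of \<alpha> \<beta>] in auto)
  also have "\<dots> = mval u \<alpha> * mval u \<beta>"
    by (simp add: lookup_add power_add prod.distrib mval_superset[of ?S \<alpha>] mval_superset[of ?S \<beta>])
  finally show ?thesis .
qed

lemma mval_zero [simp]: "mval u 0 = 1"
  by (simp add: mval_def)

lemma mval_single [simp]: "mval u (Poly_Mapping.single v k) = u v ^ k"
  by (simp add: mval_def)

lemma sum_singles: "f = (\<Sum>\<alpha>\<in>keys f. Poly_Mapping.single \<alpha> (lookup f \<alpha>))"
proof (rule poly_mapping_eqI)
  fix \<beta>
  show "lookup f \<beta> = lookup (\<Sum>\<alpha>\<in>keys f. Poly_Mapping.single \<alpha> (lookup f \<alpha>)) \<beta>"
    by (simp add: lookup_sum lookup_single when_def in_keys_iff)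
qed

lemma const_hom: "comm_ring_hom (const :: 'a::comm_ring_1 \<Rightarrow> ('v \<Rightarrow>\<^sub>0 nat) \<Rightarrow>\<^sub>0 'a)"
  by standard (simp_all add: single_add mult_single)

context
  fixes h :: "'a::comm_ring_1 \<Rightarrow> 'b::comm_ring_1"
  assumes h: "comm_ring_hom h"
begin

interpretation h: comm_ring_hom h by (rule h)

lemma ev_superset: "finite S \<Longrightarrow> keys f \<subseteq> S \<Longrightarrow> ev h u f = (\<Sum>\<alpha>\<in>S. h (lookup f \<alpha>) * mval u \<alpha>)"
  unfolding ev_def by (rule sum.mono_neutral_left) (auto simp: in_keys_iff)

lemma ev_add: "ev h u (f + g) = ev h u f + ev h u g"
proof -
  let ?S = "keys f \<union> keys g"
  have "ev h u (f + g) = (\<Sum>\<alpha>\<in>?S. h (lookup (f + g) \<alpha>) * mval u \<alpha>)"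
    by (rule ev_superset) (use Poly_Mapping.keys_add[of f g] in auto)
  also have "\<dots> = ev h u f + ev h u g"
    by (simp add: lookup_add h.hom_add distrib_right sum.distrib ev_superset[of ?S f] ev_superset[of ?S g])
  finally show ?thesis .
qed

lemma ev_single: "ev h u (Poly_Mapping.single \<alpha> c) = h c * mval u \<alpha>"
  by (cases "c = 0") (auto simp: ev_def)

lemma ev_sum: "ev h u (sum F I) = (\<Sum>i\<in>I. ev h u (F i))"
proof (induction I rule: infinite_finite_induct)
  case (insert x I)
  then show ?case by (simp add: ev_add)
qed (simp_all add: ev_def)

lemma ev_mult: "ev h u (f * g) = ev h u f * ev h u g"
proof -
  have "f * g = (\<Sum>\<alpha>\<in>keys f. \<Sum>\<beta>\<in>keys g. Poly_Mapping.single (\<alpha> + \<beta>) (lookup f \<alpha> * lookup g \<beta>))"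
    by (subst sum_singles[of f], subst sum_singles[of g]) (simp add: sum_product mult_single)
  then have "ev h u (f * g) = (\<Sum>\<alpha>\<in>keys f. \<Sum>\<beta>\<in>keys g. (h (lookup f \<alpha>) * mval u \<alpha>) * (h (lookup g \<beta>) * mval u \<beta>))"
    by (simp add: ev_sum ev_single mval_add h.hom_mult algebra_simps)
  then show ?thesis by (simp add: ev_def sum_product)
qed

lemma ev_hom: "comm_ring_hom (ev h u)"
proof
  show "ev h u 1 = 1" using ev_single[of u 0 1] by simp
  show "ev h u 0 = 0" by (simp add: ev_def)
qed (simp_all add: ev_add ev_mult)

lemma ev_const: "ev h u (const c) = h c"
  by (simp add: ev_single)

lemma ev_var: "ev h u (var v) = u v"
  by (simp add: ev_single)

lemma ev_comp:
  assumes g: "comm_ring_hom g"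
  shows "g (ev h u f) = ev (g \<circ> h) (g \<circ> u) f"
proof -
  interpret g: comm_ring_hom g by fact
  show ?thesis by (simp add: ev_def mval_def g.hom_sum g.hom_mult g.hom_prod g.hom_power)
qed

end

text \<open>Constants \<open>0\<close> and \<open>1\<close> discard some of the variables.\<close>

definition scale :: "('v \<Rightarrow> 'a) \<Rightarrow> (('v \<Rightarrow>\<^sub>0 nat) \<Rightarrow>\<^sub>0 'a::comm_ring_1) \<Rightarrow> ('v \<Rightarrow>\<^sub>0 nat) \<Rightarrow>\<^sub>0 'a" where
  "scale c = ev const (\<lambda>v. Poly_Mapping.single (Poly_Mapping.single v 1) (c v))"

lemma scale_hom: "comm_ring_hom (scale c)"
  unfolding scale_def by (rule ev_hom[OF const_hom])

lemma single_power: "Poly_Mapping.single (Poly_Mapping.single v 1) c ^ k =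
    Poly_Mapping.single (Poly_Mapping.single v k) (c ^ k :: 'a::comm_ring_1)"
  by (induction k) (simp_all add: mult_single single_add[symmetric])

lemma mval_singles:
  "mval (\<lambda>v. Poly_Mapping.single (Poly_Mapping.single v 1) (c v)) \<alpha> = Poly_Mapping.single \<alpha> (mval c \<alpha> :: 'a::comm_ring_1)"
proof -
  have "(\<Prod>v\<in>S. Poly_Mapping.single (Poly_Mapping.single v 1) (c v) ^ lookup \<alpha> v) =
      Poly_Mapping.single (\<Sum>v\<in>S. Poly_Mapping.single v (lookup \<alpha> v)) (\<Prod>v\<in>S. c v ^ lookup \<alpha> v)" for S
    by (induction S rule: infinite_finite_induct) (simp_all add: single_power mult_single del: One_nat_def)
  from this[of "keys \<alpha>"] show ?thesis unfolding mval_def using sum_singles[of \<alpha>] by simp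
qed

text \<open>Rescaling the variables is diagonal on monomials, so invariance under it is a condition
  on each coefficient separately.\<close>

lemma lookup_scale: "lookup (scale c f) \<alpha> = lookup f \<alpha> * mval c \<alpha>"
proof -
  have "scale c f = (\<Sum>\<beta>\<in>keys f. Poly_Mapping.single \<beta> (lookup f \<beta> * mval c \<beta>))"
    unfolding scale_def ev_def mval_singles by (simp add: mult_single)
  then show ?thesis by (simp add: lookup_sum lookup_single when_def in_keys_iff)
qed

lemma mval_one_but: "mval (\<lambda>v. if v = r then \<omega> else 1) \<alpha> = \<omega> ^ lookup \<alpha> r"
proof -
  have "mval (\<lambda>v. if v = r then \<omega> else 1) \<alpha> = (\<Prod>v\<in>insert r (keys \<alpha>). (if v = r then \<omega> else 1) ^ lookup \<alpha> v)"
    by (rule mval_superset) auto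
  also have "\<dots> = \<omega> ^ lookup \<alpha> r * (\<Prod>v\<in>keys \<alpha> - {r}. 1)"
    by (subst prod.insert_remove) (auto intro!: arg_cong[where f = "(*) _"] prod.cong)
  finally show ?thesis by simp
qed

lemma mval_indicator: "mval (\<lambda>v. if P v then 1 else 0) \<alpha> = (if \<forall>v\<in>keys \<alpha>. P v then 1 else 0)"
proof (cases "\<forall>v\<in>keys \<alpha>. P v")
  case False
  then obtain v where "v \<in> keys \<alpha>" "\<not> P v" by blast
  then have "mval (\<lambda>v. if P v then 1 else 0) \<alpha> = 0"
    unfolding mval_def by (intro prod_zero) (auto simp: in_keys_iff zero_power intro!: bexI[of _ v])
  then show ?thesis unfolding if_not_P[OF False] .
qed (simp add: mval_def)

section \<open>Leading monomials\<close>

definition mscale :: "nat \<Rightarrow> ('v \<Rightarrow>\<^sub>0 nat) \<Rightarrow> 'v \<Rightarrow>\<^sub>0 nat" where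
  "mscale k \<alpha> = (\<Sum>i<k. \<alpha>)"

lemma lookup_mscale [simp]: "lookup (mscale k \<alpha>) v = k * lookup \<alpha> v"
  by (simp add: mscale_def lookup_sum)

lemma mscale_add: "mscale (d + e) \<alpha> = mscale d \<alpha> + mscale e \<alpha>"
  by (rule poly_mapping_eqI) (simp add: lookup_add algebra_simps)

lemma mscale_simps [simp]: "mscale 0 \<alpha> = 0" "mscale (Suc 0) \<alpha> = \<alpha>"
  by (simp_all add: mscale_def)

lemma mscale_inj: "0 < k \<Longrightarrow> mscale k \<alpha> = mscale k \<beta> \<Longrightarrow> \<alpha> = \<beta>"
  by (rule poly_mapping_eqI) (metis lookup_mscale mult_left_cancel neq0_conv)

text \<open>The zero polynomial is bounded by every exponent, so this is a filtration and not a
  degree.\<close>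

definition bounded_by :: "('v::linorder \<Rightarrow>\<^sub>0 nat) \<Rightarrow> (('v \<Rightarrow>\<^sub>0 nat) \<Rightarrow>\<^sub>0 'a::comm_ring_1) \<Rightarrow> bool" where
  "bounded_by \<alpha> f \<longleftrightarrow> (\<forall>\<beta>\<in>keys f. \<beta> \<le> \<alpha>)"

lemma lookup_mult_top:
  assumes f: "bounded_by \<alpha> f" and g: "bounded_by \<beta> g"
  shows "bounded_by (\<alpha> + \<beta>) (f * g)" and "lookup (f * g) (\<alpha> + \<beta>) = lookup f \<alpha> * lookup g \<beta>"
proof -
  show "bounded_by (\<alpha> + \<beta>) (f * g)"
    unfolding bounded_by_def
  proof
    fix x assume "x \<in> keys (f * g)"
    then obtain a b where "a \<in> keys f" "b \<in> keys g" "x = a + b" using keys_mult[of f g] by auto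
    then show "x \<le> \<alpha> + \<beta>" using f g by (auto simp: bounded_by_def intro: add_mono)
  qed
  have e: "f * g = (\<Sum>a\<in>keys f. \<Sum>b\<in>keys g. Poly_Mapping.single (a + b) (lookup f a * lookup g b))"
    by (subst sum_singles[of f], subst sum_singles[of g]) (simp add: sum_product mult_single)
  have "lookup (f * g) (\<alpha> + \<beta>) =
      (\<Sum>a\<in>keys f. \<Sum>b\<in>keys g. if a = \<alpha> \<and> b = \<beta> then lookup f a * lookup g b else 0)"
    unfolding e lookup_sum lookup_single
  proof (intro sum.cong refl)
    fix a b assume ab: "a \<in> keys f" "b \<in> keys g"
    then have le: "a \<le> \<alpha>" "b \<le> \<beta>" using f g by (auto simp: bounded_by_def)
    \<comment> \<open>Addition is strictly monotone, so the top exponent is reached by the pair of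
      top exponents only.\<close>
    have "a + b = \<alpha> + \<beta> \<longleftrightarrow> a = \<alpha> \<and> b = \<beta>"
      using le by (metis add_less_le_mono add_le_less_mono order.not_eq_order_implies_strict order_less_irrefl)
    then show "(lookup f a * lookup g b when a + b = \<alpha> + \<beta>) =
        (if a = \<alpha> \<and> b = \<beta> then lookup f a * lookup g b else 0)" by (simp add: when_def)
  qed
  also have "\<dots> = (\<Sum>a\<in>keys f. if a = \<alpha> then \<Sum>b\<in>keys g. if b = \<beta> then lookup f a * lookup g b else 0 else 0)"
    by (intro sum.cong) auto
  also have "\<dots> = lookup f \<alpha> * lookup g \<beta>"
    by (auto simp: in_keys_iff)
  finally show "lookup (f * g) (\<alpha> + \<beta>) = lookup f \<alpha> * lookup g \<beta>" .
qed

text \<open>Only the multiples of one fixed exponent serve as degrees. The symbol is the coefficient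
  there and is allowed to vanish, which keeps it additive.\<close>

lemma leading_graded: "graded_map (\<lambda>e. bounded_by (mscale e \<alpha>)) (\<lambda>e f. lookup f (mscale e \<alpha>))"
proof
  fix d e :: nat and x y :: "('a \<Rightarrow>\<^sub>0 nat) \<Rightarrow>\<^sub>0 'b"
  show "bounded_by (mscale e \<alpha>) x \<Longrightarrow> bounded_by (mscale e \<alpha>) y \<Longrightarrow> bounded_by (mscale e \<alpha>) (x + y)"
    using Poly_Mapping.keys_add[of x y] unfolding bounded_by_def by blast
  assume "bounded_by (mscale d \<alpha>) x" "bounded_by (mscale e \<alpha>) y"
  then show "bounded_by (mscale (d + e) \<alpha>) (x * y)"
    "lookup (x * y) (mscale (d + e) \<alpha>) = lookup x (mscale d \<alpha>) * lookup y (mscale e \<alpha>)"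
    unfolding mscale_add by (rule lookup_mult_top)+
qed (auto simp: bounded_by_def lookup_add lookup_one)

section \<open>Monomial matrices\<close>

lemma sum_pairs:
  fixes n :: nat
  assumes n: "0 < n"
  shows "(\<Sum>r<n * n. f (r div n) (r mod n)) = (\<Sum>x<n. \<Sum>y<n. f x y)"
proof -
  have "(\<Sum>r<n * n. f (r div n) (r mod n)) = (\<Sum>(x, y)\<in>{..<n} \<times> {..<n}. f x y)"
  proof (rule sum.reindex_bij_witness[where i = "\<lambda>(x, y). x * n + y" and j = "\<lambda>r. (r div n, r mod n)"])
    fix r assume "r \<in> {..<n * n}"
    then have "r div n < n" using n by (simp add: div_less_iff_less_mult)
    then show "(r div n, r mod n) \<in> {..<n} \<times> {..<n}" using n by simp
  next
    fix b assume "b \<in> {..<n} \<times> {..<n}"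
    then obtain x y where b: "b = (x, y)" "x < n" "y < n" by auto
    have "(x * n + y) div n < n" using b n by simp
    then have "x * n + y < n * n" using n by (simp only: div_less_iff_less_mult)
    then show "(\<lambda>(x, y). x * n + y) b \<in> {..<n * n}" using b by simp
    show "(\<lambda>r. (r div n, r mod n)) ((\<lambda>(x, y). x * n + y) b) = b" using b n by simp
  qed auto
  then show ?thesis by (simp add: sum.cartesian_product)
qed

lemma prime_prod_dvd:
  fixes r :: nat
  assumes "finite P" "\<And>p. p \<in> P \<Longrightarrow> prime p" "\<And>p. p \<in> P \<Longrightarrow> p dvd r"
  shows "\<Prod>P dvd r"
  using assms
proof (induction P rule: finite_induct)
  case (insert p P)
  have "coprime p (\<Prod>P)"
    by (rule prod_coprime_right) (use insert in \<open>auto intro!: primes_coprime\<close>)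
  then show ?case using insert by (auto intro: divides_mult)
qed simp

lemma of_nat_neq_zero:
  assumes "(of_nat m :: 'a::semiring_1) \<noteq> 0" "k dvd m"
  shows "(of_nat k :: 'a) \<noteq> 0"
  using assms by (metis dvd_def mult_zero_left of_nat_mult)

lemma primitive_root_power:
  assumes "primitive_root_of_unity p \<zeta>" "prime p"
  shows "\<zeta> ^ a = \<zeta> ^ b \<longleftrightarrow> a mod p = b mod p" "\<zeta> \<noteq> 0"
proof -
  have p: "\<zeta> ^ p = 1" "0 < p" using assms by (auto simp: primitive_root_of_unity_def prime_gt_0_nat)
  show z: "\<zeta> \<noteq> 0" using p by (auto simp: power_0_left)
  have m: "\<zeta> ^ c = \<zeta> ^ (c mod p)" for c
  proof -
    have "\<zeta> ^ c = \<zeta> ^ (p * (c div p) + c mod p)" by simp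
    also have "\<dots> = \<zeta> ^ (c mod p)" unfolding power_add power_mult p by simp
    finally show ?thesis .
  qed
  have le: "c = d" if "\<zeta> ^ c = \<zeta> ^ d" "c \<le> d" "d < p" for c d
  proof (rule ccontr)
    assume "c \<noteq> d"
    have "\<zeta> ^ d = \<zeta> ^ (c + (d - c))" using that by simp
    also have "\<dots> = \<zeta> ^ c * \<zeta> ^ (d - c)" by (rule power_add)
    finally have "\<zeta> ^ (d - c) = 1" using that z by simp
    then show False using assms(1) that \<open>c \<noteq> d\<close> by (auto simp: primitive_root_of_unity_def)
  qed
  show "\<zeta> ^ a = \<zeta> ^ b \<longleftrightarrow> a mod p = b mod p"
  proof
    assume "\<zeta> ^ a = \<zeta> ^ b"
    then have *: "\<zeta> ^ (a mod p) = \<zeta> ^ (b mod p)" using m by metis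
    show "a mod p = b mod p"
    proof (cases "a mod p \<le> b mod p")
      case True
      then show ?thesis using le[OF *] p by simp
    next
      case False
      then show ?thesis using le[OF *[symmetric]] p by simp
    qed
  next
    assume "a mod p = b mod p"
    then show "\<zeta> ^ a = \<zeta> ^ b" using m by metis
  qed
qed

lemma one_smult: "(1 :: 'a::comm_ring_1) \<cdot>\<^sub>m M = M"
  by (rule eq_matI) auto

lemma smult_smult: "a \<cdot>\<^sub>m (b \<cdot>\<^sub>m M) = (a * b :: 'a::comm_ring_1) \<cdot>\<^sub>m M"
  by (rule eq_matI) (auto simp: mult.assoc)

text \<open>The list \<open>ps\<close> may repeat primes. Invertibility of \<open>fact n\<close>
  serves twice: for \<open>n\<close> itself in Fourier inversion, and for the binomial coefficients
  in the characteristic polynomials.\<close>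

locale monomial_matrices =
  fixes ps :: "nat list" and \<zeta> :: "nat \<Rightarrow> 'c::field" and n :: nat
  assumes prod_ps: "prod_list ps = n"
    and prime: "l < length ps \<Longrightarrow> prime (ps ! l)"
    and root: "l < length ps \<Longrightarrow> primitive_root_of_unity (ps ! l) (\<zeta> l)"
    and char: "(of_nat (fact n) :: 'c) \<noteq> 0"
begin

abbreviation "s \<equiv> length ps"
abbreviation "p l \<equiv> ps ! l"

lemma p_pos: "l < s \<Longrightarrow> 0 < p l"
  using prime prime_gt_0_nat by blast

lemma n_prod: "n = (\<Prod>l<s. p l)"
  using prod_ps by (simp add: prod.list_conv_set_nth atLeast0LessThan)

lemma n_pos: "0 < n"
  unfolding n_prod using p_pos by (intro prod_pos) auto

lemma of_nat_n: "(of_nat n :: 'c) \<noteq> 0"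
  using char n_pos by (intro of_nat_neq_zero[OF char]) (simp add: dvd_fact)

lemma zeta_pow: "l < s \<Longrightarrow> \<zeta> l ^ a = \<zeta> l ^ b \<longleftrightarrow> a mod p l = b mod p l"
  using primitive_root_power(1)[OF root prime] by blast

lemma zeta_nz: "l < s \<Longrightarrow> \<zeta> l \<noteq> 0"
  using primitive_root_power(2)[OF root prime] by blast

text \<open>The rows and columns are indexed by the group \<open>\<Prod>l. \<int>/p\<^sub>l\<close>, through an arbitrary numbering.\<close>

definition digit :: "nat \<Rightarrow> nat \<Rightarrow> nat" where
  "digit = (SOME h. bij_betw h {..<n} (\<Pi>\<^sub>E l\<in>{..<s}. {..<p l}))"

lemma digit: "bij_betw digit {..<n} (\<Pi>\<^sub>E l\<in>{..<s}. {..<p l})"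
proof -
  have "card {..<n} = card (\<Pi>\<^sub>E l\<in>{..<s}. {..<p l})"
    by (simp add: card_PiE n_prod)
  then have "\<exists>h. bij_betw h {..<n} (\<Pi>\<^sub>E l\<in>{..<s}. {..<p l})"
    by (intro finite_same_card_bij) (auto intro: finite_PiE)
  then show ?thesis unfolding digit_def by (rule someI_ex)
qed

lemma digit_less: "i < n \<Longrightarrow> l < s \<Longrightarrow> digit i l < p l"
  using digit by (fastforce simp: bij_betw_def)

lemma digit_eqI: "i < n \<Longrightarrow> j < n \<Longrightarrow> (\<And>l. l < s \<Longrightarrow> digit i l = digit j l) \<Longrightarrow> i = j"
proof -
  assume ij: "i < n" "j < n" and eq: "\<And>l. l < s \<Longrightarrow> digit i l = digit j l"
  have "digit i \<in> (\<Pi>\<^sub>E l\<in>{..<s}. {..<p l})" "digit j \<in> (\<Pi>\<^sub>E l\<in>{..<s}. {..<p l})"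
    using ij digit by (auto simp: bij_betw_def)
  then have "digit i = digit j" by (rule PiE_ext) (use eq in auto)
  then show "i = j" using digit ij by (auto simp: bij_betw_def inj_on_def)
qed

lemma digit_surj: "(\<And>l. l < s \<Longrightarrow> v l < p l) \<Longrightarrow> \<exists>i<n. \<forall>l<s. digit i l = v l"
proof -
  assume "\<And>l. l < s \<Longrightarrow> v l < p l"
  then have "restrict v {..<s} \<in> digit ` {..<n}" using digit by (auto simp: bij_betw_def)
  then obtain i where "i < n" "digit i = restrict v {..<s}" by (metis imageE lessThan_iff)
  then show ?thesis by (intro exI[of _ i]) auto
qed

definition sh :: "(nat \<Rightarrow> nat) \<Rightarrow> nat \<Rightarrow> nat" where
  "sh b i = (SOME j. j < n \<and> (\<forall>l<s. digit j l = (digit i l + b l) mod p l))"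

lemma sh: "sh b i < n" "l < s \<Longrightarrow> digit (sh b i) l = (digit i l + b l) mod p l"
proof -
  have "\<exists>j<n. \<forall>l<s. digit j l = (digit i l + b l) mod p l"
    by (rule digit_surj) (simp add: p_pos)
  from someI_ex[OF this] show "sh b i < n" "l < s \<Longrightarrow> digit (sh b i) l = (digit i l + b l) mod p l"
    unfolding sh_def by blast+
qed

lemma sh_eqI: "j < n \<Longrightarrow> (\<And>l. l < s \<Longrightarrow> digit j l = (digit i l + b l) mod p l) \<Longrightarrow> sh b i = j"
  by (rule digit_eqI) (simp_all add: sh)

lemma sh_sh: "sh b' (sh b i) = sh (\<lambda>l. b l + b' l) i"
  by (rule digit_eqI) (simp_all add: sh mod_simps ac_simps)

lemma sh_cong: "(\<And>l. l < s \<Longrightarrow> b l mod p l = b' l mod p l) \<Longrightarrow> sh b i = sh b' i"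
  by (rule digit_eqI) (auto simp: sh intro: mod_add_cong)

lemma sh_trivial: "i < n \<Longrightarrow> (\<And>l. l < s \<Longrightarrow> p l dvd b l) \<Longrightarrow> sh b i = i"
  by (rule sh_eqI) (auto simp: digit_less mod_add_eq[symmetric, of _ "b _"] dvd_imp_mod_0)

text \<open>The character of the group with exponents \<open>a\<close>, evaluated at the group
  element numbered \<open>i\<close>.\<close>

definition chi :: "(nat \<Rightarrow> nat) \<Rightarrow> nat \<Rightarrow> 'c" where
  "chi a i = (\<Prod>l<s. \<zeta> l ^ (a l * digit i l))"

lemma chi_add: "chi (\<lambda>l. a l + a' l) i = chi a i * chi a' i"
  by (simp add: chi_def power_add add_mult_distrib prod.distrib)

lemma chi_sh: "chi a (sh b i) = (\<Prod>l<s. \<zeta> l ^ (a l * b l)) * chi a i"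
proof -
  have "\<zeta> l ^ (a l * digit (sh b i) l) = \<zeta> l ^ (a l * b l) * \<zeta> l ^ (a l * digit i l)" if "l < s" for l
    unfolding power_add[symmetric] using that
    by (subst zeta_pow) (simp_all add: sh mod_simps algebra_simps)
  then show ?thesis by (simp add: chi_def prod.distrib)
qed

lemma chi_trivial: "(\<And>l. l < s \<Longrightarrow> p l dvd a l) \<Longrightarrow> chi a i = 1"
proof -
  assume a: "\<And>l. l < s \<Longrightarrow> p l dvd a l"
  have "\<zeta> l ^ (a l * digit i l) = \<zeta> l ^ 0" if "l < s" for l
    using a[OF that] by (subst zeta_pow[OF that]) auto
  then show ?thesis by (simp add: chi_def)
qed

lemma chi_sym: "chi (digit x) i = chi (digit i) x"
  by (simp add: chi_def mult.commute)

text \<open>The sum over the group factors into geometric sums, one for each prime; if the two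
  elements differ in a digit, the corresponding factor vanishes.\<close>

lemma chi_orthogonal:
  assumes "i < n" "u < n"
  shows "(\<Sum>x<n. chi (digit i) x * inverse (chi (digit u) x)) = (if i = u then of_nat n else 0)"
proof -
  define w where "w l = \<zeta> l ^ digit i l * inverse (\<zeta> l ^ digit u l)" for l
  have c: "chi (digit i) x * inverse (chi (digit u) x) = (\<Prod>l<s. w l ^ digit x l)" for x
    by (simp add: chi_def w_def prod.distrib power_mult_distrib power_mult power_inverse prod_inversef[symmetric] o_def)
  have "(\<Sum>x<n. chi (digit i) x * inverse (chi (digit u) x)) = (\<Sum>x<n. \<Prod>l<s. w l ^ digit x l)"
    by (simp add: c)
  also have "\<dots> = (\<Sum>g\<in>(\<Pi>\<^sub>E l\<in>{..<s}. {..<p l}). \<Prod>l<s. w l ^ g l)"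
    by (rule sum.reindex_bij_betw[OF digit])
  also have "\<dots> = (\<Prod>l<s. \<Sum>y<p l. w l ^ y)"
    by (rule prod_sum_PiE[symmetric]) auto
  also have "\<dots> = (if i = u then of_nat n else 0)"
  proof (cases "i = u")
    case True
    then have "w l = 1" if "l < s" for l using zeta_nz[OF that] by (simp add: w_def)
    then show ?thesis using True by (simp add: n_prod)
  next
    case False
    then obtain l where l: "l < s" "digit i l \<noteq> digit u l" using digit_eqI assms by blast
    have "w l \<noteq> 1"
    proof
      assume "w l = 1"
      then have "\<zeta> l ^ digit i l = \<zeta> l ^ digit u l" using zeta_nz[OF l(1)] by (simp add: w_def field_simps)
      then show False using l digit_less assms by (simp add: zeta_pow)
    qed
    moreover have "\<zeta> l ^ p l = 1" using root[OF l(1)] by (simp add: primitive_root_of_unity_def)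
    then have "w l ^ p l = 1"
      by (simp add: w_def power_mult_distrib power_inverse power_mult[symmetric] mult.commute[of _ "p l"])
         (simp add: power_mult)
    ultimately have "(\<Sum>y<p l. w l ^ y) = 0" by (simp add: geometric_sum)
    then have "(\<Prod>l<s. \<Sum>y<p l. w l ^ y) = 0" using l(1) by (intro prod_zero) auto
    then show ?thesis using False by simp
  qed
  finally show ?thesis .
qed

text \<open>A character times a translation: up to the numbering, a tensor product of powers of the
  clock and shift matrices of sizes \<open>p l\<close>. Only the residues of \<open>a\<close> and
  \<open>b\<close> modulo the primes matter.\<close>

definition N :: "(nat \<Rightarrow> nat) \<Rightarrow> (nat \<Rightarrow> nat) \<Rightarrow> 'c mat" where
  "N a b = mat n n (\<lambda>(i, j). if j = sh b i then chi a i else 0)"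

lemma N_carrier [simp]: "N a b \<in> carrier_mat n n"
  by (simp add: N_def)

lemma N_dim [simp]: "dim_row (N a b) = n" "dim_col (N a b) = n"
  by (simp_all add: N_def)

lemma N_index [simp]: "i < n \<Longrightarrow> j < n \<Longrightarrow> N a b $$ (i, j) = (if j = sh b i then chi a i else 0)"
  by (simp add: N_def)

text \<open>Row \<open>i\<close> is first moved to \<open>sh b i\<close>, and the second character
  is evaluated there; the scalar is the effect of that move on it.\<close>

lemma N_mult: "N a b * N a' b' = (\<Prod>l<s. \<zeta> l ^ (a' l * b l)) \<cdot>\<^sub>m N (\<lambda>l. a l + a' l) (\<lambda>l. b l + b' l)"
proof (rule eq_matI)
  fix i j assume "i < dim_row ((\<Prod>l<s. \<zeta> l ^ (a' l * b l)) \<cdot>\<^sub>m N (\<lambda>l. a l + a' l) (\<lambda>l. b l + b' l))"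
    "j < dim_col ((\<Prod>l<s. \<zeta> l ^ (a' l * b l)) \<cdot>\<^sub>m N (\<lambda>l. a l + a' l) (\<lambda>l. b l + b' l))"
  then have ij: "i < n" "j < n" by (auto simp: N_def)
  have "(N a b * N a' b') $$ (i, j) =
      (\<Sum>k<n. if k = sh b i then chi a i * (if j = sh b' k then chi a' k else 0) else 0)"
    unfolding index_mult_sum[OF N_carrier N_carrier ij] using ij by (intro sum.cong) auto
  also have "\<dots> = chi a i * (if j = sh b' (sh b i) then chi a' (sh b i) else 0)"
    by (simp add: sh)
  finally show "(N a b * N a' b') $$ (i, j) =
      ((\<Prod>l<s. \<zeta> l ^ (a' l * b l)) \<cdot>\<^sub>m N (\<lambda>l. a l + a' l) (\<lambda>l. b l + b' l)) $$ (i, j)"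
    using ij N_carrier[of "\<lambda>l. a l + a' l" "\<lambda>l. b l + b' l"] by (simp add: sh_sh chi_sh chi_add)
qed (auto simp: N_def)

lemma twist_nz: "(\<Prod>l<s. \<zeta> l ^ f l) \<noteq> 0"
  using zeta_nz by simp

lemma N_trivial:
  assumes "\<And>l. l < s \<Longrightarrow> p l dvd a l" "\<And>l. l < s \<Longrightarrow> p l dvd b l"
  shows "N a b = 1\<^sub>m n"
  by (rule eq_matI) (use assms chi_trivial[of a] sh_trivial[of _ b] in \<open>auto simp: N_def\<close>)

lemma N_pow: "\<exists>c. c \<noteq> 0 \<and> N a b ^\<^sub>m k = c \<cdot>\<^sub>m N (\<lambda>l. k * a l) (\<lambda>l. k * b l)"
proof (induction k)
  case 0
  have "N (\<lambda>l. 0 * a l) (\<lambda>l. 0 * b l) = 1\<^sub>m n" by (rule N_trivial) auto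
  then show ?case by (intro exI[of _ 1]) (auto simp: N_def)
next
  case (Suc k)
  then obtain c where c: "c \<noteq> 0" "N a b ^\<^sub>m k = c \<cdot>\<^sub>m N (\<lambda>l. k * a l) (\<lambda>l. k * b l)" by blast
  have "N a b ^\<^sub>m Suc k = c \<cdot>\<^sub>m (N (\<lambda>l. k * a l) (\<lambda>l. k * b l) * N a b)"
    using c(2) by (simp add: mult_smult_assoc_mat[of _ n n _ n])
  then show ?case using c(1) twist_nz
    by (intro exI[of _ "c * (\<Prod>l<s. \<zeta> l ^ (a l * (k * b l)))"]) (simp add: N_mult algebra_simps smult_smult)
qed

lemma N_inverse: "\<exists>Q\<in>carrier_mat n n. N a b * Q = 1\<^sub>m n \<and> Q * N a b = 1\<^sub>m n"
proof -
  \<comment> \<open>Multiplication by \<open>p l - 1\<close> is negation modulo \<open>p l\<close>,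
    expressed in natural numbers.\<close>
  let ?a = "\<lambda>l. (p l - 1) * a l" and ?b = "\<lambda>l. (p l - 1) * b l"
  let ?c = "\<Prod>l<s. \<zeta> l ^ (?a l * b l)"
  have e: "x + (p l - 1) * x = p l * x" if "l < s" for l x
    using p_pos[OF that] by (cases "p l") auto
  have "N (\<lambda>l. a l + ?a l) (\<lambda>l. b l + ?b l) = 1\<^sub>m n"     by (rule N_trivial) (simp_all only: e dvd_triv_left)
  then have "N a b * N ?a ?b = ?c \<cdot>\<^sub>m 1\<^sub>m n" using N_mult[of a b ?a ?b] by simp
  moreover have "?c \<noteq> 0" by (rule twist_nz)
  ultimately have "N a b * (inverse ?c \<cdot>\<^sub>m N ?a ?b) = 1\<^sub>m n"
    by (simp add: mult_smult_distrib[of _ n n _ n] smult_smult one_smult)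
  then show ?thesis using mat_mult_left_right_inverse[of "N a b" n "inverse ?c \<cdot>\<^sub>m N ?a ?b"]
    by (intro bexI[of _ "inverse ?c \<cdot>\<^sub>m N ?a ?b"]) auto
qed

text \<open>Fourier inversion: translations separate the entries by the difference of column and
  row, and along each such shifted diagonal the characters span all functions on the group.\<close>

lemma N_span:
  fixes M :: "'c mat"
  shows "\<exists>g. \<forall>i<n. \<forall>j<n. M $$ (i, j) =
    (\<Sum>r<n * n. g r * N (digit (r div n)) (digit (r mod n)) $$ (i, j))"
proof -
  \<comment> \<open>The Fourier coefficient, at the character of \<open>x\<close>, of the entries on
    the diagonal shifted by \<open>y\<close>.\<close>
  define g where "g x y = inverse (of_nat n) *
    (\<Sum>u<n. M $$ (u, sh (digit y) u) * inverse (chi (digit x) u))" for x y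
  have "(\<Sum>r<n * n. g (r div n) (r mod n) * N (digit (r div n)) (digit (r mod n)) $$ (i, j)) = M $$ (i, j)"
    if ij: "i < n" "j < n" for i j
  proof -
    \<comment> \<open>The one translation that takes row \<open>i\<close> to column
      \<open>j\<close>; adding \<open>p l - digit i l\<close> is subtraction modulo
      \<open>p l\<close>.\<close>
    define y0 where "y0 = sh (\<lambda>l. p l - digit i l) j"
    have y: "y0 < n" unfolding y0_def by (rule sh)
    have sy: "sh (digit y0) i = j"
    proof (rule sh_eqI[OF ij(2)])
      fix l assume l: "l < s"
      have "digit i l + (digit j l + (p l - digit i l)) = digit j l + p l"
        using digit_less[OF ij(1) l] by simp
      then show "digit j l = (digit i l + digit y0 l) mod p l"
        using digit_less[OF ij(2) l] l by (simp add: y0_def sh mod_simps)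
    qed
    have yu: "y' = y0" if "y' < n" "sh (digit y') i = j" for y'
    proof (rule digit_eqI[OF that(1) y])
      fix l assume l: "l < s"
      have "(digit i l + digit y' l) mod p l = (digit i l + digit y0 l) mod p l"
        using sh(2)[OF l, of "digit y'" i] sh(2)[OF l, of "digit y0" i] that sy by simp
      then have "[digit y' l = digit y0 l] (mod p l)"
        unfolding cong_def[symmetric] by (simp only: cong_add_lcancel_nat)
      then show "digit y' l = digit y0 l" using digit_less[OF _ l] that(1) y by (simp add: cong_def)
    qed
    have iff: "j = sh (digit y') i \<longleftrightarrow> y' = y0" if "y' < n" for y'
      using yu[OF that] sy by blast
    have "(\<Sum>r<n * n. g (r div n) (r mod n) * N (digit (r div n)) (digit (r mod n)) $$ (i, j)) =
        (\<Sum>x<n. \<Sum>y<n. g x y * N (digit x) (digit y) $$ (i, j))"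
      by (rule sum_pairs[OF n_pos])
    also have "\<dots> = (\<Sum>x<n. \<Sum>y<n. if y = y0 then g x y * chi (digit x) i else 0)"
    proof (intro sum.cong refl)
      fix x y' assume "y' \<in> {..<n}"
      then show "g x y' * N (digit x) (digit y') $$ (i, j) = (if y' = y0 then g x y' * chi (digit x) i else 0)"
        using iff[of y'] by (simp only: N_index[OF ij] lessThan_iff) simp
    qed
    also have "\<dots> = (\<Sum>x<n. g x y0 * chi (digit x) i)"
      using y by simp
    also have "\<dots> = (\<Sum>x<n. inverse (of_nat n) *
        (\<Sum>u<n. M $$ (u, sh (digit y0) u) * (chi (digit i) x * inverse (chi (digit u) x))))"
    proof (intro sum.cong refl)
      fix x
      have c: "chi (digit x) v = chi (digit v) x" for v by (rule chi_sym)
      show "g x y0 * chi (digit x) i = inverse (of_nat n) *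
          (\<Sum>u<n. M $$ (u, sh (digit y0) u) * (chi (digit i) x * inverse (chi (digit u) x)))"
        unfolding g_def c by (simp add: sum_distrib_left sum_distrib_right ac_simps)
    qed
    also have "\<dots> = inverse (of_nat n) *
        (\<Sum>u<n. M $$ (u, sh (digit y0) u) * (\<Sum>x<n. chi (digit i) x * inverse (chi (digit u) x)))"
      by (simp only: sum_distrib_left[symmetric], subst sum.swap) (simp only: sum_distrib_left)
    also have "\<dots> = inverse (of_nat n) * (\<Sum>u<n. if u = i then M $$ (u, sh (digit y0) u) * of_nat n else 0)"
      using ij by (intro arg_cong[where f = "(*) _"] sum.cong refl) (auto simp: chi_orthogonal)
    also have "\<dots> = M $$ (i, j)" using ij of_nat_n sy by simp
    finally show ?thesis .
  qed
  then show ?thesis by (intro exI[of _ "\<lambda>r. g (r div n) (r mod n)"]) simp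
qed

end

lemma to_ac_hom: "comm_ring_hom (to_ac :: 'a::field \<Rightarrow> 'a alg_closure)"
  by standard simp_all

section \<open>Characteristic polynomials of the monomial matrices\<close>

context monomial_matrices
begin

definition unit_vec :: "nat \<Rightarrow> nat \<Rightarrow> nat" where
  "unit_vec l = (\<lambda>k. if k = l then 1 else 0)"

lemma prod_unit_vec:
  "l < s \<Longrightarrow> (\<Prod>k<s. \<zeta> k ^ (unit_vec l k * f k)) = \<zeta> l ^ f l"
  "l < s \<Longrightarrow> (\<Prod>k<s. \<zeta> k ^ (f k * unit_vec l k)) = \<zeta> l ^ f l"
proof -
  assume l: "l < s"
  have "(\<Prod>k<s. \<zeta> k ^ (unit_vec l k * f k)) = (\<Prod>k<s. if k = l then \<zeta> k ^ f k else 1)"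
    by (rule prod.cong) (auto simp: unit_vec_def)
  then show "(\<Prod>k<s. \<zeta> k ^ (unit_vec l k * f k)) = \<zeta> l ^ f l" using l by simp
  then show "(\<Prod>k<s. \<zeta> k ^ (f k * unit_vec l k)) = \<zeta> l ^ f l" by (simp add: mult.commute)
qed

text \<open>Conjugation by \<open>N c d\<close> multiplies \<open>N a b\<close> by a root of unity
  and hence the coefficient in degree \<open>n - r\<close> by its \<open>r\<close>-th power. If that
  coefficient is nonzero, the power must be \<open>1\<close>.\<close>

lemma N_twist:
  assumes r: "r \<le> n" "poly.coeff (char_poly (N a b)) (n - r) \<noteq> 0"
  shows "(\<Prod>l<s. \<zeta> l ^ (c l * b l)) ^ r = (\<Prod>l<s. \<zeta> l ^ (a l * d l)) ^ r"
proof -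
  define w1 where "w1 = (\<Prod>l<s. \<zeta> l ^ (c l * b l))"
  define w2 where "w2 = (\<Prod>l<s. \<zeta> l ^ (a l * d l))"
  have w: "w1 \<noteq> 0" unfolding w1_def by (rule twist_nz)
  obtain Q where Q: "Q \<in> carrier_mat n n" "N c d * Q = 1\<^sub>m n" "Q * N c d = 1\<^sub>m n"
    using N_inverse by blast
  have e: "N c d * N a b = (w2 * inverse w1) \<cdot>\<^sub>m (N a b * N c d)"
    unfolding N_mult smult_smult w1_def[symmetric] w2_def[symmetric] using w by (simp add: add.commute mult.assoc)
  have "N a b = (Q * N c d) * N a b" using Q by simp
  also have "\<dots> = Q * (N c d * N a b)" using Q(1) by (intro assoc_mult_mat) auto
  also have "\<dots> = Q * (((w2 * inverse w1) \<cdot>\<^sub>m N a b) * N c d)"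
    unfolding e by (simp add: mult_smult_assoc_mat[of _ n n _ n])
  also have "\<dots> = Q * ((w2 * inverse w1) \<cdot>\<^sub>m N a b) * N c d"
    using Q(1) by (intro assoc_mult_mat[symmetric]) auto
  finally have "similar_mat (N a b) ((w2 * inverse w1) \<cdot>\<^sub>m N a b)"
    using Q by (intro similar_matI[of _ _ Q "N c d" n]) auto
  then have "char_poly (N a b) = char_poly ((w2 * inverse w1) \<cdot>\<^sub>m N a b)" by (rule char_poly_similar)
  then have "poly.coeff (char_poly (N a b)) (n - r) =
      (w2 * inverse w1) ^ r * poly.coeff (char_poly (N a b)) (n - r)"
    using coeff_char_poly_smult[OF N_carrier, of "n - r" "w2 * inverse w1" a b] r(1) by simp
  then have "(w2 * inverse w1) ^ r = 1" using r(2) by simp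
  then show ?thesis using w
    unfolding w1_def[symmetric] w2_def[symmetric] by (simp add: power_mult_distrib power_inverse field_simps)
qed

text \<open>If \<open>e\<close> is the order of \<open>N a b\<close> modulo scalars, its characteristic polynomial is invariant
  under multiplying the variable by the \<open>e\<close>-th roots of unity, and each of its roots is an
  \<open>e\<close>-th root of the same scalar \<open>\<mu>\<close>; so it is \<open>(\<lambda>\<^sup>e - \<mu>) ^ (n div e)\<close>.\<close>

lemma char_poly_N_nonzero:
  assumes i: "i \<le> n" and pi: "\<And>l. l < s \<Longrightarrow> \<not> (p l dvd a l \<and> p l dvd b l) \<Longrightarrow> p l dvd i"
  shows "poly.coeff (char_poly (N a b)) (n - i) \<noteq> 0"
proof -
  \<comment> \<open>The primes at which \<open>(a, b)\<close> is nontrivial. As a set it counts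
    repeated primes once, so their product \<open>e\<close> is squarefree; it is the order of
    \<open>N a b\<close> modulo scalars.\<close>
  define P where "P = p ` {l \<in> {..<s}. \<not> (p l dvd a l \<and> p l dvd b l)}"
  define e where "e = \<Prod>P"
  have P: "finite P" "\<And>q. q \<in> P \<Longrightarrow> prime q" using prime by (auto simp: P_def)
  have e0: "0 < e" unfolding e_def using P prime_gt_0_nat by (intro prod_pos) auto
  have dv: "e dvd r" if "\<And>l. l < s \<Longrightarrow> \<not> (p l dvd a l \<and> p l dvd b l) \<Longrightarrow> p l dvd r" for r
    unfolding e_def using P by (rule prime_prod_dvd) (use that in \<open>auto simp: P_def\<close>)
  have ei: "e dvd i" using dv pi by blast
  have "p l dvd n" if "l < s" for l unfolding n_prod using that by (intro dvd_prodI) auto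
  then have en: "e dvd n" using dv by blast
  have pe: "p l dvd e" if "l < s" "\<not> (p l dvd a l \<and> p l dvd b l)" for l
    unfolding e_def using P(1) that by (intro dvd_prodI) (auto simp: P_def)
  let ?f = "char_poly (N a b)"
  have f: "degree ?f = n" "poly.coeff ?f n = 1" using degree_monic_char_poly[OF N_carrier] by auto
  \<comment> \<open>Conjugating by the diagonal generator and by the translation at index
    \<open>l\<close> detects \<open>b l\<close> and \<open>a l\<close> respectively, and one of
    these is prime to \<open>p l\<close>.\<close>
  have er: "e dvd r" if r: "r \<le> n" "poly.coeff ?f (n - r) \<noteq> 0" for r
  proof (rule dv)
    fix l assume l: "l < s" "\<not> (p l dvd a l \<and> p l dvd b l)"
    have "p l dvd b l * r"
    proof -
      have "(\<zeta> l ^ b l) ^ r = 1 ^ r"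
        using N_twist[OF r, of "unit_vec l" "\<lambda>_. 0"] prod_unit_vec(1)[OF l(1), of b] by simp
      then have "\<zeta> l ^ (b l * r) = \<zeta> l ^ 0" by (simp add: power_mult)
      then show ?thesis unfolding zeta_pow[OF l(1)] by (simp add: mod_eq_0_iff_dvd)
    qed
    moreover have "p l dvd a l * r"
    proof -
      have "(\<zeta> l ^ a l) ^ r = 1 ^ r"
        using N_twist[OF r, of "\<lambda>_. 0" "unit_vec l"] prod_unit_vec(2)[OF l(1), of a] by simp
      then have "\<zeta> l ^ (a l * r) = \<zeta> l ^ 0" by (simp add: power_mult)
      then show ?thesis unfolding zeta_pow[OF l(1)] by (simp add: mod_eq_0_iff_dvd)
    qed
    ultimately show "p l dvd r" using l(2) prime[OF l(1)] by (auto simp: prime_dvd_mult_iff)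
  qed
  obtain \<mu> where "N a b ^\<^sub>m e = \<mu> \<cdot>\<^sub>m N (\<lambda>l. e * a l) (\<lambda>l. e * b l)" "\<mu> \<noteq> 0" using N_pow by blast
  moreover have "N (\<lambda>l. e * a l) (\<lambda>l. e * b l) = 1\<^sub>m n"
    by (rule N_trivial) (use pe in \<open>auto intro: dvd_mult dvd_mult2\<close>)
  ultimately have \<mu>: "N a b ^\<^sub>m e = \<mu> \<cdot>\<^sub>m 1\<^sub>m n" "\<mu> \<noteq> 0" by simp_all
  interpret ac: comm_ring_hom "to_ac :: 'c \<Rightarrow> 'c alg_closure" by (rule to_ac_hom)
  let ?N = "map_mat to_ac (N a b) :: 'c alg_closure mat"
  have Nc: "?N \<in> carrier_mat n n" by simp
  have cN: "poly.coeff (char_poly ?N) d = to_ac (poly.coeff ?f d)" for d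
    unfolding ac.char_poly_hom[OF N_carrier] by (simp add: coeff_map_poly)
  \<comment> \<open>Only degrees divisible by \<open>e\<close> occur, so the characteristic
    polynomial is \<open>q\<close> evaluated at the \<open>e\<close>-th power of the
    variable.\<close>
  define q where "q = (\<Sum>k\<le>n div e. Polynomial.monom (to_ac (poly.coeff ?f (e * k))) k)"
  have cq: "poly.coeff q k = (if k \<le> n div e then to_ac (poly.coeff ?f (e * k)) else 0)" for k
    unfolding q_def by (auto simp: coeff_sum if_distrib sum.delta cong: if_cong)
  have ev: "poly (char_poly ?N) \<rho> = poly q (\<rho> ^ e)" for \<rho>
  proof -
    have "degree (char_poly ?N) = n" using degree_monic_char_poly[OF Nc] by simp
    then have "poly (char_poly ?N) \<rho> = (\<Sum>d\<le>n. to_ac (poly.coeff ?f d) * \<rho> ^ d)"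
      by (simp add: poly_altdef cN)
    also have "\<dots> = (\<Sum>d\<in>(\<lambda>k. e * k) ` {..n div e}. to_ac (poly.coeff ?f d) * \<rho> ^ d)"
    proof (rule sum.mono_neutral_right)
      show "(\<lambda>k. e * k) ` {..n div e} \<subseteq> {..n}"
      proof (rule image_subsetI)
        fix k assume "k \<in> {..n div e}"
        then have "e * k \<le> e * (n div e)" by simp
        then show "e * k \<in> {..n}" using en by simp
      qed
      show "\<forall>d\<in>{..n} - (\<lambda>k. e * k) ` {..n div e}. to_ac (poly.coeff ?f d) * \<rho> ^ d = 0"
      proof
        fix d assume d: "d \<in> {..n} - (\<lambda>k. e * k) ` {..n div e}"
        have "poly.coeff ?f d = 0"
        proof (rule ccontr)
          assume "poly.coeff ?f d \<noteq> 0"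
          then have "e dvd n - d" using er[of "n - d"] d by simp
          then have "e dvd d" using en d by (metis DiffD1 atMost_iff dvd_diffD1)
          then obtain k where "d = e * k" by (auto elim: dvdE)
          moreover have "k \<le> n div e" using d \<open>d = e * k\<close> e0 by (auto simp: less_eq_div_iff_mult_less_eq mult.commute)
          ultimately show False using d by auto
        qed
        then show "to_ac (poly.coeff ?f d) * \<rho> ^ d = 0" by simp
      qed
    qed simp
    also have "\<dots> = (\<Sum>k\<le>n div e. to_ac (poly.coeff ?f (e * k)) * (\<rho> ^ e) ^ k)"
      using e0 by (subst sum.reindex) (auto simp: inj_on_def power_mult)
    also have "\<dots> = poly q (\<rho> ^ e)" by (simp add: q_def poly_sum poly_monom)
    finally show ?thesis .
  qed
  have q1: "poly.coeff q (n div e) = 1" using en f by (simp add: cq)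
  have dq: "degree q = n div e"
  proof (rule antisym)
    show "degree q \<le> n div e" by (rule degree_le) (simp add: cq)
    show "n div e \<le> degree q" using q1 by (intro le_degree) simp
  qed
  have q0: "q \<noteq> 0" using q1 by auto
  obtain R where R: "size R = degree q" "q = smult (lead_coeff q) (\<Prod>x\<in>#R. [:- x, 1:])"
    using alg_closed_imp_factorization[OF q0] by blast
  have qR: "q = (\<Prod>x\<in>#R. [:- x, 1:])" using R(2) q1 dq by simp
  \<comment> \<open>Every \<open>e\<close>-th root of a root of \<open>q\<close> is an eigenvalue,
    while the \<open>e\<close>-th power of the matrix is the scalar \<open>\<mu>\<close>.\<close>
  have "x = to_ac \<mu>" if x: "x \<in># R" for x
  proof -
    have "poly q x = 0"
      unfolding qR poly_prod_mset using x by (auto simp: prod_mset_zero_iff image_iff intro!: bexI[of _ x])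
    moreover obtain \<rho> where \<rho>: "\<rho> ^ e = x" using nth_root_exists[OF e0] by blast
    ultimately have "poly (char_poly ?N) \<rho> = 0" by (simp add: ev)
    then have "eigenvalue ?N \<rho>" by (simp add: eigenvalue_root_char_poly[OF Nc])
    then obtain v where v: "eigenvector ?N v \<rho>" by (auto simp: eigenvalue_def)
    then have vc: "v \<in> carrier_vec n" "v \<noteq> 0\<^sub>v n" by (auto simp: eigenvector_def)
    have "?N ^\<^sub>m e = map_mat to_ac (N a b ^\<^sub>m e)"
      by (rule ac.mat_hom_pow[OF N_carrier, symmetric])
    also have "\<dots> = to_ac \<mu> \<cdot>\<^sub>m 1\<^sub>m n" unfolding \<mu>(1) by (rule eq_matI) auto
    finally have "(to_ac \<mu> \<cdot>\<^sub>m 1\<^sub>m n) *\<^sub>v v = \<rho> ^ e \<cdot>\<^sub>v v"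
      using eigenvector_pow[OF Nc v, of e] by simp
    moreover have "(to_ac \<mu> \<cdot>\<^sub>m 1\<^sub>m n) *\<^sub>v v = to_ac \<mu> \<cdot>\<^sub>v v"
    proof (rule eq_vecI)
      fix k assume k: "k < dim_vec (to_ac \<mu> \<cdot>\<^sub>v v)"
      have "((to_ac \<mu> \<cdot>\<^sub>m 1\<^sub>m n) *\<^sub>v v) $ k = (\<Sum>l = 0..<n. if l = k then to_ac \<mu> * v $ l else 0)"
      proof -
        have "(\<Sum>i = 0..<n. to_ac \<mu> * (if i = k then 1 else 0) * v $ i) =
            (\<Sum>l = 0..<n. if l = k then to_ac \<mu> * v $ l else 0)" by (rule sum.cong) auto
        then show ?thesis using k vc(1) by (simp add: scalar_prod_def)
      qed
      then show "((to_ac \<mu> \<cdot>\<^sub>m 1\<^sub>m n) *\<^sub>v v) $ k = (to_ac \<mu> \<cdot>\<^sub>v v) $ k"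
        using k vc(1) by simp
    qed (use vc(1) in simp)
    ultimately have eqv: "to_ac \<mu> \<cdot>\<^sub>v v = x \<cdot>\<^sub>v v" using \<rho> by simp
    have "\<exists>k<n. v $ k \<noteq> 0"
    proof (rule ccontr)
      assume "\<not> (\<exists>k<n. v $ k \<noteq> 0)"
      then have "v = 0\<^sub>v n" using vc(1) by (intro eq_vecI) auto
      then show False using vc(2) by simp
    qed
    then obtain k where k: "k < n" "v $ k \<noteq> 0" by blast
    have "(to_ac \<mu> \<cdot>\<^sub>v v) $ k = (x \<cdot>\<^sub>v v) $ k" using eqv by simp
    then show ?thesis using k vc(1) by simp
  qed
  then have "(\<Prod>x\<in>#R. [:- x, 1:]) = [:- to_ac \<mu>, 1:] ^ size R" by (induction R) auto
  then have qp: "q = [:- to_ac \<mu>, 1:] ^ (n div e)" using qR R(1) dq by simp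
  obtain k where k: "n - i = e * k" "k \<le> n div e"
  proof -
    have "e dvd n - i" using ei en by simp
    then obtain k where "n - i = e * k" by (auto elim: dvdE)
    moreover from this have "e * k \<le> n" by (metis diff_le_self)
    then have "k \<le> n div e" using e0 by (simp add: less_eq_div_iff_mult_less_eq mult.commute)
    ultimately show ?thesis using that by blast
  qed
  have "to_ac (poly.coeff ?f (n - i)) = of_nat (n div e choose k) * (- to_ac \<mu>) ^ (n div e - k)"
  proof -
    have "to_ac (poly.coeff ?f (n - i)) = poly.coeff q k" using k by (simp only: cq if_True)
    also have "\<dots> = of_nat (n div e choose k) * 1 ^ k * (- to_ac \<mu>) ^ (n div e - k)"
      unfolding qp by (rule coeff_linear_poly_power[OF k(2)])
    finally show ?thesis by simp
  qed
  moreover have "(of_nat (n div e choose k) :: 'c alg_closure) \<noteq> 0"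
  proof (rule of_nat_neq_zero)
    show "(of_nat (fact n) :: 'c alg_closure) \<noteq> 0"
      using char by (metis to_ac_of_nat to_ac_eq_0_iff)
    have "n div e choose k dvd fact (n div e)"
      using binomial_fact_lemma[OF k(2)] by (metis dvd_triv_right)
    also have "\<dots> dvd fact n" by (intro fact_dvd) simp
    finally show "n div e choose k dvd fact n" .
  qed
  ultimately show ?thesis using \<mu>(2) by auto
qed

section \<open>A domain of equivariant matrices\<close>

abbreviation cmat :: "'c mat \<Rightarrow> ((nat \<Rightarrow>\<^sub>0 nat) \<Rightarrow>\<^sub>0 'c) mat" where
  "cmat \<equiv> map_mat const"

definition tw :: "nat \<Rightarrow> 'c \<Rightarrow> ((nat \<Rightarrow>\<^sub>0 nat) \<Rightarrow>\<^sub>0 'c) \<Rightarrow> (nat \<Rightarrow>\<^sub>0 nat) \<Rightarrow>\<^sub>0 'c" where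
  "tw r \<omega> = scale (\<lambda>v. if v = r then \<omega> else 1)"

lemma tw_hom: "comm_ring_hom (tw r \<omega>)"
  unfolding tw_def by (rule scale_hom)

lemma lookup_tw: "lookup (tw r \<omega> f) \<alpha> = lookup f \<alpha> * \<omega> ^ lookup \<alpha> r"
  unfolding tw_def lookup_scale mval_one_but ..

definition Xm :: "nat \<Rightarrow> ((nat \<Rightarrow>\<^sub>0 nat) \<Rightarrow>\<^sub>0 'c) mat" where "Xm l = cmat (N (unit_vec l) (\<lambda>_. 0))"
definition Ym :: "nat \<Rightarrow> ((nat \<Rightarrow>\<^sub>0 nat) \<Rightarrow>\<^sub>0 'c) mat" where "Ym l = cmat (N (\<lambda>_. 0) (unit_vec l))"

text \<open>The matrices \<open>\<Sum>\<alpha>. c\<^sub>\<alpha> T\<^sup>\<alpha> N\<^sub>\<alpha>\<close>, where the variables \<open>T\<^sub>2\<^sub>l\<close> and \<open>T\<^sub>2\<^sub>l\<^sub>+\<^sub>1\<close> stand for the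
  \<open>p\<^sub>l\<close>-th roots of the parameters of the \<open>l\<close>-th symbol algebra, described by their behaviour
  under the substitutions that multiply one variable by a root of unity.\<close>

definition D0 :: "((nat \<Rightarrow>\<^sub>0 nat) \<Rightarrow>\<^sub>0 'c) mat set" where
  "D0 = {A \<in> carrier_mat n n. \<forall>l<s. A * Xm l = Xm l * map_mat (tw (2 * l + 1) (\<zeta> l)) A \<and>
    Ym l * A = map_mat (tw (2 * l) (\<zeta> l)) A * Ym l}"

definition Nm :: "(nat \<Rightarrow>\<^sub>0 nat) \<Rightarrow> 'c mat" where
  "Nm \<alpha> = N (\<lambda>l. lookup \<alpha> (2 * l)) (\<lambda>l. lookup \<alpha> (2 * l + 1))"

lemma lookup_mult_const: "lookup (f * const c) \<alpha> = lookup f \<alpha> * (c :: 'c)"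
proof -
  have "f * const c = (\<Sum>\<beta>\<in>keys f. Poly_Mapping.single \<beta> (lookup f \<beta> * c))"
    by (subst sum_singles[of f]) (simp add: sum_distrib_right mult_single)
  then show ?thesis by (simp add: lookup_sum lookup_single when_def in_keys_iff)
qed

lemma XY_carrier [simp]: "Xm l \<in> carrier_mat n n" "Ym l \<in> carrier_mat n n"
  by (auto simp: Xm_def Ym_def)

lemma sh_inj: "j < n \<Longrightarrow> k < n \<Longrightarrow> sh b j = sh b k \<Longrightarrow> j = k"
proof -
  assume jk: "j < n" "k < n" and eq: "sh b j = sh b k"
  have e: "b l + (p l - 1) * b l = p l * b l" if "l < s" for l
    using p_pos[OF that] by (cases "p l") auto
  have "sh (\<lambda>l. (p l - 1) * b l) (sh b x) = x" if "x < n" for x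
    unfolding sh_sh by (rule sh_trivial[OF that]) (simp only: e dvd_triv_left)
  then show "j = k" using jk eq by metis
qed

text \<open>Since \<open>Xm l\<close> is diagonal and \<open>Ym l\<close> a translation, the
  defining relations become conditions on single entries: the first restricts the monomials an entry
  may contain, the second carries an entry along the translation.\<close>

lemma D0_entries:
  assumes A: "A \<in> D0" and l: "l < s" and ij: "i < n" "j < n"
  shows "A $$ (i, j) * const (\<zeta> l ^ digit j l) = const (\<zeta> l ^ digit i l) * tw (2 * l + 1) (\<zeta> l) (A $$ (i, j))"
    and "A $$ (sh (unit_vec l) i, sh (unit_vec l) j) = tw (2 * l) (\<zeta> l) (A $$ (i, j))"
proof -
  have Ac: "A \<in> carrier_mat n n" using A by (simp add: D0_def)
  have Tc: "map_mat (tw r \<omega>) A \<in> carrier_mat n n" for r \<omega> using Ac by simp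
  have X: "Xm l $$ (x, y) = (if y = x then const (\<zeta> l ^ digit x l) else 0)" if "x < n" "y < n" for x y
    using that sh_trivial[of x "\<lambda>_. 0"] prod_unit_vec(1)[OF l, of "digit x"]
    by (simp add: Xm_def chi_def)
  have Y: "Ym l $$ (x, y) = (if y = sh (unit_vec l) x then 1 else 0)" if "x < n" "y < n" for x y
    using that by (simp add: Ym_def chi_def)
  have "(A * Xm l) $$ (i, j) = (\<Sum>k<n. if k = j then A $$ (i, k) * const (\<zeta> l ^ digit k l) else 0)"
    unfolding index_mult_sum[OF Ac XY_carrier(1) ij] by (intro sum.cong refl) (use ij in \<open>auto simp: X\<close>)
  then have 1: "(A * Xm l) $$ (i, j) = A $$ (i, j) * const (\<zeta> l ^ digit j l)" using ij by simp
  have "(Xm l * map_mat (tw (2 * l + 1) (\<zeta> l)) A) $$ (i, j) =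
      (\<Sum>k<n. if k = i then const (\<zeta> l ^ digit i l) * tw (2 * l + 1) (\<zeta> l) (A $$ (k, j)) else 0)"
    unfolding index_mult_sum[OF XY_carrier(1) Tc ij] by (intro sum.cong refl) (use ij Ac in \<open>auto simp: X\<close>)
  then have 2: "(Xm l * map_mat (tw (2 * l + 1) (\<zeta> l)) A) $$ (i, j) =
      const (\<zeta> l ^ digit i l) * tw (2 * l + 1) (\<zeta> l) (A $$ (i, j))" using ij by simp
  show "A $$ (i, j) * const (\<zeta> l ^ digit j l) = const (\<zeta> l ^ digit i l) * tw (2 * l + 1) (\<zeta> l) (A $$ (i, j))"
    using 1 2 A l by (simp add: D0_def)
  let ?s = "sh (unit_vec l)"
  have sj: "?s j < n" by (rule sh)
  have "(Ym l * A) $$ (i, ?s j) = (\<Sum>k<n. if k = ?s i then A $$ (k, ?s j) else 0)"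
    unfolding index_mult_sum[OF XY_carrier(2) Ac ij(1) sj] by (intro sum.cong refl) (use ij in \<open>auto simp: Y\<close>)
  then have 3: "(Ym l * A) $$ (i, ?s j) = A $$ (?s i, ?s j)" by (simp add: sh)
  have "(map_mat (tw (2 * l) (\<zeta> l)) A * Ym l) $$ (i, ?s j) =
      (\<Sum>k<n. if k = j then tw (2 * l) (\<zeta> l) (A $$ (i, k)) else 0)"
    unfolding index_mult_sum[OF Tc XY_carrier(2) ij(1) sj]
    by (intro sum.cong refl) (use ij Ac sj sh_inj[of j] in \<open>auto simp: Y\<close>)
  then have 4: "(map_mat (tw (2 * l) (\<zeta> l)) A * Ym l) $$ (i, ?s j) = tw (2 * l) (\<zeta> l) (A $$ (i, j))"
    using ij by simp
  show "A $$ (?s i, ?s j) = tw (2 * l) (\<zeta> l) (A $$ (i, j))" using 3 4 A l by (simp add: D0_def)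
qed

text \<open>At a fixed exponent the relations with \<open>Xm\<close> confine the coefficients to the
  entries of one translation, and those with \<open>Ym\<close> determine them all from a single one;
  one scalar remains free.\<close>

lemma D0_coeff:
  assumes A: "A \<in> D0"
  shows "\<exists>g. map_mat (\<lambda>f. lookup f \<alpha>) A = g \<cdot>\<^sub>m Nm \<alpha>"
proof -
  let ?a = "\<lambda>l. lookup \<alpha> (2 * l)" and ?b = "\<lambda>l. lookup \<alpha> (2 * l + 1)"
  have Ac: "A \<in> carrier_mat n n" using A by (simp add: D0_def)
  define c where "c i j = lookup (A $$ (i, j)) \<alpha>" for i j
  have z: "c i j = 0" if ij: "i < n" "j < n" and ne: "j \<noteq> sh ?b i" for i j
  proof (rule ccontr)
    assume nz: "c i j \<noteq> 0"
    have "sh ?b i = j"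
    proof (rule sh_eqI[OF ij(2)])
      fix l assume l: "l < s"
      have "lookup (A $$ (i, j) * const (\<zeta> l ^ digit j l)) \<alpha> =
          lookup (tw (2 * l + 1) (\<zeta> l) (A $$ (i, j)) * const (\<zeta> l ^ digit i l)) \<alpha>"
        using D0_entries(1)[OF A l ij] by (simp add: mult.commute)
      then have "c i j * \<zeta> l ^ digit j l = c i j * (\<zeta> l ^ (?b l + digit i l))"
        unfolding lookup_mult_const lookup_tw c_def by (simp add: power_add)
      then have "\<zeta> l ^ digit j l = \<zeta> l ^ (?b l + digit i l)" using nz by simp
      then show "digit j l = (digit i l + ?b l) mod p l"
        using zeta_pow[OF l] digit_less[OF ij(2) l] by (simp add: add.commute)
    qed
    then show False using ne by simp
  qed
  \<comment> \<open>The row of the neutral element, from which translations reach every row.\<close>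
  obtain i0 where i0: "i0 < n" "\<And>l. l < s \<Longrightarrow> digit i0 l = 0"
    using digit_surj[of "\<lambda>_. 0"] p_pos by auto
  define g where "g = c i0 (sh ?b i0)"
  have step: "c (sh (unit_vec l) i) (sh ?b (sh (unit_vec l) i)) = \<zeta> l ^ ?a l * c i (sh ?b i)"
    if "i < n" "l < s" for i l
  proof -
    have "sh ?b (sh (unit_vec l) i) = sh (unit_vec l) (sh ?b i)" unfolding sh_sh by (simp add: add.commute)
    then show ?thesis using D0_entries(2)[OF A that(2,1) sh(1)[of ?b i]]
      by (simp add: c_def lookup_tw mult.commute)
  qed
  \<comment> \<open>Induction on the number of unit translations leading away from the neutral
    row.\<close>
  have path: "c (sh v i0) (sh ?b (sh v i0)) = (\<Prod>l<s. \<zeta> l ^ (?a l * v l)) * g" for v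
  proof (induction "\<Sum>l<s. v l" arbitrary: v)
    case 0
    then have v0: "v l = 0" if "l < s" for l using that by simp
    then have "sh v i0 = i0" by (intro sh_trivial i0) auto
    then show ?case using v0 by (simp add: g_def)
  next
    case (Suc k)
    then obtain l where l: "l < s" "v l \<noteq> 0" by (metis lessThan_iff nat.distinct(1) sum.neutral)
    define v' where "v' x = (if x = l then v x - 1 else v x)" for x
    have vv: "v = (\<lambda>x. v' x + unit_vec l x)" using l by (auto simp: v'_def unit_vec_def)
    have "(\<Sum>x<s. v x) = (\<Sum>x<s. v' x) + (\<Sum>x<s. unit_vec l x)" by (subst vv) (rule sum.distrib)
    then have "k = (\<Sum>x<s. v' x)" using l Suc.hyps(2) by (simp add: unit_vec_def)
    note IH = Suc.hyps(1)[OF this]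
    have "sh v i0 = sh (unit_vec l) (sh v' i0)" unfolding sh_sh using vv by simp
    then have "c (sh v i0) (sh ?b (sh v i0)) = \<zeta> l ^ ?a l * ((\<Prod>l<s. \<zeta> l ^ (?a l * v' l)) * g)"
      using step[OF sh(1)[of v' i0] l(1)] IH by simp
    also have "\<dots> = (\<Prod>x<s. \<zeta> x ^ (?a x * v x)) * g"
    proof -
      have "(\<Prod>x<s. \<zeta> x ^ (?a x * v x)) = (\<Prod>x<s. \<zeta> x ^ (?a x * v' x) * \<zeta> x ^ (?a x * unit_vec l x))"
        by (intro prod.cong refl) (subst vv, simp only: distrib_left power_add)
      then show ?thesis by (simp only: prod.distrib prod_unit_vec(2)[OF l(1), of ?a]) (simp only: ac_simps)
    qed
    finally show ?case .
  qed
  have di: "c i (sh ?b i) = chi ?a i * g" if i: "i < n" for i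
  proof -
    have "sh (digit i) i0 = i" by (rule sh_eqI) (use i i0 digit_less in auto)
    then show ?thesis using path[of "digit i"] by (simp add: chi_def)
  qed
  have "map_mat (\<lambda>f. lookup f \<alpha>) A = g \<cdot>\<^sub>m Nm \<alpha>"
  proof (rule eq_matI)
    fix i j assume "i < dim_row (g \<cdot>\<^sub>m Nm \<alpha>)" "j < dim_col (g \<cdot>\<^sub>m Nm \<alpha>)"
    then have ij: "i < n" "j < n" by (auto simp: Nm_def)
    have "map_mat (\<lambda>f. lookup f \<alpha>) A $$ (i, j) = c i j" using Ac ij by (simp add: c_def)
    also have "\<dots> = g * (if j = sh ?b i then chi ?a i else 0)"
      using z[OF ij] di[OF ij(1)] by (cases "j = sh ?b i") (auto simp: mult.commute)
    also have "\<dots> = (g \<cdot>\<^sub>m Nm \<alpha>) $$ (i, j)" unfolding Nm_def by (simp add: ij)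
    finally show "map_mat (\<lambda>f. lookup f \<alpha>) A $$ (i, j) = (g \<cdot>\<^sub>m Nm \<alpha>) $$ (i, j)" .
  qed (use Ac in \<open>auto simp: Nm_def\<close>)
  then show ?thesis by blast
qed

end

lemma coeff_char_poly_zero:
  fixes A :: "'a::comm_ring_1 mat"
  assumes A: "A \<in> carrier_mat n n"
  shows "poly.coeff (char_poly A) 0 = (- 1) ^ n * det A"
proof -
  have h: "comm_ring_hom (\<lambda>q :: 'a poly. poly q 0)" by standard auto
  have "map_mat (\<lambda>q. poly q 0) (char_poly_matrix A) = (- 1) \<cdot>\<^sub>m A"
    by (rule eq_matI) (use A in \<open>auto simp: char_poly_matrix_def\<close>)
  then have "poly (char_poly A) 0 = det ((- 1) \<cdot>\<^sub>m A)"
    unfolding char_poly_def comm_ring_hom.hom_det[OF h, symmetric] by simp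
  then show ?thesis using A by (simp add: poly_0_coeff_0)
qed

lemma smult_one_mult_mat:
  fixes M :: "'a::comm_ring_1 mat"
  assumes "M \<in> carrier_mat n m"
  shows "(c \<cdot>\<^sub>m 1\<^sub>m n) * M = c \<cdot>\<^sub>m M" "M * (c \<cdot>\<^sub>m 1\<^sub>m m) = c \<cdot>\<^sub>m M"
  unfolding mult_smult_assoc_mat[OF one_carrier_mat assms] mult_smult_distrib[OF assms one_carrier_mat]
    left_mult_one_mat[OF assms] right_mult_one_mat[OF assms] by simp_all

lemma sqf_dvd: "prime q \<Longrightarrow> q dvd n \<Longrightarrow> 0 < n \<Longrightarrow> q dvd sqf n"
  unfolding sqf_def by (intro dvd_prodI) (auto simp: prime_factors_dvd)

section \<open>Closure properties and leading terms of equivariant matrices\<close>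

context monomial_matrices
begin

lemma p_dvd_n: "l < s \<Longrightarrow> p l dvd n"
  unfolding n_prod by (intro dvd_prodI) auto

lemma p_dvd_sqf: "l < s \<Longrightarrow> p l dvd sqf n"
  using sqf_dvd prime p_dvd_n n_pos by blast

lemma D0_carrier: "A \<in> D0 \<Longrightarrow> A \<in> carrier_mat n n"
  by (simp add: D0_def)

lemma XY_one [simp]:
  "1\<^sub>m n * Xm l = Xm l" "Xm l * 1\<^sub>m n = Xm l" "1\<^sub>m n * Ym l = Ym l" "Ym l * 1\<^sub>m n = Ym l"
  by (simp_all only: left_mult_one_mat[OF XY_carrier(1)] right_mult_one_mat[OF XY_carrier(1)]
      left_mult_one_mat[OF XY_carrier(2)] right_mult_one_mat[OF XY_carrier(2)])

lemma D0_add: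
  assumes "A \<in> D0" "B \<in> D0"
  shows "A + B \<in> D0"
  unfolding D0_def
proof (intro CollectI conjI allI impI)
  have c: "A \<in> carrier_mat n n" "B \<in> carrier_mat n n" using assms D0_carrier by auto
  then show "A + B \<in> carrier_mat n n" by simp
  fix l assume l: "l < s"
  have h: "map_mat (tw r \<omega>) (A + B) = map_mat (tw r \<omega>) A + map_mat (tw r \<omega>) B" for r \<omega>
    by (rule eq_matI) (use c in \<open>auto simp: tw_def scale_def ev_add[OF const_hom]\<close>)
  show "(A + B) * Xm l = Xm l * map_mat (tw (2 * l + 1) (\<zeta> l)) (A + B)"
    unfolding h using assms l c
    by (subst add_mult_distrib_mat[of _ n n _ _ n]; (subst mult_add_distrib_mat[of _ n n _ n])?) (auto simp: D0_def)
  show "Ym l * (A + B) = map_mat (tw (2 * l) (\<zeta> l)) (A + B) * Ym l"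
    unfolding h using assms l c
    by (subst add_mult_distrib_mat[of _ n n _ _ n]; (subst mult_add_distrib_mat[of _ n n _ n])?) (auto simp: D0_def)
qed

lemma D0_mult:
  assumes "A \<in> D0" "B \<in> D0"
  shows "A * B \<in> D0"
  unfolding D0_def
proof (intro CollectI conjI allI impI)
  have c: "A \<in> carrier_mat n n" "B \<in> carrier_mat n n" using assms D0_carrier by auto
  then show "A * B \<in> carrier_mat n n" by simp
  fix l assume l: "l < s"
  have h: "map_mat (tw r \<omega>) (A * B) = map_mat (tw r \<omega>) A * map_mat (tw r \<omega>) B" for r \<omega>
  proof -
    interpret comm_ring_hom "tw r \<omega>" by (rule tw_hom)
    show ?thesis by (rule mat_hom_mult[OF c])
  qed
  let ?f = "map_mat (tw (2 * l + 1) (\<zeta> l))" and ?g = "map_mat (tw (2 * l) (\<zeta> l))"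
  have fc: "?f A \<in> carrier_mat n n" "?f B \<in> carrier_mat n n" "?g A \<in> carrier_mat n n" "?g B \<in> carrier_mat n n"
    using c by auto
  have X: "A * Xm l = Xm l * ?f A" "B * Xm l = Xm l * ?f B" "Ym l * A = ?g A * Ym l" "Ym l * B = ?g B * Ym l"
    using assms l by (auto simp: D0_def)
  have "A * B * Xm l = A * (Xm l * ?f B)" using c X by (simp add: assoc_mult_mat[of _ n n _ n _ n])
  also have "\<dots> = Xm l * ?f A * ?f B" using c fc X by (simp add: assoc_mult_mat[of _ n n _ n _ n, symmetric])
  also have "\<dots> = Xm l * ?f (A * B)" unfolding h using fc by (simp add: assoc_mult_mat[of _ n n _ n _ n])
  finally show "A * B * Xm l = Xm l * ?f (A * B)" .
  have "Ym l * (A * B) = ?g A * Ym l * B" using c X by (simp add: assoc_mult_mat[of _ n n _ n _ n, symmetric])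
  also have "\<dots> = ?g A * (?g B * Ym l)" using c fc X by (simp add: assoc_mult_mat[of _ n n _ n _ n])
  also have "\<dots> = ?g (A * B) * Ym l" unfolding h using fc by (simp add: assoc_mult_mat[of _ n n _ n _ n, symmetric])
  finally show "Ym l * (A * B) = ?g (A * B) * Ym l" .
qed

lemma D0_scalar:
  assumes c: "\<And>l. l < s \<Longrightarrow> tw (2 * l) (\<zeta> l) c = c \<and> tw (2 * l + 1) (\<zeta> l) c = c"
  shows "c \<cdot>\<^sub>m 1\<^sub>m n \<in> D0"
  unfolding D0_def
proof (intro CollectI conjI allI impI)
  fix l assume l: "l < s"
  have m: "map_mat (tw r \<omega>) (c \<cdot>\<^sub>m 1\<^sub>m n) = tw r \<omega> c \<cdot>\<^sub>m 1\<^sub>m n" for r \<omega>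
  proof -
    interpret comm_ring_hom "tw r \<omega>" by (rule tw_hom)
    show ?thesis by (rule eq_matI) (auto simp: hom_mult)
  qed
  show "c \<cdot>\<^sub>m 1\<^sub>m n * Xm l = Xm l * map_mat (tw (2 * l + 1) (\<zeta> l)) (c \<cdot>\<^sub>m 1\<^sub>m n)"
    "Ym l * (c \<cdot>\<^sub>m 1\<^sub>m n) = map_mat (tw (2 * l) (\<zeta> l)) (c \<cdot>\<^sub>m 1\<^sub>m n) * Ym l"
    unfolding m using c[OF l] by (simp_all add: mult_smult_distrib[of _ n n _ n] mult_smult_assoc_mat[of _ n n _ n])
qed simp

lemma D0_const: "const c \<cdot>\<^sub>m 1\<^sub>m n \<in> D0"
  by (rule D0_scalar) (simp add: tw_def scale_def ev_const[OF const_hom])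

lemma cmat_N_commute:
  "l < s \<Longrightarrow> Ym l * cmat (N a b) = const (\<zeta> l ^ a l) \<cdot>\<^sub>m (cmat (N a b) * Ym l)"
  "l < s \<Longrightarrow> cmat (N a b) * Xm l = const (\<zeta> l ^ b l) \<cdot>\<^sub>m (Xm l * cmat (N a b))"
proof -
  interpret comm_ring_hom "const :: 'c \<Rightarrow> (nat \<Rightarrow>\<^sub>0 nat) \<Rightarrow>\<^sub>0 'c" by (rule const_hom)
  have sm: "cmat (c \<cdot>\<^sub>m M) = const c \<cdot>\<^sub>m cmat M" for c M by (rule eq_matI) (auto simp: hom_mult)
  assume l: "l < s"
  have "N (\<lambda>_. 0) (unit_vec l) * N a b = \<zeta> l ^ a l \<cdot>\<^sub>m (N a b * N (\<lambda>_. 0) (unit_vec l))"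
    using prod_unit_vec(2)[OF l, of a] by (simp add: N_mult smult_smult one_smult add.commute)
  then show "Ym l * cmat (N a b) = const (\<zeta> l ^ a l) \<cdot>\<^sub>m (cmat (N a b) * Ym l)"
    unfolding Ym_def by (simp only: sm mat_hom_mult[OF N_carrier N_carrier, symmetric])
  have "N a b * N (unit_vec l) (\<lambda>_. 0) = \<zeta> l ^ b l \<cdot>\<^sub>m (N (unit_vec l) (\<lambda>_. 0) * N a b)"
    using prod_unit_vec(1)[OF l, of b] by (simp add: N_mult smult_smult one_smult add.commute)
  then show "cmat (N a b) * Xm l = const (\<zeta> l ^ b l) \<cdot>\<^sub>m (Xm l * cmat (N a b))"
    unfolding Xm_def by (simp only: sm mat_hom_mult[OF N_carrier N_carrier, symmetric])
qed

lemma D0_monomial: "Poly_Mapping.single \<alpha> c \<cdot>\<^sub>m cmat (Nm \<alpha>) \<in> D0"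
  unfolding D0_def
proof (intro CollectI conjI allI impI)
  let ?t = "Poly_Mapping.single \<alpha> c"
  show "?t \<cdot>\<^sub>m cmat (Nm \<alpha>) \<in> carrier_mat n n" by (simp add: Nm_def)
  fix l assume l: "l < s"
  have m: "map_mat (tw r \<omega>) (?t \<cdot>\<^sub>m cmat (Nm \<alpha>)) = (?t * const (\<omega> ^ lookup \<alpha> r)) \<cdot>\<^sub>m cmat (Nm \<alpha>)" for r \<omega>
  proof -
    interpret comm_ring_hom "tw r \<omega>" by (rule tw_hom)
    have 1: "tw r \<omega> (const x) = const x" for x by (simp add: tw_def scale_def ev_const[OF const_hom])
    have "tw r \<omega> ?t = ?t * const (\<omega> ^ lookup \<alpha> r)"
      by (rule poly_mapping_eqI) (auto simp: lookup_tw lookup_mult_const lookup_single when_def)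
    then show ?thesis by (intro eq_matI) (auto simp: hom_mult 1)
  qed
  have c: "cmat (Nm \<alpha>) \<in> carrier_mat n n" by (simp add: Nm_def)
  show "?t \<cdot>\<^sub>m cmat (Nm \<alpha>) * Xm l = Xm l * map_mat (tw (2 * l + 1) (\<zeta> l)) (?t \<cdot>\<^sub>m cmat (Nm \<alpha>))"
    unfolding m mult_smult_assoc_mat[OF c XY_carrier(1)] mult_smult_distrib[OF XY_carrier(1) c]
    unfolding Nm_def cmat_N_commute(2)[OF l] smult_smult ..
  show "Ym l * (?t \<cdot>\<^sub>m cmat (Nm \<alpha>)) = map_mat (tw (2 * l) (\<zeta> l)) (?t \<cdot>\<^sub>m cmat (Nm \<alpha>)) * Ym l"
    unfolding m mult_smult_assoc_mat[OF c XY_carrier(2)] mult_smult_distrib[OF XY_carrier(2) c]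
    unfolding Nm_def cmat_N_commute(1)[OF l] smult_smult ..
qed

lemma XY_inverse:
  "\<exists>Q\<in>carrier_mat n n. Xm l * Q = 1\<^sub>m n \<and> Q * Xm l = 1\<^sub>m n"
  "\<exists>Q\<in>carrier_mat n n. Ym l * Q = 1\<^sub>m n \<and> Q * Ym l = 1\<^sub>m n"
proof -
  interpret comm_ring_hom "const :: 'c \<Rightarrow> (nat \<Rightarrow>\<^sub>0 nat) \<Rightarrow>\<^sub>0 'c" by (rule const_hom)
  have "\<exists>Q\<in>carrier_mat n n. cmat (N a b) * Q = 1\<^sub>m n \<and> Q * cmat (N a b) = 1\<^sub>m n" for a b
  proof -
    obtain Q where Q: "Q \<in> carrier_mat n n" "N a b * Q = 1\<^sub>m n" "Q * N a b = 1\<^sub>m n"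
      using N_inverse by blast
    have "cmat (N a b) * cmat Q = 1\<^sub>m n" "cmat Q * cmat (N a b) = 1\<^sub>m n"
      using Q(2,3) mat_hom_mult[OF N_carrier Q(1), of a b] mat_hom_mult[OF Q(1) N_carrier, of a b] mat_hom_one by metis+
    then show ?thesis using Q(1) by (intro bexI[of _ "cmat Q"]) auto
  qed
  then show "\<exists>Q\<in>carrier_mat n n. Xm l * Q = 1\<^sub>m n \<and> Q * Xm l = 1\<^sub>m n"
    "\<exists>Q\<in>carrier_mat n n. Ym l * Q = 1\<^sub>m n \<and> Q * Ym l = 1\<^sub>m n"
    unfolding Xm_def Ym_def by blast+
qed

lemma D0_similar:
  assumes A: "A \<in> D0" and l: "l < s"
  shows "similar_mat A (map_mat (tw (2 * l + 1) (\<zeta> l)) A)" "similar_mat (map_mat (tw (2 * l) (\<zeta> l)) A) A"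
proof -
  let ?f = "map_mat (tw (2 * l + 1) (\<zeta> l)) A" and ?g = "map_mat (tw (2 * l) (\<zeta> l)) A"
  have c: "A \<in> carrier_mat n n" "?f \<in> carrier_mat n n" "?g \<in> carrier_mat n n" using D0_carrier[OF A] by auto
  have X: "A * Xm l = Xm l * ?f" "Ym l * A = ?g * Ym l" using A l by (auto simp: D0_def)
  obtain Q where Q: "Q \<in> carrier_mat n n" "Xm l * Q = 1\<^sub>m n" "Q * Xm l = 1\<^sub>m n" using XY_inverse(1) by blast
  have "Xm l * ?f * Q = A * (Xm l * Q)"
    unfolding X(1)[symmetric] using c Q by (intro assoc_mult_mat) auto
  then have "A = Xm l * ?f * Q" using c Q by simp
  then show "similar_mat A ?f" using c Q by (intro similar_matI[of _ _ "Xm l" Q n]) auto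
  obtain R where R: "R \<in> carrier_mat n n" "Ym l * R = 1\<^sub>m n" "R * Ym l = 1\<^sub>m n" using XY_inverse(2) by blast
  have "Ym l * A * R = ?g * (Ym l * R)" unfolding X(2) using c R by (intro assoc_mult_mat) auto
  then have "?g = Ym l * A * R" using c R by simp
  then show "similar_mat ?g A" using c R by (intro similar_matI[of _ _ "Ym l" R n]) auto
qed

text \<open>A twisted matrix is similar to the original one, so twisting the coefficients changes
  nothing. This is the polynomial counterpart of the reduced coefficients being central.\<close>

lemma D0_char_poly_invariant:
  assumes A: "A \<in> D0" and l: "l < s"
  shows "tw (2 * l) (\<zeta> l) (poly.coeff (char_poly A) d) = poly.coeff (char_poly A) d \<and>
    tw (2 * l + 1) (\<zeta> l) (poly.coeff (char_poly A) d) = poly.coeff (char_poly A) d"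
proof -
  have c: "poly.coeff (char_poly (map_mat (tw r \<omega>) A)) d = tw r \<omega> (poly.coeff (char_poly A) d)" for r \<omega>
  proof -
    interpret comm_ring_hom "tw r \<omega>" by (rule tw_hom)
    show ?thesis unfolding char_poly_hom[OF D0_carrier[OF A]] by (simp add: coeff_map_poly)
  qed
  show ?thesis
    using D0_similar[OF A l, THEN char_poly_similar] c[of "2 * l + 1" "\<zeta> l"] c[of "2 * l" "\<zeta> l"] by simp
qed

lemma D0_det_invariant:
  assumes A: "A \<in> D0" and l: "l < s"
  shows "tw (2 * l) (\<zeta> l) (det A) = det A \<and> tw (2 * l + 1) (\<zeta> l) (det A) = det A"
proof -
  have d: "det A = (- 1) ^ n * poly.coeff (char_poly A) 0"
    unfolding coeff_char_poly_zero[OF D0_carrier[OF A]] by (simp add: mult.assoc[symmetric] power_mult_distrib[symmetric])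
  have "tw r \<omega> (det A) = (- 1) ^ n * tw r \<omega> (poly.coeff (char_poly A) 0)" for r \<omega>
  proof -
    interpret comm_ring_hom "tw r \<omega>" by (rule tw_hom)
    show ?thesis unfolding d by (simp add: hom_mult hom_power hom_uminus)
  qed
  then show ?thesis using D0_char_poly_invariant[OF A l, of 0] d by metis
qed

text \<open>Thanks to the extra factor \<open>det A\<close>, the relations for the adjugate follow
  by multiplying those for \<open>A\<close> on both sides, without any division. This provides
  inverses up to an invariant scalar.\<close>

lemma D0_det_adj:
  assumes A: "A \<in> D0"
  shows "det A \<cdot>\<^sub>m adj_mat A \<in> D0"
  unfolding D0_def
proof (intro CollectI conjI allI impI)
  have Ac: "A \<in> carrier_mat n n" by (rule D0_carrier[OF A])
  note B = adj_mat[OF Ac]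
  let ?B = "adj_mat A" and ?d = "det A"
  show "?d \<cdot>\<^sub>m ?B \<in> carrier_mat n n" using B by simp
  fix l assume l: "l < s"
  have inv: "tw (2 * l) (\<zeta> l) ?d = ?d" "tw (2 * l + 1) (\<zeta> l) ?d = ?d" using D0_det_invariant[OF A l] by auto
  have tB: "map_mat (tw r \<omega>) A * map_mat (tw r \<omega>) ?B = ?d \<cdot>\<^sub>m 1\<^sub>m n"
    "map_mat (tw r \<omega>) ?B * map_mat (tw r \<omega>) A = ?d \<cdot>\<^sub>m 1\<^sub>m n"
    "map_mat (tw r \<omega>) (?d \<cdot>\<^sub>m ?B) = ?d \<cdot>\<^sub>m map_mat (tw r \<omega>) ?B" if i: "tw r \<omega> ?d = ?d" for r \<omega>
  proof -
    interpret comm_ring_hom "tw r \<omega>" by (rule tw_hom)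
    have e: "map_mat (tw r \<omega>) (?d \<cdot>\<^sub>m 1\<^sub>m n) = ?d \<cdot>\<^sub>m 1\<^sub>m n" by (rule eq_matI) (use i in \<open>auto simp: hom_mult\<close>)
    show "map_mat (tw r \<omega>) A * map_mat (tw r \<omega>) ?B = ?d \<cdot>\<^sub>m 1\<^sub>m n"
      unfolding mat_hom_mult[OF Ac B(1), symmetric] B(2) by (rule e)
    show "map_mat (tw r \<omega>) ?B * map_mat (tw r \<omega>) A = ?d \<cdot>\<^sub>m 1\<^sub>m n"
      unfolding mat_hom_mult[OF B(1) Ac, symmetric] B(3) by (rule e)
    show "map_mat (tw r \<omega>) (?d \<cdot>\<^sub>m ?B) = ?d \<cdot>\<^sub>m map_mat (tw r \<omega>) ?B"
      by (rule eq_matI) (use i in \<open>auto simp: hom_mult\<close>)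
  qed
  let ?f = "map_mat (tw (2 * l + 1) (\<zeta> l))" and ?g = "map_mat (tw (2 * l) (\<zeta> l))"
  have X: "A * Xm l = Xm l * ?f A" "Ym l * A = ?g A * Ym l" using A l by (auto simp: D0_def)
  have c: "?f A \<in> carrier_mat n n" "?g A \<in> carrier_mat n n" "?f ?B \<in> carrier_mat n n" "?g ?B \<in> carrier_mat n n"
    using Ac B(1) by auto
  have "?d \<cdot>\<^sub>m (?B * Xm l) = ?B * (Xm l * (?d \<cdot>\<^sub>m 1\<^sub>m n))"
    unfolding smult_one_mult_mat(2)[OF XY_carrier(1)] mult_smult_distrib[OF B(1) XY_carrier(1)] ..
  also have "\<dots> = ?B * (Xm l * ?f A * ?f ?B)"
    unfolding tB(1)[OF inv(2), symmetric] assoc_mult_mat[OF XY_carrier(1) c(1,3)] ..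
  also have "\<dots> = ?B * A * (Xm l * ?f ?B)"
    unfolding X(1)[symmetric] assoc_mult_mat[OF Ac XY_carrier(1) c(3)]
    by (rule assoc_mult_mat[symmetric, OF B(1) Ac mult_carrier_mat[OF XY_carrier(1) c(3)]])
  also have "\<dots> = Xm l * (?d \<cdot>\<^sub>m ?f ?B)"
    unfolding B(3) smult_one_mult_mat(1)[OF mult_carrier_mat[OF XY_carrier(1) c(3)]]
      mult_smult_distrib[OF XY_carrier(1) c(3)] ..
  finally show "?d \<cdot>\<^sub>m ?B * Xm l = Xm l * ?f (?d \<cdot>\<^sub>m ?B)"
    unfolding tB(3)[OF inv(2)] mult_smult_assoc_mat[OF B(1) XY_carrier(1)] .
  have "Ym l * (?d \<cdot>\<^sub>m ?B) = (?d \<cdot>\<^sub>m 1\<^sub>m n) * Ym l * ?B"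
    unfolding smult_one_mult_mat(1)[OF XY_carrier(2)] mult_smult_distrib[OF XY_carrier(2) B(1)]
      mult_smult_assoc_mat[OF XY_carrier(2) B(1)] ..
  also have "\<dots> = ?g ?B * (?g A * Ym l) * ?B"
    unfolding tB(2)[OF inv(1), symmetric] assoc_mult_mat[OF c(4,2) XY_carrier(2)] ..
  also have "\<dots> = ?g ?B * Ym l * (A * ?B)"
    unfolding X(2)[symmetric] assoc_mult_mat[OF c(4) XY_carrier(2) Ac, symmetric]
    by (rule assoc_mult_mat[OF mult_carrier_mat[OF c(4) XY_carrier(2)] Ac B(1)])
  also have "\<dots> = ?d \<cdot>\<^sub>m ?g ?B * Ym l"
    unfolding B(2) smult_one_mult_mat(2)[OF mult_carrier_mat[OF c(4) XY_carrier(2)]]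
      mult_smult_assoc_mat[OF c(4) XY_carrier(2)] ..
  finally show "Ym l * (?d \<cdot>\<^sub>m ?B) = ?g (?d \<cdot>\<^sub>m ?B) * Ym l"
    unfolding tB(3)[OF inv(1)] .
qed

text \<open>With \<open>c \<noteq> 0\<close> the exponent is attained, and the leading matrix is
  invertible because \<open>Nm \<alpha>\<close> is.\<close>

definition top_at :: "(nat \<Rightarrow>\<^sub>0 nat) \<Rightarrow> 'c \<Rightarrow> ((nat \<Rightarrow>\<^sub>0 nat) \<Rightarrow>\<^sub>0 'c) mat \<Rightarrow> bool" where
  "top_at \<alpha> c A \<longleftrightarrow> A \<in> carrier_mat n n \<and> c \<noteq> 0 \<and> (\<forall>i<n. \<forall>j<n. bounded_by \<alpha> (A $$ (i, j))) \<and>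
    map_mat (\<lambda>f. lookup f \<alpha>) A = c \<cdot>\<^sub>m Nm \<alpha>"

text \<open>Take the largest exponent over all entries; by \<open>D0_coeff\<close> its coefficient
  matrix is a multiple of \<open>Nm \<alpha>\<close>, necessarily a nonzero one.\<close>

lemma top_exists:
  assumes A: "A \<in> D0" "A \<noteq> 0\<^sub>m n n"
  shows "\<exists>\<alpha> c. top_at \<alpha> c A"
proof -
  have Ac: "A \<in> carrier_mat n n" using A D0_carrier by blast
  define S where "S = (\<Union>i<n. \<Union>j<n. keys (A $$ (i, j)))"
  have fin: "finite S" by (auto simp: S_def)
  have "S \<noteq> {}"
  proof
    assume e: "S = {}"
    have "A = 0\<^sub>m n n"
    proof (rule eq_matI)
      fix i j assume ij: "i < dim_row (0\<^sub>m n n :: ((nat \<Rightarrow>\<^sub>0 nat) \<Rightarrow>\<^sub>0 'c) mat)" "j < dim_col (0\<^sub>m n n :: ((nat \<Rightarrow>\<^sub>0 nat) \<Rightarrow>\<^sub>0 'c) mat)"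
      then have "keys (A $$ (i, j)) = {}" using e by (auto simp: S_def)
      then show "A $$ (i, j) = 0\<^sub>m n n $$ (i, j)" using ij by simp
    qed (use Ac in auto)
    then show False using A(2) by simp
  qed
  define \<alpha> where "\<alpha> = Max S"
  have \<alpha>: "\<alpha> \<in> S" "\<And>\<beta>. \<beta> \<in> S \<Longrightarrow> \<beta> \<le> \<alpha>" using fin \<open>S \<noteq> {}\<close> by (auto simp: \<alpha>_def)
  obtain g where g: "map_mat (\<lambda>f. lookup f \<alpha>) A = g \<cdot>\<^sub>m Nm \<alpha>" using D0_coeff[OF A(1)] by blast
  obtain i j where ij: "i < n" "j < n" "\<alpha> \<in> keys (A $$ (i, j))" using \<alpha>(1) by (auto simp: S_def)
  have "(g \<cdot>\<^sub>m Nm \<alpha>) $$ (i, j) \<noteq> 0" unfolding g[symmetric] using ij Ac by (simp add: in_keys_iff)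
  then have "g \<noteq> 0" using ij by (auto simp: Nm_def)
  moreover have "bounded_by \<alpha> (A $$ (i, j))" if "i < n" "j < n" for i j
    unfolding bounded_by_def using \<alpha>(2) that by (auto simp: S_def)
  ultimately show ?thesis using g Ac unfolding top_at_def by blast
qed

lemma bounded_by_sum: "(\<And>x. x \<in> I \<Longrightarrow> bounded_by \<alpha> (f x)) \<Longrightarrow> bounded_by \<alpha> (sum f I)"
proof (induction I rule: infinite_finite_induct)
  case (insert x I)
  then show ?case using Poly_Mapping.keys_add[of "f x" "sum f I"] by (auto simp: bounded_by_def)
qed (auto simp: bounded_by_def)

text \<open>Leading matrices cannot cancel: \<open>Nm \<alpha> * Nm \<beta>\<close> is a nonzero
  multiple of \<open>Nm (\<alpha> + \<beta>)\<close>.\<close>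

lemma top_mult:
  assumes "top_at \<alpha> c A" "top_at \<beta> d B"
  shows "\<exists>e. top_at (\<alpha> + \<beta>) e (A * B)"
proof -
  have A: "A \<in> carrier_mat n n" "c \<noteq> 0" "\<And>i j. i < n \<Longrightarrow> j < n \<Longrightarrow> bounded_by \<alpha> (A $$ (i, j))"
    "map_mat (\<lambda>f. lookup f \<alpha>) A = c \<cdot>\<^sub>m Nm \<alpha>" using assms(1) by (auto simp: top_at_def)
  have B: "B \<in> carrier_mat n n" "d \<noteq> 0" "\<And>i j. i < n \<Longrightarrow> j < n \<Longrightarrow> bounded_by \<beta> (B $$ (i, j))"
    "map_mat (\<lambda>f. lookup f \<beta>) B = d \<cdot>\<^sub>m Nm \<beta>" using assms(2) by (auto simp: top_at_def)
  have bd: "bounded_by (\<alpha> + \<beta>) ((A * B) $$ (i, j))" if "i < n" "j < n" for i j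
    unfolding index_mult_sum[OF A(1) B(1) that] using A(3) B(3) that
    by (intro bounded_by_sum lookup_mult_top) auto
  have "map_mat (\<lambda>f. lookup f (\<alpha> + \<beta>)) (A * B) = map_mat (\<lambda>f. lookup f \<alpha>) A * map_mat (\<lambda>f. lookup f \<beta>) B"
  proof (rule eq_matI)
    fix i j assume "i < dim_row (map_mat (\<lambda>f. lookup f \<alpha>) A * map_mat (\<lambda>f. lookup f \<beta>) B)"
      "j < dim_col (map_mat (\<lambda>f. lookup f \<alpha>) A * map_mat (\<lambda>f. lookup f \<beta>) B)"
    then have ij: "i < n" "j < n" using A(1) B(1) by auto
    have c: "map_mat (\<lambda>f. lookup f \<alpha>) A \<in> carrier_mat n n" "map_mat (\<lambda>f. lookup f \<beta>) B \<in> carrier_mat n n"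
      using A(1) B(1) by auto
    have "map_mat (\<lambda>f. lookup f (\<alpha> + \<beta>)) (A * B) $$ (i, j) = lookup ((A * B) $$ (i, j)) (\<alpha> + \<beta>)"
      using A(1) B(1) ij by simp
    also have "\<dots> = (\<Sum>k<n. lookup (A $$ (i, k)) \<alpha> * lookup (B $$ (k, j)) \<beta>)"
      unfolding index_mult_sum[OF A(1) B(1) ij] lookup_sum
      using A(3) B(3) ij by (intro sum.cong refl lookup_mult_top) auto
    also have "\<dots> = (map_mat (\<lambda>f. lookup f \<alpha>) A * map_mat (\<lambda>f. lookup f \<beta>) B) $$ (i, j)"
      unfolding index_mult_sum[OF c ij] using A(1) B(1) ij by (intro sum.cong refl) auto
    finally show "map_mat (\<lambda>f. lookup f (\<alpha> + \<beta>)) (A * B) $$ (i, j) =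
      (map_mat (\<lambda>f. lookup f \<alpha>) A * map_mat (\<lambda>f. lookup f \<beta>) B) $$ (i, j)" .
  qed (use A(1) B(1) in auto)
  also have "\<dots> = (c * d) \<cdot>\<^sub>m (Nm \<alpha> * Nm \<beta>)"
    unfolding A(4) B(4) Nm_def
    by (simp add: mult_smult_distrib[of _ n n _ n] mult_smult_assoc_mat[of _ n n _ n] smult_smult mult.commute)
  also have "\<dots> = (c * d * (\<Prod>l<s. \<zeta> l ^ (lookup \<beta> (2 * l) * lookup \<alpha> (2 * l + 1)))) \<cdot>\<^sub>m Nm (\<alpha> + \<beta>)"
    unfolding Nm_def N_mult smult_smult lookup_add ..
  finally show ?thesis
    using A(1,2) B(1,2) twist_nz bd unfolding top_at_def by (intro exI conjI) auto
qed

text \<open>The \<open>i\<close>-th characteristic coefficient has degree \<open>i\<close> in the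
  entries, so its bound lies at \<open>i\<close> times the leading exponent. Its coefficient there
  may vanish; whether it does is a question about \<open>Nm \<alpha>\<close> alone.\<close>

lemma top_sigma:
  assumes "top_at \<alpha> c A" "i \<le> n"
  shows "lookup (poly.coeff (char_poly A) (n - i)) (mscale i \<alpha>) = c ^ i * poly.coeff (char_poly (Nm \<alpha>)) (n - i)"
    and "bounded_by (mscale i \<alpha>) (poly.coeff (char_poly A) (n - i))"
proof -
  interpret G: graded_map "\<lambda>e. bounded_by (mscale e \<alpha>)" "\<lambda>e f. lookup f (mscale e \<alpha>) :: 'c"
    by (rule leading_graded)
  have A: "A \<in> carrier_mat n n" "\<And>i j. i < n \<Longrightarrow> j < n \<Longrightarrow> bounded_by (mscale 1 \<alpha>) (A $$ (i, j))"
    "map_mat (\<lambda>f. lookup f (mscale 1 \<alpha>)) A = c \<cdot>\<^sub>m Nm \<alpha>" using assms(1) by (auto simp: top_at_def)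
  have i: "n - (n - i) = i" using assms(2) by simp
  show "bounded_by (mscale i \<alpha>) (poly.coeff (char_poly A) (n - i))"
    using G.char_poly_graded(1)[OF A(1,2), of "n - i"] i by simp
  show "lookup (poly.coeff (char_poly A) (n - i)) (mscale i \<alpha>) = c ^ i * poly.coeff (char_poly (Nm \<alpha>)) (n - i)"
    using G.char_poly_graded(2)[OF A(1,2), of "n - i"] i coeff_char_poly_smult[of "Nm \<alpha>" n "n - i" c]
    unfolding A(3) by (simp add: Nm_def)
qed

lemma D0_sigma_nonzero:
  assumes "A \<in> D0" "A \<noteq> 0\<^sub>m n n" "i \<le> n" "sqf n dvd i"
  shows "poly.coeff (char_poly A) (n - i) \<noteq> 0"
proof -
  obtain \<alpha> c where t: "top_at \<alpha> c A" using top_exists assms by blast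
  have "poly.coeff (char_poly (Nm \<alpha>)) (n - i) \<noteq> 0"
    unfolding Nm_def by (rule char_poly_N_nonzero[OF assms(3)]) (use p_dvd_sqf assms(4) dvd_trans in blast)
  then show ?thesis using top_sigma(1)[OF t assms(3)] t by (auto simp: top_at_def)
qed

text \<open>The case \<open>i = n\<close>, where the coefficient is the determinant up to sign. It
  makes nonzero elements invertible once fractions are allowed.\<close>

lemma D0_det_nonzero:
  assumes "A \<in> D0" "A \<noteq> 0\<^sub>m n n"
  shows "det A \<noteq> 0"
proof -
  have "sqf n dvd n"
    unfolding sqf_def by (rule prime_prod_dvd) auto
  then have "poly.coeff (char_poly A) (n - n) \<noteq> 0" by (intro D0_sigma_nonzero[OF assms]) auto
  then show ?thesis by (auto simp: coeff_char_poly_zero[OF D0_carrier[OF assms(1)]])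
qed

text \<open>The core of the theorem: comparing leading monomials, \<open>\<sigma>\<^sup>(\<^sup>i\<^sup>)(x)\<close> determines the leading
  exponent of \<open>x\<close>, and the product of \<open>m\<close> elements with the same leading exponent \<open>\<alpha>\<close> has a scalar
  leading coefficient matrix, because \<open>m \<alpha>\<close> is a multiple of every \<open>p\<^sub>l\<close>.\<close>

theorem D0_system:
  assumes As: "set As \<subseteq> D0" "length As = m" and m: "sqf n dvd m"
    and i: "1 \<le> i" "i \<le> n" "sqf n dvd i" and j: "j \<le> n"
    and eq: "\<And>A B. A \<in> set As \<Longrightarrow> B \<in> set As \<Longrightarrow>
      poly.coeff (char_poly A) (n - i) = poly.coeff (char_poly B) (n - i)"
    and zero: "poly.coeff (char_poly (foldr (*) As (1\<^sub>m n))) (n - j) = 0"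
  shows "\<forall>A\<in>set As. A = 0\<^sub>m n n"
proof (rule ccontr)
  assume "\<not> (\<forall>A\<in>set As. A = 0\<^sub>m n n)"
  then obtain A where A: "A \<in> set As" "A \<noteq> 0\<^sub>m n n" by blast
  then have AD: "A \<in> D0" using As by blast
  obtain \<alpha> c where t: "top_at \<alpha> c A" using top_exists[OF AD A(2)] by blast
  let ?\<sigma> = "\<lambda>A. poly.coeff (char_poly A) (n - i)"
  have key: "mscale i \<beta> \<in> keys (?\<sigma> B)" if B: "B \<in> D0" and tB: "top_at \<beta> d B" for B \<beta> d
  proof -
    have "poly.coeff (char_poly (Nm \<beta>)) (n - i) \<noteq> 0"
      unfolding Nm_def by (rule char_poly_N_nonzero[OF i(2)]) (use p_dvd_sqf i(3) dvd_trans in blast)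
    then show ?thesis using top_sigma(1)[OF tB i(2)] tB by (auto simp: top_at_def in_keys_iff)
  qed
  have tops: "\<exists>d. top_at \<alpha> d B" if B: "B \<in> set As" for B
  proof -
    have BD: "B \<in> D0" using As B by blast
    have s: "?\<sigma> A = ?\<sigma> B" by (rule eq[OF A(1) B])
    have "B \<noteq> 0\<^sub>m n n"
    proof
      assume "B = 0\<^sub>m n n"
      \<comment> \<open>The zero matrix as a multiple by \<open>0\<close>, so that homogeneity
        produces the factor \<open>0 ^ i\<close>; here \<open>1 \<le> i\<close> matters.\<close>
      then have "B = 0 \<cdot>\<^sub>m 0\<^sub>m n n" by auto
      then have "?\<sigma> B = 0" using coeff_char_poly_smult[of "0\<^sub>m n n" n "n - i" 0] i by (simp add: zero_power)
      then show False using key[OF AD t] s by simp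
    qed
    then obtain \<beta> d where tB: "top_at \<beta> d B" using top_exists[OF BD] by blast
    \<comment> \<open>The two coefficients agree, and each contains the \<open>i\<close>-fold
      leading exponent of its own matrix, so each of these exponents is bounded by the
      other.\<close>
    have "mscale i \<alpha> \<le> mscale i \<beta>" using key[OF AD t] top_sigma(2)[OF tB i(2)] s by (simp add: bounded_by_def)
    moreover have "mscale i \<beta> \<le> mscale i \<alpha>" using key[OF BD tB] top_sigma(2)[OF t i(2)] s by (simp add: bounded_by_def)
    ultimately have "mscale i \<alpha> = mscale i \<beta>" by (rule antisym)
    then have "\<alpha> = \<beta>" using i(1) by (intro mscale_inj[of i \<alpha> \<beta>]) simp_all
    then show ?thesis using tB by blast
  qed
  have "\<exists>d. top_at (mscale (length Bs) \<alpha>) d (foldr (*) Bs (1\<^sub>m n))" if "set Bs \<subseteq> set As" for Bs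
    using that
  proof (induction Bs)
    case Nil
    have "Nm 0 = 1\<^sub>m n" unfolding Nm_def by (rule N_trivial) auto
    then have "top_at 0 1 (1\<^sub>m n)"
      unfolding top_at_def by (auto simp: bounded_by_def lookup_one one_smult intro!: eq_matI)
    then show ?case by auto
  next
    case (Cons B Bs)
    then obtain d where d: "top_at (mscale (length Bs) \<alpha>) d (foldr (*) Bs (1\<^sub>m n))" by auto
    obtain c where c: "top_at \<alpha> c B" using tops Cons.prems by auto
    have "mscale (length (B # Bs)) \<alpha> = \<alpha> + mscale (length Bs) \<alpha>"
      by (rule poly_mapping_eqI) (simp add: lookup_add)
    then show ?case using top_mult[OF c d] by simp
  qed
  then obtain d where d: "top_at (mscale m \<alpha>) d (foldr (*) As (1\<^sub>m n))" using As(2) by blast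
  have "poly.coeff (char_poly (Nm (mscale m \<alpha>))) (n - j) \<noteq> 0"
    unfolding Nm_def
  proof (rule char_poly_N_nonzero[OF j])
    \<comment> \<open>Every exponent of \<open>mscale m \<alpha>\<close> is a multiple of
      \<open>p l\<close>, so there is no nontrivial index at all.\<close>
    fix l assume "l < s" "\<not> (p l dvd lookup (mscale m \<alpha>) (2 * l) \<and> p l dvd lookup (mscale m \<alpha>) (2 * l + 1))"
    moreover have "p l dvd m" using p_dvd_sqf[OF \<open>l < s\<close>] m dvd_trans by blast
    ultimately show "p l dvd j" by simp
  qed
  then show False using top_sigma(1)[OF d j] zero d by (auto simp: top_at_def)
qed

end

section \<open>Algebraically independent elements\<close>

lemma field_hom_comm_ring_hom:
  assumes "field_hom h"
  shows "comm_ring_hom h"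
proof -
  interpret field_hom h by fact
  show ?thesis by unfold_locales
qed

text \<open>Elements outside \<open>V\<close> are set to zero, so that polynomials need not be restricted to the
  variables in \<open>V\<close>.\<close>

lemma ev_zero_outside:
  fixes q :: "'a::comm_ring_1 \<Rightarrow> 'e::comm_ring_1"
  assumes V: "finite V"
  shows "ev q (\<lambda>v. if v \<in> V then z v else 0) f =
    (\<Sum>\<alpha>\<in>{\<alpha> \<in> keys f. keys \<alpha> \<subseteq> V}. q (lookup f \<alpha>) * (\<Prod>v\<in>V. z v ^ lookup \<alpha> v))"
proof -
  have mv: "mval (\<lambda>v. if v \<in> V then z v else 0) \<alpha> = (if keys \<alpha> \<subseteq> V then \<Prod>v\<in>V. z v ^ lookup \<alpha> v else 0)" for \<alpha>
  proof (cases "keys \<alpha> \<subseteq> V")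
    case True
    then have "mval (\<lambda>v. if v \<in> V then z v else 0) \<alpha> = (\<Prod>v\<in>V. (if v \<in> V then z v else 0) ^ lookup \<alpha> v)"
      by (intro mval_superset V)
    then show ?thesis using True by simp
  next
    case False
    then obtain v where "v \<in> keys \<alpha>" "v \<notin> V" by blast
    then show ?thesis unfolding mval_def using False
      by (auto simp: in_keys_iff zero_power intro!: prod_zero bexI[of _ v])
  qed
  have "ev q (\<lambda>v. if v \<in> V then z v else 0) f =
      (\<Sum>\<alpha>\<in>keys f. if keys \<alpha> \<subseteq> V then q (lookup f \<alpha>) * (\<Prod>v\<in>V. z v ^ lookup \<alpha> v) else 0)"
    unfolding ev_def by (intro sum.cong refl) (simp add: mv)
  also have "\<dots> = (\<Sum>\<alpha>\<in>{\<alpha> \<in> keys f. keys \<alpha> \<subseteq> V}. q (lookup f \<alpha>) * (\<Prod>v\<in>V. z v ^ lookup \<alpha> v))"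
    by (rule sum.inter_filter[symmetric]) simp
  finally show ?thesis .
qed

text \<open>Independence is stated for exponent functions on \<open>V\<close>. On exponents
  supported in \<open>V\<close> the restriction \<open>r\<close> is injective, so polynomial
  relations translate faithfully.\<close>

lemma algebraically_independent_keys:
  fixes h :: "'a::field \<Rightarrow> 'b::field"
  assumes ind: "algebraically_independent h V x" and V: "finite V"
    and zero: "ev h (\<lambda>v. if v \<in> V then x v else 0) f = 0"
  shows "{\<alpha> \<in> keys f. keys \<alpha> \<subseteq> V} = {}"
proof -
  define K where "K = {\<alpha> \<in> keys f. keys \<alpha> \<subseteq> V}"
  define r where "r \<alpha> = restrict (lookup \<alpha>) V" for \<alpha> :: "'c \<Rightarrow>\<^sub>0 nat"
  have finK: "finite K" by (simp add: K_def)
  have inj: "inj_on r K"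
  proof (rule inj_onI)
    fix \<alpha> \<beta> assume a: "\<alpha> \<in> K" "\<beta> \<in> K" and e: "r \<alpha> = r \<beta>"
    show "\<alpha> = \<beta>"
    proof (rule poly_mapping_eqI)
      fix v show "lookup \<alpha> v = lookup \<beta> v"
      proof (cases "v \<in> V")
        case True
        then show ?thesis using fun_cong[OF e, of v] by (simp add: r_def)
      next
        case False
        then have "v \<notin> keys \<alpha>" "v \<notin> keys \<beta>" using a by (auto simp: K_def)
        then show ?thesis by (simp add: in_keys_iff)
      qed
    qed
  qed
  define c where "c e = lookup f (inv_into K r e)" for e
  have "(\<Sum>e\<in>r ` K. h (c e) * (\<Prod>v\<in>V. x v ^ e v)) = (\<Sum>\<alpha>\<in>K. h (lookup f \<alpha>) * (\<Prod>v\<in>V. x v ^ lookup \<alpha> v))"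
    unfolding sum.reindex[OF inj] o_def
  proof (rule sum.cong[OF refl])
    fix \<alpha> assume "\<alpha> \<in> K"
    then have "c (r \<alpha>) = lookup f \<alpha>" using inj by (simp add: c_def)
    moreover have "(\<Prod>v\<in>V. x v ^ r \<alpha> v) = (\<Prod>v\<in>V. x v ^ lookup \<alpha> v)"
      by (rule prod.cong) (simp_all add: r_def)
    ultimately show "h (c (r \<alpha>)) * (\<Prod>v\<in>V. x v ^ r \<alpha> v) = h (lookup f \<alpha>) * (\<Prod>v\<in>V. x v ^ lookup \<alpha> v)"
      by simp
  qed
  also have "\<dots> = 0" using zero ev_zero_outside[OF V, of h x f] by (simp add: K_def)
  finally have "(\<Sum>e\<in>r ` K. h (c e) * (\<Prod>v\<in>V. x v ^ e v)) = 0" .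
  moreover have "finite (r ` K)" "r ` K \<subseteq> (V \<rightarrow>\<^sub>E UNIV)" using finK by (auto simp: r_def)
  ultimately have c0: "\<forall>e\<in>r ` K. c e = 0" using ind unfolding algebraically_independent_def by blast
  have "K = {}"
  proof (rule equals0I)
    fix \<alpha> assume a: "\<alpha> \<in> K"
    then have "c (r \<alpha>) = lookup f \<alpha>" using inj by (simp add: c_def)
    then show False using a c0 by (auto simp: K_def in_keys_iff)
  qed
  then show ?thesis by (simp add: K_def)
qed

text \<open>A relation between independent elements has no term supported in \<open>V\<close>, and
  therefore holds under every coefficient map and for all values. This is the principle behind all
  specializations.\<close>

lemma algebraically_independent_ev:
  fixes h :: "'a::field \<Rightarrow> 'b::field" and g :: "'a \<Rightarrow> 'c::comm_ring_1"
  assumes "algebraically_independent h V x" "finite V"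
    and "ev h (\<lambda>v. if v \<in> V then x v else 0) f = 0"
  shows "ev g (\<lambda>v. if v \<in> V then y v else 0) f = 0"
  unfolding ev_zero_outside[OF assms(2)] algebraically_independent_keys[OF assms] by simp

text \<open>A root of \<open>1 + x + ... + x ^ (p - 1)\<close> works: it is a \<open>p\<close>-th
  root of unity, and it differs from \<open>1\<close> because \<open>p\<close> does not vanish in
  the field.\<close>

lemma primitive_root_exists:
  assumes p: "prime p" and nz: "(of_nat p :: 'a::alg_closed_field) \<noteq> 0"
  shows "\<exists>\<zeta>::'a. primitive_root_of_unity p \<zeta>"
proof -
  have p2: "p \<ge> 2" using p prime_ge_2_nat by blast
  obtain \<zeta> :: 'a where z: "(\<Sum>k\<le>p - 1. 1 * \<zeta> ^ k) = 0"
    using alg_closed[of "p - 1" "\<lambda>_. 1 :: 'a"] p2 by auto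
  have s: "(\<Sum>k<p. \<zeta> ^ k) = 0" using z p2 by (simp add: lessThan_Suc_atMost[symmetric])
  have "\<zeta> \<noteq> 1" using s nz by auto
  have "\<zeta> ^ p - 1 = (\<zeta> - 1) * (\<Sum>k<p. \<zeta> ^ k)" by (rule power_diff_1_eq)
  then have zp: "\<zeta> ^ p = 1" using s by simp
  have "\<zeta> ^ d \<noteq> 1" if d: "0 < d" "d < p" for d
  proof
    assume zd: "\<zeta> ^ d = 1"
    have "\<not> p dvd d" using d by (auto dest: dvd_imp_le)
    then have "gcd d p = 1" using p by (metis coprime_iff_gcd_eq_1 prime_imp_coprime coprime_commute)
    \<comment> \<open>By Bezout, the relations with exponents \<open>d\<close> and \<open>p\<close>
      together would give \<open>\<zeta> = 1\<close>.\<close>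
    then obtain a b where "d * a = p * b + 1" using bezout_nat[of d p] d by auto
    then have "\<zeta> ^ (d * a) = \<zeta> ^ (p * b + 1)" by simp
    then show False using \<open>\<zeta> \<noteq> 1\<close> by (simp add: power_mult power_add zd zp)
  qed
  then show ?thesis using zp unfolding primitive_root_of_unity_def by blast
qed

section \<open>Division algebras of matrices\<close>

definition mlin :: "nat \<Rightarrow> 'i set \<Rightarrow> ('i \<Rightarrow> 'l::comm_ring_1) \<Rightarrow> ('i \<Rightarrow> 'l mat) \<Rightarrow> 'l mat" where
  "mlin n I f b = mat n n (\<lambda>(i, j). \<Sum>r\<in>I. f r * b r $$ (i, j))"

lemma mlin_carrier [simp]: "mlin n I f b \<in> carrier_mat n n"
  by (simp add: mlin_def)

lemma mlin_index [simp]: "i < n \<Longrightarrow> j < n \<Longrightarrow> mlin n I f b $$ (i, j) = (\<Sum>r\<in>I. f r * b r $$ (i, j))"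
  by (simp add: mlin_def)

lemma mlin_mult_right:
  assumes b: "\<And>r. r \<in> I \<Longrightarrow> b r \<in> carrier_mat n n" and M: "M \<in> carrier_mat n n"
  shows "mlin n I f b * M = mlin n I f (\<lambda>r. b r * M)"
proof (rule eq_matI)
  fix i j assume "i < dim_row (mlin n I f (\<lambda>r. b r * M))" "j < dim_col (mlin n I f (\<lambda>r. b r * M))"
  then have ij: "i < n" "j < n" by (auto simp: mlin_def)
  have "(mlin n I f b * M) $$ (i, j) = (\<Sum>l<n. \<Sum>r\<in>I. f r * (b r $$ (i, l) * M $$ (l, j)))"
    unfolding index_mult_sum[OF mlin_carrier M ij] using ij
    by (intro sum.cong refl) (simp add: sum_distrib_right mult.assoc)
  also have "\<dots> = (\<Sum>r\<in>I. f r * (b r * M) $$ (i, j))"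
    by (subst sum.swap) (intro sum.cong refl, simp add: index_mult_sum[OF b M ij] sum_distrib_left)
  finally show "(mlin n I f b * M) $$ (i, j) = mlin n I f (\<lambda>r. b r * M) $$ (i, j)" using ij by simp
qed (use M in \<open>auto simp: mlin_def\<close>)

lemma mlin_mult_left:
  assumes b: "\<And>r. r \<in> I \<Longrightarrow> b r \<in> carrier_mat n n" and M: "M \<in> carrier_mat n n"
  shows "M * mlin n I f b = mlin n I f (\<lambda>r. M * b r)"
proof (rule eq_matI)
  fix i j assume "i < dim_row (mlin n I f (\<lambda>r. M * b r))" "j < dim_col (mlin n I f (\<lambda>r. M * b r))"
  then have ij: "i < n" "j < n" by (auto simp: mlin_def)
  have "(M * mlin n I f b) $$ (i, j) = (\<Sum>l<n. \<Sum>r\<in>I. f r * (M $$ (i, l) * b r $$ (l, j)))"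
    unfolding index_mult_sum[OF M mlin_carrier ij] using ij
    by (intro sum.cong refl) (simp add: sum_distrib_left mult.left_commute)
  also have "\<dots> = (\<Sum>r\<in>I. f r * (M * b r) $$ (i, j))"
    by (subst sum.swap) (intro sum.cong refl, simp add: index_mult_sum[OF M b ij] sum_distrib_left)
  finally show "(M * mlin n I f b) $$ (i, j) = mlin n I f (\<lambda>r. M * b r) $$ (i, j)" using ij by simp
qed (use M in \<open>auto simp: mlin_def\<close>)

text \<open>Cramer's rule for the linear system whose columns are the stacked matrices
  \<open>b r\<close>.\<close>

lemma span_of_det:
  fixes b :: "nat \<Rightarrow> 'l::field mat"
  assumes n: "0 < n" and d: "det (mat (n * n) (n * n) (\<lambda>(y, r). b r $$ (y mod n, y div n))) \<noteq> 0"
    and M: "M \<in> carrier_mat n n"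
  shows "\<exists>g. M = mlin n {..<n * n} g b"
proof -
  let ?W = "mat (n * n) (n * n) (\<lambda>(y, r). b r $$ (y mod n, y div n))"
  define v where "v = mat (n * n) 1 (\<lambda>(y, _). M $$ (y mod n, y div n))"
  define g where "g = inverse (det ?W) \<cdot>\<^sub>m (adj_mat ?W * v)"
  have W: "?W \<in> carrier_mat (n * n) (n * n)" and v: "v \<in> carrier_mat (n * n) 1" by (auto simp: v_def)
  note a = adj_mat[OF W]
  have gc: "g \<in> carrier_mat (n * n) 1" using a v by (auto simp: g_def)
  have "?W * g = inverse (det ?W) \<cdot>\<^sub>m (?W * (adj_mat ?W * v))"
    unfolding g_def by (rule mult_smult_distrib[OF W mult_carrier_mat[OF a(1) v]])
  also have "?W * (adj_mat ?W * v) = det ?W \<cdot>\<^sub>m v"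
    unfolding assoc_mult_mat[OF W a(1) v, symmetric] a(2) by (rule smult_one_mult_mat(1)[OF v])
  finally have Wg: "?W * g = v" using d by (simp add: smult_smult one_smult)
  have "M = mlin n {..<n * n} (\<lambda>r. g $$ (r, 0)) b"
  proof (rule eq_matI)
    fix i j assume "i < dim_row (mlin n {..<n * n} (\<lambda>r. g $$ (r, 0)) b)"
      "j < dim_col (mlin n {..<n * n} (\<lambda>r. g $$ (r, 0)) b)"
    then have ij: "i < n" "j < n" by (auto simp: mlin_def)
    let ?y = "j * n + i"
    have "?y div n < n" using ij n by simp
    then have y: "?y < n * n" using n by (simp only: div_less_iff_less_mult)
    have "M $$ (i, j) = v $$ (?y, 0)" using y ij by (simp add: v_def)
    also have "\<dots> = (\<Sum>r<n * n. ?W $$ (?y, r) * g $$ (r, 0))"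
      unfolding Wg[symmetric] by (rule index_mult_sum[OF W gc y]) simp
    also have "\<dots> = (\<Sum>r<n * n. g $$ (r, 0) * b r $$ (i, j))"
      using y ij by (intro sum.cong refl) (simp add: mult.commute)
    finally show "M $$ (i, j) = mlin n {..<n * n} (\<lambda>r. g $$ (r, 0)) b $$ (i, j)" using ij by simp
  qed (use M in \<open>auto simp: mlin_def\<close>)
  then show ?thesis by blast
qed

text \<open>The situation of UD(n): a division algebra of matrices containing generators of the full
  matrix algebra over the field. The aim is to show that the elements of \<open>D\<close> have
  coordinates in the center of \<open>D\<close>.\<close>

locale division_span =
  fixes \<iota> :: "'k::field \<Rightarrow> 'l::field" and n :: nat and D :: "'l mat set" and b :: "nat \<Rightarrow> 'l mat"
  assumes n: "0 < n" and \<iota>: "comm_ring_hom \<iota>" and div: "division_subalgebra \<iota> n D"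
    and b: "\<And>r. r < n * n \<Longrightarrow> b r \<in> D"
    and span: "\<And>M. M \<in> carrier_mat n n \<Longrightarrow> \<exists>g. M = mlin n {..<n * n} g b"
begin

lemma D_carrier: "x \<in> D \<Longrightarrow> x \<in> carrier_mat n n"
  using div by (auto simp: division_subalgebra_def)

lemma D_add: "x \<in> D \<Longrightarrow> y \<in> D \<Longrightarrow> x + y \<in> D" and D_mult: "x \<in> D \<Longrightarrow> y \<in> D \<Longrightarrow> x * y \<in> D"
  and D_scalar: "\<iota> c \<cdot>\<^sub>m 1\<^sub>m n \<in> D"
  using div by (auto simp: division_subalgebra_def)

lemma D_inverse: "x \<in> D \<Longrightarrow> x \<noteq> 0\<^sub>m n n \<Longrightarrow> \<exists>y\<in>D. x * y = 1\<^sub>m n \<and> y * x = 1\<^sub>m n"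
  using div by (auto simp: division_subalgebra_def)

text \<open>By \<open>D_central\<close> this is the center of \<open>D\<close>, viewed inside the
  field.\<close>

definition F :: "'l set" where
  "F = {f. f \<cdot>\<^sub>m 1\<^sub>m n \<in> D}"

lemma F_smult: "f \<in> F \<Longrightarrow> x \<in> D \<Longrightarrow> f \<cdot>\<^sub>m x \<in> D"
  using D_mult[of "f \<cdot>\<^sub>m 1\<^sub>m n" x] smult_one_mult_mat(1)[OF D_carrier] by (simp add: F_def)

lemma F_closed:
  "0 \<in> F" "1 \<in> F" "f \<in> F \<Longrightarrow> g \<in> F \<Longrightarrow> f + g \<in> F" "f \<in> F \<Longrightarrow> g \<in> F \<Longrightarrow> f * g \<in> F"
  "f \<in> F \<Longrightarrow> - f \<in> F" "f \<in> F \<Longrightarrow> inverse f \<in> F"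
proof -
  interpret h: comm_ring_hom \<iota> by (rule \<iota>)
  show "0 \<in> F" "1 \<in> F" using D_scalar[of 0] D_scalar[of 1] by (auto simp: F_def)
  have ml: "f * g \<in> F" if "f \<in> F" "g \<in> F" for f g
    using F_smult[OF that(1), of "g \<cdot>\<^sub>m 1\<^sub>m n"] that(2) by (simp add: F_def smult_smult)
  then show "f \<in> F \<Longrightarrow> g \<in> F \<Longrightarrow> f * g \<in> F" by blast
  have "f \<cdot>\<^sub>m 1\<^sub>m n + g \<cdot>\<^sub>m 1\<^sub>m n = (f + g) \<cdot>\<^sub>m 1\<^sub>m n" by (rule eq_matI) (auto simp: algebra_simps)
  then show "f \<in> F \<Longrightarrow> g \<in> F \<Longrightarrow> f + g \<in> F" using D_add[of "f \<cdot>\<^sub>m 1\<^sub>m n" "g \<cdot>\<^sub>m 1\<^sub>m n"] by (simp add: F_def)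
  have "- 1 \<in> F" using D_scalar[of "- 1"] by (simp add: F_def h.hom_uminus)
  then show "f \<in> F \<Longrightarrow> - f \<in> F" using ml[of "- 1" f] by simp
  show "inverse f \<in> F" if f: "f \<in> F"
  proof (cases "f = 0")
    case True
    then show ?thesis using f by simp
  next
    case False
    have "f \<cdot>\<^sub>m 1\<^sub>m n \<noteq> 0\<^sub>m n n"
    proof
      assume "f \<cdot>\<^sub>m 1\<^sub>m n = 0\<^sub>m n n"
      then have "(f \<cdot>\<^sub>m 1\<^sub>m n) $$ (0, 0) = 0\<^sub>m n n $$ (0, 0)" by (rule arg_cong)
      then show False using n False by simp
    qed
    then obtain y where y: "y \<in> D" "(f \<cdot>\<^sub>m 1\<^sub>m n) * y = 1\<^sub>m n" using D_inverse f by (auto simp: F_def)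
    then have "inverse f \<cdot>\<^sub>m (f \<cdot>\<^sub>m y) = inverse f \<cdot>\<^sub>m 1\<^sub>m n"
      using smult_one_mult_mat(1)[OF D_carrier[OF y(1)]] by simp
    then show ?thesis using y(1) False by (simp add: F_def smult_smult one_smult)
  qed
qed

lemma F_sum: "(\<And>i. i \<in> I \<Longrightarrow> f i \<in> F) \<Longrightarrow> sum f I \<in> F"
  by (induction I rule: infinite_finite_induct) (auto intro: F_closed)

lemma D_minus: "x \<in> D \<Longrightarrow> y \<in> D \<Longrightarrow> x - y \<in> D"
proof -
  assume xy: "x \<in> D" "y \<in> D"
  then have "x - y = x + (- 1) \<cdot>\<^sub>m y" using D_carrier by (intro eq_matI) auto
  then show ?thesis using xy D_add F_smult F_closed by metis
qed

lemma D_central: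
  assumes x: "x \<in> carrier_mat n n" and c: "\<And>y. y \<in> D \<Longrightarrow> x * y = y * x"
  shows "\<exists>e. x = e \<cdot>\<^sub>m 1\<^sub>m n"
proof (rule commuting_imp_scalar[OF x n])
  fix M :: "'l mat" assume "M \<in> carrier_mat n n"
  then obtain g where g: "M = mlin n {..<n * n} g b" using span by blast
  have bc: "\<And>r. r \<in> {..<n * n} \<Longrightarrow> b r \<in> carrier_mat n n" using b D_carrier by blast
  have "mlin n {..<n * n} g (\<lambda>r. x * b r) = mlin n {..<n * n} g (\<lambda>r. b r * x)"
    unfolding mlin_def using c b by (intro arg_cong[where f = "mat n n"] ext) auto
  then show "x * M = M * x" by (simp only: g mlin_mult_left[OF bc x] mlin_mult_right[OF bc x])
qed

text \<open>Multiplying by an inverse makes one of the coefficients \<open>1\<close>; taking commutators with the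
  elements of \<open>D\<close> then produces shorter relations.\<close>

lemma F_independent_imp:
  assumes "finite I"
    and "\<And>c. (\<And>i. i \<in> I \<Longrightarrow> c i \<in> F) \<Longrightarrow> (\<Sum>i\<in>I. c i * e i) = 0 \<Longrightarrow> \<forall>i\<in>I. c i = 0"
    and "\<And>i. i \<in> I \<Longrightarrow> d i \<in> D" and "mlin n I e d = 0\<^sub>m n n"
  shows "\<forall>i\<in>I. d i = 0\<^sub>m n n"
  using assms
proof (induction "card I" arbitrary: I d rule: less_induct)
  case less
  show ?case
  proof (rule ccontr)
    assume "\<not> (\<forall>i\<in>I. d i = 0\<^sub>m n n)"
    then obtain k where k: "k \<in> I" "d k \<noteq> 0\<^sub>m n n" by blast
    obtain y where y: "y \<in> D" "d k * y = 1\<^sub>m n" using D_inverse[OF less.prems(3)[OF k(1)] k(2)] by blast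
    define d' where "d' i = d i * y" for i
    have dc: "\<And>i. i \<in> I \<Longrightarrow> d i \<in> carrier_mat n n" using less.prems(3) D_carrier by blast
    have d'D: "d' i \<in> D" if "i \<in> I" for i using less.prems(3)[OF that] y(1) D_mult by (simp add: d'_def)
    have d'c: "\<And>i. i \<in> I \<Longrightarrow> d' i \<in> carrier_mat n n" using d'D D_carrier by blast
    have d'_eq: "d' = (\<lambda>i. d i * y)" by (rule ext) (simp add: d'_def)
    have rel: "mlin n I e d' = 0\<^sub>m n n" unfolding d'_eq
      using mlin_mult_right[where I = I and b = d and f = e, OF dc D_carrier[OF y(1)]] less.prems(4) D_carrier[OF y(1)] by simp
    have "\<forall>i\<in>I. \<exists>c. c \<in> F \<and> d' i = c \<cdot>\<^sub>m 1\<^sub>m n"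
    proof
      fix i assume i: "i \<in> I"
      show "\<exists>c. c \<in> F \<and> d' i = c \<cdot>\<^sub>m 1\<^sub>m n"
      proof (cases "i = k")
        case True
        then have "d' i = 1 \<cdot>\<^sub>m 1\<^sub>m n" using y(2) by (simp add: d'_def one_smult)
        then show ?thesis using F_closed(2) by blast
      next
        case False
        have "d' i * x = x * d' i" if x: "x \<in> D" for x
        proof -
          have xc: "x \<in> carrier_mat n n" by (rule D_carrier[OF x])
          \<comment> \<open>Commutators with \<open>x\<close> satisfy the same relation, and the one
            at \<open>k\<close> vanishes because \<open>d' k\<close> is the identity; so the
            relation has become shorter.\<close>
          define d'' where "d'' j = d' j * x - x * d' j" for j
          have dk: "d'' k = 0\<^sub>m n n" using y(2) xc by (simp add: d''_def d'_def)

          have "mlin n (I - {k}) e d'' = 0\<^sub>m n n"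
          proof (rule eq_matI)
            fix a c assume "a < dim_row (0\<^sub>m n n :: 'l mat)" "c < dim_col (0\<^sub>m n n :: 'l mat)"
            then have ac: "a < n" "c < n" by auto
            have "(\<Sum>j\<in>I - {k}. e j * d'' j $$ (a, c)) = (\<Sum>j\<in>I. e j * d'' j $$ (a, c))"
              using less.prems(1) k(1) dk ac by (simp add: sum.remove[of I k])
            also have "\<dots> = (\<Sum>j\<in>I. e j * (d' j * x) $$ (a, c) - e j * (x * d' j) $$ (a, c))"
            proof (rule sum.cong[OF refl])
              fix j assume "j \<in> I"
              then show "e j * d'' j $$ (a, c) = e j * (d' j * x) $$ (a, c) - e j * (x * d' j) $$ (a, c)"
                unfolding d''_def using ac d'c[OF \<open>j \<in> I\<close>] xc by (simp add: right_diff_distrib)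
            qed
            also have "\<dots> = (mlin n I e d' * x) $$ (a, c) - (x * mlin n I e d') $$ (a, c)"
              using ac mlin_mult_right[where I = I and b = d' and f = e, OF d'c xc]
                mlin_mult_left[where I = I and b = d' and f = e, OF d'c xc]
              by (simp add: sum_subtractf del: index_mult_mat)
            also have "\<dots> = 0" unfolding rel using xc ac by simp
            finally show "mlin n (I - {k}) e d'' $$ (a, c) = 0\<^sub>m n n $$ (a, c)" using ac by simp
          qed (auto simp: mlin_def)
          moreover have "card (I - {k}) < card I" using less.prems(1) k(1) by (rule card_Diff1_less)
          moreover have "\<forall>i\<in>I - {k}. c i = 0"
            if c: "\<And>i. i \<in> I - {k} \<Longrightarrow> c i \<in> F" "(\<Sum>i\<in>I - {k}. c i * e i) = 0" for c
          proof -
            let ?c = "\<lambda>i. if i = k then 0 else c i"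
            have "(\<Sum>i\<in>I. ?c i * e i) = (\<Sum>i\<in>I - {k}. c i * e i)"
              using less.prems(1) k(1) by (simp add: sum.remove[of I k])
            then have z: "\<forall>i\<in>I. ?c i = 0" using c F_closed(1) by (intro less.prems(2)) auto
            show ?thesis
            proof
              fix i assume "i \<in> I - {k}"
              then show "c i = 0" using bspec[OF z, of i] by simp
            qed
          qed
          moreover have "d'' j \<in> D" if "j \<in> I - {k}" for j
            unfolding d''_def using d'D that x by (intro D_minus D_mult) auto
          ultimately have "\<forall>j\<in>I - {k}. d'' j = 0\<^sub>m n n"
            using less.prems(1) by (intro less.hyps) auto
          then have z: "d' i * x - x * d' i = 0\<^sub>m n n" using i False by (auto simp: d''_def)
          show ?thesis
          proof (rule eq_matI)
            have cc: "d' i * x \<in> carrier_mat n n" "x * d' i \<in> carrier_mat n n"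
              using mult_carrier_mat[OF d'c[OF i] xc] mult_carrier_mat[OF xc d'c[OF i]] by blast+
            fix a c assume "a < dim_row (x * d' i)" "c < dim_col (x * d' i)"
            then have ac: "a < n" "c < n" using cc by auto
            have "(d' i * x - x * d' i) $$ (a, c) = 0" unfolding z using ac by simp
            then show "(d' i * x) $$ (a, c) = (x * d' i) $$ (a, c)" using d'c[OF i] xc ac by simp
          qed (use d'c[OF i] xc in auto)
        qed
        then obtain c where "d' i = c \<cdot>\<^sub>m 1\<^sub>m n" using D_central[OF d'c[OF i]] by blast
        then show ?thesis using d'D[OF i] by (auto simp: F_def)
      qed
    qed
    from bchoice[OF this] obtain c where c: "\<forall>i\<in>I. c i \<in> F \<and> d' i = c i \<cdot>\<^sub>m 1\<^sub>m n" ..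
    \<comment> \<open>All \<open>d' i\<close> are now scalars from \<open>F\<close>, so one diagonal
      entry of the matrix relation is an \<open>F\<close>-relation between the
      \<open>e i\<close>.\<close>
    have "(\<Sum>i\<in>I. c i * e i) = (\<Sum>i\<in>I. e i * d' i $$ (0, 0))"
      using c n by (intro sum.cong refl) (auto simp: mult.commute)
    also have "\<dots> = mlin n I e d' $$ (0, 0)" using n by simp
    also have "\<dots> = 0" unfolding rel using n by simp
    finally have "\<forall>i\<in>I. c i = 0" using c by (intro less.prems(2)) auto
    then have "d' k = 0 \<cdot>\<^sub>m 1\<^sub>m n" using c k(1) by auto
    moreover have "d' k = 1\<^sub>m n" using y(2) by (simp add: d'_def)
    ultimately have "(1\<^sub>m n :: 'l mat) $$ (0, 0) = (0 \<cdot>\<^sub>m 1\<^sub>m n) $$ (0, 0)" by simp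
    then show False using n by simp
  qed
qed

text \<open>Descent on the number of coefficients. If \<open>1\<close> and the \<open>f r\<close>
  are independent over \<open>F\<close>, the relation between \<open>a\<close> and the
  \<open>x r\<close> forces \<open>a\<close> to be zero. Otherwise some \<open>f k\<close> is an
  \<open>F\<close>-combination of \<open>1\<close> and the others, and is eliminated by changing
  \<open>a\<close> and the remaining \<open>x r\<close>.\<close>

lemma coordinates:
  assumes "finite I" "a \<in> D" "\<And>r. r \<in> I \<Longrightarrow> x r \<in> D" "a = mlin n I f x"
  shows "\<exists>c. (\<forall>r\<in>I. c r \<in> F) \<and> a = mlin n I c x"
  using assms
proof (induction "card I" arbitrary: I a x rule: less_induct)
  case less
  \<comment> \<open>\<open>None\<close> stands for the element \<open>a\<close>, up to sign, whose
    coefficient in the relation is \<open>1\<close>.\<close>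
  let ?I = "insert None (Some ` I)" and ?e = "case_option 1 f"
  have sumI: "(\<Sum>i\<in>?I. G i) = G None + (\<Sum>r\<in>I. G (Some r))" for G :: "'a option \<Rightarrow> 'l"
    using less.prems(1) by (subst sum.insert) (auto simp: sum.reindex)
  show ?case
  proof (cases "\<forall>c. (\<forall>i\<in>?I. c i \<in> F) \<and> (\<Sum>i\<in>?I. c i * ?e i) = 0 \<longrightarrow> (\<forall>i\<in>?I. c i = 0)")
    case True
    let ?d = "case_option ((- 1) \<cdot>\<^sub>m a) x"
    have ac: "a \<in> carrier_mat n n" by (rule D_carrier[OF less.prems(2)])
    have "mlin n ?I ?e ?d = 0\<^sub>m n n"
    proof (rule eq_matI)
      fix i j assume "i < dim_row (0\<^sub>m n n :: 'l mat)" "j < dim_col (0\<^sub>m n n :: 'l mat)"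
      then have ij: "i < n" "j < n" by auto
      have "a $$ (i, j) = (\<Sum>r\<in>I. f r * x r $$ (i, j))" by (subst less.prems(4)) (use ij in simp)
      then have "(\<Sum>k\<in>?I. ?e k * ?d k $$ (i, j)) = 0" unfolding sumI using ij ac by simp
      then show "mlin n ?I ?e ?d $$ (i, j) = 0\<^sub>m n n $$ (i, j)" using ij by simp
    qed (auto simp: mlin_def)
    moreover have "?d i \<in> D" if "i \<in> ?I" for i
      using that less.prems(2,3) F_smult F_closed by auto
    ultimately have "\<forall>i\<in>?I. ?d i = 0\<^sub>m n n"
      using less.prems(1) True by (intro F_independent_imp[of ?I ?e ?d]) auto
    then have "(- 1) \<cdot>\<^sub>m a = 0\<^sub>m n n" by auto
    then have "(- 1) \<cdot>\<^sub>m ((- 1) \<cdot>\<^sub>m a) = (- 1) \<cdot>\<^sub>m 0\<^sub>m n n" by simp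
    then have "a = (- 1) \<cdot>\<^sub>m 0\<^sub>m n n" by (simp add: smult_smult one_smult)
    then have "a = mlin n I (\<lambda>_. 0) x" by (auto simp: mlin_def)
    then show ?thesis using F_closed(1) by (intro exI[of _ "\<lambda>_. 0"]) simp
  next
    case False
    then obtain c where c: "\<forall>i\<in>?I. c i \<in> F" "(\<Sum>i\<in>?I. c i * ?e i) = 0" "\<not> (\<forall>i\<in>?I. c i = 0)" by blast
    have rel: "c None + (\<Sum>r\<in>I. c (Some r) * f r) = 0" using c(2) unfolding sumI by simp
    have "\<exists>k\<in>I. c (Some k) \<noteq> 0"
    proof (rule ccontr)
      assume a: "\<not> (\<exists>k\<in>I. c (Some k) \<noteq> 0)"
      then have "c None = 0" using rel by simp
      then show False using a c(3) by auto
    qed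
    then obtain k where k: "k \<in> I" "c (Some k) \<noteq> 0" by blast
    define \<gamma>0 where "\<gamma>0 = - (inverse (c (Some k)) * c None)"
    define \<gamma> where "\<gamma> r = - (inverse (c (Some k)) * c (Some r))" for r
    have \<gamma>F: "\<gamma>0 \<in> F" "\<And>r. r \<in> I \<Longrightarrow> \<gamma> r \<in> F" unfolding \<gamma>0_def \<gamma>_def using c(1) k(1)
      by (auto intro!: F_closed)
    let ?J = "I - {k}"
    have fJ: "finite ?J" using less.prems(1) by simp
    have split: "sum G I = G k + sum G ?J" for G :: "'a \<Rightarrow> 'l" using less.prems(1) k(1) by (rule sum.remove)
    have "c (Some k) * f k = - (c None + (\<Sum>r\<in>?J. c (Some r) * f r))"
      using rel unfolding split by (simp add: eq_neg_iff_add_eq_0 algebra_simps)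
    then have *: "inverse (c (Some k)) * (c (Some k) * f k) = inverse (c (Some k)) * - (c None + (\<Sum>r\<in>?J. c (Some r) * f r))"
      by simp
    then have fk: "f k = \<gamma>0 + (\<Sum>r\<in>?J. \<gamma> r * f r)"
    proof -
      have "f k = inverse (c (Some k)) * - (c None + (\<Sum>r\<in>?J. c (Some r) * f r))"
        unfolding *[symmetric] using k(2) by simp
      then show ?thesis
        by (simp add: \<gamma>0_def \<gamma>_def sum_negf right_diff_distrib sum_distrib_left mult.assoc)
    qed
    \<comment> \<open>Substituting for \<open>f k\<close> adds multiples of \<open>x k\<close> to
      the other generators; the constant part \<open>\<gamma>0\<close> of \<open>f k\<close> is
      moved to the side of \<open>a\<close>.\<close>
    define x' where "x' r = x r + \<gamma> r \<cdot>\<^sub>m x k" for r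
    have xc: "\<And>r. r \<in> I \<Longrightarrow> x r \<in> carrier_mat n n" using less.prems(3) D_carrier by blast
    have x'i: "x' r $$ (i, j) = x r $$ (i, j) + \<gamma> r * x k $$ (i, j)" if "r \<in> I" "i < n" "j < n" for r i j
      using that xc[OF that(1)] xc[OF k(1)] by (simp add: x'_def)
    have ac: "a \<in> carrier_mat n n" by (rule D_carrier[OF less.prems(2)])
    let ?a = "a - \<gamma>0 \<cdot>\<^sub>m x k"
    have "?a = mlin n ?J f x'"
    proof (rule eq_matI)
      fix i j assume "i < dim_row (mlin n ?J f x')" "j < dim_col (mlin n ?J f x')"
      then have ij: "i < n" "j < n" by (auto simp: mlin_def)
      have "a $$ (i, j) = (\<Sum>r\<in>I. f r * x r $$ (i, j))" by (subst less.prems(4)) (use ij in simp)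
      also have "\<dots> = (\<gamma>0 + (\<Sum>r\<in>?J. \<gamma> r * f r)) * x k $$ (i, j) + (\<Sum>r\<in>?J. f r * x r $$ (i, j))"
        unfolding split fk[symmetric] ..
      also have "\<dots> = \<gamma>0 * x k $$ (i, j) + (\<Sum>r\<in>?J. f r * x' r $$ (i, j))"
        using ij by (simp add: x'i distrib_right distrib_left sum.distrib sum_distrib_right)
          (simp add: ac_simps)
      finally show "?a $$ (i, j) = mlin n ?J f x' $$ (i, j)" using ij ac xc[OF k(1)] by simp
    qed (use ac xc[OF k(1)] in \<open>auto simp: mlin_def\<close>)
    moreover have "?a \<in> D" using less.prems(2,3) k(1) \<gamma>F by (intro D_minus F_smult) auto
    moreover have "x' r \<in> D" if "r \<in> ?J" for r
      unfolding x'_def using less.prems(3) k(1) that \<gamma>F by (intro D_add F_smult) auto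
    moreover have "card ?J < card I" using less.prems(1) k(1) by (rule card_Diff1_less)
    ultimately have "\<exists>c. (\<forall>r\<in>?J. c r \<in> F) \<and> ?a = mlin n ?J c x'"
      using fJ by (intro less.hyps) auto
    then obtain e where e: "\<And>r. r \<in> ?J \<Longrightarrow> e r \<in> F" "?a = mlin n ?J e x'" by blast
    \<comment> \<open>The coordinate at \<open>x k\<close> collects the constant part and the
      contributions of the modified generators.\<close>
    define e' where "e' r = (if r = k then \<gamma>0 + (\<Sum>r\<in>?J. \<gamma> r * e r) else e r)" for r
    have "a = mlin n I e' x"
    proof (rule eq_matI)
      fix i j assume "i < dim_row (mlin n I e' x)" "j < dim_col (mlin n I e' x)"
      then have ij: "i < n" "j < n" by (auto simp: mlin_def)
      have "a $$ (i, j) = \<gamma>0 * x k $$ (i, j) + ?a $$ (i, j)" using ij ac xc[OF k(1)] by simp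
      also have "?a $$ (i, j) = (\<Sum>r\<in>?J. e r * x' r $$ (i, j))" unfolding e(2) using ij by simp
      also have "\<dots> = (\<Sum>r\<in>?J. \<gamma> r * e r) * x k $$ (i, j) + (\<Sum>r\<in>?J. e r * x r $$ (i, j))"
        using ij by (simp add: x'i distrib_left sum.distrib sum_distrib_right) (simp add: ac_simps)
      finally have "a $$ (i, j) = e' k * x k $$ (i, j) + (\<Sum>r\<in>?J. e' r * x r $$ (i, j))"
        by (simp add: e'_def algebra_simps)
      then show "a $$ (i, j) = mlin n I e' x $$ (i, j)"
        using ij split[of "\<lambda>r. e' r * x r $$ (i, j)"] by simp
    qed (use ac in \<open>auto simp: mlin_def\<close>)
    moreover have "e' r \<in> F" if "r \<in> I" for r
      unfolding e'_def using e(1) \<gamma>F that by (auto intro!: F_closed F_sum)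
    ultimately show ?thesis by blast
  qed
qed

end

lemma comp_hom: "comm_ring_hom f \<Longrightarrow> comm_ring_hom g \<Longrightarrow> comm_ring_hom (g \<circ> f)"
proof -
  assume "comm_ring_hom f" "comm_ring_hom g"
  then interpret f: comm_ring_hom f + g: comm_ring_hom g by auto
  show ?thesis by standard (simp_all add: f.hom_add g.hom_add f.hom_mult g.hom_mult)
qed

lemma id_hom: "comm_ring_hom (\<lambda>x :: 'a::comm_ring_1. x)"
  by standard auto

lemma field_hom_eq_0:
  assumes "comm_ring_hom (h :: 'a::field \<Rightarrow> 'b::field)"
  shows "h x = 0 \<longleftrightarrow> x = 0"
proof -
  interpret comm_ring_hom h by fact
  have "x = 0" if "h x = 0"
  proof (rule ccontr)
    assume "x \<noteq> 0"
    then have "h (x * inverse x) = 1" by simp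
    then show False using that by (simp add: hom_mult)
  qed
  then show ?thesis by auto
qed

lemma hom_of_nat:
  assumes "comm_ring_hom h"
  shows "h (of_nat k) = of_nat k"
proof -
  interpret comm_ring_hom h by fact
  show ?thesis by (induction k) (simp_all add: hom_add)
qed

lemma mval_sum: "mval w (sum f I) = (\<Prod>i\<in>I. mval w (f i))"
  by (induction I rule: infinite_finite_induct) (simp_all add: mval_add)

lemma smult_mult_smult:
  assumes "A \<in> carrier_mat n k" "B \<in> carrier_mat k m"
  shows "(a \<cdot>\<^sub>m A) * (b \<cdot>\<^sub>m B) = (a * b :: 'a::comm_ring_1) \<cdot>\<^sub>m (A * B)"
  using assms by (simp add: mult_smult_assoc_mat[of _ n k _ m] mult_smult_distrib[of _ n k _ m] smult_smult mult.commute)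

lemma hom_adj_mat:
  assumes h: "comm_ring_hom h" and A: "A \<in> carrier_mat n n"
  shows "map_mat h (adj_mat A) = adj_mat (map_mat h A)"
proof -
  interpret comm_ring_hom h by fact
  have c: "h (cofactor A i j) = cofactor (map_mat h A) i j" if "i < n" "j < n" for i j
  proof -
    have "map_mat h (mat_delete A i j) = mat_delete (map_mat h A) i j"
      by (rule eq_matI) (use A that in \<open>auto simp: mat_delete_def\<close>)
    then show ?thesis by (simp add: cofactor_def hom_mult hom_power hom_uminus hom_det[symmetric] del: hom_det)
  qed
  show ?thesis by (rule eq_matI) (use A c in \<open>auto simp: adj_mat_def\<close>)
qed

lemma foldr_mult_carrier: "set xs \<subseteq> carrier_mat n n \<Longrightarrow> foldr (*) xs (1\<^sub>m n) \<in> carrier_mat n n"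
  by (induction xs) auto

lemma hom_foldr_mult:
  assumes h: "comm_ring_hom h" and xs: "set xs \<subseteq> carrier_mat n n"
  shows "map_mat h (foldr (*) xs (1\<^sub>m n)) = foldr (*) (map (map_mat h) xs) (1\<^sub>m n)"
proof -
  interpret comm_ring_hom h by fact
  show ?thesis using xs
  proof (induction xs)
    case Nil
    then show ?case by (simp add: mat_hom_one)
  next
    case (Cons x xs)
    then show ?case using mat_hom_mult[of x n n "foldr (*) xs (1\<^sub>m n)" n] foldr_mult_carrier[of xs n] by simp
  qed
qed

lemma foldr_mult_smult:
  assumes "set xs \<subseteq> carrier_mat n n"
  shows "foldr (*) (map (\<lambda>x. c \<cdot>\<^sub>m x) xs) (1\<^sub>m n) = (c ^ length xs :: 'a::comm_ring_1) \<cdot>\<^sub>m foldr (*) xs (1\<^sub>m n)"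
  using assms
proof (induction xs)
  case Nil
  then show ?case by (simp add: one_smult)
next
  case (Cons x xs)
  then have c: "x \<in> carrier_mat n n" "foldr (*) xs (1\<^sub>m n) \<in> carrier_mat n n" using foldr_mult_carrier by auto
  then show ?case using Cons
    by (simp add: mult_smult_assoc_mat[OF c(1), of "_ \<cdot>\<^sub>m foldr (*) xs (1\<^sub>m n)" n] mult_smult_distrib[OF c] smult_smult)
qed

lemma monomial_matrices_exist:
  assumes n: "0 < n" and c: "(of_nat (fact n) :: 'a::alg_closed_field) \<noteq> 0"
  shows "\<exists>ps (\<zeta> :: nat \<Rightarrow> 'a). monomial_matrices ps \<zeta> n"
proof -
  obtain ps where ps: "mset ps = prime_factorization n" using ex_mset by blast
  have pr: "prime (ps ! l) \<and> ps ! l dvd n" if "l < length ps" for l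
  proof -
    have "ps ! l \<in># prime_factorization n" using that unfolding ps[symmetric] by simp
    then show ?thesis by auto
  qed
  have "\<forall>l. \<exists>z::'a. l < length ps \<longrightarrow> primitive_root_of_unity (ps ! l) z"
  proof
    fix l show "\<exists>z::'a. l < length ps \<longrightarrow> primitive_root_of_unity (ps ! l) z"
    proof (cases "l < length ps")
      case True
      have "1 \<le> ps ! l" "ps ! l \<le> n"
        using pr[OF True] n by (auto dest: dvd_imp_le simp: prime_gt_0_nat Suc_leI)
      then have "ps ! l dvd fact n" by (rule dvd_fact)
      then show ?thesis using primitive_root_exists pr[OF True] of_nat_neq_zero[OF c] by blast
    qed simp
  qed
  from choice[OF this] obtain \<zeta> :: "nat \<Rightarrow> 'a" where
    "\<forall>l. l < length ps \<longrightarrow> primitive_root_of_unity (ps ! l) (\<zeta> l)" ..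
  moreover have "prod_list ps = n"
    using n prod_mset_prod_list[of ps] by (simp add: ps prod_mset_prime_factorization_nat)
  ultimately have "monomial_matrices ps \<zeta> n" using pr c by unfold_locales auto
  then show ?thesis by blast
qed

section \<open>Generic equivariant matrices\<close>

context monomial_matrices
begin

lemma D0_mlin:
  assumes "finite I" "\<And>r. r \<in> I \<Longrightarrow> M r \<in> D0"
  shows "mlin n I (\<lambda>_. 1) M \<in> D0"
  using assms
proof (induction I rule: finite_induct)
  case empty
  have "mlin n {} (\<lambda>_. 1) M = const 0 \<cdot>\<^sub>m 1\<^sub>m n" by (rule eq_matI) (auto simp: mlin_def)
  then show ?case using D0_const[of 0] by simp
next
  case (insert x I)
  have "M x \<in> carrier_mat n n" using insert D0_carrier by blast
  then have "mlin n (insert x I) (\<lambda>_. 1) M = M x + mlin n I (\<lambda>_. 1) M"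
    using insert by (intro eq_matI) (auto simp: mlin_def)
  then show ?case using insert D0_add by simp
qed

lemma N_cong: "(\<And>l. l < s \<Longrightarrow> a l = a' l) \<Longrightarrow> (\<And>l. l < s \<Longrightarrow> b l = b' l) \<Longrightarrow> N a b = N a' b'"
proof -
  assume ab: "\<And>l. l < s \<Longrightarrow> a l = a' l" "\<And>l. l < s \<Longrightarrow> b l = b' l"
  have 1: "sh b = sh b'" by (rule ext, rule sh_cong) (simp add: ab)
  have 2: "chi a = chi a'" by (rule ext) (simp add: chi_def ab)
  show ?thesis unfolding N_def 1 2 ..
qed

text \<open>The reduced exponent, below \<open>p l\<close> at each place, whose matrix is
  \<open>NB r\<close>. The index \<open>r\<close> encodes two group elements, one for the even and
  one for the odd variables.\<close>

definition expo :: "nat \<Rightarrow> nat \<Rightarrow>\<^sub>0 nat" where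
  "expo r = (\<Sum>l<s. Poly_Mapping.single (2 * l) (digit (r div n) l) + Poly_Mapping.single (2 * l + 1) (digit (r mod n) l))"

lemma lookup_expo:
  "l < s \<Longrightarrow> lookup (expo r) (2 * l) = digit (r div n) l"
  "l < s \<Longrightarrow> lookup (expo r) (2 * l + 1) = digit (r mod n) l"
  "2 * s \<le> v \<Longrightarrow> lookup (expo r) v = 0"
proof -
  have o: "2 * k + 1 \<noteq> 2 * (l :: nat)" "2 * l \<noteq> 2 * k + 1" for k l :: nat by presburger+
  show "l < s \<Longrightarrow> lookup (expo r) (2 * l) = digit (r div n) l"
    by (simp add: expo_def lookup_sum lookup_add lookup_single when_def sum.distrib o[simplified])
  show "l < s \<Longrightarrow> lookup (expo r) (2 * l + 1) = digit (r mod n) l"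
    by (simp add: expo_def lookup_sum lookup_add lookup_single when_def sum.distrib o[simplified])
  show "2 * s \<le> v \<Longrightarrow> lookup (expo r) v = 0"
    by (auto simp: expo_def lookup_sum lookup_add lookup_single when_def intro!: sum.neutral)
qed

lemma mval_expo:
  "mval w (expo r) = (\<Prod>l<s. w (2 * l) ^ digit (r div n) l * w (2 * l + 1) ^ digit (r mod n) l)"
  by (simp add: expo_def mval_sum mval_add)

abbreviation NB :: "nat \<Rightarrow> 'c mat" where
  "NB r \<equiv> N (digit (r div n)) (digit (r mod n))"

lemma Nm_expo:
  assumes "\<And>v. v < 2 * s \<Longrightarrow> lookup \<beta> v = 0"
  shows "Nm (expo r + \<beta>) = NB r"
  unfolding Nm_def by (rule N_cong) (use assms in \<open>simp_all add: lookup_add lookup_expo lookup_expo(2)[simplified]\<close>)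

lemma NB_span: "M \<in> carrier_mat n n \<Longrightarrow> \<exists>g. M = mlin n {..<n * n} g NB"
proof -
  assume M: "M \<in> carrier_mat n n"
  obtain g where "\<And>i j. i < n \<Longrightarrow> j < n \<Longrightarrow> M $$ (i, j) = (\<Sum>r<n * n. g r * NB r $$ (i, j))"
    using N_span[of M] by blast
  then have "M = mlin n {..<n * n} g NB" using M by (intro eq_matI) (auto simp: mlin_def)
  then show ?thesis by blast
qed

text \<open>Each of the \<open>n * n\<close> terms carries a fresh variable beyond the first
  \<open>2 * s\<close>. The twists do not touch these, so equivariance is preserved, and the offset
  \<open>k\<close> keeps the variables of two such matrices apart.\<close>

definition generic :: "nat \<Rightarrow> ((nat \<Rightarrow>\<^sub>0 nat) \<Rightarrow>\<^sub>0 'c) mat" where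
  "generic k = mlin n {..<n * n} (\<lambda>_. 1)
    (\<lambda>r. Poly_Mapping.single (expo r + Poly_Mapping.single (2 * s + k + r) 1) 1 \<cdot>\<^sub>m cmat (NB r))"

lemma generic_D0: "generic k \<in> D0"
  unfolding generic_def
proof (rule D0_mlin)
  fix r
  let ?\<alpha> = "expo r + Poly_Mapping.single (2 * s + k + r) 1"
  have "Nm ?\<alpha> = NB r" by (rule Nm_expo) (simp add: lookup_single when_def)
  then show "Poly_Mapping.single ?\<alpha> 1 \<cdot>\<^sub>m cmat (NB r) \<in> D0" using D0_monomial[of ?\<alpha> 1] by simp
qed simp

lemma generic_ev:
  assumes "\<And>v. v < 2 * s \<Longrightarrow> w v = 1" "i < n" "j < n"
  shows "ev (\<lambda>x. x) w (generic k $$ (i, j)) = (\<Sum>r<n * n. w (2 * s + k + r) * NB r $$ (i, j))"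
proof -
  interpret h: comm_ring_hom "ev (\<lambda>x :: 'c. x) w" by (rule ev_hom[OF id_hom])
  have m: "mval w (expo r) = 1" for r unfolding mval_expo using assms(1) by simp
  show ?thesis unfolding generic_def using assms(2,3)
    by (simp add: h.hom_sum h.hom_mult ev_single[OF id_hom] mval_add m)
qed

end

text \<open>The roots of unity for the monomial matrices need not lie in the base field, so they are
  taken in an algebraic closure; the polynomials in the generic entries keep their coefficients in
  the base field.\<close>

locale generic_matrices = monomial_matrices ps \<zeta> n
  for ps n and \<zeta> :: "nat \<Rightarrow> 'l::field alg_closure" +
  fixes \<iota> :: "'k::field \<Rightarrow> 'l" and gs gt :: "nat \<Rightarrow> nat \<Rightarrow> 'l"
  assumes \<iota>: "comm_ring_hom \<iota>"
    and ind: "algebraically_independent \<iota> (({..<n} \<times> {..<n}) <+> ({..<n} \<times> {..<n}))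
      (case_sum (case_prod gs) (case_prod gt))"
begin

abbreviation "V \<equiv> ({..<n} \<times> {..<n}) <+> ({..<n} \<times> {..<n})"

definition x0 :: "(nat \<times> nat) + (nat \<times> nat) \<Rightarrow> 'l" where
  "x0 v = (if v \<in> V then case_sum (case_prod gs) (case_prod gt) v else 0)"

abbreviation evL :: "(((nat \<times> nat) + (nat \<times> nat) \<Rightarrow>\<^sub>0 nat) \<Rightarrow>\<^sub>0 'k) \<Rightarrow> 'l" where
  "evL \<equiv> ev \<iota> x0"

definition \<kappa> :: "'k \<Rightarrow> (nat \<Rightarrow>\<^sub>0 nat) \<Rightarrow>\<^sub>0 'l alg_closure" where
  "\<kappa> = const \<circ> (to_ac \<circ> \<iota>)"

text \<open>Pairs of matrices in \<open>D0\<close>, as values for the generic entries. Stray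
  variables get the value zero, in agreement with \<open>x0\<close>.\<close>

definition pts :: "((nat \<times> nat) + (nat \<times> nat) \<Rightarrow> (nat \<Rightarrow>\<^sub>0 nat) \<Rightarrow>\<^sub>0 'l alg_closure) set" where
  "pts = {u. (\<forall>v. v \<notin> V \<longrightarrow> u v = 0) \<and> mat n n (\<lambda>(a, b). u (Inl (a, b))) \<in> D0 \<and>
    mat n n (\<lambda>(a, b). u (Inr (a, b))) \<in> D0}"

lemma \<kappa>_hom: "comm_ring_hom \<kappa>"
  unfolding \<kappa>_def by (intro comp_hom \<iota> to_ac_hom const_hom)

lemma evL_hom: "comm_ring_hom evL"
  by (rule ev_hom[OF \<iota>])

lemma evu_hom: "comm_ring_hom (ev \<kappa> u)"
  by (rule ev_hom[OF \<kappa>_hom])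

lemma ev_of_evL:
  assumes "evL f = 0"
  shows "ev g (\<lambda>v. if v \<in> V then y v else 0) f = 0"
  by (rule algebraically_independent_ev[OF ind _ assms[unfolded x0_def]]) simp

lemma evu_of_evL:
  assumes "evL f = 0" "u \<in> pts"
  shows "ev \<kappa> u f = 0"
proof -
  have "u = (\<lambda>v. if v \<in> V then u v else 0)" using assms(2) by (auto simp: pts_def)
  then show ?thesis using ev_of_evL[OF assms(1), of \<kappa> u] by simp
qed

text \<open>A specialization of a generic point of \<open>D0\<close> recovers the generic matrices, so a polynomial
  vanishing at all points of \<open>D0\<close> is zero.\<close>

lemma evL_of_evu:
  assumes "\<And>u. u \<in> pts \<Longrightarrow> ev \<kappa> u f = 0"
  shows "evL f = 0"
proof -
  define u where "u v = (if v \<in> V then case v of Inl (a, b) \<Rightarrow> generic 0 $$ (a, b)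
    | Inr (a, b) \<Rightarrow> generic (n * n) $$ (a, b) else 0)" for v
  have gc: "generic k \<in> carrier_mat n n" for k using generic_D0 D0_carrier by blast
  have "mat n n (\<lambda>(a, b). u (Inl (a, b))) = generic 0" "mat n n (\<lambda>(a, b). u (Inr (a, b))) = generic (n * n)"
    by (auto intro!: eq_matI simp: u_def gc[THEN carrier_matD(1)] gc[THEN carrier_matD(2)])
  then have "u \<in> pts" unfolding pts_def using generic_D0 by (auto simp: u_def)
  then have z: "ev \<kappa> u f = 0" by (rule assms)
  obtain g1 where g1: "mat n n (\<lambda>(a, b). to_ac (gs a b)) = mlin n {..<n * n} g1 NB"
    using NB_span[of "mat n n (\<lambda>(a, b). to_ac (gs a b))"] by auto
  obtain g2 where g2: "mat n n (\<lambda>(a, b). to_ac (gt a b)) = mlin n {..<n * n} g2 NB"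
    using NB_span[of "mat n n (\<lambda>(a, b). to_ac (gt a b))"] by auto
  \<comment> \<open>The root variables go to \<open>1\<close>, the fresh ones to the coordinates of
    the two generic matrices with respect to the matrices \<open>NB\<close>.\<close>
  define w where "w v = (if v < 2 * s then 1 else if v < 2 * s + n * n then g1 (v - 2 * s)
    else g2 (v - 2 * s - n * n))" for v
  let ?\<theta> = "ev (\<lambda>x. x) w"
  have \<theta>: "comm_ring_hom ?\<theta>" by (rule ev_hom[OF id_hom])
  interpret \<theta>: comm_ring_hom ?\<theta> by (rule \<theta>)
  have "?\<theta> (u v) = to_ac (x0 v)" for v
  proof (cases "v \<in> V")
    case True
    then consider a b where "v = Inl (a, b)" "a < n" "b < n" | a b where "v = Inr (a, b)" "a < n" "b < n" by auto
    then show ?thesis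
    proof cases
      case 1
      then have vV: "Inl (a, b) \<in> V" by auto
      have "?\<theta> (u v) = (\<Sum>r<n * n. w (2 * s + 0 + r) * NB r $$ (a, b))"
        using 1 vV generic_ev[of w a b 0] by (simp add: u_def w_def del: N_index)
      also have "\<dots> = (\<Sum>r<n * n. g1 r * NB r $$ (a, b))" by (intro sum.cong refl) (simp add: w_def)
      also have "\<dots> = mlin n {..<n * n} g1 NB $$ (a, b)" using 1 by simp
      also have "\<dots> = to_ac (x0 v)" unfolding g1[symmetric] using 1 vV by (simp add: x0_def)
      finally show ?thesis .
    next
      case 2
      then have vV: "Inr (a, b) \<in> V" by auto
      have "?\<theta> (u v) = (\<Sum>r<n * n. w (2 * s + n * n + r) * NB r $$ (a, b))"
        using 2 vV generic_ev[of w a b "n * n"] by (simp add: u_def w_def del: N_index)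
      also have "\<dots> = (\<Sum>r<n * n. g2 r * NB r $$ (a, b))" by (intro sum.cong refl) (simp add: w_def)
      also have "\<dots> = mlin n {..<n * n} g2 NB $$ (a, b)" using 2 by simp
      also have "\<dots> = to_ac (x0 v)" unfolding g2[symmetric] using 2 vV by (simp add: x0_def)
      finally show ?thesis .
    qed
  next
    case False
    then show ?thesis by (simp add: u_def x0_def)
  qed
  then have u: "?\<theta> \<circ> u = to_ac \<circ> x0" by auto
  have "?\<theta> \<circ> \<kappa> = to_ac \<circ> \<iota>" by (auto simp: \<kappa>_def ev_const[OF id_hom])
  then have "?\<theta> (ev \<kappa> u f) = ev (to_ac \<circ> \<iota>) (to_ac \<circ> x0) f"
    using ev_comp[OF \<kappa>_hom \<theta>, of u f] u by simp
  also have "\<dots> = to_ac (evL f)" by (rule ev_comp[OF \<iota> to_ac_hom, symmetric])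
  finally show ?thesis using z by simp
qed

text \<open>Large enough to contain the generic matrices and to be closed under ring operations, and
  under \<open>det A\<close> times the adjugate when \<open>A\<close> is generically nonzero; yet
  controlled by \<open>D0\<close> at each point.\<close>

definition R :: "((((nat \<times> nat) + (nat \<times> nat) \<Rightarrow>\<^sub>0 nat) \<Rightarrow>\<^sub>0 'k) mat) set" where
  "R = {A \<in> carrier_mat n n. \<forall>u\<in>pts. map_mat (ev \<kappa> u) A \<in> D0}"

text \<open>Denominators are taken to be scalars, so that they are central and can be made
  common.\<close>

definition Q :: "'l mat set" where
  "Q = {M \<in> carrier_mat n n. \<exists>A\<in>R. \<exists>c. c \<cdot>\<^sub>m 1\<^sub>m n \<in> R \<and> evL c \<noteq> 0 \<and> evL c \<cdot>\<^sub>m M = map_mat evL A}"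

lemma R_closed:
  "A \<in> R \<Longrightarrow> B \<in> R \<Longrightarrow> A + B \<in> R" "A \<in> R \<Longrightarrow> B \<in> R \<Longrightarrow> A * B \<in> R" "const a \<cdot>\<^sub>m 1\<^sub>m n \<in> R"
  "c \<cdot>\<^sub>m 1\<^sub>m n \<in> R \<Longrightarrow> A \<in> R \<Longrightarrow> c \<cdot>\<^sub>m A \<in> R"
proof -
  show ml: "A * B \<in> R" if "A \<in> R" "B \<in> R" for A B
    unfolding R_def
  proof (intro CollectI conjI ballI)
    have c: "A \<in> carrier_mat n n" "B \<in> carrier_mat n n" using that by (auto simp: R_def)
    then show "A * B \<in> carrier_mat n n" by simp
    fix u assume u: "u \<in> pts"
    interpret h: comm_ring_hom "ev \<kappa> u" by (rule evu_hom)
    show "map_mat (ev \<kappa> u) (A * B) \<in> D0"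
      unfolding h.mat_hom_mult[OF c] using that u by (intro D0_mult) (auto simp: R_def)
  qed
  show "A \<in> R \<Longrightarrow> B \<in> R \<Longrightarrow> A + B \<in> R"
    unfolding R_def
  proof (intro CollectI conjI ballI)
    assume AB: "A \<in> {A \<in> carrier_mat n n. \<forall>u\<in>pts. map_mat (ev \<kappa> u) A \<in> D0}"
      "B \<in> {A \<in> carrier_mat n n. \<forall>u\<in>pts. map_mat (ev \<kappa> u) A \<in> D0}"
    then have c: "A \<in> carrier_mat n n" "B \<in> carrier_mat n n" by auto
    then show "A + B \<in> carrier_mat n n" by simp
    fix u assume u: "u \<in> pts"
    interpret h: comm_ring_hom "ev \<kappa> u" by (rule evu_hom)
    have "map_mat (ev \<kappa> u) (A + B) = map_mat (ev \<kappa> u) A + map_mat (ev \<kappa> u) B"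
      by (rule eq_matI) (use c in \<open>auto simp: h.hom_add\<close>)
    then show "map_mat (ev \<kappa> u) (A + B) \<in> D0" using AB u D0_add by auto
  qed
  show "const a \<cdot>\<^sub>m 1\<^sub>m n \<in> R"
    unfolding R_def
  proof (intro CollectI conjI ballI)
    fix u assume u: "u \<in> pts"
    interpret h: comm_ring_hom "ev \<kappa> u" by (rule evu_hom)
    have "map_mat (ev \<kappa> u) (const a \<cdot>\<^sub>m 1\<^sub>m n) = const (to_ac (\<iota> a)) \<cdot>\<^sub>m 1\<^sub>m n"
    proof -
      have e: "ev \<kappa> u (const a) = const (to_ac (\<iota> a))"
        unfolding ev_const[OF \<kappa>_hom] by (simp add: \<kappa>_def)
      show ?thesis by (rule eq_matI) (auto simp: e h.hom_mult)
    qed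
    then show "map_mat (ev \<kappa> u) (const a \<cdot>\<^sub>m 1\<^sub>m n) \<in> D0" using D0_const by simp
  qed simp
  show "c \<cdot>\<^sub>m A \<in> R" if "c \<cdot>\<^sub>m 1\<^sub>m n \<in> R" "A \<in> R"
  proof -
    have "A \<in> carrier_mat n n" using that by (simp add: R_def)
    then show ?thesis using ml[OF that] by (simp add: smult_one_mult_mat)
  qed
qed

lemma evL_smult: "map_mat evL (c \<cdot>\<^sub>m A) = evL c \<cdot>\<^sub>m map_mat evL A"
proof -
  interpret h: comm_ring_hom evL by (rule evL_hom)
  show ?thesis by (rule eq_matI) (auto simp: h.hom_mult)
qed

text \<open>A determinant that is zero at the generic entries is zero at every point. There
  \<open>D0_det_nonzero\<close> makes the specialized matrix zero, and a matrix that vanishes at all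
  points vanishes generically.\<close>

lemma R_det:
  assumes A: "A \<in> R" and nz: "map_mat evL A \<noteq> 0\<^sub>m n n"
  shows "evL (det A) \<noteq> 0" "det A \<cdot>\<^sub>m adj_mat A \<in> R" "det A \<cdot>\<^sub>m 1\<^sub>m n \<in> R"
proof -
  have Ac: "A \<in> carrier_mat n n" using A by (simp add: R_def)
  note a = adj_mat[OF Ac]
  show "evL (det A) \<noteq> 0"
  proof
    assume z: "evL (det A) = 0"
    have "evL (A $$ (i, j)) = 0" if ij: "i < n" "j < n" for i j
    proof (rule evL_of_evu)
      fix u assume u: "u \<in> pts"
      interpret h: comm_ring_hom "ev \<kappa> u" by (rule evu_hom)
      have "det (map_mat (ev \<kappa> u) A) = 0" using evu_of_evL[OF z u] by simp
      moreover have "map_mat (ev \<kappa> u) A \<in> D0" using A u by (simp add: R_def)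
      ultimately have "map_mat (ev \<kappa> u) A = 0\<^sub>m n n" using D0_det_nonzero by blast
      then have "map_mat (ev \<kappa> u) A $$ (i, j) = 0\<^sub>m n n $$ (i, j)" by simp
      then show "ev \<kappa> u (A $$ (i, j)) = 0" using ij Ac by simp
    qed
    then have "map_mat evL A = 0\<^sub>m n n" using Ac by (intro eq_matI) auto
    then show False using nz by simp
  qed
  show "det A \<cdot>\<^sub>m adj_mat A \<in> R"
    unfolding R_def
  proof (intro CollectI conjI ballI)
    show "det A \<cdot>\<^sub>m adj_mat A \<in> carrier_mat n n" using a by simp
    fix u assume u: "u \<in> pts"
    interpret h: comm_ring_hom "ev \<kappa> u" by (rule evu_hom)
    let ?A = "map_mat (ev \<kappa> u) A"
    have "map_mat (ev \<kappa> u) (det A \<cdot>\<^sub>m adj_mat A) = ev \<kappa> u (det A) \<cdot>\<^sub>m map_mat (ev \<kappa> u) (adj_mat A)"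
      by (rule eq_matI) (auto simp: h.hom_mult)
    also have "\<dots> = det ?A \<cdot>\<^sub>m adj_mat ?A" by (simp add: hom_adj_mat[OF evu_hom Ac])
    finally show "map_mat (ev \<kappa> u) (det A \<cdot>\<^sub>m adj_mat A) \<in> D0"
      using D0_det_adj[of ?A] A u by (simp add: R_def)
  qed
  show "det A \<cdot>\<^sub>m 1\<^sub>m n \<in> R"
    unfolding R_def
  proof (intro CollectI conjI ballI)
    fix u assume u: "u \<in> pts"
    interpret h: comm_ring_hom "ev \<kappa> u" by (rule evu_hom)
    have "map_mat (ev \<kappa> u) (det A \<cdot>\<^sub>m 1\<^sub>m n) = det (map_mat (ev \<kappa> u) A) \<cdot>\<^sub>m 1\<^sub>m n"
      by (rule eq_matI) (auto simp: h.hom_mult)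
    moreover have "map_mat (ev \<kappa> u) A \<in> D0" using A u by (simp add: R_def)
    then have "det (map_mat (ev \<kappa> u) A) \<cdot>\<^sub>m 1\<^sub>m n \<in> D0" by (intro D0_scalar D0_det_invariant)
    ultimately show "map_mat (ev \<kappa> u) (det A \<cdot>\<^sub>m 1\<^sub>m n) \<in> D0" by (simp only:)
  qed simp
qed

lemma Q_I:
  assumes "A \<in> R" "c \<cdot>\<^sub>m 1\<^sub>m n \<in> R" "evL c \<noteq> 0" "M \<in> carrier_mat n n" "evL c \<cdot>\<^sub>m M = map_mat evL A"
  shows "M \<in> Q"
  unfolding Q_def using assms by blast

text \<open>Together with \<open>generators_Q\<close>, this is the part of Amitsur's theorem that is
  needed: some division algebra contains the generic matrices.\<close>

lemma Q_division: "division_subalgebra \<iota> n Q"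
  unfolding division_subalgebra_def
proof (intro conjI allI ballI impI)
  interpret h: comm_ring_hom evL by (rule evL_hom)
  show "Q \<subseteq> carrier_mat n n" by (auto simp: Q_def)
  have one: "const 1 \<cdot>\<^sub>m 1\<^sub>m n \<in> R" by (rule R_closed)
  show "\<iota> c \<cdot>\<^sub>m 1\<^sub>m n \<in> Q" for c
  proof (rule Q_I[of "const c \<cdot>\<^sub>m 1\<^sub>m n" "const 1"])
    show "const c \<cdot>\<^sub>m 1\<^sub>m n \<in> R" "const 1 \<cdot>\<^sub>m 1\<^sub>m n \<in> R" by (rule R_closed)+
    interpret i: comm_ring_hom \<iota> by (rule \<iota>)
    show "evL (const 1) \<noteq> 0" unfolding ev_const[OF \<iota>] by simp
    show "evL (const 1) \<cdot>\<^sub>m (\<iota> c \<cdot>\<^sub>m 1\<^sub>m n) = map_mat evL (const c \<cdot>\<^sub>m 1\<^sub>m n)"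
      unfolding evL_smult ev_const[OF \<iota>] by (simp add: one_smult h.mat_hom_one)
  qed simp
  fix M assume "M \<in> Q"
  then obtain A c where M: "M \<in> carrier_mat n n" "A \<in> R" "c \<cdot>\<^sub>m 1\<^sub>m n \<in> R" "evL c \<noteq> 0" "evL c \<cdot>\<^sub>m M = map_mat evL A"
    by (auto simp: Q_def)
  have Ac: "A \<in> carrier_mat n n" using M(2) by (simp add: R_def)
  have Me: "M = inverse (evL c) \<cdot>\<^sub>m map_mat evL A"
    unfolding M(5)[symmetric] using M(4) by (simp add: smult_smult one_smult)
  {
    fix M' assume "M' \<in> Q"
    then obtain A' c' where M': "M' \<in> carrier_mat n n" "A' \<in> R" "c' \<cdot>\<^sub>m 1\<^sub>m n \<in> R" "evL c' \<noteq> 0"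
      "evL c' \<cdot>\<^sub>m M' = map_mat evL A'"
      by (auto simp: Q_def)
    have A'c: "A' \<in> carrier_mat n n" using M'(2) by (simp add: R_def)
    have cc: "(c * c') \<cdot>\<^sub>m 1\<^sub>m n \<in> R" using R_closed(4)[OF M(3) M'(3)] by (simp add: smult_smult)
    have nz: "evL (c * c') \<noteq> 0" using M(4) M'(4) by (simp add: h.hom_mult)
    show "M + M' \<in> Q"
    proof (rule Q_I[of "c' \<cdot>\<^sub>m A + c \<cdot>\<^sub>m A'" "c * c'"])
      show "c' \<cdot>\<^sub>m A + c \<cdot>\<^sub>m A' \<in> R" by (rule R_closed(1)[OF R_closed(4)[OF M'(3) M(2)] R_closed(4)[OF M(3) M'(2)]])
      have "map_mat evL (c' \<cdot>\<^sub>m A + c \<cdot>\<^sub>m A') = evL c' \<cdot>\<^sub>m map_mat evL A + evL c \<cdot>\<^sub>m map_mat evL A'"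
        by (rule eq_matI) (use Ac A'c in \<open>auto simp: h.hom_add h.hom_mult\<close>)
      also have "\<dots> = evL (c * c') \<cdot>\<^sub>m (M + M')"
        unfolding M(5)[symmetric] M'(5)[symmetric]
        by (rule eq_matI) (use M(1) M'(1) in \<open>auto simp: h.hom_mult algebra_simps\<close>)
      finally show "evL (c * c') \<cdot>\<^sub>m (M + M') = map_mat evL (c' \<cdot>\<^sub>m A + c \<cdot>\<^sub>m A')" by simp
    qed (use cc nz M(1) M'(1) in auto)
    show "M * M' \<in> Q"
    proof (rule Q_I[of "A * A'" "c * c'"])
      show "A * A' \<in> R" using M(2) M'(2) by (rule R_closed)
      have "map_mat evL (A * A') = (evL c \<cdot>\<^sub>m M) * (evL c' \<cdot>\<^sub>m M')"
        unfolding M(5) M'(5) by (rule h.mat_hom_mult[OF Ac A'c])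
      also have "\<dots> = evL (c * c') \<cdot>\<^sub>m (M * M')"
        using M(1) M'(1) by (simp add: mult_smult_assoc_mat[of _ n n _ n] mult_smult_distrib[of _ n n _ n] smult_smult h.hom_mult mult.commute)
      finally show "evL (c * c') \<cdot>\<^sub>m (M * M') = map_mat evL (A * A')" by simp
    qed (use cc nz M(1) M'(1) in auto)
  }
  assume Mnz: "M \<noteq> 0\<^sub>m n n"
  have "map_mat evL A \<noteq> 0\<^sub>m n n" using Mnz Me by auto
  note d = R_det[OF M(2) this]
  note a = adj_mat[OF Ac]
  let ?d = "det A" and ?B = "det A \<cdot>\<^sub>m adj_mat A"
  \<comment> \<open>The adjugate over the determinant, corrected by the denominator
    \<open>c\<close>. Below, the denominator is the square of the determinant, because it is
    \<open>det A\<close> times the adjugate that is known to lie in \<open>R\<close>.\<close>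
  define Y where "Y = (evL c * inverse (evL ?d)) \<cdot>\<^sub>m map_mat evL (adj_mat A)"
  have Yc: "Y \<in> carrier_mat n n" using a by (simp add: Y_def)
  have AB: "map_mat evL A * map_mat evL (adj_mat A) = evL ?d \<cdot>\<^sub>m 1\<^sub>m n"
    "map_mat evL (adj_mat A) * map_mat evL A = evL ?d \<cdot>\<^sub>m 1\<^sub>m n"
    unfolding h.mat_hom_mult[OF Ac a(1), symmetric] h.mat_hom_mult[OF a(1) Ac, symmetric] a(2,3) evL_smult
    by (simp_all add: h.mat_hom_one)
  have c: "map_mat evL A \<in> carrier_mat n n" "map_mat evL (adj_mat A) \<in> carrier_mat n n" using Ac a by auto
  have "M * Y = 1\<^sub>m n" "Y * M = 1\<^sub>m n"
    unfolding Me Y_def smult_mult_smult[OF c] smult_mult_smult[OF c(2,1)] AB smult_smult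
  proof -
    have "inverse (evL c) * (evL c * inverse (evL ?d)) * evL ?d = 1"
      "evL c * inverse (evL ?d) * inverse (evL c) * evL ?d = 1"
      using M(4) d(1) by (simp_all add: field_simps)
    then show "(inverse (evL c) * (evL c * inverse (evL ?d)) * evL ?d) \<cdot>\<^sub>m 1\<^sub>m n = 1\<^sub>m n"
      "(evL c * inverse (evL ?d) * inverse (evL c) * evL ?d) \<cdot>\<^sub>m 1\<^sub>m n = 1\<^sub>m n"
      by (simp_all only: one_smult)
  qed
  moreover have "Y \<in> Q"
  proof (rule Q_I[of "c \<cdot>\<^sub>m ?B" "?d * ?d"])
    show "c \<cdot>\<^sub>m ?B \<in> R" using M(3) d(2) by (rule R_closed)
    show "(?d * ?d) \<cdot>\<^sub>m 1\<^sub>m n \<in> R" using R_closed(4)[OF d(3) d(3)] by (simp add: smult_smult)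
    show "evL (?d * ?d) \<noteq> 0" using d(1) by (simp only: h.hom_mult mult_eq_0_iff not_False_eq_True disj_absorb)
    show "evL (?d * ?d) \<cdot>\<^sub>m Y = map_mat evL (c \<cdot>\<^sub>m ?B)"
      unfolding Y_def evL_smult smult_smult using d(1) by (simp add: h.hom_mult field_simps)
  qed (rule Yc)
  ultimately show "\<exists>Y\<in>Q. M * Y = 1\<^sub>m n \<and> Y * M = 1\<^sub>m n" by blast
qed

lemma generators_Q:
  "mat n n (\<lambda>(a, b). gs a b) \<in> Q" "mat n n (\<lambda>(a, b). gt a b) \<in> Q"
proof -
  interpret i: comm_ring_hom \<iota> by (rule \<iota>)
  have vR: "mat n n (\<lambda>(a, b). var (Inl (a, b))) \<in> R" "mat n n (\<lambda>(a, b). var (Inr (a, b))) \<in> R"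
  proof -
    have "map_mat (ev \<kappa> u) (mat n n (\<lambda>(a, b). var (f (a, b)))) = mat n n (\<lambda>(a, b). u (f (a, b)))"
      for u and f :: "nat \<times> nat \<Rightarrow> (nat \<times> nat) + (nat \<times> nat)"
      by (rule eq_matI) (auto simp: ev_var[OF \<kappa>_hom] simp del: One_nat_def)
    then show "mat n n (\<lambda>(a, b). var (Inl (a, b))) \<in> R" "mat n n (\<lambda>(a, b). var (Inr (a, b))) \<in> R"
      by (auto simp: R_def pts_def)
  qed
  have one: "const 1 \<cdot>\<^sub>m 1\<^sub>m n \<in> R" "evL (const 1) = 1"
    unfolding ev_const[OF \<iota>] by (rule R_closed) simp
  have "mat n n (\<lambda>(a, b). gs a b) = map_mat evL (mat n n (\<lambda>(a, b). var (Inl (a, b))))"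
    "mat n n (\<lambda>(a, b). gt a b) = map_mat evL (mat n n (\<lambda>(a, b). var (Inr (a, b))))"
    by (auto intro!: eq_matI simp: ev_var[OF \<iota>] x0_def simp del: One_nat_def)
  then show "mat n n (\<lambda>(a, b). gs a b) \<in> Q" "mat n n (\<lambda>(a, b). gt a b) \<in> Q"
    using Q_I[OF vR(1) one(1)] Q_I[OF vR(2) one(1)] unfolding one(2) by (simp_all add: one_smult)
qed

abbreviation "UDc \<equiv> UD_carrier \<iota> n gs gt"

lemma UD_subset: "UDc \<subseteq> Q"
  unfolding UD_carrier_def using Q_division generators_Q by blast

lemma UD_generators: "mat n n (\<lambda>(a, b). gs a b) \<in> UDc" "mat n n (\<lambda>(a, b). gt a b) \<in> UDc"
  unfolding UD_carrier_def by blast+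

text \<open>\<open>Q\<close> shows that the intersection runs over a nonempty family and that a
  nonzero element has an inverse at all; uniqueness puts this inverse into every other
  member.\<close>

lemma UD_division: "division_subalgebra \<iota> n UDc"
  unfolding division_subalgebra_def
proof (intro conjI allI ballI impI)
  have Qc: "Q \<subseteq> carrier_mat n n" by (auto simp: Q_def)
  show "UDc \<subseteq> carrier_mat n n" using UD_subset Qc by blast
  show "\<iota> c \<cdot>\<^sub>m 1\<^sub>m n \<in> UDc" for c unfolding UD_carrier_def division_subalgebra_def by blast
  fix A assume A: "A \<in> UDc"
  show "A + B \<in> UDc" "A * B \<in> UDc" if "B \<in> UDc" for B
    using A that unfolding UD_carrier_def division_subalgebra_def by blast+
  assume nz: "A \<noteq> 0\<^sub>m n n"
  have Ac: "A \<in> carrier_mat n n" using A UD_subset Qc by blast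
  obtain B where B: "B \<in> Q" "A * B = 1\<^sub>m n" "B * A = 1\<^sub>m n"
    using Q_division A UD_subset nz unfolding division_subalgebra_def by blast
  have Bc: "B \<in> carrier_mat n n" using B(1) Qc by blast
  have "B \<in> S" if S: "division_subalgebra \<iota> n S" "mat n n (\<lambda>(a, b). gs a b) \<in> S" "mat n n (\<lambda>(a, b). gt a b) \<in> S" for S
  proof -
    have "A \<in> S" using A S unfolding UD_carrier_def by blast
    then obtain C where C: "C \<in> S" "A * C = 1\<^sub>m n" using S(1) nz unfolding division_subalgebra_def by blast
    have Cc: "C \<in> carrier_mat n n" using C(1) S(1) unfolding division_subalgebra_def by blast
    have "B = B * (A * C)" using C(2) Bc by simp
    also have "\<dots> = C" using B(3) Cc assoc_mult_mat[OF Bc Ac Cc] by simp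
    finally show ?thesis using C(1) by simp
  qed
  then have "B \<in> UDc" unfolding UD_carrier_def by blast
  then show "\<exists>B\<in>UDc. A * B = 1\<^sub>m n \<and> B * A = 1\<^sub>m n" using B by blast
qed

text \<open>A single denominator is essential: separate ones would rescale the coefficients
  differently and destroy their equality.\<close>

lemma Q_common_denominator:
  assumes "set xs \<subseteq> Q"
  shows "\<exists>c. evL c \<noteq> 0 \<and> c \<cdot>\<^sub>m 1\<^sub>m n \<in> R \<and> (\<forall>x\<in>set xs. \<exists>A\<in>R. evL c \<cdot>\<^sub>m x = map_mat evL A)"
  using assms
proof (induction xs)
  case Nil
  interpret i: comm_ring_hom \<iota> by (rule \<iota>)
  have "const 1 \<cdot>\<^sub>m 1\<^sub>m n \<in> R" "evL (const 1) \<noteq> 0"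
    unfolding ev_const[OF \<iota>] by (rule R_closed) simp
  then show ?case by (intro exI[of _ "const 1"]) simp
next
  case (Cons x xs)
  interpret h: comm_ring_hom evL by (rule evL_hom)
  obtain c where c: "evL c \<noteq> 0" "c \<cdot>\<^sub>m 1\<^sub>m n \<in> R" "\<And>y. y \<in> set xs \<Longrightarrow> \<exists>A\<in>R. evL c \<cdot>\<^sub>m y = map_mat evL A"
    using Cons by auto
  obtain A d where d: "A \<in> R" "d \<cdot>\<^sub>m 1\<^sub>m n \<in> R" "evL d \<noteq> 0" "evL d \<cdot>\<^sub>m x = map_mat evL A"
    using Cons.prems by (auto simp: Q_def)
  have "\<exists>A\<in>R. evL (c * d) \<cdot>\<^sub>m y = map_mat evL A" if "y \<in> set (x # xs)" for y
  proof (cases "y = x")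
    case True
    have "evL (c * d) \<cdot>\<^sub>m x = map_mat evL (c \<cdot>\<^sub>m A)"
      unfolding evL_smult d(4)[symmetric] by (simp add: h.hom_mult smult_smult)
    then show ?thesis using True R_closed(4)[OF c(2) d(1)] by blast
  next
    case False
    then obtain B where B: "B \<in> R" "evL c \<cdot>\<^sub>m y = map_mat evL B" using c(3) \<open>y \<in> set (x # xs)\<close> by auto
    have "evL (c * d) \<cdot>\<^sub>m y = map_mat evL (d \<cdot>\<^sub>m B)"
      unfolding evL_smult B(2)[symmetric] by (simp add: h.hom_mult smult_smult mult.commute)
    then show ?thesis using R_closed(4)[OF d(2) B(1)] by blast
  qed
  moreover have "(c * d) \<cdot>\<^sub>m 1\<^sub>m n \<in> R" using R_closed(4)[OF c(2) d(2)] by (simp add: smult_smult)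
  moreover have "evL (c * d) \<noteq> 0" using c(1) d(3) by (simp add: h.hom_mult)
  ultimately show ?case by blast
qed

text \<open>Clearing the common denominator rescales a homogeneous system. Its equations then hold
  at every point, where \<open>D0_system\<close> gives zero; hence the numerators vanish at the
  generic entries.\<close>

theorem Q_system:
  assumes xs: "set xs \<subseteq> Q" "length xs = m" and m: "sqf n dvd m"
    and i: "1 \<le> i" "i \<le> n" "sqf n dvd i" and j: "j \<le> n"
    and eq: "\<And>x y. x \<in> set xs \<Longrightarrow> y \<in> set xs \<Longrightarrow>
      poly.coeff (char_poly x) (n - i) = poly.coeff (char_poly y) (n - i)"
    and zero: "poly.coeff (char_poly (foldr (*) xs (1\<^sub>m n))) (n - j) = 0"
  shows "\<forall>x\<in>set xs. x = 0\<^sub>m n n"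
proof -
  interpret h: comm_ring_hom evL by (rule evL_hom)
  have xc: "set xs \<subseteq> carrier_mat n n" using xs by (auto simp: Q_def)
  obtain c where c: "evL c \<noteq> 0" "\<forall>x\<in>set xs. \<exists>A. A \<in> R \<and> evL c \<cdot>\<^sub>m x = map_mat evL A"
    using Q_common_denominator[OF xs(1)] by blast
  from bchoice[OF c(2)] obtain A where
    A: "\<forall>x\<in>set xs. A x \<in> R \<and> evL c \<cdot>\<^sub>m x = map_mat evL (A x)" ..
  have Ac: "A x \<in> carrier_mat n n" if "x \<in> set xs" for x using A that by (simp add: R_def)
  have sg: "evL (poly.coeff (char_poly (A x)) (n - i)) = evL c ^ i * poly.coeff (char_poly x) (n - i)"
    if x: "x \<in> set xs" for x
  proof -
    have "evL (poly.coeff (char_poly (A x)) (n - i)) = poly.coeff (char_poly (evL c \<cdot>\<^sub>m x)) (n - i)"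
      using h.char_poly_hom[OF Ac[OF x]] A x by (simp add: coeff_map_poly)
    then show ?thesis using coeff_char_poly_smult[of x n "n - i" "evL c"] xc x i by auto
  qed
  let ?P = "foldr (*) (map A xs) (1\<^sub>m n)"
  have Pc: "?P \<in> carrier_mat n n" by (rule foldr_mult_carrier) (use Ac in auto)
  have "map_mat evL ?P = foldr (*) (map (map_mat evL) (map A xs)) (1\<^sub>m n)"
    by (rule hom_foldr_mult[OF evL_hom]) (use Ac in auto)
  also have "map (map_mat evL) (map A xs) = map (\<lambda>x. evL c \<cdot>\<^sub>m x) xs" using A by simp
  also have "foldr (*) \<dots> (1\<^sub>m n) = (evL c ^ m) \<cdot>\<^sub>m foldr (*) xs (1\<^sub>m n)"
    using foldr_mult_smult[OF xc] xs(2) by simp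
  finally have "evL (poly.coeff (char_poly ?P) (n - j)) =
      poly.coeff (char_poly ((evL c ^ m) \<cdot>\<^sub>m foldr (*) xs (1\<^sub>m n))) (n - j)"
    using h.char_poly_hom[OF Pc] by (simp add: coeff_map_poly)
  then have zP: "evL (poly.coeff (char_poly ?P) (n - j)) = 0"
    using coeff_char_poly_smult[OF foldr_mult_carrier[OF xc], of "n - j"] zero by simp
  have van: "map_mat (ev \<kappa> u) (A x) = 0\<^sub>m n n" if u: "u \<in> pts" and x: "x \<in> set xs" for u x
  proof -
    interpret g: comm_ring_hom "ev \<kappa> u" by (rule evu_hom)
    let ?As = "map (map_mat (ev \<kappa> u)) (map A xs)"
    have "\<forall>B\<in>set ?As. B = 0\<^sub>m n n"
    proof (rule D0_system[OF _ _ m i j])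
      show "set ?As \<subseteq> D0" using A u by (auto simp: R_def)
      show "length ?As = m" using xs(2) by simp
      show "poly.coeff (char_poly B) (n - i) = poly.coeff (char_poly B') (n - i)"
        if B: "B \<in> set ?As" "B' \<in> set ?As" for B B'
      proof -
        obtain y y' where y: "y \<in> set xs" "B = map_mat (ev \<kappa> u) (A y)"
          "y' \<in> set xs" "B' = map_mat (ev \<kappa> u) (A y')" using B by auto
        have "evL (poly.coeff (char_poly (A y)) (n - i) - poly.coeff (char_poly (A y')) (n - i)) = 0"
          using sg[OF y(1)] sg[OF y(3)] eq[OF y(1,3)] by (simp add: h.hom_minus)
        from evu_of_evL[OF this u] show ?thesis
          unfolding y(2,4) g.char_poly_hom[OF Ac[OF y(1)]] g.char_poly_hom[OF Ac[OF y(3)]]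
          by (simp add: coeff_map_poly g.hom_minus)
      qed
      have "foldr (*) ?As (1\<^sub>m n) = map_mat (ev \<kappa> u) ?P"
        by (rule hom_foldr_mult[OF evu_hom, symmetric]) (use Ac in auto)
      then show "poly.coeff (char_poly (foldr (*) ?As (1\<^sub>m n))) (n - j) = 0"
        using evu_of_evL[OF zP u] g.char_poly_hom[OF Pc] by (simp add: coeff_map_poly)
    qed
    then show ?thesis using x by auto
  qed
  show ?thesis
  proof
    fix x assume x: "x \<in> set xs"
    have "evL (A x $$ (a, b)) = 0" if ab: "a < n" "b < n" for a b
    proof (rule evL_of_evu)
      fix u assume "u \<in> pts"
      then have "map_mat (ev \<kappa> u) (A x) $$ (a, b) = 0\<^sub>m n n $$ (a, b)" using van[OF _ x] by simp
      then show "ev \<kappa> u (A x $$ (a, b)) = 0" using ab Ac[OF x] by simp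
    qed
    then have "map_mat evL (A x) = 0\<^sub>m n n" using Ac[OF x] by (intro eq_matI) auto
    then have "inverse (evL c) \<cdot>\<^sub>m (evL c \<cdot>\<^sub>m x) = inverse (evL c) \<cdot>\<^sub>m 0\<^sub>m n n" using A x by simp
    then have "x = inverse (evL c) \<cdot>\<^sub>m 0\<^sub>m n n" using c(1) by (simp add: smult_smult one_smult)
    then show "x = 0\<^sub>m n n" by (auto intro: eq_matI)
  qed
qed

end

section \<open>The universal division algebra\<close>

text \<open>The \<open>n * n\<close> products of powers that will serve as a basis; the quotient and
  the remainder of the index are the two exponents.\<close>

definition word :: "'a::comm_ring_1 mat \<Rightarrow> 'a mat \<Rightarrow> nat \<Rightarrow> nat \<Rightarrow> 'a mat" where
  "word A B n r = A ^\<^sub>m (r div n) * B ^\<^sub>m (r mod n)"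

definition word_stack :: "'a::comm_ring_1 mat \<Rightarrow> 'a mat \<Rightarrow> nat \<Rightarrow> 'a mat" where
  "word_stack A B n = mat (n * n) (n * n) (\<lambda>(y, r). word A B n r $$ (y mod n, y div n))"

lemma word_carrier: "A \<in> carrier_mat n n \<Longrightarrow> B \<in> carrier_mat n n \<Longrightarrow> word A B n r \<in> carrier_mat n n"
  unfolding word_def by (rule mult_carrier_mat[OF pow_carrier_mat pow_carrier_mat])

lemma hom_word:
  assumes h: "comm_ring_hom h" and c: "A \<in> carrier_mat n n" "B \<in> carrier_mat n n"
  shows "map_mat h (word A B n r) = word (map_mat h A) (map_mat h B) n r"
proof -
  interpret comm_ring_hom h by fact
  show ?thesis unfolding word_def
    using mat_hom_mult[OF pow_carrier_mat[OF c(1)] pow_carrier_mat[OF c(2)]] mat_hom_pow[OF c(1)] mat_hom_pow[OF c(2)]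
    by simp
qed

lemma hom_word_stack:
  assumes h: "comm_ring_hom h" and c: "A \<in> carrier_mat n n" "B \<in> carrier_mat n n" and n: "0 < n"
  shows "map_mat h (word_stack A B n) = word_stack (map_mat h A) (map_mat h B) n"
proof (rule eq_matI)
  fix y r assume "y < dim_row (word_stack (map_mat h A) (map_mat h B) n)"
    "r < dim_col (word_stack (map_mat h A) (map_mat h B) n)"
  then have yr: "y < n * n" "r < n * n" by (auto simp: word_stack_def)
  then have "y mod n < n" "y div n < n" using n by (auto simp: div_less_iff_less_mult)
  then show "map_mat h (word_stack A B n) $$ (y, r) = word_stack (map_mat h A) (map_mat h B) n $$ (y, r)"
    using yr word_carrier[OF c, of r] by (simp add: word_stack_def hom_word[OF h c, symmetric])
qed (simp_all add: word_stack_def)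

lemma diag_pow:
  fixes d :: "nat \<Rightarrow> 'a::comm_ring_1"
  shows "mat n n (\<lambda>(i, j). if i = j then d i else 0) ^\<^sub>m k = mat n n (\<lambda>(i, j). if i = j then d i ^ k else 0)"
proof (induction k)
  case 0
  show ?case by (rule eq_matI) auto
next
  case (Suc k)
  let ?A = "\<lambda>k. mat n n (\<lambda>(i, j). if i = j then d i ^ k else 0)"
  have c: "?A k \<in> carrier_mat n n" for k by simp
  have "?A k * ?A 1 = ?A (Suc k)"
  proof (rule eq_matI)
    fix i j assume "i < dim_row (?A (Suc k))" "j < dim_col (?A (Suc k))"
    then have ij: "i < n" "j < n" by auto
    have "(?A k * ?A 1) $$ (i, j) = (\<Sum>l<n. if l = i then (if i = j then d i ^ k * d i else 0) else 0)"
      unfolding index_mult_sum[OF c c ij] using ij by (intro sum.cong) auto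
    then show "(?A k * ?A 1) $$ (i, j) = ?A (Suc k) $$ (i, j)" using ij by (simp add: mult.commute)
  qed auto
  then have "?A k * mat n n (\<lambda>(i, j). if i = j then d i else 0) = ?A (Suc k)"
    by (simp only: power_one_right)
  then show ?case unfolding pow_mat.simps Suc .
qed

lemma cyclic_pow:
  fixes n :: nat
  assumes n: "0 < n"
  shows "mat n n (\<lambda>(i, j). if j = (i + 1) mod n then 1 else 0 :: 'a::comm_ring_1) ^\<^sub>m k =
    mat n n (\<lambda>(i, j). if j = (i + k) mod n then 1 else 0)"
proof (induction k)
  case 0
  show ?case by (rule eq_matI) auto
next
  case (Suc k)
  let ?A = "\<lambda>k. mat n n (\<lambda>(i, j). if j = (i + k) mod n then 1 else 0 :: 'a)"
  have c: "?A k \<in> carrier_mat n n" for k by simp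
  have "?A k * ?A 1 = ?A (Suc k)"
  proof (rule eq_matI)
    fix i j assume "i < dim_row (?A (Suc k))" "j < dim_col (?A (Suc k))"
    then have ij: "i < n" "j < n" by auto
    have "(?A k * ?A 1) $$ (i, j) = (\<Sum>l<n. if l = (i + k) mod n then (if j = (l + 1) mod n then 1 else 0) else 0)"
      unfolding index_mult_sum[OF c c ij] using ij by (intro sum.cong) auto
    also have "\<dots> = (if j = ((i + k) mod n + 1) mod n then 1 else 0)" using n by simp
    also have "\<dots> = ?A (Suc k) $$ (i, j)" using ij by (simp add: mod_simps)
    finally show "(?A k * ?A 1) $$ (i, j) = ?A (Suc k) $$ (i, j)" .
  qed auto
  then show ?case using Suc by simp
qed

text \<open>A Vandermonde argument: a kernel vector yields, for each power of the cyclic matrix, a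
  polynomial of degree below \<open>n\<close> that vanishes at the \<open>n\<close> distinct
  diagonal entries.\<close>

lemma det_word_stack_nonzero:
  fixes d :: "nat \<Rightarrow> 'a::idom"
  assumes n: "0 < n" and d: "inj_on d {..<n}"
  shows "det (word_stack (mat n n (\<lambda>(i, j). if i = j then d i else 0))
    (mat n n (\<lambda>(i, j). if j = (i + 1) mod n then 1 else 0)) n) \<noteq> 0"
proof
  let ?A = "mat n n (\<lambda>(i, j). if i = j then d i else 0)"
  let ?B = "mat n n (\<lambda>(i, j). if j = (i + 1) mod n then 1 else 0 :: 'a)"
  let ?W = "word_stack ?A ?B n"
  have W: "?W \<in> carrier_mat (n * n) (n * n)" by (simp add: word_stack_def)
  assume "det ?W = 0"
  then obtain v where v: "v \<in> carrier_vec (n * n)" "v \<noteq> 0\<^sub>v (n * n)" "?W *\<^sub>v v = 0\<^sub>v (n * n)"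
    using det_0_iff_vec_prod_zero[OF W] by blast
  have w: "word ?A ?B n r $$ (i, j) = (if j = (i + r mod n) mod n then d i ^ (r div n) else 0)"
    if "i < n" "j < n" for i j r
  proof -
    have c: "mat n n (\<lambda>(i, j). if i = j then d i ^ k else 0) \<in> carrier_mat n n"
      "mat n n (\<lambda>(i, j). if j = (i + k) mod n then 1 else 0 :: 'a) \<in> carrier_mat n n" for k by auto
    have "word ?A ?B n r $$ (i, j) = (\<Sum>l<n. if l = i then (if j = (i + r mod n) mod n then d i ^ (r div n) else 0) else 0)"
      unfolding word_def diag_pow cyclic_pow[OF n] index_mult_sum[OF c that]
      using that by (intro sum.cong) auto
    then show ?thesis using that by simp
  qed
  have zero: "v $ (a * n + b) = 0" if ab: "a < n" "b < n" for a b
  proof -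
    define q where "q = (\<Sum>a<n. Polynomial.monom (v $ (a * n + b)) a)"
    have root: "poly q (d i) = 0" if i: "i < n" for i
    proof -
      \<comment> \<open>The column in which the \<open>b\<close>-th power of the cyclic matrix has
        its entry of row \<open>i\<close>; so row \<open>i\<close> and column \<open>j\<close>
        single out the words with second exponent \<open>b\<close>.\<close>
      define j where "j = (i + b) mod n"
      define y where "y = j * n + i"
      have j: "j < n" using n by (simp add: j_def)
      then have "y div n < n" using i n by (simp add: y_def)
      then have y: "y < n * n" using n by (simp only: div_less_iff_less_mult)
      have ym: "y mod n = i" "y div n = j" using i j by (auto simp: y_def)
      have "0 = (?W *\<^sub>v v) $ y" using v(3) y by simp
      also have "\<dots> = (\<Sum>r = 0..<n * n. ?W $$ (y, r) * v $ r)"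
        using W y v(1) by (auto simp: scalar_prod_def intro!: sum.cong)
      also have "\<dots> = (\<Sum>r<n * n. (if r mod n = b then d i ^ (r div n) else 0) * v $ ((r div n) * n + r mod n))"
        unfolding atLeast0LessThan
      proof (rule sum.cong[OF refl])
        fix r assume r: "r \<in> {..<n * n}"
        have "j = (i + r mod n) mod n \<longleftrightarrow> [i + b = i + r mod n] (mod n)" by (auto simp: j_def cong_def)
        also have "\<dots> \<longleftrightarrow> [b = r mod n] (mod n)" by (rule cong_add_lcancel_nat)
        also have "\<dots> \<longleftrightarrow> r mod n = b" using ab by (auto simp: cong_def)
        finally show "?W $$ (y, r) * v $ r = (if r mod n = b then d i ^ (r div n) else 0) * v $ ((r div n) * n + r mod n)"
          using y r w[OF i j, of r] by (simp add: word_stack_def ym)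
      qed
      also have "\<dots> = (\<Sum>x<n. \<Sum>y<n. (if y = b then d i ^ x else 0) * v $ (x * n + y))"
        by (rule sum_pairs[OF n])
      also have "\<dots> = (\<Sum>x<n. \<Sum>y<n. if y = b then d i ^ x * v $ (x * n + y) else 0)"
        by (intro sum.cong refl) simp
      also have "\<dots> = (\<Sum>x<n. d i ^ x * v $ (x * n + b))" using ab by simp
      also have "\<dots> = poly q (d i)" by (simp add: q_def poly_sum poly_monom mult.commute)
      finally show ?thesis by simp
    qed
    have cq: "poly.coeff q a = (if a < n then v $ (a * n + b) else 0)" for a
      unfolding q_def by (auto simp: coeff_sum if_distrib sum.delta cong: if_cong)
    have "q = 0"
    proof (rule ccontr)
      assume q: "q \<noteq> 0"
      have "card (d ` {..<n}) \<le> card {x. poly q x = 0}"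
        by (rule card_mono) (use q root in \<open>auto simp: poly_roots_finite\<close>)
      also have "\<dots> \<le> degree q" using q by (rule card_poly_roots_bound)
      also have "degree q \<le> n - 1" by (rule degree_le) (auto simp: cq)
      finally show False using card_image[OF d] n by simp
    qed
    then show ?thesis using cq[of a] ab by simp
  qed
  have "v = 0\<^sub>v (n * n)"
  proof (rule eq_vecI)
    fix r assume r: "r < dim_vec (0\<^sub>v (n * n) :: 'a vec)"
    then have "r div n < n" "r mod n < n" using n by (auto simp: div_less_iff_less_mult)
    then show "v $ r = 0\<^sub>v (n * n) $ r" using zero[of "r div n" "r mod n"] r by simp
  qed (use v(1) in simp)
  then show False using v(2) by simp
qed

section \<open>A basis of words and the splitting of UD(n)\<close>

context generic_matrices
begin

abbreviation "GS \<equiv> mat n n (\<lambda>(a, b). gs a b)"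
abbreviation "GT \<equiv> mat n n (\<lambda>(a, b). gt a b)"

text \<open>The determinant is a polynomial in the generic entries, so one specialization at which
  it is nonzero suffices.\<close>

lemma det_generic_words: "det (word_stack GS GT n) \<noteq> 0"
proof
  let ?S = "mat n n (\<lambda>(a, b). var (Inl (a, b))) :: (((nat \<times> nat) + (nat \<times> nat) \<Rightarrow>\<^sub>0 nat) \<Rightarrow>\<^sub>0 'k) mat"
  let ?T = "mat n n (\<lambda>(a, b). var (Inr (a, b))) :: (((nat \<times> nat) + (nat \<times> nat) \<Rightarrow>\<^sub>0 nat) \<Rightarrow>\<^sub>0 'k) mat"
  let ?W = "word_stack ?S ?T n"
  interpret L: comm_ring_hom evL by (rule evL_hom)
  have c: "?S \<in> carrier_mat n n" "?T \<in> carrier_mat n n" by auto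
  have "map_mat evL ?S = GS" "map_mat evL ?T = GT"
    by (auto intro!: eq_matI simp: ev_var[OF \<iota>] x0_def simp del: One_nat_def)
  then have "map_mat evL ?W = word_stack GS GT n" using hom_word_stack[OF evL_hom c n_pos] by simp
  moreover assume "det (word_stack GS GT n) = 0"
  ultimately have "evL (det ?W) = 0" using L.hom_det[of ?W] by simp
  let ?c = "const :: 'k \<Rightarrow> (nat \<Rightarrow>\<^sub>0 nat) \<Rightarrow>\<^sub>0 'k"
  \<comment> \<open>The test point: a diagonal matrix of distinct variables and the cyclic
    permutation matrix.\<close>
  define u :: "(nat \<times> nat) + (nat \<times> nat) \<Rightarrow> (nat \<Rightarrow>\<^sub>0 nat) \<Rightarrow>\<^sub>0 'k" where
    "u v = (case v of Inl (a, b) \<Rightarrow> if a = b then var a else 0 | Inr (a, b) \<Rightarrow> if b = (a + 1) mod n then 1 else 0)" for v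
  let ?e = "ev ?c (\<lambda>v. if v \<in> V then u v else 0)"
  have h: "comm_ring_hom ?e" by (rule ev_hom[OF const_hom])
  interpret E: comm_ring_hom ?e by (rule h)
  have "map_mat ?e ?S = mat n n (\<lambda>(i, j). if i = j then var i else 0)"
    "map_mat ?e ?T = mat n n (\<lambda>(i, j). if j = (i + 1) mod n then 1 else 0)"
    by (auto intro!: eq_matI simp: ev_var[OF const_hom] u_def simp del: One_nat_def)
  then have "map_mat ?e ?W = word_stack (mat n n (\<lambda>(i, j). if i = j then var i else 0))
      (mat n n (\<lambda>(i, j). if j = (i + 1) mod n then 1 else 0)) n"
    using hom_word_stack[OF h c n_pos] by simp
  note W = this
  have "inj_on (var :: nat \<Rightarrow> (nat \<Rightarrow>\<^sub>0 nat) \<Rightarrow>\<^sub>0 'k) {..<n}"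
  proof (rule inj_onI)
    fix a b :: nat assume "(var a :: (nat \<Rightarrow>\<^sub>0 nat) \<Rightarrow>\<^sub>0 'k) = var b"
    then have "keys (var a :: (nat \<Rightarrow>\<^sub>0 nat) \<Rightarrow>\<^sub>0 'k) = keys (var b :: (nat \<Rightarrow>\<^sub>0 nat) \<Rightarrow>\<^sub>0 'k)" by (rule arg_cong)
    then have "Poly_Mapping.single a 1 = (Poly_Mapping.single b 1 :: nat \<Rightarrow>\<^sub>0 nat)" by (simp del: One_nat_def)
    then have "keys (Poly_Mapping.single a 1 :: nat \<Rightarrow>\<^sub>0 nat) = keys (Poly_Mapping.single b 1 :: nat \<Rightarrow>\<^sub>0 nat)"
      by (rule arg_cong)
    then show "a = b" by (simp del: One_nat_def)
  qed
  note inj = this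
  have "det (map_mat ?e ?W) \<noteq> 0"
    unfolding W by (rule det_word_stack_nonzero[OF n_pos inj])
  then have "?e (det ?W) \<noteq> 0" unfolding E.hom_det .
  then show False using ev_of_evL[OF \<open>evL (det ?W) = 0\<close>] by blast
qed

lemma UD_division_span: "division_span \<iota> n UDc (word GS GT n)"
proof (rule division_span.intro)
  show "0 < n" by (rule n_pos)
  show "division_subalgebra \<iota> n UDc" by (rule UD_division)
  have pw: "A ^\<^sub>m k \<in> UDc" if "A \<in> UDc" for A k
  proof (induction k)
    case 0
    interpret i: comm_ring_hom \<iota> by (rule \<iota>)
    have "\<iota> 1 \<cdot>\<^sub>m 1\<^sub>m n \<in> UDc" using UD_division unfolding division_subalgebra_def by blast
    moreover have "A \<in> carrier_mat n n" using that UD_division unfolding division_subalgebra_def by blast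
    ultimately show ?case by (simp add: one_smult)
  next
    case (Suc k)
    then show ?case using that UD_division unfolding division_subalgebra_def by simp
  qed
  show "word GS GT n r \<in> UDc" for r
    unfolding word_def using pw UD_generators UD_division unfolding division_subalgebra_def by blast
  show "\<exists>g. M = mlin n {..<n * n} g (word GS GT n)" if "M \<in> carrier_mat n n" for M
    using det_generic_words that unfolding word_stack_def by (intro span_of_det n_pos)
  show "comm_ring_hom \<iota>" by (rule \<iota>)
qed

abbreviation "UDr \<equiv> UD \<iota> n gs gt"

lemma UD_simps:
  "carrier UDr = UDc" "x \<otimes>\<^bsub>UDr\<^esub> y = x * y" "x \<oplus>\<^bsub>UDr\<^esub> y = x + y" "\<one>\<^bsub>UDr\<^esub> = 1\<^sub>m n" "\<zero>\<^bsub>UDr\<^esub> = 0\<^sub>m n n"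
  by (simp_all add: UD_def ring_mat_def)

lemma UD_ring: "ring UDr"
proof -
  interpret D: division_span \<iota> n UDc "word GS GT n" by (rule UD_division_span)
  interpret M: ring "ring_mat TYPE('l) n ()" by (rule ring_mat)
  have "subring UDc (ring_mat TYPE('l) n ())"
  proof (rule M.subringI)
    show "UDc \<subseteq> carrier (ring_mat TYPE('l) n ())" using D.D_carrier by (auto simp: ring_mat_simps)
    have "1 \<cdot>\<^sub>m 1\<^sub>m n \<in> UDc" using D.F_closed(2) by (simp add: D.F_def)
    then show "\<one>\<^bsub>ring_mat TYPE('l) n ()\<^esub> \<in> UDc" by (simp add: ring_mat_simps one_smult)
    fix h assume h: "h \<in> UDc"
    have hc: "h \<in> carrier_mat n n" by (rule D.D_carrier[OF h])
    have "(- 1) \<cdot>\<^sub>m h + h = 0\<^sub>m n n" using hc by (intro eq_matI) auto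
    then have "\<ominus>\<^bsub>ring_mat TYPE('l) n ()\<^esub> h = (- 1) \<cdot>\<^sub>m h"
      using hc by (intro M.minus_equality) (auto simp: ring_mat_simps)
    then show "\<ominus>\<^bsub>ring_mat TYPE('l) n ()\<^esub> h \<in> UDc"
      using D.F_smult[OF D.F_closed(5)[OF D.F_closed(2)] h] by simp
    fix h' assume h': "h' \<in> UDc"
    show "h \<otimes>\<^bsub>ring_mat TYPE('l) n ()\<^esub> h' \<in> UDc" "h \<oplus>\<^bsub>ring_mat TYPE('l) n ()\<^esub> h' \<in> UDc"
      using D.D_mult[OF h h'] D.D_add[OF h h'] by (simp_all add: ring_mat_simps)
  qed
  then show ?thesis unfolding UD_def by (rule M.subring_is_ring)
qed

text \<open>The splitting is the inclusion into matrices over the closure. The words still span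
  there because their determinant is nonzero, and \<open>coordinates\<close> makes the coordinates
  of elements of the algebra central.\<close>

lemma UD_explicit_splitting: "explicit_splitting UDr n (map_mat to_ac) (word GS GT n)"
proof (rule explicit_splitting.intro)
  interpret D: division_span \<iota> n UDc "word GS GT n" by (rule UD_division_span)
  interpret ac: comm_ring_hom "to_ac :: 'l \<Rightarrow> 'l alg_closure" by (rule to_ac_hom)
  note cm = carrier_matD[OF D.D_carrier]
  have inj: "inj_on (map_mat (to_ac :: 'l \<Rightarrow> 'l alg_closure)) UDc"
  proof (rule inj_onI)
    fix x y :: "'l mat" assume xy: "x \<in> UDc" "y \<in> UDc" and e: "map_mat to_ac x = (map_mat to_ac y :: 'l alg_closure mat)"
    show "x = y"
    proof (rule eq_matI)
      fix i j assume ij: "i < dim_row y" "j < dim_col y"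
      then have "map_mat to_ac x $$ (i, j) = (map_mat to_ac y $$ (i, j) :: 'l alg_closure)" using e by simp
      then show "x $$ (i, j) = y $$ (i, j)" using ij cm[OF xy(1)] cm[OF xy(2)] by simp
    qed (use cm[OF xy(1)] cm[OF xy(2)] in auto)
  qed
  show "ring UDr" by (rule UD_ring)

  show "0 < n" by (rule n_pos)
  show "map_mat (to_ac :: 'l \<Rightarrow> 'l alg_closure) \<in> Ring.ring_hom UDr (ring_mat TYPE('l alg_closure) n ())"
  proof (rule ring_hom_memI)
    fix x y assume "x \<in> carrier UDr" "y \<in> carrier UDr"
    then have c: "x \<in> carrier_mat n n" "y \<in> carrier_mat n n" using D.D_carrier by (auto simp: UD_simps)
    show "map_mat to_ac x \<in> carrier (ring_mat TYPE('l alg_closure) n ())" using c by (simp add: ring_mat_simps)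
    show "map_mat to_ac (x \<otimes>\<^bsub>UDr\<^esub> y) = map_mat to_ac x \<otimes>\<^bsub>ring_mat TYPE('l alg_closure) n ()\<^esub> map_mat to_ac y"
      unfolding UD_simps ring_mat_simps by (rule ac.mat_hom_mult[OF c])
    show "map_mat to_ac (x \<oplus>\<^bsub>UDr\<^esub> y) = map_mat to_ac x \<oplus>\<^bsub>ring_mat TYPE('l alg_closure) n ()\<^esub> map_mat to_ac y"
      unfolding UD_simps ring_mat_simps by (rule eq_matI) (use c in auto)
  next
    show "map_mat to_ac \<one>\<^bsub>UDr\<^esub> = \<one>\<^bsub>ring_mat TYPE('l alg_closure) n ()\<^esub>"
      unfolding UD_simps ring_mat_simps by (rule ac.mat_hom_one)
  qed
  show "inj_on (map_mat (to_ac :: 'l \<Rightarrow> 'l alg_closure)) (carrier UDr)" unfolding UD_simps by (rule inj)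
  show "word GS GT n r \<in> carrier UDr" if "r < n * n" for r using D.b[OF that] by (simp add: UD_simps)
  show "\<exists>g. \<forall>i<n. \<forall>j<n. M $$ (i, j) = (\<Sum>r<n * n. g r * map_mat to_ac (word GS GT n r) $$ (i, j))"
    if M: "M \<in> carrier_mat n n" for M :: "'l alg_closure mat"
  proof -
    have G: "GS \<in> carrier_mat n n" "GT \<in> carrier_mat n n" by auto
    have "to_ac (det (word_stack GS GT n)) \<noteq> (0 :: 'l alg_closure)" using det_generic_words by simp
    then have "det (word_stack (map_mat to_ac GS) (map_mat to_ac GT) n) \<noteq> (0 :: 'l alg_closure)"
      unfolding hom_word_stack[OF to_ac_hom G n_pos, symmetric] by simp
    then obtain g where "M = mlin n {..<n * n} g (word (map_mat to_ac GS) (map_mat to_ac GT) n)"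
      using span_of_det[OF n_pos _ M] unfolding word_stack_def by blast
    then show ?thesis unfolding hom_word[OF to_ac_hom G] by (intro exI[of _ g]) simp
  qed
  show "\<exists>f. (\<forall>r<n * n. \<exists>c\<in>carrier UDr. map_mat to_ac c = f r \<cdot>\<^sub>m 1\<^sub>m n) \<and>
      (\<forall>i<n. \<forall>j<n. map_mat to_ac a $$ (i, j) = (\<Sum>r<n * n. f r * map_mat to_ac (word GS GT n r) $$ (i, j)))"
    if a: "a \<in> carrier UDr" for a
  proof -
    have aU: "a \<in> UDc" using a by (simp add: UD_simps)
    obtain g where g: "a = mlin n {..<n * n} g (word GS GT n)" using D.span[OF D.D_carrier[OF aU]] by blast
    obtain c where c: "\<forall>r\<in>{..<n * n}. c r \<in> D.F" "a = mlin n {..<n * n} c (word GS GT n)"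
      using D.coordinates[OF _ aU _ g] D.b by auto
    have 1: "\<exists>y\<in>carrier UDr. map_mat to_ac y = to_ac (c r) \<cdot>\<^sub>m (1\<^sub>m n :: 'l alg_closure mat)" if "r < n * n" for r
    proof (rule bexI[of _ "c r \<cdot>\<^sub>m 1\<^sub>m n"])
      show "map_mat to_ac (c r \<cdot>\<^sub>m 1\<^sub>m n) = to_ac (c r) \<cdot>\<^sub>m (1\<^sub>m n :: 'l alg_closure mat)"
        by (rule eq_matI) auto
      show "c r \<cdot>\<^sub>m 1\<^sub>m n \<in> carrier UDr" using c(1) that by (auto simp: UD_simps D.F_def)
    qed
    have "map_mat to_ac a $$ (i, j) = (\<Sum>r<n * n. to_ac (c r) * map_mat to_ac (word GS GT n r) $$ (i, j))"
      if ij: "i < n" "j < n" for i j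
    proof -
      have "map_mat to_ac a $$ (i, j) = to_ac (a $$ (i, j))" using ij cm[OF aU] by simp
      also have "a $$ (i, j) = (\<Sum>r<n * n. c r * word GS GT n r $$ (i, j))" by (subst c(2)) (use ij in simp)
      also have "to_ac \<dots> = (\<Sum>r<n * n. to_ac (c r) * map_mat to_ac (word GS GT n r) $$ (i, j))"
        unfolding to_ac_sum
      proof (rule sum.cong[OF refl])
        fix r
        have "word GS GT n r \<in> carrier_mat n n" by (rule word_carrier) auto
        then show "to_ac (c r * word GS GT n r $$ (i, j)) = to_ac (c r) * map_mat to_ac (word GS GT n r) $$ (i, j)"
          using ij by simp
      qed
      finally show ?thesis .
    qed
    then show ?thesis using 1 by (intro exI[of _ "\<lambda>r. to_ac (c r)"]) blast
  qed
  show "\<exists>d\<in>carrier UDr. map_mat to_ac d = inverse f \<cdot>\<^sub>m (1\<^sub>m n :: 'l alg_closure mat)"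
    if c: "c \<in> carrier UDr" and f: "map_mat to_ac c = f \<cdot>\<^sub>m (1\<^sub>m n :: 'l alg_closure mat)" "f \<noteq> 0" for c f
  proof -
    have cU: "c \<in> UDc" using c by (simp add: UD_simps)
    have e: "to_ac (c $$ (i, j)) = (if i = j then f else 0)" if "i < n" "j < n" for i j
      using arg_cong[OF f(1), of "\<lambda>M. M $$ (i, j)"] that cm[OF cU] by simp
    define f' where "f' = c $$ (0, 0)"
    have ff: "to_ac f' = f" using e[of 0 0] n_pos by (simp add: f'_def)
    have "c = f' \<cdot>\<^sub>m 1\<^sub>m n"
    proof (rule eq_matI)
      fix i j assume "i < dim_row (f' \<cdot>\<^sub>m 1\<^sub>m n)" "j < dim_col (f' \<cdot>\<^sub>m 1\<^sub>m n)"
      then have ij: "i < n" "j < n" by auto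
      have "to_ac (c $$ (i, j)) = to_ac ((f' \<cdot>\<^sub>m 1\<^sub>m n) $$ (i, j))" using e[OF ij] ij ff by simp
      then show "c $$ (i, j) = (f' \<cdot>\<^sub>m 1\<^sub>m n) $$ (i, j)" by (simp only: to_ac_eq_iff)
    qed (use cm[OF cU] in auto)
    then have "f' \<in> D.F" using cU by (simp add: D.F_def)
    then have "inverse f' \<cdot>\<^sub>m 1\<^sub>m n \<in> UDc" using D.F_closed(6) by (simp add: D.F_def)
    moreover have "map_mat to_ac (inverse f' \<cdot>\<^sub>m 1\<^sub>m n) = inverse f \<cdot>\<^sub>m (1\<^sub>m n :: 'l alg_closure mat)"
      by (rule eq_matI) (auto simp: ff)
    ultimately show ?thesis by (auto simp: UD_simps)
  qed
qed

text \<open>Under this splitting the reduced coefficients are the ordinary characteristic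
  coefficients of the matrices, so \<open>Q_system\<close> applies.\<close>

theorem UD_system:
  assumes i: "i \<in> {1..n}" "sqf n dvd i" and j: "j \<in> {1..n}" and m: "sqf n dvd length xs"
    and xs: "set xs \<subseteq> carrier UDr" and sol: "solves_system TYPE('l alg_closure) UDr n i j xs"
  shows "\<forall>x\<in>set xs. x = \<zero>\<^bsub>UDr\<^esub>"
proof -
  interpret E: explicit_splitting UDr n "map_mat (to_ac :: 'l \<Rightarrow> 'l alg_closure)" "word GS GT n"
    by (rule UD_explicit_splitting)
  interpret D: division_span \<iota> n UDc "word GS GT n" by (rule UD_division_span)
  interpret ac: comm_ring_hom "to_ac :: 'l \<Rightarrow> 'l alg_closure" by (rule to_ac_hom)
  let ?\<sigma> = "reduced_sigma TYPE('l alg_closure) UDr n"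
  have sg: "map_mat to_ac (?\<sigma> k x) = to_ac (poly.coeff (char_poly x) (n - k)) \<cdot>\<^sub>m (1\<^sub>m n :: 'l alg_closure mat)"
    if "x \<in> carrier UDr" for k x
    using E.reduced_sigma(2)[OF of_nat_n that, of "TYPE('l alg_closure)" k]
      ac.char_poly_hom[of x n] D.D_carrier[of x] that by (simp add: UD_simps coeff_map_poly)
  have "foldr (\<otimes>\<^bsub>UDr\<^esub>) ys \<one>\<^bsub>UDr\<^esub> \<in> carrier UDr \<and> foldr (\<otimes>\<^bsub>UDr\<^esub>) ys \<one>\<^bsub>UDr\<^esub> = foldr (*) ys (1\<^sub>m n)"
    if "set ys \<subseteq> carrier UDr" for ys
    using that
  proof (induction ys)
    case Nil
    then show ?case using E.one_closed by (simp add: UD_simps)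
  next
    case (Cons y ys)
    have ys: "set ys \<subseteq> carrier UDr" and y: "y \<in> carrier UDr" using Cons.prems by simp_all
    note IH = conjunct1[OF Cons.IH[OF ys]] conjunct2[OF Cons.IH[OF ys]]
    show ?case using E.m_closed[OF y IH(1)] IH(2) by (simp add: UD_simps(2))
  qed
  note fold = this[OF xs]
  have "\<forall>x\<in>set xs. x = 0\<^sub>m n n"
  proof (rule Q_system)
    show "set xs \<subseteq> Q" using order_trans[OF xs[unfolded UD_simps] UD_subset] .
    show "length xs = length xs" ..
    show "sqf n dvd length xs" "sqf n dvd i" "1 \<le> i" "i \<le> n" "j \<le> n" using i j m by auto
    show "poly.coeff (char_poly x) (n - i) = poly.coeff (char_poly y) (n - i)"
      if "x \<in> set xs" "y \<in> set xs" for x y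
    proof -
      have "?\<sigma> i x = ?\<sigma> i y" using sol that unfolding solves_system_def by blast
      then have "to_ac (poly.coeff (char_poly x) (n - i)) \<cdot>\<^sub>m (1\<^sub>m n :: 'l alg_closure mat) =
          to_ac (poly.coeff (char_poly y) (n - i)) \<cdot>\<^sub>m 1\<^sub>m n"
        using sg[of x i, OF subsetD[OF xs that(1)]] sg[of y i, OF subsetD[OF xs that(2)]] by simp
      then have "to_ac (poly.coeff (char_poly x) (n - i)) = to_ac (poly.coeff (char_poly y) (n - i))"
        by (rule smult_one_eqD[OF n_pos])
      then show ?thesis by simp
    qed
    have "?\<sigma> j (foldr (*) xs (1\<^sub>m n)) = \<zero>\<^bsub>UDr\<^esub>"
      using sol unfolding solves_system_def conjunct2[OF fold] by blast
    also have "\<zero>\<^bsub>UDr\<^esub> = 0\<^sub>m n n" by (simp add: UD_simps)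
    finally have sg0: "?\<sigma> j (foldr (*) xs (1\<^sub>m n)) = 0\<^sub>m n n" .
    have hom_zero_mat: "map_mat to_ac (0\<^sub>m n n :: 'l mat) = (0\<^sub>m n n :: 'l alg_closure mat)"
      by (rule eq_matI) auto
    have "to_ac (poly.coeff (char_poly (foldr (*) xs (1\<^sub>m n))) (n - j)) \<cdot>\<^sub>m (1\<^sub>m n :: 'l alg_closure mat) = 0\<^sub>m n n"
      using sg[of "foldr (*) xs (1\<^sub>m n)" j] conjunct1[OF fold, unfolded conjunct2[OF fold]] sg0
      by (simp add: hom_zero_mat)
    then have "(to_ac (poly.coeff (char_poly (foldr (*) xs (1\<^sub>m n))) (n - j)) \<cdot>\<^sub>m (1\<^sub>m n :: 'l alg_closure mat)) $$ (0, 0) = 0"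
      using n_pos by simp
    then show "poly.coeff (char_poly (foldr (*) xs (1\<^sub>m n))) (n - j) = 0" using n_pos by simp
  qed
  then show ?thesis by (simp add: UD_simps)
qed

end

section \<open>Monoid algebras\<close>

text \<open>Evaluating a finitely supported function against a function on the monoid turns the
  convolution product into an iterated sum; this reduces the ring laws to those of sums.\<close>

definition pairing :: "('c::field \<Rightarrow> 'l::field) \<Rightarrow> ('m \<Rightarrow> 'c) \<Rightarrow> ('m \<Rightarrow> 'l) \<Rightarrow> 'l" where
  "pairing h f k = (\<Sum>u | f u \<noteq> 0. h (f u) * k u)"

lemma pairing_cong: "(\<And>u. f u \<noteq> 0 \<Longrightarrow> k u = k' u) \<Longrightarrow> pairing h f k = pairing h f k'"
  unfolding pairing_def by (rule sum.cong) auto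

lemma pairing_sum: "pairing h f (\<lambda>u. \<Sum>i\<in>I. k i u * c i) = (\<Sum>i\<in>I. pairing h f (k i) * c i)"
  unfolding pairing_def sum_distrib_left sum_distrib_right
  by (subst sum.swap) (simp add: mult.assoc)

lemma pairing_add_right: "pairing h f (\<lambda>u. k u + k' u) = pairing h f k + pairing h f k'"
  unfolding pairing_def by (simp add: distrib_left sum.distrib)

context
  fixes h :: "'c::field \<Rightarrow> 'l::field"
  assumes h: "comm_ring_hom h"
begin

interpretation comm_ring_hom h by (rule h)

lemma pairing_superset:
  "finite S \<Longrightarrow> (\<And>u. f u \<noteq> 0 \<Longrightarrow> u \<in> S) \<Longrightarrow> pairing h f k = (\<Sum>u\<in>S. h (f u) * k u)"
  unfolding pairing_def by (rule sum.mono_neutral_left) auto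

lemma pairing_single: "pairing h (single v c) k = h c * k v"
  by (subst pairing_superset[of "{v}"]) (auto simp: Defs.single_def split: if_splits)

lemma pairing_add:
  assumes "finite {u. f u \<noteq> 0}" "finite {u. g u \<noteq> 0}"
  shows "pairing h (\<lambda>u. f u + g u) k = pairing h f k + pairing h g k"
proof -
  let ?S = "{u. f u \<noteq> 0} \<union> {u. g u \<noteq> 0}"
  have S: "finite ?S" using assms by simp
  show ?thesis
    by (subst (1 2 3) pairing_superset[OF S]) (auto simp: hom_add distrib_right sum.distrib)
qed

end

context monoid
begin

abbreviation MA :: "('a \<Rightarrow> 'c::field) ring" where "MA \<equiv> monoid_algebra G"

lemma MA_carrier: "f \<in> carrier MA \<longleftrightarrow> finite {u. f u \<noteq> 0} \<and> (\<forall>u. f u \<noteq> 0 \<longrightarrow> u \<in> carrier G)"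
  by (auto simp: monoid_algebra_def)

lemma MA_zero: "\<zero>\<^bsub>MA\<^esub> = (\<lambda>u. 0)" by (simp add: monoid_algebra_def)
lemma MA_add: "f \<oplus>\<^bsub>MA\<^esub> g = (\<lambda>u. f u + g u)" by (simp add: monoid_algebra_def)
lemma MA_one: "\<one>\<^bsub>MA\<^esub> = single \<one> 1" by (simp add: monoid_algebra_def Defs.single_def)

lemma single_closed: "u \<in> carrier G \<Longrightarrow> single u c \<in> carrier MA"
  unfolding MA_carrier
  by (auto simp: Defs.single_def intro: finite_subset[of _ "{u}"] split: if_splits)

text \<open>The double sum over pairs of monoid elements is grouped by their product.\<close>

lemma pairing_mult:
  fixes h :: "'c::field \<Rightarrow> 'l::field" and f g :: "'a \<Rightarrow> 'c"
  assumes h: "comm_ring_hom h" and f: "f \<in> carrier MA" and g: "g \<in> carrier MA"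
  shows "pairing h (f \<otimes>\<^bsub>MA\<^esub> g) k = pairing h f (\<lambda>v. pairing h g (\<lambda>w. k (v \<otimes> w)))"
proof -
  interpret comm_ring_hom h by (rule h)
  let ?P = "{v. f v \<noteq> 0} \<times> {w. g w \<noteq> 0}"
  let ?m = "\<lambda>(v, w). v \<otimes> w"
  have P: "finite ?P" using f g by (auto simp: MA_carrier)
  have S: "{(v, w). f v \<noteq> 0 \<and> g w \<noteq> 0 \<and> v \<otimes> w = u} = {x \<in> ?P. ?m x = u}" for u by auto
  have m: "(f \<otimes>\<^bsub>MA\<^esub> g) u = (\<Sum>x\<in>{x \<in> ?P. ?m x = u}. f (fst x) * g (snd x))" for u
    unfolding monoid_algebra_def by (simp add: S case_prod_beta)
  have z: "u \<in> ?m ` ?P" if "(f \<otimes>\<^bsub>MA\<^esub> g) u \<noteq> 0" for u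
  proof (rule ccontr)
    assume "u \<notin> ?m ` ?P"
    then have "{x \<in> ?P. ?m x = u} = {}" by auto
    then have "(f \<otimes>\<^bsub>MA\<^esub> g) u = 0" unfolding m by (simp only: sum.empty)
    then show False using that by contradiction
  qed
  have "pairing h (f \<otimes>\<^bsub>MA\<^esub> g) k = (\<Sum>u\<in>?m ` ?P. h ((f \<otimes>\<^bsub>MA\<^esub> g) u) * k u)"
    by (rule pairing_superset[OF h finite_imageI[OF P] z])
  also have "\<dots> = (\<Sum>u\<in>?m ` ?P. \<Sum>x\<in>{x \<in> ?P. ?m x = u}. h (f (fst x)) * h (g (snd x)) * k (?m x))"
    unfolding m hom_sum hom_mult sum_distrib_right
    by (rule sum.cong[OF refl], rule sum.cong[OF refl]) (simp add: case_prod_beta)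
  also have "\<dots> = (\<Sum>x\<in>?P. h (f (fst x)) * h (g (snd x)) * k (?m x))"
    by (rule sum.image_gen[OF P, symmetric,
          where h = "\<lambda>x. h (f (fst x)) * h (g (snd x)) * k (?m x)" and g = ?m])
  also have "\<dots> = pairing h f (\<lambda>v. pairing h g (\<lambda>w. k (v \<otimes> w)))"
    unfolding pairing_def sum.cartesian_product' sum_distrib_left by (simp add: mult.assoc)
  finally show ?thesis .
qed

lemma MA_mult_closed:
  fixes f g :: "'a \<Rightarrow> 'c::field"
  assumes f: "f \<in> carrier MA" and g: "g \<in> carrier MA"
  shows "f \<otimes>\<^bsub>MA\<^esub> g \<in> carrier MA"
proof -
  let ?P = "{v. f v \<noteq> 0} \<times> {w. g w \<noteq> 0}"
  have "u \<in> (\<lambda>(v, w). v \<otimes> w) ` ?P" if "(f \<otimes>\<^bsub>MA\<^esub> g) u \<noteq> 0" for u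
  proof (rule ccontr)
    assume "u \<notin> (\<lambda>(v, w). v \<otimes> w) ` ?P"
    then have "{(v, w). f v \<noteq> 0 \<and> g w \<noteq> 0 \<and> v \<otimes> w = u} = {}" by auto
    then have "(f \<otimes>\<^bsub>MA\<^esub> g) u = 0" unfolding monoid_algebra_def by (simp only: monoid.simps sum.empty)
    then show False using that by simp
  qed
  then have s: "{u. (f \<otimes>\<^bsub>MA\<^esub> g) u \<noteq> 0} \<subseteq> (\<lambda>(v, w). v \<otimes> w) ` ?P" by blast
  have "finite ?P" "?P \<subseteq> carrier G \<times> carrier G" using f g by (auto simp: MA_carrier)
  then show ?thesis using finite_subset[OF s] s unfolding MA_carrier by fastforce
qed

lemma pairing_ext:
  fixes f g :: "'a \<Rightarrow> 'c::field"
  assumes "f \<in> carrier MA" "g \<in> carrier MA" and eq: "\<And>k. pairing (\<lambda>x. x) f k = pairing (\<lambda>x :: 'c. x) g k"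
  shows "f = g"
proof
  fix u
  have *: "f u = pairing (\<lambda>x. x) f (\<lambda>v. if v = u then 1 else 0)" if f: "f \<in> carrier MA" for f :: "'a \<Rightarrow> 'c"
  proof -
    have "pairing (\<lambda>x. x) f (\<lambda>v. if v = u then 1 else 0) = (\<Sum>v | f v \<noteq> 0. if v = u then f v else 0)"
      unfolding pairing_def by (rule sum.cong) auto
    also have "\<dots> = f u" using f by (simp add: MA_carrier sum.delta)
    finally show ?thesis ..
  qed
  show "f u = g u" unfolding *[OF assms(1)] *[OF assms(2)] by (rule eq)
qed

lemma MA_ring: "ring (MA :: ('a \<Rightarrow> 'c::field) ring)"
proof (rule ringI)
  note I = id_hom[where 'a='c]
  note m = pairing_mult[OF I]
  have a: "pairing (\<lambda>x :: 'c. x) (f \<oplus>\<^bsub>MA\<^esub> g) k = pairing (\<lambda>x. x) f k + pairing (\<lambda>x. x) g k"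
    if "f \<in> carrier MA" "g \<in> carrier MA" for f g :: "'a \<Rightarrow> 'c" and k
    unfolding MA_add by (rule pairing_add[OF I]) (use that in \<open>auto simp: MA_carrier\<close>)
  have ac: "f \<oplus>\<^bsub>MA\<^esub> g \<in> carrier MA" if "f \<in> carrier MA" "g \<in> carrier MA" for f g :: "'a \<Rightarrow> 'c"
    using that unfolding MA_add MA_carrier
    by (auto intro: finite_subset[of _ "{u. f u \<noteq> 0} \<union> {u. g u \<noteq> 0}"] split: if_splits)
      (metis add_0)
  show "abelian_group (MA :: ('a \<Rightarrow> 'c) ring)"
  proof (rule abelian_groupI)
    fix f :: "'a \<Rightarrow> 'c" assume "f \<in> carrier MA"
    then have "(\<lambda>u. - f u) \<in> carrier MA" by (simp add: MA_carrier)
    moreover have "(\<lambda>u. - f u) \<oplus>\<^bsub>MA\<^esub> f = \<zero>\<^bsub>MA\<^esub>" by (simp add: MA_add MA_zero)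
    ultimately show "\<exists>g\<in>carrier MA. g \<oplus>\<^bsub>MA\<^esub> f = \<zero>\<^bsub>MA\<^esub>" by blast
  qed (simp_all add: ac, simp_all add: MA_add MA_zero ac_simps, simp add: MA_carrier)
  show "monoid (MA :: ('a \<Rightarrow> 'c) ring)"
  proof (rule monoidI)
    show one: "\<one>\<^bsub>MA\<^esub> \<in> carrier (MA :: ('a \<Rightarrow> 'c) ring)" unfolding MA_one by (rule single_closed) simp
    fix f g e :: "'a \<Rightarrow> 'c"
    assume f: "f \<in> carrier MA"
    show "\<one>\<^bsub>MA\<^esub> \<otimes>\<^bsub>MA\<^esub> f = f" "f \<otimes>\<^bsub>MA\<^esub> \<one>\<^bsub>MA\<^esub> = f"
    proof -
      have *: "u \<in> carrier G" if "f u \<noteq> 0" for u using f that by (simp add: MA_carrier)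
      show "\<one>\<^bsub>MA\<^esub> \<otimes>\<^bsub>MA\<^esub> f = f"
      proof (rule pairing_ext[OF MA_mult_closed[OF one f] f])
        show "pairing (\<lambda>x. x) (\<one>\<^bsub>MA\<^esub> \<otimes>\<^bsub>MA\<^esub> f) k = pairing (\<lambda>x. x) f k" for k
          unfolding m[OF one f] unfolding MA_one pairing_single[OF I]
          by (simp, rule pairing_cong) (use * in auto)
      qed
      show "f \<otimes>\<^bsub>MA\<^esub> \<one>\<^bsub>MA\<^esub> = f"
      proof (rule pairing_ext[OF MA_mult_closed[OF f one] f])
        show "pairing (\<lambda>x. x) (f \<otimes>\<^bsub>MA\<^esub> \<one>\<^bsub>MA\<^esub>) k = pairing (\<lambda>x. x) f k" for k
          unfolding m[OF f one] unfolding MA_one pairing_single[OF I]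
          by (rule pairing_cong) (use * in auto)
      qed
    qed
    assume g: "g \<in> carrier MA"
    show "f \<otimes>\<^bsub>MA\<^esub> g \<in> carrier MA" by (rule MA_mult_closed[OF f g])
    assume e: "e \<in> carrier MA"
    show "f \<otimes>\<^bsub>MA\<^esub> g \<otimes>\<^bsub>MA\<^esub> e = f \<otimes>\<^bsub>MA\<^esub> (g \<otimes>\<^bsub>MA\<^esub> e)"
    proof (rule pairing_ext)
      show "pairing (\<lambda>x. x) (f \<otimes>\<^bsub>MA\<^esub> g \<otimes>\<^bsub>MA\<^esub> e) k = pairing (\<lambda>x. x) (f \<otimes>\<^bsub>MA\<^esub> (g \<otimes>\<^bsub>MA\<^esub> e)) k" for k
        unfolding m[OF MA_mult_closed[OF f g] e] m[OF f g] m[OF f MA_mult_closed[OF g e]] m[OF g e]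
        by (intro pairing_cong) (use f g e in \<open>auto simp: MA_carrier m_assoc\<close>)
    qed (use f g e MA_mult_closed in auto)
  qed
  fix f g e :: "'a \<Rightarrow> 'c"
  assume c: "f \<in> carrier MA" "g \<in> carrier MA" "e \<in> carrier MA"
  show "(f \<oplus>\<^bsub>MA\<^esub> g) \<otimes>\<^bsub>MA\<^esub> e = f \<otimes>\<^bsub>MA\<^esub> e \<oplus>\<^bsub>MA\<^esub> g \<otimes>\<^bsub>MA\<^esub> e"
    by (rule pairing_ext) (use c in \<open>simp_all add: ac MA_mult_closed m a\<close>)
  show "e \<otimes>\<^bsub>MA\<^esub> (f \<oplus>\<^bsub>MA\<^esub> g) = e \<otimes>\<^bsub>MA\<^esub> f \<oplus>\<^bsub>MA\<^esub> e \<otimes>\<^bsub>MA\<^esub> g"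
    by (rule pairing_ext) (use c in \<open>simp_all add: ac MA_mult_closed m a pairing_add_right\<close>)
qed

lemma single_mult:
  assumes "u \<in> carrier G" "v \<in> carrier G"
  shows "single u c \<otimes>\<^bsub>MA\<^esub> single v d = single (u \<otimes> v) (c * d :: 'c::field)"
proof (rule pairing_ext)
  note I = id_hom[where 'a='c]
  show "pairing (\<lambda>x. x) (single u c \<otimes>\<^bsub>MA\<^esub> single v d) k = pairing (\<lambda>x. x) (single (u \<otimes> v) (c * d)) k" for k
    unfolding pairing_mult[OF I single_closed[OF assms(1)] single_closed[OF assms(2)]] pairing_single[OF I]
    by simp
qed (intro MA_mult_closed single_closed m_closed assms)+

lemma MA_induct [consumes 1, case_names zero single add]:
  fixes f :: "'a \<Rightarrow> 'c::field"
  assumes f: "f \<in> carrier MA" and zero: "P \<zero>\<^bsub>MA\<^esub>"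
    and single: "\<And>u c. u \<in> carrier G \<Longrightarrow> P (single u c)"
    and add: "\<And>f g. f \<in> carrier MA \<Longrightarrow> g \<in> carrier MA \<Longrightarrow> P f \<Longrightarrow> P g \<Longrightarrow> P (f \<oplus>\<^bsub>MA\<^esub> g)"
  shows "P f"
proof -
  have "P f" if "finite S" "f \<in> carrier MA" "{u. f u \<noteq> 0} \<subseteq> S" for S and f :: "'a \<Rightarrow> 'c"
    using that
  proof (induction S arbitrary: f rule: finite_induct)
    case empty
    then have "f = \<zero>\<^bsub>MA\<^esub>" by (auto simp: MA_zero)
    then show ?case using zero by simp
  next
    case (insert u S)
    show ?case
    proof (cases "f u = 0")
      case True
      then show ?thesis using insert by (intro insert.IH) auto
    next
      case False
      then have u: "u \<in> carrier G" using insert.prems(1) by (simp add: MA_carrier)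
      let ?g = "\<lambda>v. if v = u then 0 else f v"
      have g: "?g \<in> carrier MA" using insert.prems(1) unfolding MA_carrier
        by (auto intro: finite_subset[of _ "{u. f u \<noteq> 0}"] split: if_splits)
      have "P ?g" by (rule insert.IH[OF g]) (use insert.prems in \<open>auto split: if_splits\<close>)
      then have "P (single u (f u) \<oplus>\<^bsub>MA\<^esub> ?g)" by (intro add single single_closed u g)
      moreover have "single u (f u) \<oplus>\<^bsub>MA\<^esub> ?g = f" by (auto simp: MA_add Defs.single_def)
      ultimately show ?thesis by simp
    qed
  qed
  then show ?thesis using f by (auto simp: MA_carrier)
qed

lemma single_add: "single u c \<oplus>\<^bsub>MA\<^esub> single u d = single u (c + d)"
  by (auto simp: MA_add Defs.single_def)

definition matrix_rep :: "('c::field \<Rightarrow> 'l::field) \<Rightarrow> nat \<Rightarrow> ('a \<Rightarrow> 'l mat) \<Rightarrow> ('a \<Rightarrow> 'c) \<Rightarrow> 'l mat" where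
  "matrix_rep h n \<rho> f = mat n n (\<lambda>(i, j). pairing h f (\<lambda>u. \<rho> u $$ (i, j)))"

lemma matrix_rep_single:
  "comm_ring_hom h \<Longrightarrow> \<rho> u \<in> carrier_mat n n \<Longrightarrow> matrix_rep h n \<rho> (single u c) = h c \<cdot>\<^sub>m \<rho> u"
  by (rule eq_matI) (auto simp: matrix_rep_def pairing_single)

lemma matrix_rep_hom:
  assumes h: "comm_ring_hom (h :: 'c::field \<Rightarrow> 'l::field)"
    and \<rho>: "\<And>u. u \<in> carrier G \<Longrightarrow> \<rho> u \<in> carrier_mat n n"
    and \<rho>_mult: "\<And>u v. u \<in> carrier G \<Longrightarrow> v \<in> carrier G \<Longrightarrow> \<rho> (u \<otimes> v) = \<rho> u * \<rho> v" and \<rho>_one: "\<rho> \<one> = 1\<^sub>m n"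
  shows "matrix_rep h n \<rho> \<in> Ring.ring_hom MA (ring_mat TYPE('l) n ())"
proof (rule ring_hom_memI)
  interpret comm_ring_hom h by (rule h)
  fix f g :: "'a \<Rightarrow> 'c"
  show "matrix_rep h n \<rho> f \<in> carrier (ring_mat TYPE('l) n ())" by (simp add: matrix_rep_def ring_mat_def)
  assume f: "f \<in> carrier MA" and g: "g \<in> carrier MA"
  show "matrix_rep h n \<rho> (f \<oplus>\<^bsub>MA\<^esub> g) = matrix_rep h n \<rho> f \<oplus>\<^bsub>ring_mat TYPE('l) n ()\<^esub> matrix_rep h n \<rho> g"
    using f g by (intro eq_matI) (auto simp: ring_mat_def matrix_rep_def MA_add MA_carrier pairing_add[OF h])
  have "matrix_rep h n \<rho> (f \<otimes>\<^bsub>MA\<^esub> g) = matrix_rep h n \<rho> f * matrix_rep h n \<rho> g"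
  proof (rule eq_matI)
    fix i j assume "i < dim_row (matrix_rep h n \<rho> f * matrix_rep h n \<rho> g)" "j < dim_col (matrix_rep h n \<rho> f * matrix_rep h n \<rho> g)"
    then have ij: "i < n" "j < n" by (auto simp: matrix_rep_def)
    have "matrix_rep h n \<rho> (f \<otimes>\<^bsub>MA\<^esub> g) $$ (i, j) = pairing h f (\<lambda>v. pairing h g (\<lambda>w. \<rho> (v \<otimes> w) $$ (i, j)))"
      using ij by (simp add: matrix_rep_def pairing_mult[OF h f g])
    also have "\<dots> = pairing h f (\<lambda>v. pairing h g (\<lambda>w. \<Sum>k<n. \<rho> w $$ (k, j) * \<rho> v $$ (i, k)))"
    proof (intro pairing_cong)
      fix v w assume "f v \<noteq> 0" "g w \<noteq> 0"
      then have "v \<in> carrier G" "w \<in> carrier G" using f g by (auto simp: MA_carrier)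
      then show "\<rho> (v \<otimes> w) $$ (i, j) = (\<Sum>k<n. \<rho> w $$ (k, j) * \<rho> v $$ (i, k))"
        using index_mult_sum[OF \<rho>[of v] \<rho>[of w] ij] by (simp add: \<rho>_mult mult.commute)
    qed
    also have "\<dots> = (\<Sum>k<n. pairing h f (\<lambda>v. \<rho> v $$ (i, k)) * pairing h g (\<lambda>w. \<rho> w $$ (k, j)))"
      unfolding pairing_sum
      by (rule trans[OF pairing_cong pairing_sum]) (rule sum.cong[OF refl], rule mult.commute)
    also have "\<dots> = (matrix_rep h n \<rho> f * matrix_rep h n \<rho> g) $$ (i, j)"
      using ij by (subst index_mult_sum[of _ n n _ n]) (auto simp: matrix_rep_def)
    finally show "matrix_rep h n \<rho> (f \<otimes>\<^bsub>MA\<^esub> g) $$ (i, j) = (matrix_rep h n \<rho> f * matrix_rep h n \<rho> g) $$ (i, j)" .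
  qed (auto simp: matrix_rep_def)
  then show "matrix_rep h n \<rho> (f \<otimes>\<^bsub>MA\<^esub> g) = matrix_rep h n \<rho> f \<otimes>\<^bsub>ring_mat TYPE('l) n ()\<^esub> matrix_rep h n \<rho> g"
    by (simp add: ring_mat_def)
next
  interpret comm_ring_hom h by (rule h)
  show "matrix_rep h n \<rho> \<one>\<^bsub>MA\<^esub> = \<one>\<^bsub>ring_mat TYPE('l) n ()\<^esub>"
    unfolding MA_one using matrix_rep_single[of h \<rho> \<one> n 1, OF h] \<rho>_one by (simp add: ring_mat_def one_smult)
qed

end

lemma monoid_product_group:
  assumes "\<And>i. i \<in> I \<Longrightarrow> monoid (G i)"
  shows "monoid (product_group I G)"
proof (rule monoidI; simp)
  have c: "x i \<in> carrier (G i)" if "x \<in> (\<Pi>\<^sub>E i\<in>I. carrier (G i))" "i \<in> I" for x i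
    using that by (rule PiE_mem)
  show "(\<lambda>i. x i \<otimes>\<^bsub>G i\<^esub> y i) \<in> (\<Pi> i\<in>I. carrier (G i))"
    if "x \<in> (\<Pi>\<^sub>E i\<in>I. carrier (G i))" "y \<in> (\<Pi>\<^sub>E i\<in>I. carrier (G i))" for x y
    using c[OF that(1)] c[OF that(2)] by (simp add: Pi_def monoid.m_closed[OF assms])
  show "(\<lambda>i. \<one>\<^bsub>G i\<^esub>) \<in> (\<Pi> i\<in>I. carrier (G i))"
    by (simp add: Pi_def monoid.one_closed[OF assms])
  show "(\<lambda>i\<in>I. (if i \<in> I then x i \<otimes>\<^bsub>G i\<^esub> y i else undefined) \<otimes>\<^bsub>G i\<^esub> z i) =
      (\<lambda>i\<in>I. x i \<otimes>\<^bsub>G i\<^esub> (if i \<in> I then y i \<otimes>\<^bsub>G i\<^esub> z i else undefined))"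
    if "x \<in> (\<Pi>\<^sub>E i\<in>I. carrier (G i))" "y \<in> (\<Pi>\<^sub>E i\<in>I. carrier (G i))" "z \<in> (\<Pi>\<^sub>E i\<in>I. carrier (G i))"
    for x y z
    by (rule restrict_ext)
      (simp add: monoid.m_assoc[OF assms] c[OF that(1)] c[OF that(2)] c[OF that(3)])
  show "(\<lambda>i\<in>I. (if i \<in> I then \<one>\<^bsub>G i\<^esub> else undefined) \<otimes>\<^bsub>G i\<^esub> x i) = x"
    "(\<lambda>i\<in>I. x i \<otimes>\<^bsub>G i\<^esub> (if i \<in> I then \<one>\<^bsub>G i\<^esub> else undefined)) = x"
    if x: "x \<in> (\<Pi>\<^sub>E i\<in>I. carrier (G i))" for x
    using PiE_arb[OF x]
    by (auto simp: fun_eq_iff restrict_def monoid.l_one[OF assms] monoid.r_one[OF assms] c[OF x])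
qed

section \<open>Homomorphisms on quotient rings\<close>

text \<open>The image of a coset is a singleton once the generators of the ideal are mapped to zero;
  the definition is used only in that case.\<close>

definition quot_lift :: "('a \<Rightarrow> 'b) \<Rightarrow> 'a set \<Rightarrow> 'b" where "quot_lift \<phi> S = the_elem (\<phi> ` S)"

context
  fixes R :: "('a, 'x) ring_scheme" and T :: "('b, 'y) ring_scheme" and \<phi> :: "'a \<Rightarrow> 'b" and Z :: "'a set"
  assumes R: "ring R" and T: "ring T" and \<phi>: "\<phi> \<in> Ring.ring_hom R T"
    and Z: "Z \<subseteq> carrier R" "\<And>g. g \<in> Z \<Longrightarrow> \<phi> g = \<zero>\<^bsub>T\<^esub>"
begin

interpretation R: ring R by (rule R)
interpretation T: ring T by (rule T)
interpretation \<phi>: ring_hom_ring R T \<phi> by (rule ring_hom_ringI2[OF R T \<phi>])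
interpretation I: ideal "Idl\<^bsub>R\<^esub> Z" R by (rule R.genideal_ideal[OF Z(1)])

lemma quot_lift_coset:
  assumes a: "a \<in> carrier R"
  shows "quot_lift \<phi> (Idl\<^bsub>R\<^esub> Z +>\<^bsub>R\<^esub> a) = \<phi> a"
proof -
  have "Z \<subseteq> a_kernel R T \<phi>" unfolding a_kernel_def' using Z by blast
  from R.genideal_minimal[OF \<phi>.kernel_is_ideal this]
  have k: "x \<in> carrier R \<and> \<phi> x = \<zero>\<^bsub>T\<^esub>" if "x \<in> Idl\<^bsub>R\<^esub> Z" for x
    using that unfolding a_kernel_def' by blast
  have "\<phi> y = \<phi> a" if y: "y \<in> Idl\<^bsub>R\<^esub> Z +>\<^bsub>R\<^esub> a" for y
  proof -
    obtain x where x: "x \<in> Idl\<^bsub>R\<^esub> Z" "y = x \<oplus>\<^bsub>R\<^esub> a" using y unfolding a_r_coset_def' by blast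
    show ?thesis using k[OF x(1)] a unfolding x(2) by (simp add: \<phi>.hom_add)
  qed
  moreover have "a \<in> Idl\<^bsub>R\<^esub> Z +>\<^bsub>R\<^esub> a" by (rule I.a_rcos_self[OF a])
  ultimately have "\<phi> ` (Idl\<^bsub>R\<^esub> Z +>\<^bsub>R\<^esub> a) = {\<phi> a}" by blast
  then show ?thesis by (simp add: quot_lift_def)
qed

lemma quot_lift_hom: "quot_lift \<phi> \<in> Ring.ring_hom (R Quot Idl\<^bsub>R\<^esub> Z) T"
proof (rule ring_hom_memI)
  let ?q = "\<lambda>a. Idl\<^bsub>R\<^esub> Z +>\<^bsub>R\<^esub> a"
  note q = I.rcos_ring_hom
  have ex: "\<exists>a\<in>carrier R. S = ?q a" if "S \<in> carrier (R Quot Idl\<^bsub>R\<^esub> Z)" for S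
    using that unfolding FactRing_def A_RCOSETS_def' by auto
  fix S S' assume S: "S \<in> carrier (R Quot Idl\<^bsub>R\<^esub> Z)"
  then obtain a where a: "a \<in> carrier R" "S = ?q a" using ex by blast
  show "quot_lift \<phi> S \<in> carrier T" unfolding a(2) quot_lift_coset[OF a(1)] using a(1) by simp
  assume S': "S' \<in> carrier (R Quot Idl\<^bsub>R\<^esub> Z)"
  then obtain b where b: "b \<in> carrier R" "S' = ?q b" using ex by blast
  have "S \<otimes>\<^bsub>R Quot Idl\<^bsub>R\<^esub> Z\<^esub> S' = ?q (a \<otimes>\<^bsub>R\<^esub> b)" "S \<oplus>\<^bsub>R Quot Idl\<^bsub>R\<^esub> Z\<^esub> S' = ?q (a \<oplus>\<^bsub>R\<^esub> b)"
    unfolding a(2) b(2) using ring_hom_mult[OF q a(1) b(1)] ring_hom_add[OF q a(1) b(1)] by simp_all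
  then show "quot_lift \<phi> (S \<otimes>\<^bsub>R Quot Idl\<^bsub>R\<^esub> Z\<^esub> S') = quot_lift \<phi> S \<otimes>\<^bsub>T\<^esub> quot_lift \<phi> S'"
    "quot_lift \<phi> (S \<oplus>\<^bsub>R Quot Idl\<^bsub>R\<^esub> Z\<^esub> S') = quot_lift \<phi> S \<oplus>\<^bsub>T\<^esub> quot_lift \<phi> S'"
    unfolding a(2) b(2) using a(1) b(1) by (simp_all add: quot_lift_coset)
next
  have "\<one>\<^bsub>R Quot Idl\<^bsub>R\<^esub> Z\<^esub> = Idl\<^bsub>R\<^esub> Z +>\<^bsub>R\<^esub> \<one>\<^bsub>R\<^esub>" by (rule ring_hom_one[OF I.rcos_ring_hom, symmetric])
  then show "quot_lift \<phi> \<one>\<^bsub>R Quot Idl\<^bsub>R\<^esub> Z\<^esub> = \<one>\<^bsub>T\<^esub>" by (simp add: quot_lift_coset)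
qed

end

lemma (in monoid) matrix_rep_commute:
  fixes h :: "'c::field \<Rightarrow> 'l::field"
  assumes f: "f \<in> carrier MA" and M: "M \<in> carrier_mat n n"
    and \<rho>: "\<And>u. u \<in> carrier G \<Longrightarrow> \<rho> u \<in> carrier_mat n n"
    and comm: "\<And>u. u \<in> carrier G \<Longrightarrow> \<rho> u * M = M * \<rho> u"
  shows "matrix_rep h n \<rho> f * M = M * matrix_rep h n \<rho> f"
proof (rule eq_matI)
  fix i j assume "i < dim_row (M * matrix_rep h n \<rho> f)" "j < dim_col (M * matrix_rep h n \<rho> f)"
  then have ij: "i < n" "j < n" using M by (auto simp: matrix_rep_def)
  have c: "matrix_rep h n \<rho> f \<in> carrier_mat n n" by (simp add: matrix_rep_def)
  have "(matrix_rep h n \<rho> f * M) $$ (i, j) = (\<Sum>k<n. pairing h f (\<lambda>u. \<rho> u $$ (i, k)) * M $$ (k, j))"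
    using ij by (subst index_mult_sum[OF c M]) (simp_all add: matrix_rep_def)
  also have "\<dots> = pairing h f (\<lambda>u. \<Sum>k<n. \<rho> u $$ (i, k) * M $$ (k, j))" by (rule pairing_sum[symmetric])
  also have "\<dots> = pairing h f (\<lambda>u. \<Sum>k<n. \<rho> u $$ (k, j) * M $$ (i, k))"
  proof (rule pairing_cong)
    fix u assume "f u \<noteq> 0"
    then have u: "u \<in> carrier G" using f by (simp add: MA_carrier)
    have "(\<Sum>k<n. \<rho> u $$ (i, k) * M $$ (k, j)) = (\<rho> u * M) $$ (i, j)"
      by (rule index_mult_sum[OF \<rho>[OF u] M ij, symmetric])
    also have "\<dots> = (\<Sum>k<n. M $$ (i, k) * \<rho> u $$ (k, j))"
      unfolding comm[OF u] by (rule index_mult_sum[OF M \<rho>[OF u] ij])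
    finally show "(\<Sum>k<n. \<rho> u $$ (i, k) * M $$ (k, j)) = (\<Sum>k<n. \<rho> u $$ (k, j) * M $$ (i, k))"
      by (simp add: mult.commute)
  qed
  also have "\<dots> = (\<Sum>k<n. pairing h f (\<lambda>u. \<rho> u $$ (k, j)) * M $$ (i, k))" by (rule pairing_sum)
  also have "\<dots> = (M * matrix_rep h n \<rho> f) $$ (i, j)"
    using ij by (subst index_mult_sum[OF M c]) (simp_all add: matrix_rep_def mult.commute)
  finally show "(matrix_rep h n \<rho> f * M) $$ (i, j) = (M * matrix_rep h n \<rho> f) $$ (i, j)" .
qed (use M in \<open>auto simp: matrix_rep_def\<close>)

section \<open>Symbol algebras\<close>

interpretation W: monoid word_monoid
  by (rule monoidI) (auto simp: word_monoid_def)

lemma word_simps: "carrier word_monoid = UNIV" "u \<otimes>\<^bsub>word_monoid\<^esub> v = u @ v" "\<one>\<^bsub>word_monoid\<^esub> = []"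
  by (simp_all add: word_monoid_def)

interpretation FXY: ring free_xy by (rule W.MA_ring)

lemma word_single_closed: "single u c \<in> carrier free_xy"
  by (rule W.single_closed) (simp add: word_simps)

lemma word_single_mult: "single u c \<otimes>\<^bsub>free_xy\<^esub> single v d = single (u @ v) (c * d)"
  using W.single_mult[of u v c d] by (simp add: word_simps)

abbreviation xy :: "nat \<Rightarrow> nat \<Rightarrow> symbol_gen list" where
  "xy a b \<equiv> replicate a GenX @ replicate b GenY"

context
  fixes r :: nat and \<zeta> z w :: "'c::field"
begin

abbreviation "gens \<equiv> {single (replicate r GenX) 1 \<ominus>\<^bsub>free_xy\<^esub> single [] z,
      single (replicate r GenY) 1 \<ominus>\<^bsub>free_xy\<^esub> single [] w,
      single [GenY, GenX] 1 \<ominus>\<^bsub>free_xy\<^esub> single [GenX, GenY] \<zeta>}"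

definition symbol_class :: "(symbol_gen list \<Rightarrow> 'c) \<Rightarrow> (symbol_gen list \<Rightarrow> 'c) set" where
  "symbol_class f = symbol_ideal r \<zeta> z w +>\<^bsub>free_xy\<^esub> f"

lemma gens_closed: "gens \<subseteq> carrier free_xy"
  using word_single_closed FXY.minus_closed by auto

lemma symbol_ideal: "ideal (symbol_ideal r \<zeta> z w) free_xy"
  unfolding symbol_ideal_def by (rule FXY.genideal_ideal[OF gens_closed])

lemma symbol_algebra_ring: "ring (symbol_algebra r \<zeta> z w)"
  unfolding symbol_algebra_def by (rule ideal.quotient_is_ring[OF symbol_ideal])

lemma symbol_class_hom: "symbol_class \<in> Ring.ring_hom free_xy (symbol_algebra r \<zeta> z w)"
  using ideal.rcos_ring_hom[OF symbol_ideal]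
  unfolding symbol_algebra_def symbol_class_def[abs_def] by simp

lemma symbol_class_surj:
  assumes "y \<in> carrier (symbol_algebra r \<zeta> z w)"
  obtains f where "f \<in> carrier free_xy" "y = symbol_class f"
  using assms unfolding symbol_algebra_def symbol_class_def FactRing_def A_RCOSETS_def' by auto

lemma symbol_scalar: "symbol_scalar r \<zeta> z w c = symbol_class (single [] c)"
  by (simp add: symbol_scalar_def symbol_class_def)

lemma symbol_class_eqI:
  assumes "single u c \<ominus>\<^bsub>free_xy\<^esub> single v d \<in> gens"
  shows "symbol_class (single u c) = symbol_class (single v d)"
proof -
  have "single u c \<ominus>\<^bsub>free_xy\<^esub> single v d \<in> symbol_ideal r \<zeta> z w"
    using FXY.genideal_self[OF gens_closed] assms unfolding symbol_ideal_def by blast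
  then show ?thesis
    unfolding symbol_class_def
    using FXY.quotient_eq_iff_same_a_r_cos[OF symbol_ideal word_single_closed word_single_closed] by blast
qed

lemma symbol_class_mult:
  "symbol_class (single u c) \<otimes>\<^bsub>symbol_algebra r \<zeta> z w\<^esub> symbol_class (single v d) =
    symbol_class (single (u @ v) (c * d))"
  unfolding word_single_mult[symmetric]
  by (rule ring_hom_mult[OF symbol_class_hom word_single_closed word_single_closed, symmetric])

lemma symbol_class_replace:
  assumes "symbol_class (single u 1) = symbol_class (single u' d)"
  shows "symbol_class (single (v @ u @ v') c) = symbol_class (single (v @ u' @ v') (c * d))"
proof -
  have "symbol_class (single (v @ u @ v') c) = symbol_class (single v c) \<otimes>\<^bsub>symbol_algebra r \<zeta> z w\<^esub>
      (symbol_class (single u 1) \<otimes>\<^bsub>symbol_algebra r \<zeta> z w\<^esub> symbol_class (single v' 1))"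
    by (simp add: symbol_class_mult)
  also have "\<dots> = symbol_class (single (v @ u' @ v') (c * d))"
    unfolding assms by (simp add: symbol_class_mult)
  finally show ?thesis .
qed

text \<open>Each letter \<open>x\<close> that the letter \<open>y\<close> passes contributes a
  factor \<open>\<zeta>\<close>.\<close>

lemma symbol_class_move:
  "symbol_class (single (GenY # replicate a GenX @ v) c) =
    symbol_class (single (replicate a GenX @ GenY # v) (c * \<zeta> ^ a))"
proof (induction a arbitrary: c v)
  case (Suc a)
  have yx: "symbol_class (single [GenY, GenX] 1) = symbol_class (single [GenX, GenY] \<zeta>)"
    by (rule symbol_class_eqI) simp
  have "symbol_class (single (GenY # replicate (Suc a) GenX @ v) c) =
      symbol_class (single (GenY # replicate a GenX @ GenX # v) c)"
    by (simp add: replicate_app_Cons_same)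
  also have "\<dots> = symbol_class (single (replicate a GenX @ [GenY, GenX] @ v) (c * \<zeta> ^ a))"
    unfolding Suc.IH by simp
  also have "\<dots> = symbol_class (single (replicate a GenX @ [GenX, GenY] @ v) (c * \<zeta> ^ a * \<zeta>))"
    by (rule symbol_class_replace[OF yx])
  finally show ?case by (simp add: replicate_app_Cons_same ac_simps)
qed simp

text \<open>Letters are added on the left of a normal form: an \<open>x\<close> may complete the
  power equal to \<open>z\<close>; a \<open>y\<close> is first moved past all letters
  \<open>x\<close> and may complete the power equal to \<open>w\<close>. Independence of the normal
  forms will come from the matrix representation.\<close>

lemma symbol_class_word:
  assumes r: "0 < r"
  shows "\<exists>a<r. \<exists>b<r. \<exists>d. symbol_class (single u c) = symbol_class (single (xy a b) d)"
proof (induction u arbitrary: c)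
  case Nil
  then show ?case using r by (intro exI[of _ 0] conjI exI[of _ c]) auto
next
  case (Cons g u)
  have xr: "symbol_class (single (replicate r GenX) 1) = symbol_class (single [] z)"
    and yr: "symbol_class (single (replicate r GenY) 1) = symbol_class (single [] w)"
    by (rule symbol_class_eqI, simp)+
  obtain a b d where ab: "a < r" "b < r" and d: "symbol_class (single u 1) = symbol_class (single (xy a b) d)"
    using Cons.IH by blast
  have e: "symbol_class (single (g # u) c) = symbol_class (single (g # xy a b) (c * d))"
    using symbol_class_replace[OF d, of "[g]" "[]" c] by simp
  have fin: ?case
    if "a' < r" "b' < r" "symbol_class (single (g # xy a b) (c * d)) = symbol_class (single (xy a' b') d')"
    for a' b' d'
    unfolding e by (rule exI[of _ a'], rule conjI[OF that(1)], rule exI[of _ b'], rule conjI[OF that(2)],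
      rule exI[of _ d'], rule that(3))
  show ?case
  proof (cases g)
    case GenX
    show ?thesis
    proof (cases "Suc a < r")
      case True
      show ?thesis by (rule fin[OF True ab(2), of "c * d"]) (simp add: GenX)
    next
      case False
      then have "r = Suc a" using ab(1) by simp
      then have eq: "g # xy a b = [] @ replicate r GenX @ replicate b GenY" by (simp add: GenX)
      show ?thesis
        by (rule fin[OF r ab(2), of "c * d * z"]) (unfold eq symbol_class_replace[OF xr], simp)
    qed
  next
    case GenY
    have m: "symbol_class (single (g # xy a b) (c * d)) = symbol_class (single (xy a (Suc b)) (c * d * \<zeta> ^ a))"
      using symbol_class_move[of a "replicate b GenY" "c * d"] by (simp add: GenY)
    show ?thesis
    proof (cases "Suc b < r")
      case True
      show ?thesis by (rule fin[OF ab(1) True m])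
    next
      case False
      then have "r = Suc b" using ab(2) by simp
      then have eq: "xy a (Suc b) = replicate a GenX @ replicate r GenY @ []" by simp
      show ?thesis
        by (rule fin[OF ab(1) r, of "c * d * \<zeta> ^ a * w"]) (unfold m eq symbol_class_replace[OF yr], simp)
    qed
  qed
qed

lemma symbol_class_scale:
  "symbol_class (single u (c * d)) = symbol_scalar r \<zeta> z w c \<otimes>\<^bsub>symbol_algebra r \<zeta> z w\<^esub> symbol_class (single u d)"
  by (simp add: symbol_scalar symbol_class_mult)

end

section \<open>The matrix representation of a tensor product of symbol algebras\<close>

text \<open>The representation requires \<open>p l\<close>-th roots of the parameters. They are
  collected in \<open>t\<close>, numbered like the variables of the equivariant matrices.\<close>

locale symbol_product = monomial_matrices ps \<zeta> n for ps and \<zeta> :: "nat \<Rightarrow> 'l::field" and n +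
  fixes h :: "'c::field \<Rightarrow> 'l" and \<zeta>0 z w :: "nat \<Rightarrow> 'c" and t :: "nat \<Rightarrow> 'l"
  assumes h: "comm_ring_hom h"
    and h_zeta: "l < length ps \<Longrightarrow> h (\<zeta>0 l) = \<zeta> l"
    and t_even: "l < length ps \<Longrightarrow> t (2 * l) ^ (ps ! l) = h (z l)"
    and t_odd: "l < length ps \<Longrightarrow> t (2 * l + 1) ^ (ps ! l) = h (w l)"
    and t_nonzero: "v < 2 * length ps \<Longrightarrow> t v \<noteq> 0"
begin

interpretation h: comm_ring_hom h by (rule h)

abbreviation mat_ring :: "'l mat ring" where "mat_ring \<equiv> ring_mat TYPE('l) n ()"

lemma mat_ring: "ring mat_ring" by (rule ring_mat)

text \<open>The unscaled matrices have \<open>p l\<close>-th power equal to the identity, so the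
  factors \<open>t\<close> turn these powers into the parameters.\<close>

definition gen_mat :: "nat \<Rightarrow> symbol_gen \<Rightarrow> 'l mat" where
  "gen_mat l g = (case g of GenX \<Rightarrow> t (2 * l) \<cdot>\<^sub>m N (unit_vec l) (\<lambda>_. 0)
     | GenY \<Rightarrow> t (2 * l + 1) \<cdot>\<^sub>m N (\<lambda>_. 0) (unit_vec l))"

definition word_mat :: "nat \<Rightarrow> symbol_gen list \<Rightarrow> 'l mat" where
  "word_mat l u = foldr (\<lambda>g M. gen_mat l g * M) u (1\<^sub>m n)"

lemma gen_mat_carrier [simp]: "gen_mat l g \<in> carrier_mat n n"
  by (cases g) (simp_all add: gen_mat_def)

lemma word_mat_simps: "word_mat l [] = 1\<^sub>m n" "word_mat l (g # u) = gen_mat l g * word_mat l u"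
  by (simp_all add: word_mat_def)

lemma word_mat_carrier [simp]: "word_mat l u \<in> carrier_mat n n"
  by (induction u) (simp_all add: word_mat_simps mult_carrier_mat[OF gen_mat_carrier])

lemma word_mat_append: "word_mat l (u @ v) = word_mat l u * word_mat l v"
  by (induction u) (simp_all add: word_mat_simps left_mult_one_mat[OF word_mat_carrier]
    assoc_mult_mat[OF gen_mat_carrier word_mat_carrier word_mat_carrier])

lemma word_mat_replicate:
  "word_mat l (replicate a GenX) = t (2 * l) ^ a \<cdot>\<^sub>m N (\<lambda>k. a * unit_vec l k) (\<lambda>_. 0)"
  "word_mat l (replicate a GenY) = t (2 * l + 1) ^ a \<cdot>\<^sub>m N (\<lambda>_. 0) (\<lambda>k. a * unit_vec l k)"
proof (induction a)
  case 0
  have "N (\<lambda>k. 0 * unit_vec l k) (\<lambda>_. 0) = 1\<^sub>m n" "N (\<lambda>_. 0) (\<lambda>k. 0 * unit_vec l k) = 1\<^sub>m n"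
    by (rule N_trivial; simp)+
  then show "word_mat l (replicate 0 GenX) = t (2 * l) ^ 0 \<cdot>\<^sub>m N (\<lambda>k. 0 * unit_vec l k) (\<lambda>_. 0)"
    "word_mat l (replicate 0 GenY) = t (2 * l + 1) ^ 0 \<cdot>\<^sub>m N (\<lambda>_. 0) (\<lambda>k. 0 * unit_vec l k)"
    by (simp_all only: replicate_0 word_mat_simps power_0 one_smult)
next
  case (Suc a)
  show "word_mat l (replicate (Suc a) GenX) = t (2 * l) ^ Suc a \<cdot>\<^sub>m N (\<lambda>k. Suc a * unit_vec l k) (\<lambda>_. 0)"
    by (simp add: word_mat_simps Suc.IH gen_mat_def smult_mult_smult[of _ n n _ n] N_mult one_smult)
  show "word_mat l (replicate (Suc a) GenY) = t (2 * l + 1) ^ Suc a \<cdot>\<^sub>m N (\<lambda>_. 0) (\<lambda>k. Suc a * unit_vec l k)"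
    by (simp add: word_mat_simps Suc.IH gen_mat_def smult_mult_smult[of _ n n _ n] N_mult one_smult)
qed

lemma word_mat_xy:
  "word_mat l (xy a b) = (t (2 * l) ^ a * t (2 * l + 1) ^ b) \<cdot>\<^sub>m N (\<lambda>k. a * unit_vec l k) (\<lambda>k. b * unit_vec l k)"
  by (simp add: word_mat_append word_mat_replicate smult_mult_smult[of _ n n _ n] N_mult one_smult)

lemma word_mat_relations:
  assumes l: "l < s"
  shows "word_mat l (replicate (p l) GenX) = h (z l) \<cdot>\<^sub>m 1\<^sub>m n"
    "word_mat l (replicate (p l) GenY) = h (w l) \<cdot>\<^sub>m 1\<^sub>m n"
    "word_mat l [GenY, GenX] = \<zeta> l \<cdot>\<^sub>m word_mat l [GenX, GenY]"
proof -
  have d: "p k dvd p l * unit_vec l k" for k by (simp add: unit_vec_def)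
  have "N (\<lambda>k. p l * unit_vec l k) (\<lambda>_. 0) = 1\<^sub>m n" "N (\<lambda>_. 0) (\<lambda>k. p l * unit_vec l k) = 1\<^sub>m n"
    by (rule N_trivial; simp add: d)+
  then show "word_mat l (replicate (p l) GenX) = h (z l) \<cdot>\<^sub>m 1\<^sub>m n"
    "word_mat l (replicate (p l) GenY) = h (w l) \<cdot>\<^sub>m 1\<^sub>m n"
    unfolding word_mat_replicate t_even[OF l] t_odd[OF l] by simp_all
  have "(\<Prod>k<s. \<zeta> k ^ (unit_vec l k * unit_vec l k)) = \<zeta> l"
    unfolding prod_unit_vec(1)[OF l] by (simp add: unit_vec_def)
  then show "word_mat l [GenY, GenX] = \<zeta> l \<cdot>\<^sub>m word_mat l [GenX, GenY]"
    by (simp add: word_mat_simps right_mult_one_mat[OF gen_mat_carrier])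
      (simp add: gen_mat_def smult_mult_smult[of _ n n _ n] N_mult smult_smult mult.commute del: mult_eq_1_iff)
qed

lemma gen_mat_commute:
  assumes "l \<noteq> k"
  shows "gen_mat l g * gen_mat k g' = gen_mat k g' * gen_mat l g"
proof -
  have u: "unit_vec l i * unit_vec k i = 0" "unit_vec k i * unit_vec l i = 0" for i
    using assms by (auto simp: unit_vec_def)
  show ?thesis
    by (cases g; cases g') (simp_all add: gen_mat_def smult_mult_smult[of _ n n _ n] N_mult u mult.commute add.commute del: mult_eq_0_iff mult_is_0)
qed

lemma word_mat_commute:
  assumes "l \<noteq> k"
  shows "word_mat l u * word_mat k v = word_mat k v * word_mat l u"
proof -
  have 1: "gen_mat l g * word_mat k v = word_mat k v * gen_mat l g" for g
  proof (induction v)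
    case (Cons g' v)
    have "gen_mat l g * (gen_mat k g' * word_mat k v) = gen_mat l g * gen_mat k g' * word_mat k v"
      by (simp add: assoc_mult_mat[OF gen_mat_carrier gen_mat_carrier word_mat_carrier])
    also have "\<dots> = gen_mat k g' * (gen_mat l g * word_mat k v)"
      unfolding gen_mat_commute[OF assms] by (rule assoc_mult_mat[OF gen_mat_carrier gen_mat_carrier word_mat_carrier])
    also have "\<dots> = gen_mat k g' * word_mat k v * gen_mat l g"
      unfolding Cons.IH by (rule assoc_mult_mat[OF gen_mat_carrier word_mat_carrier gen_mat_carrier, symmetric])
    finally show ?case by (simp add: word_mat_simps)
  qed (simp add: word_mat_simps left_mult_one_mat[OF gen_mat_carrier] right_mult_one_mat[OF gen_mat_carrier])
  show ?thesis
  proof (induction u)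
    case (Cons g u)
    have "gen_mat l g * word_mat l u * word_mat k v = gen_mat l g * (word_mat k v * word_mat l u)"
      unfolding assoc_mult_mat[OF gen_mat_carrier word_mat_carrier word_mat_carrier] Cons.IH ..
    also have "\<dots> = word_mat k v * gen_mat l g * word_mat l u"
      unfolding 1[symmetric] by (rule assoc_mult_mat[OF gen_mat_carrier word_mat_carrier word_mat_carrier, symmetric])
    also have "\<dots> = word_mat k v * (gen_mat l g * word_mat l u)"
      by (rule assoc_mult_mat[OF word_mat_carrier gen_mat_carrier word_mat_carrier])
    finally show ?case by (simp add: word_mat_simps)
  qed (simp add: word_mat_simps left_mult_one_mat[OF word_mat_carrier] right_mult_one_mat[OF word_mat_carrier])
qed

abbreviation S :: "nat \<Rightarrow> (symbol_gen list \<Rightarrow> 'c) set ring" where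
  "S l \<equiv> symbol_algebra (p l) (\<zeta>0 l) (z l) (w l)"

abbreviation cls :: "nat \<Rightarrow> (symbol_gen list \<Rightarrow> 'c) \<Rightarrow> (symbol_gen list \<Rightarrow> 'c) set" where
  "cls l \<equiv> symbol_class (p l) (\<zeta>0 l) (z l) (w l)"

abbreviation sca :: "nat \<Rightarrow> 'c \<Rightarrow> (symbol_gen list \<Rightarrow> 'c) set" where
  "sca l \<equiv> symbol_scalar (p l) (\<zeta>0 l) (z l) (w l)"

definition symbol_rep :: "nat \<Rightarrow> (symbol_gen list \<Rightarrow> 'c) set \<Rightarrow> 'l mat" where
  "symbol_rep l = quot_lift (W.matrix_rep h n (word_mat l))"

lemma word_rep_hom: "W.matrix_rep h n (word_mat l) \<in> Ring.ring_hom free_xy mat_ring"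
  by (rule W.matrix_rep_hom[OF h]) (simp_all add: word_simps word_mat_append word_mat_simps)

lemma word_rep_single: "W.matrix_rep h n (word_mat l) (single u c) = h c \<cdot>\<^sub>m word_mat l u"
  by (rule W.matrix_rep_single[OF h word_mat_carrier])

lemma word_rep_minus:
  assumes "h c \<cdot>\<^sub>m word_mat l u = h d \<cdot>\<^sub>m word_mat l v"
  shows "W.matrix_rep h n (word_mat l) (single u c \<ominus>\<^bsub>free_xy\<^esub> single v d) = \<zero>\<^bsub>mat_ring\<^esub>"
proof -
  interpret M: ring mat_ring by (rule mat_ring)
  interpret f: ring_hom_ring free_xy mat_ring "W.matrix_rep h n (word_mat l)"
    by (rule ring_hom_ringI2[OF W.MA_ring mat_ring word_rep_hom])
  have "W.matrix_rep h n (word_mat l) (single u c) = W.matrix_rep h n (word_mat l) (single v d)"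
    unfolding word_rep_single by (rule assms)
  then show ?thesis
    using f.hom_closed[OF word_single_closed[of v d]]
    by (simp add: a_minus_def word_single_closed f.hom_add f.hom_a_inv M.r_neg)
qed

lemma symbol_rep_hom:
  assumes l: "l < s"
  shows "symbol_rep l \<in> Ring.ring_hom (S l) mat_ring"
    and "f \<in> carrier free_xy \<Longrightarrow> symbol_rep l (cls l f) = W.matrix_rep h n (word_mat l) f"
proof -
  have "h 1 \<cdot>\<^sub>m word_mat l (replicate (p l) GenX) = h (z l) \<cdot>\<^sub>m word_mat l []"
    "h 1 \<cdot>\<^sub>m word_mat l (replicate (p l) GenY) = h (w l) \<cdot>\<^sub>m word_mat l []"
    "h 1 \<cdot>\<^sub>m word_mat l [GenY, GenX] = h (\<zeta>0 l) \<cdot>\<^sub>m word_mat l [GenX, GenY]"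
    by (simp_all only: word_mat_relations[OF l] h.hom_one one_smult word_mat_simps(1) h_zeta[OF l])
  note k' = this[THEN word_rep_minus]
  have k: "W.matrix_rep h n (word_mat l) g = \<zero>\<^bsub>mat_ring\<^esub>" if "g \<in> gens (p l) (\<zeta>0 l) (z l) (w l)" for g
    using that by (elim insertE emptyE) (simp_all only: k')
  show "symbol_rep l \<in> Ring.ring_hom (S l) mat_ring"
    unfolding symbol_rep_def symbol_algebra_def symbol_ideal_def
    by (rule quot_lift_hom[OF W.MA_ring mat_ring word_rep_hom gens_closed k])
  show "symbol_rep l (cls l f) = W.matrix_rep h n (word_mat l) f" if "f \<in> carrier free_xy"
    unfolding symbol_rep_def symbol_class_def symbol_ideal_def
    by (rule quot_lift_coset[OF W.MA_ring mat_ring word_rep_hom gens_closed k that])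
qed

lemma symbol_rep_single: "l < s \<Longrightarrow> symbol_rep l (cls l (single u c)) = h c \<cdot>\<^sub>m word_mat l u"
  by (simp add: symbol_rep_hom(2) word_single_closed word_rep_single)

lemma symbol_rep_carrier: "l < s \<Longrightarrow> a \<in> carrier (S l) \<Longrightarrow> symbol_rep l a \<in> carrier_mat n n"
  using ring_hom_closed[OF symbol_rep_hom(1)] by (simp add: ring_mat_def)

text \<open>Commutation of words is extended linearly in one argument at a time.\<close>

lemma symbol_rep_commute:
  assumes lk: "l < s" "k < s" "l \<noteq> k" and a: "a \<in> carrier (S l)" and b: "b \<in> carrier (S k)"
  shows "symbol_rep l a * symbol_rep k b = symbol_rep k b * symbol_rep l a"
proof -
  obtain f where f: "f \<in> carrier free_xy" "a = cls l f" using symbol_class_surj[OF a] .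
  obtain g where g: "g \<in> carrier free_xy" "b = cls k g" using symbol_class_surj[OF b] .
  let ?F = "W.matrix_rep h n (word_mat l) f" and ?G = "W.matrix_rep h n (word_mat k) g"
  have "?G * word_mat l u = word_mat l u * ?G" for u
    by (rule W.matrix_rep_commute[OF g(1)]) (simp_all add: word_mat_commute[OF lk(3)])
  moreover have "?G \<in> carrier_mat n n" by (simp add: W.matrix_rep_def)
  ultimately have "?F * ?G = ?G * ?F" by (intro W.matrix_rep_commute[OF f(1)]) simp_all
  then show ?thesis unfolding f(2) g(2) symbol_rep_hom(2)[OF lk(1) f(1)] symbol_rep_hom(2)[OF lk(2) g(1)] .
qed

end

lemma (in ring) minus_minus_eq_zero:
  assumes "a \<in> carrier R" "b \<in> carrier R"
  shows "((a \<oplus> b) \<ominus> a) \<ominus> b = \<zero>"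
proof -
  have "((a \<oplus> b) \<ominus> a) \<ominus> b = (b \<oplus> (a \<oplus> \<ominus> a)) \<oplus> \<ominus> b" using assms by (simp add: minus_eq a_ac)
  then show ?thesis using assms by (simp add: r_neg)
qed

section \<open>The representation on the tensor product\<close>

context symbol_product
begin

interpretation h: comm_ring_hom h by (rule h)

abbreviation P :: "(nat \<Rightarrow> (symbol_gen list \<Rightarrow> 'c) set) monoid" where
  "P \<equiv> product_group {..<s} S"

lemma S_ring: "ring (S l)" by (rule symbol_algebra_ring)

lemma monoid_S: "monoid (S l)" using S_ring by (simp add: ring.is_monoid)

lemma P_monoid: "monoid P" by (rule monoid_product_group) (rule monoid_S)

interpretation P: monoid P by (rule P_monoid)

abbreviation FP :: "((nat \<Rightarrow> (symbol_gen list \<Rightarrow> 'c) set) \<Rightarrow> 'c) ring" where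
  "FP \<equiv> monoid_algebra P"

interpretation FP: ring FP by (rule P.MA_ring)

text \<open>Factors of different indices commute, and this is what will make the ordered product
  multiplicative in the family.\<close>

fun fam_mat :: "(nat \<Rightarrow> (symbol_gen list \<Rightarrow> 'c) set) \<Rightarrow> nat \<Rightarrow> 'l mat" where
  "fam_mat T 0 = 1\<^sub>m n"
| "fam_mat T (Suc m) = fam_mat T m * symbol_rep m (T m)"

lemma fam_mat_carrier:
  "m \<le> s \<Longrightarrow> (\<And>l. l < s \<Longrightarrow> T l \<in> carrier (S l)) \<Longrightarrow> fam_mat T m \<in> carrier_mat n n"
  by (induction m) (auto intro!: mult_carrier_mat symbol_rep_carrier)

lemma fam_mat_cong: "(\<And>l. l < m \<Longrightarrow> T l = T' l) \<Longrightarrow> fam_mat T m = fam_mat T' m"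
  by (induction m) auto

lemma fam_mat_commute:
  assumes T: "\<And>l. l < s \<Longrightarrow> T l \<in> carrier (S l)" and a: "a \<in> carrier (S k)" and k: "k < s" and m: "m \<le> k"
  shows "fam_mat T m * symbol_rep k a = symbol_rep k a * fam_mat T m"
  using m
proof (induction m)
  case 0
  then show ?case using symbol_rep_carrier[OF k a] by simp
next
  case (Suc m)
  have c: "fam_mat T m \<in> carrier_mat n n" "symbol_rep k a \<in> carrier_mat n n" "symbol_rep m (T m) \<in> carrier_mat n n"
    using Suc.prems k by (auto intro!: fam_mat_carrier T symbol_rep_carrier a)
  have "fam_mat T m * symbol_rep m (T m) * symbol_rep k a = fam_mat T m * (symbol_rep k a * symbol_rep m (T m))"
    unfolding assoc_mult_mat[OF c(1,3,2)]
    using symbol_rep_commute[of m k "T m" a] Suc.prems k T[of m] a by simp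
  also have "\<dots> = fam_mat T m * symbol_rep k a * symbol_rep m (T m)" by (rule assoc_mult_mat[OF c(1,2,3), symmetric])
  also have "\<dots> = symbol_rep k a * (fam_mat T m * symbol_rep m (T m))"
    using Suc by (simp add: assoc_mult_mat[OF c(2,1,3)])
  finally show ?case by simp
qed

lemma symbol_rep_mult:
  "l < s \<Longrightarrow> a \<in> carrier (S l) \<Longrightarrow> b \<in> carrier (S l) \<Longrightarrow>
    symbol_rep l (a \<otimes>\<^bsub>S l\<^esub> b) = symbol_rep l a * symbol_rep l b"
  using ring_hom_mult[OF symbol_rep_hom(1)] by (simp add: ring_mat_simps)

lemma symbol_rep_add:
  "l < s \<Longrightarrow> a \<in> carrier (S l) \<Longrightarrow> b \<in> carrier (S l) \<Longrightarrow>
    symbol_rep l (a \<oplus>\<^bsub>S l\<^esub> b) = symbol_rep l a + symbol_rep l b"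
  using ring_hom_add[OF symbol_rep_hom(1)] by (simp add: ring_mat_simps)

lemma sca_carrier: "sca l c \<in> carrier (S l)"
  unfolding symbol_scalar by (rule ring_hom_closed[OF symbol_class_hom word_single_closed])

lemma symbol_rep_scale:
  assumes l: "l < s" and a: "a \<in> carrier (S l)"
  shows "symbol_rep l (sca l c \<otimes>\<^bsub>S l\<^esub> a) = h c \<cdot>\<^sub>m symbol_rep l a"
  using symbol_rep_mult[OF l sca_carrier a, of c] smult_one_mult_mat(1)[OF symbol_rep_carrier[OF l a], of "h c"]
  by (simp add: symbol_scalar symbol_rep_single[OF l] word_mat_simps)

lemma fam_mat_mult:
  assumes T: "\<And>l. l < s \<Longrightarrow> T l \<in> carrier (S l)" and T': "\<And>l. l < s \<Longrightarrow> T' l \<in> carrier (S l)" and m: "m \<le> s"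
  shows "fam_mat (\<lambda>l\<in>{..<s}. T l \<otimes>\<^bsub>S l\<^esub> T' l) m = fam_mat T m * fam_mat T' m"
  using m
proof (induction m)
  case (Suc m)
  let ?A = "fam_mat T m" and ?A' = "fam_mat T' m" and ?B = "symbol_rep m (T m)" and ?B' = "symbol_rep m (T' m)"
  have m: "m < s" "m \<le> s" using Suc.prems by auto
  have c: "?A \<in> carrier_mat n n" "?A' \<in> carrier_mat n n" "?B \<in> carrier_mat n n" "?B' \<in> carrier_mat n n"
    using m by (auto intro!: fam_mat_carrier T T' symbol_rep_carrier)
  have "?A * ?A' * (?B * ?B') = ?A * (?A' * ?B * ?B')"
    unfolding assoc_mult_mat[OF c(1,2) mult_carrier_mat[OF c(3,4)]] assoc_mult_mat[OF c(2,3,4)] ..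
  \<comment> \<open>The new factor of the first family passes the earlier factors of the
    second.\<close>
  also have "?A' * ?B = ?B * ?A'" by (rule fam_mat_commute[OF T' T[OF m(1)] m(1) order_refl])
  also have "?A * (?B * ?A' * ?B') = ?A * ?B * (?A' * ?B')"
    unfolding assoc_mult_mat[OF c(3,2,4)] assoc_mult_mat[OF c(1,3) mult_carrier_mat[OF c(2,4)]] ..
  finally show ?case using Suc.IH m T T' by (simp add: symbol_rep_mult)
qed simp

lemma fam_mat_add:
  assumes T: "\<And>l. l < s \<Longrightarrow> T l \<in> carrier (S l)" and a: "a \<in> carrier (S k)" "b \<in> carrier (S k)"
    and k: "k < m" and m: "m \<le> s"
  shows "fam_mat (T(k := a \<oplus>\<^bsub>S k\<^esub> b)) m = fam_mat (T(k := a)) m + fam_mat (T(k := b)) m"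
  using k m
proof (induction m)
  case (Suc m)
  have m: "m < s" "m \<le> s" using Suc.prems by auto
  have T': "(T(k := x)) l \<in> carrier (S l)" if "x \<in> carrier (S k)" "l < s" for x l using T that by simp
  have c: "fam_mat (T(k := x)) m \<in> carrier_mat n n" if "x \<in> carrier (S k)" for x
    by (rule fam_mat_carrier[OF m(2)]) (rule T'[OF that])
  show ?case
  proof (cases "k = m")
    case True
    have e: "fam_mat (T(k := x)) m = fam_mat T m" for x by (rule fam_mat_cong) (use True in auto)
    show ?thesis
      unfolding True fam_mat.simps fun_upd_same e[unfolded True] symbol_rep_add[OF m(1) a[unfolded True]]
      by (rule mult_add_distrib_mat[OF fam_mat_carrier[OF m(2) T] symbol_rep_carrier[OF m(1)]
            symbol_rep_carrier[OF m(1)]]) (use a True in simp_all)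
  next
    case False
    then have km: "k < m" "m \<noteq> k" using Suc.prems by auto
    show ?thesis
      unfolding fam_mat.simps fun_upd_other[OF km(2)] Suc.IH[OF km(1) m(2)]
      by (rule add_mult_distrib_mat[OF c[OF a(1)] c[OF a(2)] symbol_rep_carrier[OF m(1) T[OF m(1)]]])
  qed
qed simp

lemma fam_mat_scale:
  assumes T: "\<And>l. l < s \<Longrightarrow> T l \<in> carrier (S l)" and a: "a \<in> carrier (S k)" and k: "k < m" and m: "m \<le> s"
  shows "fam_mat (T(k := sca k c \<otimes>\<^bsub>S k\<^esub> a)) m = h c \<cdot>\<^sub>m fam_mat (T(k := a)) m"
  using k m
proof (induction m)
  case (Suc m)
  have m: "m < s" "m \<le> s" using Suc.prems by auto
  show ?case
  proof (cases "k = m")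
    case True
    have e: "fam_mat (T(k := x)) m = fam_mat T m" for x by (rule fam_mat_cong) (use True in auto)
    show ?thesis
      unfolding True fam_mat.simps fun_upd_same e[unfolded True] symbol_rep_scale[OF m(1) a[unfolded True]]
      by (rule mult_smult_distrib[OF fam_mat_carrier[OF m(2) T] symbol_rep_carrier[OF m(1)]])
        (use a True in simp_all)
  next
    case False
    then have km: "k < m" "m \<noteq> k" using Suc.prems by auto
    have "fam_mat (T(k := a)) m \<in> carrier_mat n n"
      by (rule fam_mat_carrier[OF m(2)]) (simp add: T a)
    then show ?thesis
      unfolding fam_mat.simps fun_upd_other[OF km(2)] Suc.IH[OF km(1) m(2)]
      by (rule mult_smult_assoc_mat[OF _ symbol_rep_carrier[OF m(1) T[OF m(1)]]])
  qed
qed simp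

definition fam_rep :: "(nat \<Rightarrow> (symbol_gen list \<Rightarrow> 'c) set) \<Rightarrow> 'l mat" where
  "fam_rep T = fam_mat T s"

lemma P_mem: "T \<in> carrier P \<Longrightarrow> l < s \<Longrightarrow> T l \<in> carrier (S l)" by (auto simp: PiE_iff)

lemma fam_rep_carrier: "T \<in> carrier P \<Longrightarrow> fam_rep T \<in> carrier_mat n n"
  unfolding fam_rep_def by (rule fam_mat_carrier[OF order_refl]) (rule P_mem)

lemma fam_rep_mult:
  assumes "T \<in> carrier P" "T' \<in> carrier P"
  shows "fam_rep (T \<otimes>\<^bsub>P\<^esub> T') = fam_rep T * fam_rep T'"
  unfolding fam_rep_def mult_product_group
  by (rule fam_mat_mult[OF P_mem[OF assms(1)] P_mem[OF assms(2)] order_refl])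

lemma fam_rep_one: "fam_rep \<one>\<^bsub>P\<^esub> = 1\<^sub>m n"
proof -
  have "fam_mat \<one>\<^bsub>P\<^esub> m = 1\<^sub>m n" if "m \<le> s" for m
    using that
  proof (induction m)
    case (Suc m)
    have "symbol_rep m \<one>\<^bsub>S m\<^esub> = 1\<^sub>m n"
      using ring_hom_one[OF symbol_rep_hom(1)[of m]] Suc.prems by (simp add: ring_mat_simps)
    then show ?case using Suc by simp
  qed simp
  then show ?thesis by (simp add: fam_rep_def)
qed

definition tensor_rep0 :: "((nat \<Rightarrow> (symbol_gen list \<Rightarrow> 'c) set) \<Rightarrow> 'c) \<Rightarrow> 'l mat" where
  "tensor_rep0 = P.matrix_rep h n fam_rep"

lemma tensor_rep0_hom: "tensor_rep0 \<in> Ring.ring_hom FP mat_ring"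
  unfolding tensor_rep0_def by (rule P.matrix_rep_hom[OF h fam_rep_carrier fam_rep_mult fam_rep_one])

lemma tensor_rep0_single: "T \<in> carrier P \<Longrightarrow> tensor_rep0 (single T c) = h c \<cdot>\<^sub>m fam_rep T"
  unfolding tensor_rep0_def by (rule P.matrix_rep_single[OF h fam_rep_carrier])

abbreviation rels :: "((nat \<Rightarrow> (symbol_gen list \<Rightarrow> 'c) set) \<Rightarrow> 'c) set" where
  "rels \<equiv> tensor_relations {..<s} S sca"

lemma update_P: "T \<in> carrier P \<Longrightarrow> l < s \<Longrightarrow> a \<in> carrier (S l) \<Longrightarrow> T(l := a) \<in> carrier P"
  by (auto simp: PiE_iff extensional_def)

lemma relsE:
  assumes "g \<in> rels"
  obtains (add) T l a b where "T \<in> carrier P" "l < s" "a \<in> carrier (S l)" "b \<in> carrier (S l)"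
      "g = single (T(l := a \<oplus>\<^bsub>S l\<^esub> b)) 1 \<ominus>\<^bsub>FP\<^esub> single (T(l := a)) 1 \<ominus>\<^bsub>FP\<^esub> single (T(l := b)) 1"
    | (scale) T l a c where "T \<in> carrier P" "l < s" "a \<in> carrier (S l)"
      "g = single (T(l := sca l c \<otimes>\<^bsub>S l\<^esub> a)) 1 \<ominus>\<^bsub>FP\<^esub> single (T(l := a)) c"
  using assms unfolding tensor_relations_def Let_def Un_iff mem_Collect_eq carrier_product_group lessThan_iff by blast

lemma S_closed:
  "a \<in> carrier (S l) \<Longrightarrow> b \<in> carrier (S l) \<Longrightarrow> a \<oplus>\<^bsub>S l\<^esub> b \<in> carrier (S l)"
  "a \<in> carrier (S l) \<Longrightarrow> sca l c \<otimes>\<^bsub>S l\<^esub> a \<in> carrier (S l)"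
  using ring.ring_simprules(1)[OF S_ring] ring.ring_simprules(5)[OF S_ring] sca_carrier by blast+

lemma rels_closed: "rels \<subseteq> carrier FP"
proof
  fix g assume "g \<in> rels"
  then show "g \<in> carrier FP"
  proof (cases rule: relsE)
    case (add T l a b)
    show ?thesis unfolding add(5)
      by (intro FP.minus_closed P.single_closed update_P add S_closed)
  next
    case (scale T l a c)
    show ?thesis unfolding scale(4)
      by (intro FP.minus_closed P.single_closed update_P scale S_closed)
  qed
qed

lemma tensor_rep0_rels:
  assumes "g \<in> rels"
  shows "tensor_rep0 g = \<zero>\<^bsub>mat_ring\<^esub>"
proof -
  interpret M: ring mat_ring by (rule mat_ring)
  interpret f: ring_hom_ring FP mat_ring tensor_rep0
    by (rule ring_hom_ringI2[OF P.MA_ring mat_ring tensor_rep0_hom])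
  have f_minus: "tensor_rep0 (a \<ominus>\<^bsub>FP\<^esub> b) = tensor_rep0 a \<ominus>\<^bsub>mat_ring\<^esub> tensor_rep0 b"
    if "a \<in> carrier FP" "b \<in> carrier FP" for a b
    using that by (simp add: a_minus_def f.hom_add f.hom_a_inv)
  show ?thesis
    using assms
  proof (cases rule: relsE)
    case (add T l a b)
    note u = update_P[OF add(1,2)]
    let ?a = "single (T(l := a)) 1" and ?b = "single (T(l := b)) 1"
      and ?ab = "single (T(l := a \<oplus>\<^bsub>S l\<^esub> b)) (1 :: 'c)"
    have c: "?a \<in> carrier FP" "?b \<in> carrier FP" "?ab \<in> carrier FP"
      by (intro P.single_closed u add S_closed)+
    have "fam_rep (T(l := a \<oplus>\<^bsub>S l\<^esub> b)) = fam_rep (T(l := a)) + fam_rep (T(l := b))"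
      unfolding fam_rep_def by (rule fam_mat_add[OF P_mem[OF add(1)] add(3,4,2) order_refl])
    then have "tensor_rep0 ?ab = tensor_rep0 ?a \<oplus>\<^bsub>mat_ring\<^esub> tensor_rep0 ?b"
      by (simp only: tensor_rep0_single[OF u[OF add(3)]] tensor_rep0_single[OF u[OF add(4)]]
        tensor_rep0_single[OF u[OF S_closed(1)[OF add(3,4)]]] h.hom_one one_smult ring_mat_simps)
    then show ?thesis
      using M.minus_minus_eq_zero[OF f.hom_closed[OF c(1)] f.hom_closed[OF c(2)]]
      by (simp only: add(5) f_minus[OF FP.minus_closed[OF c(3,1)] c(2)] f_minus[OF c(3,1)])
  next
    case (scale T l a c)
    note u = update_P[OF scale(1,2)]
    let ?a = "single (T(l := a)) c" and ?b = "single (T(l := sca l c \<otimes>\<^bsub>S l\<^esub> a)) (1 :: 'c)"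
    have c: "?a \<in> carrier FP" "?b \<in> carrier FP"
      by (intro P.single_closed u scale S_closed)+
    have "fam_rep (T(l := sca l c \<otimes>\<^bsub>S l\<^esub> a)) = h c \<cdot>\<^sub>m fam_rep (T(l := a))"
      unfolding fam_rep_def by (rule fam_mat_scale[OF P_mem[OF scale(1)] scale(3,2) order_refl])
    then have "tensor_rep0 ?b = tensor_rep0 ?a"
      by (simp only: tensor_rep0_single[OF u[OF scale(3)]] tensor_rep0_single[OF u[OF S_closed(2)[OF scale(3)]]]
        h.hom_one one_smult)
    moreover have "tensor_rep0 ?a \<ominus>\<^bsub>mat_ring\<^esub> tensor_rep0 ?a = \<zero>\<^bsub>mat_ring\<^esub>"
      using M.r_neg[OF f.hom_closed[OF c(1)]] by (simp only: a_minus_def)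
    ultimately show ?thesis by (simp only: scale(4) f_minus[OF c(2,1)])
  qed
qed

abbreviation A :: "((nat \<Rightarrow> (symbol_gen list \<Rightarrow> 'c) set) \<Rightarrow> 'c) set ring" where
  "A \<equiv> tensor_algebra {..<s} S sca"

definition tensor_class ::
    "((nat \<Rightarrow> (symbol_gen list \<Rightarrow> 'c) set) \<Rightarrow> 'c) \<Rightarrow> ((nat \<Rightarrow> (symbol_gen list \<Rightarrow> 'c) set) \<Rightarrow> 'c) set" where
  "tensor_class F = (Idl\<^bsub>FP\<^esub> rels) +>\<^bsub>FP\<^esub> F"

definition tensor_rep :: "((nat \<Rightarrow> (symbol_gen list \<Rightarrow> 'c) set) \<Rightarrow> 'c) set \<Rightarrow> 'l mat" where
  "tensor_rep = quot_lift tensor_rep0"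

lemma A_eq: "A = FP Quot (Idl\<^bsub>FP\<^esub> rels)"
  by (simp add: tensor_algebra_def Let_def)

lemma tensor_ideal: "ideal (Idl\<^bsub>FP\<^esub> rels) FP" by (rule FP.genideal_ideal[OF rels_closed])

lemma A_ring: "ring A"
  unfolding A_eq by (rule ideal.quotient_is_ring[OF tensor_ideal])

lemma tensor_class_hom: "tensor_class \<in> Ring.ring_hom FP A"
  using ideal.rcos_ring_hom[OF tensor_ideal] unfolding A_eq tensor_class_def[abs_def] by simp

lemma tensor_class_surj:
  assumes "a \<in> carrier A"
  obtains F where "F \<in> carrier FP" "a = tensor_class F"
  using assms unfolding A_eq tensor_class_def FactRing_def A_RCOSETS_def' by auto

lemma tensor_rep_hom: "tensor_rep \<in> Ring.ring_hom A mat_ring"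
  unfolding A_eq tensor_rep_def
  by (rule quot_lift_hom[OF P.MA_ring mat_ring tensor_rep0_hom rels_closed tensor_rep0_rels])

lemma tensor_rep_class: "F \<in> carrier FP \<Longrightarrow> tensor_rep (tensor_class F) = tensor_rep0 F"
  unfolding tensor_rep_def tensor_class_def
  by (rule quot_lift_coset[OF P.MA_ring mat_ring tensor_rep0_hom rels_closed tensor_rep0_rels])

end

lemma pairing_sum_single:
  fixes h :: "'c::field \<Rightarrow> 'l::field"
  assumes h: "comm_ring_hom h" and I: "finite I"
  shows "pairing h (\<lambda>u. \<Sum>r\<in>I. single (v r) (c r) u) k = (\<Sum>r\<in>I. h (c r) * k (v r))"
proof -
  interpret comm_ring_hom h by (rule h)
  have "pairing h (\<lambda>u. \<Sum>r\<in>I. single (v r) (c r) u) k = (\<Sum>u\<in>v ` I. h (\<Sum>r\<in>I. single (v r) (c r) u) * k u)"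
  proof (rule pairing_superset[OF h finite_imageI[OF I]])
    fix u assume "(\<Sum>r\<in>I. single (v r) (c r) u) \<noteq> 0"
    then obtain r where "r \<in> I" "single (v r) (c r) u \<noteq> 0" by (meson sum.neutral)
    then show "u \<in> v ` I" by (auto simp: Defs.single_def split: if_splits)
  qed
  also have "\<dots> = (\<Sum>r\<in>I. \<Sum>u\<in>v ` I. if u = v r then h (c r) * k (v r) else 0)"
    unfolding hom_sum sum_distrib_right
    by (subst sum.swap) (intro sum.cong refl, simp add: Defs.single_def)
  also have "\<dots> = (\<Sum>r\<in>I. h (c r) * k (v r))"
    by (intro sum.cong refl) (simp add: I sum.delta)
  finally show ?thesis .
qed

context monomial_matrices
begin

lemma sh_digit_inj:
  assumes "y < n" "y' < n" "sh (digit y) i = sh (digit y') i"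
  shows "y = y'"
proof (rule digit_eqI[OF assms(1,2)])
  fix l assume l: "l < s"
  have "(digit i l + digit y l) mod p l = (digit i l + digit y' l) mod p l"
    using sh(2)[OF l, of "digit y" i] sh(2)[OF l, of "digit y'" i] assms(3) by simp
  then have "[digit i l + digit y l = digit i l + digit y' l] (mod p l)" by (simp only: cong_def)
  then have "digit y l mod p l = digit y' l mod p l" by (simp only: cong_add_lcancel_nat) (simp only: cong_def)
  then show "digit y l = digit y' l" using digit_less[OF assms(1) l] digit_less[OF assms(2) l] by simp
qed

text \<open>A coefficient is recovered from the entries on one shifted diagonal by the inverse
  Fourier sum.\<close>

lemma NB_independent:
  assumes eq: "mlin n {..<n * n} g NB = mlin n {..<n * n} g' NB" and r: "r < n * n"
  shows "g r = g' r"
proof -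
  define x y where "x = r div n" and "y = r mod n"
  have xy: "x < n" "y < n" "r = x * n + y" using r n_pos
    by (auto simp: x_def y_def less_mult_imp_div_less)
  have e: "(\<Sum>i<n. mlin n {..<n * n} g NB $$ (i, sh (digit y) i) * inverse (chi (digit x) i)) = of_nat n * g r" for g
  proof -
    have "mlin n {..<n * n} g NB $$ (i, sh (digit y) i) = (\<Sum>x'<n. g (x' * n + y) * chi (digit x') i)" if i: "i < n" for i
    proof -
      have "mlin n {..<n * n} g NB $$ (i, sh (digit y) i) =
          (\<Sum>r<n * n. g ((r div n) * n + r mod n) * (if sh (digit y) i = sh (digit (r mod n)) i then chi (digit (r div n)) i else 0))"
        using i sh(1) by simp
      also have "\<dots> = (\<Sum>x'<n. \<Sum>y'<n. g (x' * n + y') * (if sh (digit y) i = sh (digit y') i then chi (digit x') i else 0))"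
        by (rule sum_pairs[OF n_pos, where f = "\<lambda>x' y'. g (x' * n + y') *
          (if sh (digit y) i = sh (digit y') i then chi (digit x') i else 0)"])
      also have "\<dots> = (\<Sum>x'<n. \<Sum>y'<n. if y' = y then g (x' * n + y) * chi (digit x') i else 0)"
        by (intro sum.cong refl) (use sh_digit_inj[of y _ i] xy(2) in auto)
      finally show ?thesis using xy(2) by (simp add: sum.delta)
    qed
    then have "(\<Sum>i<n. mlin n {..<n * n} g NB $$ (i, sh (digit y) i) * inverse (chi (digit x) i)) =
        (\<Sum>i<n. \<Sum>x'<n. g (x' * n + y) * (chi (digit x') i * inverse (chi (digit x) i)))"
      by (simp add: sum_distrib_right mult.assoc)
    also have "\<dots> = (\<Sum>x'<n. g (x' * n + y) * (\<Sum>i<n. chi (digit x') i * inverse (chi (digit x) i)))"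
      by (subst sum.swap) (simp add: sum_distrib_left)
    also have "\<dots> = (\<Sum>x'<n. if x' = x then of_nat n * g (x' * n + y) else 0)"
      by (intro sum.cong refl) (simp add: chi_orthogonal xy(1) mult.commute)
    finally show ?thesis using xy by (simp add: sum.delta)
  qed
  show ?thesis using e[of g] e[of g'] of_nat_n unfolding eq by simp
qed

end

section \<open>A basis of the tensor product of symbol algebras\<close>

context symbol_product
begin

interpretation h: comm_ring_hom h by (rule h)
interpretation P: monoid P by (rule P_monoid)
interpretation FP: ring FP by (rule P.MA_ring)
interpretation A: ring A by (rule A_ring)

definition basis_fam :: "nat \<Rightarrow> nat \<Rightarrow> (symbol_gen list \<Rightarrow> 'c) set" where
  "basis_fam r = (\<lambda>l\<in>{..<s}. cls l (single (xy (digit (r div n) l) (digit (r mod n) l)) 1))"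

lemma cls_closed: "cls l (single u c) \<in> carrier (S l)"
  by (rule ring_hom_closed[OF symbol_class_hom word_single_closed])

lemma basis_fam_P: "basis_fam r \<in> carrier P"
  by (simp add: basis_fam_def cls_closed)

lemma basis_fam_rep: "fam_rep (basis_fam r) = mval t (expo r) \<cdot>\<^sub>m NB r"
proof -
  let ?a = "digit (r div n)" and ?b = "digit (r mod n)"
  have "fam_mat (basis_fam r) m = (\<Prod>l<m. t (2 * l) ^ ?a l * t (2 * l + 1) ^ ?b l) \<cdot>\<^sub>m
      N (\<lambda>l. if l < m then ?a l else 0) (\<lambda>l. if l < m then ?b l else 0)" if "m \<le> s" for m
    using that
  proof (induction m)
    case 0
    have "N (\<lambda>l. if l < 0 then ?a l else 0) (\<lambda>l. if l < 0 then ?b l else 0) = 1\<^sub>m n"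
      by (rule N_trivial) simp_all
    then show ?case by (simp add: one_smult)
  next
    case (Suc m)
    then have m: "m < s" by simp
    have rep: "symbol_rep m (basis_fam r m) = (t (2 * m) ^ ?a m * t (2 * m + 1) ^ ?b m) \<cdot>\<^sub>m
        N (\<lambda>k. ?a m * unit_vec m k) (\<lambda>k. ?b m * unit_vec m k)"
      using m by (simp add: basis_fam_def symbol_rep_single word_mat_xy one_smult)
    have z: "\<zeta> l ^ ((?a m * unit_vec m l) * (if l < m then ?b l else 0)) = 1" for l by (simp add: unit_vec_def)
    have N: "N (\<lambda>l. (if l < m then ?a l else 0) + ?a m * unit_vec m l) (\<lambda>l. (if l < m then ?b l else 0) + ?b m * unit_vec m l)
        = N (\<lambda>l. if l < Suc m then ?a l else 0) (\<lambda>l. if l < Suc m then ?b l else 0)"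
      by (rule N_cong) (auto simp: unit_vec_def less_Suc_eq)
    show ?case
      unfolding fam_mat.simps Suc.IH[OF less_imp_le[OF m]] rep smult_mult_smult[OF N_carrier N_carrier] N_mult z
      by (simp only: N prod.neutral_const one_smult prod.lessThan_Suc)
  qed
  from this[OF order_refl] have "fam_rep (basis_fam r) = mval t (expo r) \<cdot>\<^sub>m
      N (\<lambda>l. if l < s then ?a l else 0) (\<lambda>l. if l < s then ?b l else 0)"
    by (simp only: fam_rep_def mval_expo)
  also have "N (\<lambda>l. if l < s then ?a l else 0) (\<lambda>l. if l < s then ?b l else 0) = NB r"
    by (rule N_cong) simp_all
  finally show ?thesis .
qed

text \<open>Combinations of the pure tensors of monomials, before passing to the quotient; every
  element of the algebra turns out to be the class of one of them.\<close>

definition comb :: "(nat \<Rightarrow> 'c) \<Rightarrow> (nat \<Rightarrow> (symbol_gen list \<Rightarrow> 'c) set) \<Rightarrow> 'c" where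
  "comb c = (\<lambda>T. \<Sum>r<n * n. single (basis_fam r) (c r) T)"

lemma comb_closed: "comb c \<in> carrier FP"
proof -
  have *: "T \<in> basis_fam ` {..<n * n}" if "comb c T \<noteq> 0" for T
  proof -
    obtain r where "r < n * n" "single (basis_fam r) (c r) T \<noteq> 0"
      using \<open>comb c T \<noteq> 0\<close> unfolding comb_def by (meson lessThan_iff sum.neutral)
    then show ?thesis by (auto simp: Defs.single_def split: if_splits)
  qed
  then have "{T. comb c T \<noteq> 0} \<subseteq> basis_fam ` {..<n * n}" by blast
  then have "finite {T. comb c T \<noteq> 0}" by (rule finite_subset) simp
  moreover have "T \<in> carrier P" if "comb c T \<noteq> 0" for T using *[OF that] basis_fam_P by blast
  ultimately show ?thesis unfolding P.MA_carrier by blast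
qed

lemma comb_add: "comb c \<oplus>\<^bsub>FP\<^esub> comb c' = comb (\<lambda>r. c r + c' r)"
  unfolding P.MA_add comb_def sum.distrib[symmetric]
  by (rule ext, rule sum.cong[OF refl]) (simp add: Defs.single_def)

lemma comb_single:
  assumes "r < n * n"
  shows "single (basis_fam r) d = comb (\<lambda>r'. if r' = r then d else 0)"
proof
  fix T
  have "comb (\<lambda>r'. if r' = r then d else 0) T = (\<Sum>r'<n * n. if r' = r then single (basis_fam r) d T else 0)"
    unfolding comb_def by (rule sum.cong) (auto simp: Defs.single_def)
  then show "single (basis_fam r) d T = comb (\<lambda>r'. if r' = r then d else 0) T" using assms by (simp add: sum.delta)
qed

lemma tensor_class_scale:
  assumes "T \<in> carrier P"
  shows "tensor_class (single T (c * d)) = tensor_class (single \<one>\<^bsub>P\<^esub> c) \<otimes>\<^bsub>A\<^esub> tensor_class (single T d)"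
proof -
  have "single T (c * d) = single \<one>\<^bsub>P\<^esub> c \<otimes>\<^bsub>FP\<^esub> single T d"
    unfolding P.single_mult[OF P.one_closed assms] P.l_one[OF assms] ..
  then show ?thesis
    by (simp only: ring_hom_mult[OF tensor_class_hom P.single_closed[OF P.one_closed] P.single_closed[OF assms]])
qed

lemma tensor_class_add:
  assumes T: "T \<in> carrier P" and l: "l < s" and ab: "a \<in> carrier (S l)" "b \<in> carrier (S l)"
  shows "tensor_class (single (T(l := a \<oplus>\<^bsub>S l\<^esub> b)) c) =
    tensor_class (single (T(l := a)) c) \<oplus>\<^bsub>A\<^esub> tensor_class (single (T(l := b)) c)"
proof -
  note u = update_P[OF T l]
  let ?a = "single (T(l := a)) (1 :: 'c)" and ?b = "single (T(l := b)) (1 :: 'c)"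
    and ?ab = "single (T(l := a \<oplus>\<^bsub>S l\<^esub> b)) (1 :: 'c)" and ?c = "single \<one>\<^bsub>P\<^esub> c"
  have cl: "?a \<in> carrier FP" "?b \<in> carrier FP" "?ab \<in> carrier FP" "?c \<in> carrier FP"
    by (intro P.single_closed u ab S_closed P.one_closed)+
  note tc = ring_hom_closed[OF tensor_class_hom]
  have "?ab \<ominus>\<^bsub>FP\<^esub> ?a \<ominus>\<^bsub>FP\<^esub> ?b \<in> rels"
    unfolding tensor_relations_def Let_def
    by (rule UnI1, rule CollectI, intro exI conjI, rule refl) (use T l ab in auto)
  then have "?ab \<ominus>\<^bsub>FP\<^esub> ?a \<ominus>\<^bsub>FP\<^esub> ?b \<in> Idl\<^bsub>FP\<^esub> rels" using FP.genideal_self[OF rels_closed] by blast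
  also have "?ab \<ominus>\<^bsub>FP\<^esub> ?a \<ominus>\<^bsub>FP\<^esub> ?b = ?ab \<ominus>\<^bsub>FP\<^esub> (?a \<oplus>\<^bsub>FP\<^esub> ?b)"
    using cl by (simp add: a_minus_def FP.minus_add FP.a_assoc)
  finally have "tensor_class ?ab = tensor_class (?a \<oplus>\<^bsub>FP\<^esub> ?b)"
    using FP.quotient_eq_iff_same_a_r_cos[OF tensor_ideal cl(3) FP.a_closed[OF cl(1,2)]] unfolding tensor_class_def by blast
  also have "\<dots> = tensor_class ?a \<oplus>\<^bsub>A\<^esub> tensor_class ?b" by (rule ring_hom_add[OF tensor_class_hom cl(1,2)])
  finally have "tensor_class ?c \<otimes>\<^bsub>A\<^esub> tensor_class ?ab = tensor_class ?c \<otimes>\<^bsub>A\<^esub> tensor_class ?a \<oplus>\<^bsub>A\<^esub> tensor_class ?c \<otimes>\<^bsub>A\<^esub> tensor_class ?b"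
    by (simp only: A.r_distr[OF tc[OF cl(1)] tc[OF cl(2)] tc[OF cl(4)]])
  then show ?thesis
    using tensor_class_scale[OF u[OF ab(1)], of c 1] tensor_class_scale[OF u[OF ab(2)], of c 1]
      tensor_class_scale[OF u[OF S_closed(1)[OF ab]], of c 1] by simp
qed

lemma tensor_class_pull:
  assumes T: "T \<in> carrier P" and l: "l < s" and a: "a \<in> carrier (S l)"
  shows "tensor_class (single (T(l := sca l d \<otimes>\<^bsub>S l\<^esub> a)) c) = tensor_class (single (T(l := a)) (c * d))"
proof -
  note u = update_P[OF T l]
  let ?a = "single (T(l := a)) d" and ?b = "single (T(l := sca l d \<otimes>\<^bsub>S l\<^esub> a)) (1 :: 'c)"
  have cl: "?a \<in> carrier FP" "?b \<in> carrier FP" by (intro P.single_closed u a S_closed)+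
  have "?b \<ominus>\<^bsub>FP\<^esub> ?a \<in> rels"
    unfolding tensor_relations_def Let_def
    by (rule UnI2, rule CollectI, intro exI conjI, rule refl) (use T l a in auto)
  then have "?b \<ominus>\<^bsub>FP\<^esub> ?a \<in> Idl\<^bsub>FP\<^esub> rels" using FP.genideal_self[OF rels_closed] by blast
  then have "tensor_class ?b = tensor_class ?a"
    using FP.quotient_eq_iff_same_a_r_cos[OF tensor_ideal cl(2,1)] unfolding tensor_class_def by blast
  then show ?thesis
    unfolding tensor_class_scale[OF u[OF a], of c d]
    using tensor_class_scale[OF u[OF S_closed(2)[OF a, of d]], of c 1] by (simp only: mult_1_right)
qed

lemma tensor_class_comb_add:
  "tensor_class (comb c) \<oplus>\<^bsub>A\<^esub> tensor_class (comb c') = tensor_class (comb (\<lambda>r. c r + c' r))"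
  unfolding comb_add[symmetric] by (rule ring_hom_add[OF tensor_class_hom comb_closed comb_closed, symmetric])

text \<open>The coordinates of a pure tensor are replaced by sums of basis elements one after the other.\<close>

lemma tensor_class_single:
  assumes "m \<le> s" "T \<in> carrier P"
    and "\<And>l. m \<le> l \<Longrightarrow> l < s \<Longrightarrow> \<exists>a<p l. \<exists>b<p l. T l = cls l (single (xy a b) 1)"
  shows "\<exists>c'. tensor_class (single T c) = tensor_class (comb c')"
  using assms
proof (induction m arbitrary: T c)
  case 0
  from 0(3) have "\<forall>l\<in>{..<s}. \<exists>a b. a < p l \<and> b < p l \<and> T l = cls l (single (xy a b) 1)" by (meson le0 lessThan_iff)
  from bchoice[OF this] obtain a where
    "\<forall>l\<in>{..<s}. \<exists>b. a l < p l \<and> b < p l \<and> T l = cls l (single (xy (a l) b) 1)" ..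
  from bchoice[OF this] obtain b where
    ab: "\<forall>l\<in>{..<s}. a l < p l \<and> b l < p l \<and> T l = cls l (single (xy (a l) (b l)) 1)" ..
  have "\<exists>x<n. \<forall>l<s. digit x l = a l" by (rule digit_surj) (use ab in simp)
  then obtain x where x: "x < n" "\<forall>l<s. digit x l = a l" by (elim exE conjE)
  have "\<exists>y<n. \<forall>l<s. digit y l = b l" by (rule digit_surj) (use ab in simp)
  then obtain y where y: "y < n" "\<forall>l<s. digit y l = b l" by (elim exE conjE)
  let ?r = "x * n + y"
  have r: "?r div n = x" "?r mod n = y" using y(1) by auto
  have rn: "?r < n * n" using x(1) div_less_iff_less_mult[OF n_pos, of ?r n] unfolding r by blast
  have "T = basis_fam ?r"
  proof
    fix l
    show "T l = basis_fam ?r l"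
      unfolding basis_fam_def r using 0(2) ab x(2) y(2) by (cases "l < s") (auto simp: PiE_iff extensional_def)
  qed
  then have "tensor_class (single T c) = tensor_class (comb (\<lambda>r'. if r' = ?r then c else 0))"
    by (simp only: comb_single[OF rn])
  then show ?case by - (rule exI)
next
  case (Suc m)
  have m: "m < s" using Suc.prems(1) by simp
  obtain f where f: "f \<in> carrier free_xy" "T m = cls m f" using symbol_class_surj[OF P_mem[OF Suc.prems(2) m]] .
  \<comment> \<open>Coordinate \<open>m\<close> is decomposed into words, each of which reduces to a
    monomial times a scalar that can be pulled out of the tensor.\<close>
  have "\<forall>c. \<exists>c'. tensor_class (single (T(m := cls m f)) c) = tensor_class (comb c')"
    using f(1)
  proof (induction f rule: W.MA_induct)
    have sg: "\<exists>c'. tensor_class (single (T(m := cls m (single u d))) c) = tensor_class (comb c')" for u d c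
    proof -
      from symbol_class_word[OF p_pos[OF m], of "\<zeta>0 m" "z m" "w m" u d]
      obtain a b d' where ab: "a < p m" "b < p m"
        and d': "cls m (single u d) = cls m (single (xy a b) d')"
        by (elim exE conjE)
      let ?T = "T(m := cls m (single (xy a b) 1))"
      have "cls m (single u d) = sca m d' \<otimes>\<^bsub>S m\<^esub> cls m (single (xy a b) 1)"
        unfolding d' using symbol_class_scale[of "p m" "\<zeta>0 m" "z m" "w m" "xy a b" d' 1]
        by (simp only: mult_1_right)
      then have "tensor_class (single (T(m := cls m (single u d))) c) = tensor_class (single ?T (c * d'))"
        by (simp only: tensor_class_pull[OF Suc.prems(2) m cls_closed])
      moreover have "\<exists>c'. tensor_class (single ?T (c * d')) = tensor_class (comb c')"
      proof (rule Suc.IH)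
        show "m \<le> s" using m by simp
        show "?T \<in> carrier P" by (rule update_P[OF Suc.prems(2) m cls_closed])
        show "\<exists>a<p l. \<exists>b<p l. ?T l = cls l (single (xy a b) 1)" if "m \<le> l" "l < s" for l
        proof (cases "l = m")
          case True
          show ?thesis unfolding True fun_upd_same using ab by blast
        next
          case False
          then have "Suc m \<le> l" using that by simp
          from Suc.prems(3)[OF this that(2)] show ?thesis unfolding fun_upd_other[OF False] .
        qed
      qed
      ultimately show ?thesis by (simp only:)
    qed
    show "\<forall>c. \<exists>c'. tensor_class (single (T(m := cls m (single u d))) c) = tensor_class (comb c')" for u d
      using sg by blast
    have z: "\<zero>\<^bsub>free_xy\<^esub> = single [] (0 :: 'c)" by (auto simp: W.MA_zero Defs.single_def)
    show "\<forall>c. \<exists>c'. tensor_class (single (T(m := cls m \<zero>\<^bsub>free_xy\<^esub>)) c) = tensor_class (comb c')"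
      unfolding z using sg by blast
    fix f g :: "symbol_gen list \<Rightarrow> 'c"
    assume fg: "f \<in> carrier free_xy" "g \<in> carrier free_xy"
      and IH: "\<forall>c. \<exists>c'. tensor_class (single (T(m := cls m f)) c) = tensor_class (comb c')"
        "\<forall>c. \<exists>c'. tensor_class (single (T(m := cls m g)) c) = tensor_class (comb c')"
    show "\<forall>c. \<exists>c'. tensor_class (single (T(m := cls m (f \<oplus>\<^bsub>free_xy\<^esub> g))) c) = tensor_class (comb c')"
    proof
      fix c
      obtain c1 where c1: "tensor_class (single (T(m := cls m f)) c) = tensor_class (comb c1)" using IH(1) by blast
      obtain c2 where c2: "tensor_class (single (T(m := cls m g)) c) = tensor_class (comb c2)" using IH(2) by blast
      have "tensor_class (single (T(m := cls m (f \<oplus>\<^bsub>free_xy\<^esub> g))) c) = tensor_class (comb (\<lambda>r. c1 r + c2 r))"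
        unfolding ring_hom_add[OF symbol_class_hom fg] tensor_class_comb_add[symmetric] c1[symmetric] c2[symmetric]
        by (rule tensor_class_add[OF Suc.prems(2) m ring_hom_closed[OF symbol_class_hom fg(1)]
              ring_hom_closed[OF symbol_class_hom fg(2)]])
      then show "\<exists>c'. tensor_class (single (T(m := cls m (f \<oplus>\<^bsub>free_xy\<^esub> g))) c) = tensor_class (comb c')"
        by - (rule exI)
    qed
  qed
  then show ?case unfolding f(2)[symmetric] fun_upd_triv by blast
qed

lemma tensor_comb:
  assumes "a \<in> carrier A"
  obtains c where "a = tensor_class (comb c)"
proof -
  obtain F where F: "F \<in> carrier FP" "a = tensor_class F" using tensor_class_surj[OF assms] .
  have "\<exists>c. tensor_class F = tensor_class (comb c)"
    using F(1)
  proof (induction F rule: P.MA_induct)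
    case zero
    have "\<zero>\<^bsub>FP\<^esub> = comb (\<lambda>_. 0)" by (auto simp: P.MA_zero comb_def Defs.single_def)
    then have "tensor_class \<zero>\<^bsub>FP\<^esub> = tensor_class (comb (\<lambda>_. 0))" by (rule arg_cong)
    then show ?case by - (rule exI)
  next
    case (single T c)
    show ?case by (rule tensor_class_single[OF order_refl single]) simp
  next
    case (add F G)
    then obtain c1 c2 where "tensor_class F = tensor_class (comb c1)" "tensor_class G = tensor_class (comb c2)" by blast
    then have "tensor_class (F \<oplus>\<^bsub>FP\<^esub> G) = tensor_class (comb (\<lambda>r. c1 r + c2 r))"
      unfolding ring_hom_add[OF tensor_class_hom add(1,2)] tensor_class_comb_add[symmetric] by simp
    then show ?case by - (rule exI)
  qed
  then show ?thesis using F(2) that by blast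
qed

lemma tensor_rep_comb:
  "tensor_rep (tensor_class (comb c)) = mlin n {..<n * n} (\<lambda>r. h (c r) * mval t (expo r)) NB"
proof (rule eq_matI)
  fix i j assume "i < dim_row (mlin n {..<n * n} (\<lambda>r. h (c r) * mval t (expo r)) NB)"
    "j < dim_col (mlin n {..<n * n} (\<lambda>r. h (c r) * mval t (expo r)) NB)"
  then have ij: "i < n" "j < n" by (auto simp: mlin_def)
  have "tensor_rep (tensor_class (comb c)) $$ (i, j) = pairing h (comb c) (\<lambda>T. fam_rep T $$ (i, j))"
    unfolding tensor_rep_class[OF comb_closed] tensor_rep0_def P.matrix_rep_def using ij by simp
  also have "\<dots> = (\<Sum>r<n * n. h (c r) * fam_rep (basis_fam r) $$ (i, j))"
    unfolding comb_def by (rule pairing_sum_single[OF h]) simp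
  also have "\<dots> = mlin n {..<n * n} (\<lambda>r. h (c r) * mval t (expo r)) NB $$ (i, j)"
    unfolding basis_fam_rep using ij by (simp add: mult.assoc)
  finally show "tensor_rep (tensor_class (comb c)) $$ (i, j) = mlin n {..<n * n} (\<lambda>r. h (c r) * mval t (expo r)) NB $$ (i, j)" .
qed (simp_all add: tensor_rep_class[OF comb_closed] tensor_rep0_def P.matrix_rep_def mlin_def)

lemma mval_t_nonzero: "mval t (expo r) \<noteq> 0"
proof -
  have "t (2 * l) \<noteq> 0 \<and> t (2 * l + 1) \<noteq> 0" if "l < s" for l
    using t_nonzero[of "2 * l"] t_nonzero[of "2 * l + 1"] that by simp
  then show ?thesis unfolding mval_expo prod_zero_iff[OF finite_lessThan] by simp
qed

definition basis_elt :: "nat \<Rightarrow> ((nat \<Rightarrow> (symbol_gen list \<Rightarrow> 'c) set) \<Rightarrow> 'c) set" where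
  "basis_elt r = tensor_class (single (basis_fam r) 1)"

lemma basis_elt_rep: "tensor_rep (basis_elt r) = mval t (expo r) \<cdot>\<^sub>m NB r"
  unfolding basis_elt_def tensor_rep_class[OF P.single_closed[OF basis_fam_P]] tensor_rep0_single[OF basis_fam_P]
    basis_fam_rep by (simp only: h.hom_one one_smult)

lemma scalar_rep:
  "tensor_class (single \<one>\<^bsub>P\<^esub> c) \<in> carrier A"
  "tensor_rep (tensor_class (single \<one>\<^bsub>P\<^esub> c)) = h c \<cdot>\<^sub>m 1\<^sub>m n"
  unfolding tensor_rep_class[OF P.single_closed[OF P.one_closed]] tensor_rep0_single[OF P.one_closed] fam_rep_one
  by (rule ring_hom_closed[OF tensor_class_hom P.single_closed[OF P.one_closed]], rule refl)

lemma h_inj: "h x = h y \<Longrightarrow> x = y"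
proof -
  assume "h x = h y"
  then have "h (x - y) = 0" by (simp add: h.hom_minus)
  then show "x = y" using field_hom_eq_0[OF h] by simp
qed

text \<open>The \<open>n * n\<close> tensors of monomials span the algebra and have independent
  images. So the representation is injective, and the tensor relations cannot identify more than
  they should.\<close>

lemma tensor_explicit_splitting: "explicit_splitting A n tensor_rep basis_elt"
proof (rule explicit_splitting.intro)
  show "ring A" by (rule A_ring)
  show "0 < n" by (rule n_pos)
  show "tensor_rep \<in> Ring.ring_hom A mat_ring" by (rule tensor_rep_hom)
  show "inj_on tensor_rep (carrier A)"
  proof (rule inj_onI)
    fix a b assume ab: "a \<in> carrier A" "b \<in> carrier A" and eq: "tensor_rep a = tensor_rep b"
    obtain c where c: "a = tensor_class (comb c)" using tensor_comb[OF ab(1)] .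
    obtain d where d: "b = tensor_class (comb d)" using tensor_comb[OF ab(2)] .
    have "c r = d r" if "r < n * n" for r
      using NB_independent[OF eq[unfolded c d tensor_rep_comb] that] mval_t_nonzero[of r] h_inj by simp
    then have "comb c = comb d" unfolding comb_def by (intro ext sum.cong) auto
    then show "a = b" by (simp add: c d)
  qed
  show "basis_elt r \<in> carrier A" for r
    unfolding basis_elt_def by (rule ring_hom_closed[OF tensor_class_hom P.single_closed[OF basis_fam_P]])
  show "\<exists>g. \<forall>i<n. \<forall>j<n. M $$ (i, j) = (\<Sum>r<n * n. g r * tensor_rep (basis_elt r) $$ (i, j))"
    if "M \<in> carrier_mat n n" for M
  proof -
    obtain g where g: "M = mlin n {..<n * n} g NB" using NB_span[OF \<open>M \<in> carrier_mat n n\<close>] ..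
    have "M $$ (i, j) = (\<Sum>r<n * n. (g r / mval t (expo r)) * tensor_rep (basis_elt r) $$ (i, j))" if "i < n" "j < n" for i j
      unfolding g basis_elt_rep using that by (simp add: mval_t_nonzero del: N_index)
    then show ?thesis by (intro exI[of _ "\<lambda>r. g r / mval t (expo r)"]) blast
  qed
  show "\<exists>f. (\<forall>r<n * n. \<exists>c\<in>carrier A. tensor_rep c = f r \<cdot>\<^sub>m 1\<^sub>m n) \<and>
      (\<forall>i<n. \<forall>j<n. tensor_rep a $$ (i, j) = (\<Sum>r<n * n. f r * tensor_rep (basis_elt r) $$ (i, j)))"
    if a: "a \<in> carrier A" for a
  proof -
    obtain c where c: "a = tensor_class (comb c)" using tensor_comb[OF a] .
    have "tensor_rep a $$ (i, j) = (\<Sum>r<n * n. h (c r) * tensor_rep (basis_elt r) $$ (i, j))" if "i < n" "j < n" for i j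
      unfolding c tensor_rep_comb basis_elt_rep using that by (simp add: mult.assoc del: N_index)
    moreover have "\<exists>e\<in>carrier A. tensor_rep e = h (c r) \<cdot>\<^sub>m 1\<^sub>m n" for r
      using scalar_rep by blast
    ultimately show ?thesis by (intro exI[of _ "\<lambda>r. h (c r)"]) blast
  qed
  show "\<exists>d\<in>carrier A. tensor_rep d = inverse f \<cdot>\<^sub>m 1\<^sub>m n"
    if a: "a \<in> carrier A" "tensor_rep a = f \<cdot>\<^sub>m 1\<^sub>m n" "f \<noteq> 0" for a f
  proof -
    obtain c where c: "a = tensor_class (comb c)" using tensor_comb[OF a(1)] .
    have "\<exists>x<n. \<forall>l<s. digit x l = 0" by (rule digit_surj) (rule p_pos)
    then obtain x where x: "x < n" "\<forall>l<s. digit x l = 0" by (elim exE conjE)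
    \<comment> \<open>The index of the unit tensor, both halves being the neutral element. Comparing
      coefficients there shows that \<open>f\<close> comes from the base field.\<close>
    define q where "q = x * n + x"
    have r: "q div n = x" "q mod n = x" using x(1) by (auto simp: q_def)
    have rn: "q < n * n" using x(1) div_less_iff_less_mult[OF n_pos, of q n] unfolding r by blast
    have NB1: "NB q = 1\<^sub>m n" unfolding r by (rule N_trivial) (simp_all add: x(2))
    have m1: "mval t (expo q) = 1" unfolding mval_expo r by (simp add: x(2))
    have "f \<cdot>\<^sub>m 1\<^sub>m n = mlin n {..<n * n} (\<lambda>r. if r = q then f else 0) NB"
    proof (rule eq_matI)
      fix i j assume "i < dim_row (mlin n {..<n * n} (\<lambda>r. if r = q then f else 0) NB)"
        "j < dim_col (mlin n {..<n * n} (\<lambda>r. if r = q then f else 0) NB)"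
      then have ij: "i < n" "j < n" by (auto simp: mlin_def)
      have "mlin n {..<n * n} (\<lambda>r. if r = q then f else 0) NB $$ (i, j) =
          (\<Sum>r<n * n. if r = q then f * NB q $$ (i, j) else 0)"
        unfolding mlin_index[OF ij] by (rule sum.cong[OF refl]) (auto simp del: N_index)
      also have "\<dots> = f * (1\<^sub>m n :: 'l mat) $$ (i, j)" using rn unfolding NB1 by (simp add: sum.delta)
      finally show "(f \<cdot>\<^sub>m 1\<^sub>m n) $$ (i, j) = mlin n {..<n * n} (\<lambda>r. if r = q then f else 0) NB $$ (i, j)"
        using ij by simp
    qed (auto simp: mlin_def)
    then have "mlin n {..<n * n} (\<lambda>r. h (c r) * mval t (expo r)) NB = mlin n {..<n * n} (\<lambda>r. if r = q then f else 0) NB"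
      using a(2) unfolding c tensor_rep_comb by simp
    from NB_independent[OF this rn] have f: "f = h (c q)" by (simp add: m1)
    have "c q \<noteq> 0" using a(3) f by auto
    then have "h (inverse (c q)) * h (c q) = 1" unfolding h.hom_mult[symmetric] by simp
    then have "inverse f = h (inverse (c q))" unfolding f by (intro inverse_unique) (simp add: mult.commute)
    show ?thesis
      by (rule bexI[OF _ scalar_rep(1)[of "inverse (c q)"]]) (simp only: scalar_rep(2) \<open>inverse f = _\<close>)
  qed
qed

end

section \<open>Fractions in a field of rational functions\<close>

lemma ring_of_type_simps:
  "carrier (ring_of_type_algebra :: 'a::field ring) = UNIV"
  "x \<oplus>\<^bsub>ring_of_type_algebra :: 'a ring\<^esub> y = x + y" "x \<otimes>\<^bsub>ring_of_type_algebra :: 'a ring\<^esub> y = x * y"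
  "\<zero>\<^bsub>ring_of_type_algebra :: 'a ring\<^esub> = 0" "\<one>\<^bsub>ring_of_type_algebra :: 'a ring\<^esub> = 1"
  by (simp_all add: ring_of_type_algebra_def)

lemma ring_of_type_inverse:
  "\<ominus>\<^bsub>ring_of_type_algebra :: 'a::field ring\<^esub> x = - x"
  "x \<noteq> 0 \<Longrightarrow> inv\<^bsub>ring_of_type_algebra :: 'a::field ring\<^esub> x = inverse x"
proof -
  interpret cring "ring_of_type_algebra :: 'a ring" by (rule cring_from_type_algebra)
  show "\<ominus>\<^bsub>ring_of_type_algebra :: 'a ring\<^esub> x = - x"
    by (rule minus_equality) (simp_all add: ring_of_type_simps)
  show "inv\<^bsub>ring_of_type_algebra :: 'a ring\<^esub> x = inverse x" if "x \<noteq> 0"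
    using that by (intro comm_inv_char) (simp_all add: ring_of_type_simps)
qed

locale generated_by_polynomials =
  fixes \<iota> :: "'k::field \<Rightarrow> 'K::field" and V :: "'v set" and x0 :: "'v \<Rightarrow> 'K"
  assumes \<iota>: "comm_ring_hom \<iota>" and V: "finite V"
    and independent: "algebraically_independent \<iota> V x0"
    and gen: "generate_field (ring_of_type_algebra :: 'K ring) (range \<iota> \<union> x0 ` V) = UNIV"
begin

definition pev :: "(('v \<Rightarrow>\<^sub>0 nat) \<Rightarrow>\<^sub>0 'k) \<Rightarrow> 'K" where
  "pev = ev \<iota> (\<lambda>v. if v \<in> V then x0 v else 0)"

lemma pev_hom: "comm_ring_hom pev"
  unfolding pev_def by (rule ev_hom[OF \<iota>])

interpretation pev: comm_ring_hom pev by (rule pev_hom)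

text \<open>Quotients of polynomial values are closed under the operations by which the field is
  generated.\<close>

lemma fraction: "\<exists>f g. pev g \<noteq> 0 \<and> c * pev g = pev f"
proof -
  have "c \<in> generate_field (ring_of_type_algebra :: 'K ring) (range \<iota> \<union> x0 ` V)" using gen by simp
  then show ?thesis
  proof (induction rule: generate_field.induct)
    case one
    show ?case by (intro exI[of _ 1]) (simp add: ring_of_type_simps)
  next
    case (incl c)
    then consider a where "c = \<iota> a" | v where "v \<in> V" "c = x0 v" by blast
    then obtain f where "pev f = c"
    proof cases
      case (1 a)
      show ?thesis by (rule that[of "const a"]) (simp only: pev_def ev_const[OF \<iota>] 1)
    next
      case (2 v)
      show ?thesis by (rule that[of "var v"]) (simp only: pev_def ev_var[OF \<iota>] if_P[OF 2(1)] 2(2))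
    qed
    then show ?case by (intro exI[of _ f] exI[of _ 1]) simp
  next
    case (a_inv c)
    then obtain f g where "pev g \<noteq> 0" "c * pev g = pev f" by blast
    then have "pev g \<noteq> 0 \<and> - c * pev g = pev (- f)" by (simp add: pev.hom_uminus)
    then show ?case unfolding ring_of_type_inverse by blast
  next
    case (m_inv c)
    then obtain f g where fg: "pev g \<noteq> 0" "c * pev g = pev f" by blast
    have c: "c \<noteq> 0" using m_inv by (simp add: ring_of_type_simps)
    have "pev f \<noteq> 0 \<and> inverse c * pev f = pev g" using fg c unfolding fg(2)[symmetric] by simp
    then show ?case unfolding ring_of_type_inverse(2)[OF c] by blast
  next
    case (eng_add c d)
    obtain f g where fg: "pev g \<noteq> 0" "c * pev g = pev f" using eng_add.IH(1) by blast
    obtain f' g' where fg': "pev g' \<noteq> 0" "d * pev g' = pev f'" using eng_add.IH(2) by blast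
    have "(c + d) * pev (g * g') = pev (f * g' + f' * g)"
      unfolding pev.hom_add pev.hom_mult fg(2)[symmetric] fg'(2)[symmetric] by (simp add: algebra_simps)
    moreover have "pev (g * g') \<noteq> 0" using fg fg' by (simp add: pev.hom_mult)
    ultimately show ?case unfolding ring_of_type_simps by blast
  next
    case (eng_mult c d)
    obtain f g where fg: "pev g \<noteq> 0" "c * pev g = pev f" using eng_mult.IH(1) by blast
    obtain f' g' where fg': "pev g' \<noteq> 0" "d * pev g' = pev f'" using eng_mult.IH(2) by blast
    have "(c * d) * pev (g * g') = pev (f * f')"
      unfolding pev.hom_mult fg(2)[symmetric] fg'(2)[symmetric] by (simp add: algebra_simps)
    moreover have "pev (g * g') \<noteq> 0" using fg fg' by (simp add: pev.hom_mult)
    ultimately show ?case unfolding ring_of_type_simps by blast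
  qed
qed

lemma common_denominator:
  assumes "finite C"
  shows "\<exists>g. pev g \<noteq> 0 \<and> (\<forall>c\<in>C. \<exists>f. c * pev g = pev f)"
  using assms
proof (induction C rule: finite_induct)
  case empty
  show ?case by (intro exI[of _ 1]) simp
next
  case (insert c C)
  obtain g where g: "pev g \<noteq> 0" "\<forall>c\<in>C. \<exists>f. c * pev g = pev f" using insert.IH by blast
  obtain f' g' where fg': "pev g' \<noteq> 0" "c * pev g' = pev f'" using fraction by blast
  have d: "\<exists>f. d * pev (g * g') = pev f" if "d \<in> insert c C" for d
  proof (cases "d = c")
    case True
    have "d * pev (g * g') = pev (f' * g)" unfolding True pev.hom_mult fg'(2)[symmetric] by simp
    then show ?thesis by blast
  next
    case False
    then have "d \<in> C" using that by simp
    from bspec[OF g(2) this] obtain f where f: "d * pev g = pev f" ..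
    have "d * pev (g * g') = pev (f * g')" unfolding pev.hom_mult f[symmetric] by simp
    then show ?thesis by (rule exI)
  qed
  have "pev (g * g') \<noteq> 0" using g(1) fg'(1) by (simp add: pev.hom_mult)
  then show ?case by - (rule exI[of _ "g * g'"], rule conjI, assumption, rule ballI, rule d)
qed

end

section \<open>The algebra of generic symbols\<close>

locale generic_symbols = monomial_matrices ps \<zeta> n for ps and \<zeta> :: "nat \<Rightarrow> 'k::field" and n +
  fixes \<iota> :: "'k \<Rightarrow> 'K::field" and z w :: "nat \<Rightarrow> 'K"
  assumes rational: "rational_function_field \<iota> ({..<length ps} <+> {..<length ps}) (case_sum z w)"
begin

abbreviation "V \<equiv> {..<s} <+> {..<s}"

lemma iota: "comm_ring_hom \<iota>"
  using rational field_hom_comm_ring_hom unfolding rational_function_field_def by blast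

sublocale generated_by_polynomials \<iota> V "case_sum z w"
  by (rule generated_by_polynomials.intro[OF iota])
    (use rational in \<open>auto simp: rational_function_field_def\<close>)

abbreviation hac :: "'K \<Rightarrow> 'K alg_closure" where "hac \<equiv> to_ac"

definition root_val :: "nat \<Rightarrow> 'K alg_closure" where
  "root_val v = (if v < 2 * s then SOME y. y ^ p (v div 2) = hac (if even v then z (v div 2) else w (v div 2)) else 0)"

lemma root_val:
  "l < s \<Longrightarrow> root_val (2 * l) ^ p l = hac (z l)" "l < s \<Longrightarrow> root_val (2 * l + 1) ^ p l = hac (w l)"
proof -
  assume l: "l < s"
  show "root_val (2 * l) ^ p l = hac (z l)"
    using someI_ex[OF nth_root_exists[OF p_pos[OF l], of "hac (z l)"]] l by (simp add: root_val_def)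
  have d: "(2 * l + 1) div 2 = l" "odd (2 * l + 1)" "2 * l + 1 < 2 * s" using l by auto
  show "root_val (2 * l + 1) ^ p l = hac (w l)"
    using someI_ex[OF nth_root_exists[OF p_pos[OF l], of "hac (w l)"]] unfolding root_val_def d
    using d by (simp only: if_True if_False)
qed

lemma variables_nonzero: "l < s \<Longrightarrow> z l \<noteq> 0" "l < s \<Longrightarrow> w l \<noteq> 0"
proof -
  have nz: "case_sum z w v \<noteq> 0" if v: "v \<in> V" for v
  proof
    assume "case_sum z w v = 0"
    then have "pev (var v) = 0" unfolding pev_def ev_var[OF iota] using v by simp
    from algebraically_independent_keys[OF independent V this[unfolded pev_def]] show False using v by auto
  qed
  show "l < s \<Longrightarrow> z l \<noteq> 0" "l < s \<Longrightarrow> w l \<noteq> 0" using nz[of "Inl l"] nz[of "Inr l"] by auto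
qed

lemma root_val_nonzero:
  assumes "v < 2 * s"
  shows "root_val v \<noteq> 0"
proof -
  define l where "l = v div 2"
  have l: "l < s" using assms by (simp add: l_def)
  have "v = 2 * l \<or> v = 2 * l + 1" unfolding l_def by presburger
  then show ?thesis
    using root_val[OF l] variables_nonzero[OF l] p_pos[OF l] by (auto simp: zero_power)
qed

lemma hac_iota: "comm_ring_hom (hac \<circ> \<iota>)" by (rule comp_hom[OF iota to_ac_hom])

abbreviation zL :: "nat \<Rightarrow> 'K alg_closure" where "zL l \<equiv> hac (\<iota> (\<zeta> l))"

lemma zL_matrices: "monomial_matrices ps zL n"
proof
  interpret i: comm_ring_hom \<iota> by (rule iota)
  interpret a: comm_ring_hom hac by (rule to_ac_hom)
  have inj: "\<iota> x = 1 \<longleftrightarrow> x = 1" for x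
  proof
    assume "\<iota> x = 1"
    then have "\<iota> (x - 1) = 0" by (simp add: i.hom_minus)
    then show "x = 1" using field_hom_eq_0[OF iota] by simp
  qed simp
  show "prod_list ps = n" by (rule prod_ps)
  show "Factorial_Ring.prime (p l)" if "l < s" for l by (rule prime[OF that])
  show "primitive_root_of_unity (p l) (zL l)" if "l < s" for l
    using root[OF that] unfolding primitive_root_of_unity_def
    by (simp add: inj flip: a.hom_power i.hom_power)
  show "(of_nat (fact n) :: 'K alg_closure) \<noteq> 0"
    unfolding hom_of_nat[OF hac_iota, symmetric] using char field_hom_eq_0[OF hac_iota] by blast
qed

text \<open>Two systems of monomial matrices occur: the original one over the base field, for
  polynomial matrices in \<open>D0\<close>, and this one over the closure of the rational function
  field, for the splitting of the algebra.\<close>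

sublocale L: symbol_product ps zL n hac "\<lambda>l. \<iota> (\<zeta> l)" z w root_val
  by (intro symbol_product.intro symbol_product_axioms.intro zL_matrices to_ac_hom refl root_val root_val_nonzero)

text \<open>Rewrites a polynomial in the parameters as one in their roots: each parameter becomes
  the \<open>p l\<close>-th power of a variable.\<close>

definition subst :: "((nat + nat \<Rightarrow>\<^sub>0 nat) \<Rightarrow>\<^sub>0 'k) \<Rightarrow> ((nat \<Rightarrow>\<^sub>0 nat) \<Rightarrow>\<^sub>0 'k)" where
  "subst = ev const (\<lambda>v. if v \<in> V then
     Poly_Mapping.single (case_sum (\<lambda>l. Poly_Mapping.single (2 * l) (p l)) (\<lambda>l. Poly_Mapping.single (2 * l + 1) (p l)) v) 1 else 0)"

definition evt :: "((nat \<Rightarrow>\<^sub>0 nat) \<Rightarrow>\<^sub>0 'k) \<Rightarrow> 'K alg_closure" where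
  "evt = ev (hac \<circ> \<iota>) root_val"

text \<open>The condition \<open>kill g = g\<close> says that \<open>g\<close> involves only the
  first \<open>2 * s\<close> variables, those that stand for roots of parameters; membership in
  \<open>D0\<close> alone allows others.\<close>

definition kill :: "((nat \<Rightarrow>\<^sub>0 nat) \<Rightarrow>\<^sub>0 'k) \<Rightarrow> ((nat \<Rightarrow>\<^sub>0 nat) \<Rightarrow>\<^sub>0 'k)" where
  "kill = scale (\<lambda>v. if v < 2 * s then 1 else 0)"

lemma evt_hom: "comm_ring_hom evt" unfolding evt_def by (rule ev_hom[OF hac_iota])
lemma subst_hom: "comm_ring_hom subst" unfolding subst_def by (rule ev_hom[OF const_hom])
lemma kill_hom: "comm_ring_hom kill" unfolding kill_def by (rule scale_hom)

lemma lookup_kill: "lookup (kill f) \<alpha> = (if \<forall>v\<in>keys \<alpha>. v < 2 * s then lookup f \<alpha> else 0)"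
  unfolding kill_def lookup_scale mval_indicator by simp

text \<open>This links polynomials in the roots to elements of the rational function field, where
  the independence of the parameters can be used.\<close>

lemma evt_subst: "evt (subst f) = hac (pev f)"
proof -
  interpret a: comm_ring_hom hac by (rule to_ac_hom)
  let ?y = "\<lambda>v. if v \<in> V then
     Poly_Mapping.single (case_sum (\<lambda>l. Poly_Mapping.single (2 * l) (p l)) (\<lambda>l. Poly_Mapping.single (2 * l + 1) (p l)) v) (1 :: 'k) else 0"
  have "evt (subst f) = ev (evt \<circ> const) (evt \<circ> ?y) f"
    unfolding subst_def by (rule ev_comp[OF const_hom evt_hom])
  also have "evt \<circ> const = hac \<circ> \<iota>" by (rule ext) (simp add: evt_def ev_const[OF hac_iota])
  also have "evt \<circ> ?y = hac \<circ> (\<lambda>v. if v \<in> V then case_sum z w v else 0)"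
  proof
    fix v
    interpret e: comm_ring_hom evt by (rule evt_hom)
    interpret i: comm_ring_hom \<iota> by (rule iota)
    show "(evt \<circ> ?y) v = (hac \<circ> (\<lambda>v. if v \<in> V then case_sum z w v else 0)) v"
    proof (cases "v \<in> V")
      case True
      then show ?thesis
      proof
        fix l assume l: "v = Inl l" "l \<in> {..<s}"
        have V: "Inl l \<in> V" using l by auto
        show ?thesis using root_val(1)[of l] l(2)
          unfolding l(1) comp_apply if_P[OF V] sum.case evt_def ev_single[OF hac_iota] mval_single by simp
      next
        fix l assume l: "v = Inr l" "l \<in> {..<s}"
        have V: "Inr l \<in> V" using l by auto
        show ?thesis using root_val(2)[of l] l(2)
          unfolding l(1) comp_apply if_P[OF V] sum.case evt_def ev_single[OF hac_iota] mval_single by simp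
      qed
    qed (simp only: comp_apply if_False e.hom_zero a.hom_zero)
  qed
  also have "ev (hac \<circ> \<iota>) (hac \<circ> (\<lambda>v. if v \<in> V then case_sum z w v else 0)) f = hac (pev f)"
    unfolding pev_def by (rule ev_comp[OF iota to_ac_hom, symmetric])
  finally show ?thesis .
qed

lemma scale_subst:
  assumes c: "\<And>l. l < s \<Longrightarrow> c (2 * l) ^ p l = 1 \<and> c (2 * l + 1) ^ p l = 1"
  shows "scale c (subst f) = subst f"
proof -
  let ?y = "\<lambda>v. if v \<in> V then
     Poly_Mapping.single (case_sum (\<lambda>l. Poly_Mapping.single (2 * l) (p l)) (\<lambda>l. Poly_Mapping.single (2 * l + 1) (p l)) v) (1 :: 'k) else 0"
  have sc: "scale c (Poly_Mapping.single \<beta> d) = Poly_Mapping.single \<beta> (d * mval c \<beta>)" for \<beta> d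
    by (rule poly_mapping_eqI) (simp add: lookup_scale lookup_single when_def)
  interpret comm_ring_hom "scale c" by (rule scale_hom)
  have "scale c (subst f) = ev (scale c \<circ> const) (scale c \<circ> ?y) f"
    unfolding subst_def by (rule ev_comp[OF const_hom scale_hom])
  also have "scale c \<circ> const = const" by (rule ext) (simp add: sc)
  also have "scale c \<circ> ?y = ?y"
  proof
    fix v
    show "(scale c \<circ> ?y) v = ?y v"
    proof (cases "v \<in> V")
      case True
      then show ?thesis
      proof
        fix l assume l: "v = Inl l" "l \<in> {..<s}"
        have V: "Inl l \<in> V" using l by auto
        show ?thesis using c[of l] l(2)
          unfolding l(1) comp_apply if_P[OF V] sum.case sc mval_single by simp
      next
        fix l assume l: "v = Inr l" "l \<in> {..<s}"
        have V: "Inr l \<in> V" using l by auto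
        show ?thesis using c[of l] l(2)
          unfolding l(1) comp_apply if_P[OF V] sum.case sc mval_single by simp
      qed
    qed (simp only: comp_apply if_False hom_zero)
  qed
  finally show ?thesis unfolding subst_def .
qed

lemma tw_subst: "l < s \<Longrightarrow> tw (2 * l) (\<zeta> l) (subst f) = subst f" "l < s \<Longrightarrow> tw (2 * l + 1) (\<zeta> l) (subst f) = subst f"
proof -
  assume l: "l < s"
  have r: "\<zeta> l ^ p l = 1" using root[OF l] by (simp add: primitive_root_of_unity_def)
  have o: "2 * k + 1 \<noteq> 2 * (m :: nat)" for k m by presburger
  show "tw (2 * l) (\<zeta> l) (subst f) = subst f" "tw (2 * l + 1) (\<zeta> l) (subst f) = subst f"
    unfolding tw_def by (rule scale_subst; use r o in auto)+
qed

lemma kill_subst: "kill (subst f) = subst f"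
  unfolding kill_def by (rule scale_subst) simp

text \<open>An invariant polynomial involves only powers of the parameters of the symbol algebras,
  which are algebraically independent.\<close>

lemma invariant_eq_zero:
  assumes inv: "\<And>l. l < s \<Longrightarrow> tw (2 * l) (\<zeta> l) g = g \<and> tw (2 * l + 1) (\<zeta> l) g = g"
    and k: "kill g = g" and zero: "evt g = 0"
  shows "g = 0"
proof -
  \<comment> \<open>Invariance under the twists makes the exponents occurring in \<open>g\<close>
    divisible by \<open>p l\<close>; dividing them gives a polynomial \<open>f\<close> in the
    parameters with \<open>subst f = g\<close>.\<close>
  define \<gamma> where "\<gamma> \<alpha> = (\<Sum>l<s. Poly_Mapping.single (Inl l) (lookup \<alpha> (2 * l) div p l) +
      Poly_Mapping.single (Inr l) (lookup \<alpha> (2 * l + 1) div p l))" for \<alpha> :: "nat \<Rightarrow>\<^sub>0 nat"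
  let ?y = "\<lambda>v. if v \<in> V then
     Poly_Mapping.single (case_sum (\<lambda>l. Poly_Mapping.single (2 * l) (p l)) (\<lambda>l. Poly_Mapping.single (2 * l + 1) (p l)) v) (1 :: 'k) else 0"
  interpret c: comm_ring_hom "const :: 'k \<Rightarrow> (nat \<Rightarrow>\<^sub>0 nat) \<Rightarrow>\<^sub>0 'k" by (rule const_hom)
  interpret sb: comm_ring_hom subst by (rule subst_hom)
  have sp: "Poly_Mapping.single \<beta> (1 :: 'k) ^ e = Poly_Mapping.single (mscale e \<beta>) 1" for \<beta> :: "nat \<Rightarrow>\<^sub>0 nat" and e
    by (induction e) (simp_all add: mult_single mscale_add[of "Suc 0", simplified])
  have ms: "mscale e (Poly_Mapping.single v a) = Poly_Mapping.single v (e * a)" for e a and v :: nat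
    by (rule poly_mapping_eqI) (simp add: lookup_single when_def)
  have sprod: "(\<Prod>l<m. Poly_Mapping.single (\<beta> l) (1 :: 'k)) = Poly_Mapping.single (\<Sum>l<m. \<beta> l) 1" for m and \<beta> :: "nat \<Rightarrow> nat \<Rightarrow>\<^sub>0 nat"
    by (induction m) (simp_all add: mult_single)
  have mv: "subst (Poly_Mapping.single (\<gamma> \<alpha>) a) = Poly_Mapping.single \<alpha> a" if \<alpha>: "\<alpha> \<in> keys g" for \<alpha> a
  proof -
    have nz: "lookup g \<alpha> \<noteq> 0" using \<alpha> by (simp add: in_keys_iff)
    have d: "p l dvd lookup \<alpha> (2 * l)" "p l dvd lookup \<alpha> (2 * l + 1)" if l: "l < s" for l
    proof -
      have "lookup g \<alpha> * \<zeta> l ^ lookup \<alpha> (2 * l) = lookup g \<alpha>" "lookup g \<alpha> * \<zeta> l ^ lookup \<alpha> (2 * l + 1) = lookup g \<alpha>"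
        using inv[OF l] unfolding lookup_tw[symmetric] by simp_all
      then have "\<zeta> l ^ lookup \<alpha> (2 * l) = \<zeta> l ^ 0" "\<zeta> l ^ lookup \<alpha> (2 * l + 1) = \<zeta> l ^ 0" using nz by simp_all
      then show "p l dvd lookup \<alpha> (2 * l)" "p l dvd lookup \<alpha> (2 * l + 1)"
        unfolding zeta_pow[OF l] by (simp_all add: dvd_eq_mod_eq_0)
    qed
    have o: "2 * k + 1 \<noteq> 2 * (l :: nat)" "2 * l \<noteq> 2 * k + 1" for k l :: nat by presburger+
    have "mval ?y (\<gamma> \<alpha>) = (\<Prod>l<s. Poly_Mapping.single (Poly_Mapping.single (2 * l) (p l)) 1 ^ (lookup \<alpha> (2 * l) div p l) *
        Poly_Mapping.single (Poly_Mapping.single (2 * l + 1) (p l)) 1 ^ (lookup \<alpha> (2 * l + 1) div p l))"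
      unfolding \<gamma>_def mval_sum mval_add mval_single by (rule prod.cong) auto
    also have "\<dots> = (\<Prod>l<s. Poly_Mapping.single (Poly_Mapping.single (2 * l) (lookup \<alpha> (2 * l)) +
        Poly_Mapping.single (2 * l + 1) (lookup \<alpha> (2 * l + 1))) 1)"
      by (rule prod.cong[OF refl]) (simp only: sp ms mult_single dvd_div_mult_self[OF d(1)] dvd_div_mult_self[OF d(2)] lessThan_iff mult_1)
    also have "\<dots> = Poly_Mapping.single (\<Sum>l<s. Poly_Mapping.single (2 * l) (lookup \<alpha> (2 * l)) +
        Poly_Mapping.single (2 * l + 1) (lookup \<alpha> (2 * l + 1))) 1" by (rule sprod)
    also have "(\<Sum>l<s. Poly_Mapping.single (2 * l) (lookup \<alpha> (2 * l)) + Poly_Mapping.single (2 * l + 1) (lookup \<alpha> (2 * l + 1))) = \<alpha>"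
    proof (rule poly_mapping_eqI)
      fix v
      have "lookup (kill g) \<alpha> \<noteq> 0" using nz k by simp
      then have "\<forall>v\<in>keys \<alpha>. v < 2 * s" unfolding lookup_kill by presburger
      then have out: "lookup \<alpha> v = 0" if "\<not> v < 2 * s" using that by (auto simp: in_keys_iff)
      define l where "l = v div 2"
      have "v = 2 * l \<or> v = 2 * l + 1" unfolding l_def by presburger
      then show "lookup (\<Sum>l<s. Poly_Mapping.single (2 * l) (lookup \<alpha> (2 * l)) + Poly_Mapping.single (2 * l + 1) (lookup \<alpha> (2 * l + 1))) v = lookup \<alpha> v"
        using out o by (auto simp: lookup_sum lookup_add lookup_single when_def sum.distrib)
    qed
    finally show ?thesis
      unfolding subst_def ev_single[OF const_hom] by (simp add: mult_single)
  qed
  define f where "f = (\<Sum>\<alpha>\<in>keys g. Poly_Mapping.single (\<gamma> \<alpha>) (lookup g \<alpha>))"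
  have "subst f = (\<Sum>\<alpha>\<in>keys g. Poly_Mapping.single \<alpha> (lookup g \<alpha>))"
    unfolding f_def sb.hom_sum by (rule sum.cong[OF refl mv])
  then have g: "subst f = g" by (simp only: sum_singles[symmetric])
  have "hac (pev f) = 0" using zero unfolding evt_subst[symmetric] g .
  then have "pev f = 0" by simp
  from algebraically_independent_keys[OF independent V this[unfolded pev_def]]
  have no: "{\<alpha> \<in> keys f. keys \<alpha> \<subseteq> V} = {}" .
  have kf: "keys \<beta> \<subseteq> V" if "\<beta> \<in> keys f" for \<beta>
  proof -
    have "lookup f \<beta> \<noteq> 0" using that by (simp add: in_keys_iff)
    then have "(\<Sum>\<alpha>\<in>keys g. lookup g \<alpha> when \<gamma> \<alpha> = \<beta>) \<noteq> 0" by (simp add: f_def lookup_sum lookup_single)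
    then obtain \<alpha> where "(lookup g \<alpha> when \<gamma> \<alpha> = \<beta>) \<noteq> 0" by (rule sum.not_neutral_contains_not_neutral)
    then have "\<beta> = \<gamma> \<alpha>" by (simp add: when_def split: if_splits)
    have "lookup (\<gamma> \<alpha>) v = 0" if "v \<notin> V" for v
      using that unfolding \<gamma>_def by (auto simp: lookup_sum lookup_add lookup_single when_def)
    then show ?thesis unfolding \<open>\<beta> = \<gamma> \<alpha>\<close> by (auto simp: in_keys_iff)
  qed
  have "keys f = {}" using no kf by blast
  then have "f = 0" by simp
  then show ?thesis using g by simp
qed

end

section \<open>Lifting elements of the algebra to equivariant matrices\<close>

context generic_symbols
begin

lemma L_chi: "L.chi a i = hac (\<iota> (chi a i))"
proof -
  interpret i: comm_ring_hom \<iota> by (rule iota)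
  interpret a: comm_ring_hom hac by (rule to_ac_hom)
  show ?thesis unfolding L.chi_def chi_def by (simp add: a.hom_prod i.hom_prod a.hom_power i.hom_power)
qed

lemma L_N_index: "i < n \<Longrightarrow> j < n \<Longrightarrow> L.N a b $$ (i, j) = hac (\<iota> (N a b $$ (i, j)))"
proof -
  interpret i: comm_ring_hom \<iota> by (rule iota)
  show "i < n \<Longrightarrow> j < n \<Longrightarrow> L.N a b $$ (i, j) = hac (\<iota> (N a b $$ (i, j)))" by (simp add: L_chi)
qed

lemma kill_single:
  assumes "\<And>v. 2 * s \<le> v \<Longrightarrow> lookup \<beta> v = 0"
  shows "kill (Poly_Mapping.single \<beta> d) = Poly_Mapping.single \<beta> d"
proof (rule poly_mapping_eqI)
  fix \<alpha>
  have "\<forall>v\<in>keys \<beta>. v < 2 * s" using assms by (metis in_keys_iff not_le)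
  then show "lookup (kill (Poly_Mapping.single \<beta> d)) \<alpha> = lookup (Poly_Mapping.single \<beta> d) \<alpha>"
    unfolding lookup_kill lookup_single by (cases "\<alpha> = \<beta>") (simp_all add: when_def)
qed

text \<open>The polynomials \<open>F r\<close> in the parameters serve as coordinates on the
  monomial tensors; the result is the corresponding matrix, written with polynomials in the
  roots.\<close>

definition lift_mat :: "(nat \<Rightarrow> ((nat + nat \<Rightarrow>\<^sub>0 nat) \<Rightarrow>\<^sub>0 'k)) \<Rightarrow> ((nat \<Rightarrow>\<^sub>0 nat) \<Rightarrow>\<^sub>0 'k) mat" where
  "lift_mat F = mlin n {..<n * n} (\<lambda>_. 1)
    (\<lambda>r. (subst (F r) * Poly_Mapping.single (expo r) 1) \<cdot>\<^sub>m cmat (NB r))"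

lemma lift_mat_index:
  assumes "i < n" "j < n"
  shows "lift_mat F $$ (i, j) = (\<Sum>r<n * n. subst (F r) * Poly_Mapping.single (expo r) 1 * const (NB r $$ (i, j)))"
  unfolding lift_mat_def using assms by (simp del: N_index)

lemma lift_mat_carrier: "lift_mat F \<in> carrier_mat n n"
  by (simp add: lift_mat_def)

lemma lift_mat_D0: "lift_mat F \<in> D0"
  unfolding lift_mat_def
proof (rule D0_mlin[OF finite_lessThan])
  fix r
  have Nm: "Nm (expo r) = NB r" using Nm_expo[of 0 r] by simp
  have "(subst (F r) \<cdot>\<^sub>m 1\<^sub>m n) * (Poly_Mapping.single (expo r) 1 \<cdot>\<^sub>m cmat (NB r)) \<in> D0"
    unfolding Nm[symmetric] by (rule D0_mult[OF D0_scalar D0_monomial]) (simp only: tw_subst)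
  then show "(subst (F r) * Poly_Mapping.single (expo r) 1) \<cdot>\<^sub>m cmat (NB r) \<in> D0"
    by (subst (asm) smult_one_mult_mat(1)[of _ n n]) (simp_all add: smult_smult)
qed

lemma lift_mat_kill: "map_mat kill (lift_mat F) = lift_mat F"
proof (rule eq_matI)
  interpret k: comm_ring_hom kill by (rule kill_hom)
  fix i j assume "i < dim_row (lift_mat F)" "j < dim_col (lift_mat F)"
  then have ij: "i < n" "j < n" using lift_mat_carrier[of F] by auto
  have "kill (Poly_Mapping.single (expo r) 1) = Poly_Mapping.single (expo r) 1" for r
    by (rule kill_single) (rule lookup_expo(3))
  moreover have "kill (const c) = const c" for c by (rule kill_single) simp
  ultimately have "kill (lift_mat F $$ (i, j)) = lift_mat F $$ (i, j)"
    unfolding lift_mat_index[OF ij] by (simp only: k.hom_sum k.hom_mult kill_subst)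
  then show "map_mat kill (lift_mat F) $$ (i, j) = lift_mat F $$ (i, j)"
    using ij lift_mat_carrier[of F] by simp
qed auto

lemma lift_mat_evt:
  assumes F: "\<And>r. r < n * n \<Longrightarrow> c r * pev g = pev (F r)"
  shows "map_mat evt (lift_mat F) = hac (pev g) \<cdot>\<^sub>m L.tensor_rep (L.tensor_class (L.comb c))"
proof (rule eq_matI)
  interpret e: comm_ring_hom evt by (rule evt_hom)
  interpret a: comm_ring_hom hac by (rule to_ac_hom)
  interpret i: comm_ring_hom \<iota> by (rule iota)
  fix i j assume "i < dim_row (hac (pev g) \<cdot>\<^sub>m L.tensor_rep (L.tensor_class (L.comb c)))"
    "j < dim_col (hac (pev g) \<cdot>\<^sub>m L.tensor_rep (L.tensor_class (L.comb c)))"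
  then have ij: "i < n" "j < n" by (auto simp: L.tensor_rep_comb mlin_def)
  have m: "evt (Poly_Mapping.single (expo r) 1) = mval root_val (expo r)" for r
    unfolding evt_def ev_single[OF hac_iota] by simp
  have k: "evt (const b) = hac (\<iota> b)" for b unfolding evt_def ev_const[OF hac_iota] by simp
  have "evt (lift_mat F $$ (i, j)) = (\<Sum>r<n * n. hac (pev (F r)) * mval root_val (expo r) * L.NB r $$ (i, j))"
    unfolding lift_mat_index[OF ij] e.hom_sum e.hom_mult evt_subst m k L_N_index[OF ij] ..
  also have "\<dots> = (\<Sum>r<n * n. hac (pev g) * (hac (c r) * mval root_val (expo r) * L.NB r $$ (i, j)))"
  proof (rule sum.cong[OF refl])
    fix r assume "r \<in> {..<n * n}"
    then have "hac (pev (F r)) = hac (pev g) * hac (c r)" using F[of r] by (simp add: mult.commute flip: a.hom_mult)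
    then show "hac (pev (F r)) * mval root_val (expo r) * L.NB r $$ (i, j) =
        hac (pev g) * (hac (c r) * mval root_val (expo r) * L.NB r $$ (i, j))" by (simp only: mult.assoc)
  qed
  also have "\<dots> = (hac (pev g) \<cdot>\<^sub>m L.tensor_rep (L.tensor_class (L.comb c))) $$ (i, j)"
    unfolding L.tensor_rep_comb using ij
    by (simp add: carrier_matD[OF mlin_carrier] sum_distrib_left del: L.N_index)
  finally show "map_mat evt (lift_mat F) $$ (i, j) = (hac (pev g) \<cdot>\<^sub>m L.tensor_rep (L.tensor_class (L.comb c))) $$ (i, j)"
    using ij lift_mat_carrier[of F] by simp
qed (use lift_mat_carrier[of F] in \<open>auto simp: L.tensor_rep_comb mlin_def\<close>)

text \<open>The coordinates of finitely many elements are rational functions with a common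
  denominator, whose image is \<open>d\<close>; multiplied by it they become polynomials in the
  parameters.\<close>

lemma lift:
  assumes Q: "finite Q" "Q \<subseteq> carrier L.A"
  shows "\<exists>d. d \<noteq> 0 \<and> (\<forall>x\<in>Q. \<exists>B. B \<in> D0 \<and> map_mat kill B = B \<and> map_mat evt B = d \<cdot>\<^sub>m L.tensor_rep x)"
proof -
  have "\<forall>x\<in>Q. \<exists>c. x = L.tensor_class (L.comb c)"
  proof
    fix x assume "x \<in> Q"
    then have "x \<in> carrier L.A" using Q(2) by blast
    from L.tensor_comb[OF this] obtain c where "x = L.tensor_class (L.comb c)" .
    then show "\<exists>c. x = L.tensor_class (L.comb c)" by - (rule exI)
  qed
  from bchoice[OF this] obtain c where c: "\<forall>x\<in>Q. x = L.tensor_class (L.comb (c x))" ..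
  have "finite (\<Union>x\<in>Q. c x ` {..<n * n})" using Q(1) by simp
  from common_denominator[OF this] obtain g where
    g: "pev g \<noteq> 0" "\<forall>b\<in>(\<Union>x\<in>Q. c x ` {..<n * n}). \<exists>f. b * pev g = pev f" by (elim exE conjE)
  have "\<exists>B. B \<in> D0 \<and> map_mat kill B = B \<and> map_mat evt B = hac (pev g) \<cdot>\<^sub>m L.tensor_rep x" if x: "x \<in> Q" for x
  proof -
    have "\<forall>r\<in>{..<n * n}. \<exists>f. c x r * pev g = pev f" using g(2) x by blast
    from bchoice[OF this] obtain F where F: "\<forall>r\<in>{..<n * n}. c x r * pev g = pev (F r)" ..
    have "map_mat evt (lift_mat F) = hac (pev g) \<cdot>\<^sub>m L.tensor_rep (L.tensor_class (L.comb (c x)))"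
      by (rule lift_mat_evt) (use F in simp)
    then have "map_mat evt (lift_mat F) = hac (pev g) \<cdot>\<^sub>m L.tensor_rep x"
      unfolding bspec[OF c x, symmetric] .
    then show ?thesis using lift_mat_D0 lift_mat_kill by blast
  qed
  moreover have "hac (pev g) \<noteq> 0" using g(1) by simp
  ultimately show ?thesis by blast
qed

lemma foldr_D0: "set As \<subseteq> D0 \<Longrightarrow> foldr (*) As (1\<^sub>m n) \<in> D0"
proof (induction As)
  case Nil
  have "const 1 \<cdot>\<^sub>m 1\<^sub>m n \<in> D0" by (rule D0_const)
  then show ?case by (simp add: one_smult)
qed (simp add: D0_mult)

lemma kill_coeff:
  assumes "M \<in> D0" "map_mat kill M = M"
  shows "kill (poly.coeff (char_poly M) d) = poly.coeff (char_poly M) d"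
proof -
  interpret k: comm_ring_hom kill by (rule kill_hom)
  have "map_poly kill (char_poly M) = char_poly M"
    using k.char_poly_hom[OF D0_carrier[OF assms(1)]] assms(2) by simp
  then have "poly.coeff (map_poly kill (char_poly M)) d = poly.coeff (char_poly M) d" by simp
  then show ?thesis by (simp add: coeff_map_poly)
qed

lemma D0_coeff_zero:
  assumes B: "B \<in> D0" "map_mat kill B = B" and zero: "evt (poly.coeff (char_poly B) d) = 0"
  shows "poly.coeff (char_poly B) d = 0"
  by (rule invariant_eq_zero[OF D0_char_poly_invariant[OF B(1)] kill_coeff[OF B] zero])

text \<open>Equality of values is turned back into equality of polynomials: the difference of the
  coefficients is invariant and contains no other variables, so \<open>invariant_eq_zero\<close>
  applies to it.\<close>

lemma D0_coeff_eq:
  assumes B: "B \<in> D0" "map_mat kill B = B" and B': "B' \<in> D0" "map_mat kill B' = B'"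
    and eq: "evt (poly.coeff (char_poly B) d) = evt (poly.coeff (char_poly B') d)"
  shows "poly.coeff (char_poly B) d = poly.coeff (char_poly B') d"
proof -
  interpret k: comm_ring_hom kill by (rule kill_hom)
  interpret e: comm_ring_hom evt by (rule evt_hom)
  have "poly.coeff (char_poly B) d - poly.coeff (char_poly B') d = 0"
  proof (rule invariant_eq_zero)
    fix l assume l: "l < s"
    interpret t0: comm_ring_hom "tw (2 * l) (\<zeta> l)" by (rule tw_hom)
    interpret t1: comm_ring_hom "tw (2 * l + 1) (\<zeta> l)" by (rule tw_hom)
    show "tw (2 * l) (\<zeta> l) (poly.coeff (char_poly B) d - poly.coeff (char_poly B') d) =
        poly.coeff (char_poly B) d - poly.coeff (char_poly B') d \<and>
      tw (2 * l + 1) (\<zeta> l) (poly.coeff (char_poly B) d - poly.coeff (char_poly B') d) =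
        poly.coeff (char_poly B) d - poly.coeff (char_poly B') d"
      unfolding t0.hom_minus t1.hom_minus
      by (simp only: D0_char_poly_invariant[OF B(1) l] D0_char_poly_invariant[OF B'(1) l] simp_thms)
  next
    show "kill (poly.coeff (char_poly B) d - poly.coeff (char_poly B') d) =
        poly.coeff (char_poly B) d - poly.coeff (char_poly B') d"
      unfolding k.hom_minus kill_coeff[OF B] kill_coeff[OF B'] ..
    show "evt (poly.coeff (char_poly B) d - poly.coeff (char_poly B') d) = 0"
      unfolding e.hom_minus eq by simp
  qed
  then show ?thesis by simp
qed

text \<open>The unknowns are multiplied by a common \<open>d\<close> and lifted to
  \<open>D0\<close>. Homogeneity preserves both conditions, and by invariance they hold for the
  polynomials themselves, where \<open>D0_system\<close> applies. Injectivity of the representation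
  leads back to the algebra.\<close>

theorem D_system:
  assumes i: "i \<in> {1..n}" "sqf n dvd i" and j: "j \<in> {1..n}" and m: "sqf n dvd length xs"
    and xs: "set xs \<subseteq> carrier L.A" and sol: "solves_system TYPE('K alg_closure) L.A n i j xs"
  shows "\<forall>x\<in>set xs. x = \<zero>\<^bsub>L.A\<^esub>"
proof -
  interpret E: explicit_splitting L.A n L.tensor_rep L.basis_elt by (rule L.tensor_explicit_splitting)
  interpret e: comm_ring_hom evt by (rule evt_hom)
  let ?\<sigma> = "reduced_sigma TYPE('K alg_closure) L.A n"
  let ?\<Phi> = "L.tensor_rep"
  have sg: "?\<Phi> (?\<sigma> k x) = poly.coeff (char_poly (?\<Phi> x)) (n - k) \<cdot>\<^sub>m 1\<^sub>m n" if "x \<in> carrier L.A" for k x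
    by (rule E.reduced_sigma(2)[OF L.of_nat_n that])
  have \<Phi>c: "?\<Phi> x \<in> carrier_mat n n" if "x \<in> carrier L.A" for x
    using ring_hom_closed[OF L.tensor_rep_hom that] by (simp only: ring_mat_simps)
  have \<Phi>0: "?\<Phi> \<zero>\<^bsub>L.A\<^esub> = 0\<^sub>m n n"
    using ring_hom_zero[OF L.tensor_rep_hom L.A_ring L.mat_ring] by (simp only: ring_mat_simps)
  have fold: "foldr (\<otimes>\<^bsub>L.A\<^esub>) ys \<one>\<^bsub>L.A\<^esub> \<in> carrier L.A \<and>
      ?\<Phi> (foldr (\<otimes>\<^bsub>L.A\<^esub>) ys \<one>\<^bsub>L.A\<^esub>) = foldr (*) (map ?\<Phi> ys) (1\<^sub>m n)"
    if "set ys \<subseteq> carrier L.A" for ys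
    using that
  proof (induction ys)
    case Nil
    show ?case using E.one_closed ring_hom_one[OF L.tensor_rep_hom] by (simp only: foldr.simps list.map id_apply ring_mat_simps simp_thms)
  next
    case (Cons y ys)
    have ys: "set ys \<subseteq> carrier L.A" and y: "y \<in> carrier L.A" using Cons.prems by simp_all
    note IH = conjunct1[OF Cons.IH[OF ys]] conjunct2[OF Cons.IH[OF ys]]
    show ?case
      using E.m_closed[OF y IH(1)] ring_hom_mult[OF L.tensor_rep_hom y IH(1)]
      by (simp only: foldr.simps list.map comp_apply IH(2) ring_mat_simps simp_thms)
  qed
  obtain d where d: "d \<noteq> 0" and "\<forall>x\<in>set xs. \<exists>B. B \<in> D0 \<and> map_mat kill B = B \<and> map_mat evt B = d \<cdot>\<^sub>m ?\<Phi> x"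
    using lift[OF finite_set xs] by (elim exE conjE)
  from bchoice[OF this(2)] obtain B where
    B: "\<forall>x\<in>set xs. B x \<in> D0 \<and> map_mat kill (B x) = B x \<and> map_mat evt (B x) = d \<cdot>\<^sub>m ?\<Phi> x" ..
  have B1: "B x \<in> D0" and B2: "map_mat kill (B x) = B x" and B3: "map_mat evt (B x) = d \<cdot>\<^sub>m ?\<Phi> x" if "x \<in> set xs" for x
    using bspec[OF B that] by simp_all
  have Bc: "set (map B xs) \<subseteq> carrier_mat n n" using B1 D0_carrier by auto
  have evc: "evt (poly.coeff (char_poly M) k) = poly.coeff (char_poly (map_mat evt M)) k" if "M \<in> carrier_mat n n" for M k
    unfolding e.char_poly_hom[OF that] by (simp add: coeff_map_poly)
  let ?P = "foldr (*) (map B xs) (1\<^sub>m n)"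
  have PD: "?P \<in> D0" by (rule foldr_D0) (use B1 in auto)
  have Pk: "map_mat kill ?P = ?P"
  proof -
    have "map (map_mat kill) (map B xs) = map B xs" using B2 by simp
    then show ?thesis by (simp only: hom_foldr_mult[OF kill_hom Bc])
  qed
  have "map_mat evt ?P = foldr (*) (map (\<lambda>x. d \<cdot>\<^sub>m x) (map ?\<Phi> xs)) (1\<^sub>m n)"
  proof -
    have "map (map_mat evt) (map B xs) = map (\<lambda>x. d \<cdot>\<^sub>m x) (map ?\<Phi> xs)" using B3 by simp
    then show ?thesis by (simp only: hom_foldr_mult[OF evt_hom Bc])
  qed
  also have "\<dots> = d ^ length xs \<cdot>\<^sub>m foldr (*) (map ?\<Phi> xs) (1\<^sub>m n)"
  proof -
    have "set (map ?\<Phi> xs) \<subseteq> carrier_mat n n" using \<Phi>c xs by auto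
    from foldr_mult_smult[OF this] show ?thesis unfolding length_map .
  qed
  finally have evP: "map_mat evt ?P = d ^ length xs \<cdot>\<^sub>m ?\<Phi> (foldr (\<otimes>\<^bsub>L.A\<^esub>) xs \<one>\<^bsub>L.A\<^esub>)"
    unfolding conjunct2[OF fold[OF xs]] .
  have "\<forall>M\<in>set (map B xs). M = 0\<^sub>m n n"
  proof (rule D0_system)
    show "set (map B xs) \<subseteq> D0" using B1 by auto
    show "length (map B xs) = length xs" by simp
    show "sqf n dvd length xs" "sqf n dvd i" "1 \<le> i" "i \<le> n" "j \<le> n" using i j m by auto
    show "poly.coeff (char_poly M) (n - i) = poly.coeff (char_poly M') (n - i)"
      if M: "M \<in> set (map B xs)" "M' \<in> set (map B xs)" for M M'
    proof -
      obtain x where x: "x \<in> set xs" "M = B x" using M(1) by auto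
      obtain y where y: "y \<in> set xs" "M' = B y" using M(2) by auto
      have "?\<sigma> i x = ?\<sigma> i y" using sol x(1) y(1) unfolding solves_system_def by blast
      then have "poly.coeff (char_poly (?\<Phi> x)) (n - i) \<cdot>\<^sub>m (1\<^sub>m n :: 'K alg_closure mat) =
          poly.coeff (char_poly (?\<Phi> y)) (n - i) \<cdot>\<^sub>m 1\<^sub>m n"
        using sg[OF subsetD[OF xs x(1)], of i] sg[OF subsetD[OF xs y(1)], of i] by (simp only:)
      then have c: "poly.coeff (char_poly (?\<Phi> x)) (n - i) = poly.coeff (char_poly (?\<Phi> y)) (n - i)"
        by (rule smult_one_eqD[OF n_pos])
      have "evt (poly.coeff (char_poly (B x)) (n - i)) = evt (poly.coeff (char_poly (B y)) (n - i))"
        unfolding evc[OF D0_carrier[OF B1[OF x(1)]]] evc[OF D0_carrier[OF B1[OF y(1)]]] B3[OF x(1)] B3[OF y(1)]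
        unfolding coeff_char_poly_smult[OF \<Phi>c[OF subsetD[OF xs x(1)]] diff_le_self]
          coeff_char_poly_smult[OF \<Phi>c[OF subsetD[OF xs y(1)]] diff_le_self] c ..
      then show ?thesis unfolding x(2) y(2) by (rule D0_coeff_eq[OF B1[OF x(1)] B2[OF x(1)] B1[OF y(1)] B2[OF y(1)]])
    qed
    show "poly.coeff (char_poly ?P) (n - j) = 0"
    proof (rule D0_coeff_zero[OF PD Pk])
      let ?f = "foldr (\<otimes>\<^bsub>L.A\<^esub>) xs \<one>\<^bsub>L.A\<^esub>"
      note fc = conjunct1[OF fold[OF xs]]
      have "?\<sigma> j ?f = \<zero>\<^bsub>L.A\<^esub>" using sol unfolding solves_system_def by blast
      then have "poly.coeff (char_poly (?\<Phi> ?f)) (n - j) \<cdot>\<^sub>m 1\<^sub>m n = (0\<^sub>m n n :: 'K alg_closure mat)"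
        using sg[OF fc, of j] \<Phi>0 by (simp only:)
      also have "0\<^sub>m n n = (0 :: 'K alg_closure) \<cdot>\<^sub>m 1\<^sub>m n" by (rule eq_matI) auto
      finally have "poly.coeff (char_poly (?\<Phi> ?f)) (n - j) = 0" by (rule smult_one_eqD[OF n_pos])
      then show "evt (poly.coeff (char_poly ?P) (n - j)) = 0"
        unfolding evc[OF D0_carrier[OF PD]] evP coeff_char_poly_smult[OF \<Phi>c[OF fc] diff_le_self] by simp
    qed
  qed
  then have B0: "B x = 0\<^sub>m n n" if "x \<in> set xs" for x using that by simp
  show ?thesis
  proof
    fix x assume x: "x \<in> set xs"
    have xc: "x \<in> carrier L.A" by (rule subsetD[OF xs x])
    have "d \<cdot>\<^sub>m ?\<Phi> x = 0\<^sub>m n n" unfolding B3[OF x, symmetric] B0[OF x] by (rule eq_matI) auto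
    then have "inverse d \<cdot>\<^sub>m (d \<cdot>\<^sub>m ?\<Phi> x) = inverse d \<cdot>\<^sub>m 0\<^sub>m n n" by (rule arg_cong)
    also have "inverse d \<cdot>\<^sub>m 0\<^sub>m n n = (0\<^sub>m n n :: 'K alg_closure mat)" by (rule eq_matI) auto
    finally have "?\<Phi> x = 0\<^sub>m n n" using d by (simp add: smult_smult one_smult)
    also have "\<dots> = ?\<Phi> \<zero>\<^bsub>L.A\<^esub>" by (rule \<Phi>0[symmetric])
    finally show "x = \<zero>\<^bsub>L.A\<^esub>" using inj_onD[OF E.inj _ xc E.zero_closed] by blast
  qed
qed

end

theorem theorem1p5:
  fixes n m i j :: nat
    and ps :: "nat list"
    and \<zeta> :: "nat \<Rightarrow> 'k::field"
    and \<iota>K :: "'k \<Rightarrow> 'K::field"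
    and z w :: "nat \<Rightarrow> 'K"
    and \<iota>L :: "'k \<Rightarrow> 'L::field"
    and s t :: "nat \<Rightarrow> nat \<Rightarrow> 'L"
  assumes "n \<ge> 1"
    and "\<not> CHAR('k) dvd fact n"
    and "m \<ge> 1"
    and "i \<in> {1..n}" and "j \<in> {1..n}"
    and "sqf n dvd i" and "sqf n dvd m"
  shows
    "((\<forall>p\<in>set ps. prime p \<and> primitive_root_of_unity p (\<zeta> p)) \<and> prod_list ps = n \<and>
      rational_function_field \<iota>K ({..<length ps} <+> {..<length ps}) (case_sum z w)
      \<longrightarrow> (\<forall>xs. length xs = m \<and> set xs \<subseteq> carrier (D_algebra ps (\<iota>K \<circ> \<zeta>) z w) \<and>
             solves_system TYPE('K alg_closure) (D_algebra ps (\<iota>K \<circ> \<zeta>) z w) n i j xs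
             \<longrightarrow> (\<forall>x\<in>set xs. x = \<zero>\<^bsub>D_algebra ps (\<iota>K \<circ> \<zeta>) z w\<^esub>)))
     \<and>
     (rational_function_field \<iota>L (({..<n} \<times> {..<n}) <+> ({..<n} \<times> {..<n}))
        (case_sum (case_prod s) (case_prod t))
      \<longrightarrow> (\<forall>xs. length xs = m \<and> set xs \<subseteq> carrier (UD \<iota>L n s t) \<and>
             solves_system TYPE('L alg_closure) (UD \<iota>L n s t) n i j xs
             \<longrightarrow> (\<forall>x\<in>set xs. x = \<zero>\<^bsub>UD \<iota>L n s t\<^esub>)))"
proof (rule conjI; intro impI allI; elim conjE)
  \<comment> \<open>Characteristic 0 is covered as well, since \<open>0\<close> does not divide the
    nonzero number \<open>fact n\<close>.\<close>
  have char: "(of_nat (fact n) :: 'k) \<noteq> 0"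
    using assms(2) of_nat_eq_0_iff_char_dvd[of "fact n", where 'a = 'k] by blast
  {
    fix xs
    assume ps: "\<forall>p\<in>set ps. prime p \<and> primitive_root_of_unity p (\<zeta> p)" "prod_list ps = n"
      and rat: "rational_function_field \<iota>K ({..<length ps} <+> {..<length ps}) (case_sum z w)"
      and xs: "length xs = m" "set xs \<subseteq> carrier (D_algebra ps (\<iota>K \<circ> \<zeta>) z w)"
        "solves_system TYPE('K alg_closure) (D_algebra ps (\<iota>K \<circ> \<zeta>) z w) n i j xs"
    \<comment> \<open>The roots of unity are given for each prime; the locale indexes them by the
      position in the list.\<close>
    have "monomial_matrices ps (\<lambda>l. \<zeta> (ps ! l)) n"
      by (rule monomial_matrices.intro) (use ps char in \<open>auto simp: all_set_conv_all_nth\<close>)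
    then interpret G: generic_symbols ps "\<lambda>l. \<zeta> (ps ! l)" n \<iota>K z w
      by (intro generic_symbols.intro generic_symbols_axioms.intro rat)
    have D: "D_algebra ps (\<iota>K \<circ> \<zeta>) z w = G.L.A" by (simp only: D_algebra_def comp_apply)
    have "sqf n dvd length xs" using assms(7) xs(1) by simp
    then show "\<forall>x\<in>set xs. x = \<zero>\<^bsub>D_algebra ps (\<iota>K \<circ> \<zeta>) z w\<^esub>"
      unfolding D by (rule G.D_system[OF assms(4,6,5) _ xs(2,3)[unfolded D]])
  }
  {
    fix xs
    assume rat: "rational_function_field \<iota>L (({..<n} \<times> {..<n}) <+> ({..<n} \<times> {..<n}))
        (case_sum (case_prod s) (case_prod t))"
      and xs: "length xs = m" "set xs \<subseteq> carrier (UD \<iota>L n s t)"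
        "solves_system TYPE('L alg_closure) (UD \<iota>L n s t) n i j xs"
    have \<iota>: "comm_ring_hom \<iota>L"
      using rat field_hom_comm_ring_hom unfolding rational_function_field_def by blast
    \<comment> \<open>No roots of unity are assumed in the base field here; they are found in the
      closure, to which this embedding transfers the condition on the characteristic.\<close>
    have hom: "comm_ring_hom (to_ac \<circ> \<iota>L :: 'k \<Rightarrow> 'L alg_closure)" by (rule comp_hom[OF \<iota> to_ac_hom])
    have "(of_nat (fact n) :: 'L alg_closure) \<noteq> 0"
      unfolding hom_of_nat[OF hom, symmetric] using char field_hom_eq_0[OF hom] by blast
    then obtain qs \<xi> where "monomial_matrices qs (\<xi> :: nat \<Rightarrow> 'L alg_closure) n"
      using monomial_matrices_exist[of n, where 'a = "'L alg_closure"] assms(1) by auto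
    then interpret G: generic_matrices qs n \<xi> \<iota>L s t
      by (intro generic_matrices.intro generic_matrices_axioms.intro \<iota>)
        (use rat in \<open>auto simp: rational_function_field_def\<close>)
    have "sqf n dvd length xs" using assms(7) xs(1) by simp
    then show "\<forall>x\<in>set xs. x = \<zero>\<^bsub>UD \<iota>L n s t\<^esub>"
      by (rule G.UD_system[OF assms(4,6,5) _ xs(2,3)])
  }
qed

end
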